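(* Let $\delta>0$ and consider the system $$r_1' = v+2\delta r_1 l^3,\qquad v' = -\frac{r_1-1}{r_1^3}-2\delta v l^3,\qquad l' = -\delta l^4$$ on $\{(r_1,v,l): r_1>0,\ v\in\mathbb R,\ l\ge 0\}$. Let $$H(r_1,v)=\tfrac12 v^2+\frac{(r_1-1)^2}{2r_1^2},\qquad \Gamma_1(h)=\{(r_1,v,0): r_1>0,\ H(r_1,v)=h\},$$ and let $H_\infty(r_1,v,l)$ be the limit, as time tends to $+\infty$, of $H$ along the solution of the system starting at $(r_1,v,l)$. Fix $h\in(0,\frac12)$. Then the stable set $W^s(\Gamma_1(h))$ of the periodic orbit $\Gamma_1(h)$ is defined by the equation $H_\infty(r_1,v,l)=h$. Moreover, fix any $k\in\mathbb N$. Then there exists a neighborhood $N(k,h)$ of $\Gamma_1(h)$ such that $$W^s_{loc}(\Gamma_1(h)) = W^s(\Gamma_1(h))\cap N(k,h)$$ is a $C^k$-smooth two-dimensional submanifold. The dependency on $h$ is also $C^k$-smooth.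
   Context: The system is the Kepler problem with linear drag $\ddot u+\delta\dot u+u/|u|^3=0$, $u=re^{i\theta}\in\mathbb C\setminus\{0\}$, written in the variables $l=r^2\dot\theta$ (angular momentum magnitude), $r_1=l^{-2}r$, $v=l\dot r$, after multiplying the vector field by $l^3$; the prime denotes differentiation with respect to the new time. On the invariant plane $l=0$ the system is Hamiltonian with Hamiltonian function $H$, and for $h\in(0,\frac12)$ the set $\Gamma_1(h)$ is a periodic orbit around the center $(r_1,v)=(1,0)$. The limit $H_\infty$ is known to exist: $H_\infty=\frac12|\mathcal E_\infty|^2$ where $\mathcal E_\infty$ is the limiting eccentricity vector, i.e. the limit along the solution of $\mathcal E(u,\dot u)=\dot u\wedge(u\wedge\dot u)-u/|u|$. The stable set $W^s(\Gamma_1(h))$ is the set of points of the phase space $\{r_1>0,\ l\ge0\}$ whose forward orbits converge to $\Gamma_1(h)$ (distance to $\Gamma_1(h)$ tends to $0$). Neighborhoods are taken in the phase space $\{r_1>0,\ l\ge 0\}$ and smoothness is understood up to and including the boundary $l=0$. "$C^k$-smooth dependency on $h$" means that, locally in $h$, these manifolds are parametrized by an angle $\phi\in\mathbb R/2\pi\mathbb Z$ and $l\in[0,l_0)$ through a map that is $C^k$ jointly in $(h,\phi,l)$. *)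

theory Defs
  imports "HOL-Analysis.Analysis"
begin

definition phase_space :: "(real \<times> real \<times> real) set" where
  "phase_space = {(r, v, l). r > 0 \<and> l \<ge> 0}"

definition vector_field :: "real \<Rightarrow> real \<times> real \<times> real \<Rightarrow> real \<times> real \<times> real" where
  "vector_field \<delta> = (\<lambda>(r, v, l).
     (v + 2 * \<delta> * r * l ^ 3, - (r - 1) / r ^ 3 - 2 * \<delta> * v * l ^ 3, - \<delta> * l ^ 4))"

definition is_solution :: "real \<Rightarrow> real \<times> real \<times> real \<Rightarrow> (real \<Rightarrow> real \<times> real \<times> real) \<Rightarrow> bool" where
  "is_solution \<delta> p x \<longleftrightarrow> x 0 = p \<and>
     (\<forall>t\<ge>0. x t \<in> phase_space \<and>
        (x has_vector_derivative vector_field \<delta> (x t)) (at t within {0..}))"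

text \<open>Since the vector field is locally Lipschitz and, for \<open>\<delta> > 0\<close>, forward solutions in the phase
  space are global, \<open>flow \<delta> t p\<close> is well defined for \<open>p \<in> phase_space\<close> and \<open>t \<ge> 0\<close>.\<close>

definition flow :: "real \<Rightarrow> real \<Rightarrow> real \<times> real \<times> real \<Rightarrow> real \<times> real \<times> real" where
  "flow \<delta> t p = (THE q. \<exists>x. is_solution \<delta> p x \<and> x t = q)"

definition H :: "real \<Rightarrow> real \<Rightarrow> real" where
  "H r v = v\<^sup>2 / 2 + (r - 1)\<^sup>2 / (2 * r\<^sup>2)"

definition Gamma1 :: "real \<Rightarrow> (real \<times> real \<times> real) set" where
  "Gamma1 h = {(r, v, l). r > 0 \<and> l = 0 \<and> H r v = h}"

text \<open>The limit exists at every point of the phase space: \<open>H\<close> is half the squared norm of the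
  eccentricity vector, which converges along solutions.\<close>

definition H_infinity :: "real \<Rightarrow> real \<times> real \<times> real \<Rightarrow> real" where
  "H_infinity \<delta> p = Lim at_top (\<lambda>t. case flow \<delta> t p of (r, v, l) \<Rightarrow> H r v)"

definition stable_set :: "real \<Rightarrow> (real \<times> real \<times> real) set \<Rightarrow> (real \<times> real \<times> real) set" where
  "stable_set \<delta> A = {p \<in> phase_space. ((\<lambda>t. infdist (flow \<delta> t p) A) \<longlongrightarrow> 0) at_top}"

definition open_nbhd :: "(real \<times> real \<times> real) set \<Rightarrow> (real \<times> real \<times> real) set \<Rightarrow> bool" where
  "open_nbhd A N \<longleftrightarrow> openin (top_of_set phase_space) N \<and> A \<subseteq> N"

text \<open>\<open>C\<^sup>k\<close> maps, with derivatives taken within the domain \<open>S\<close>. It is used only for \<open>S\<close> relatively open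
  in a half-space, where these derivatives are unique, and one-sided on the boundary: this is
  \<open>C\<^sup>k\<close>-smoothness up to and including the boundary. To stay within one type, continuity of
  the higher derivatives is expressed by evaluating them at fixed vectors, which in finite
  dimension is equivalent to continuity in operator norm.\<close>

primrec Ck_on :: "nat \<Rightarrow> ('a::euclidean_space \<Rightarrow> 'b::euclidean_space) \<Rightarrow> 'a set \<Rightarrow> bool" where
  "Ck_on 0 f S \<longleftrightarrow> continuous_on S f"
| "Ck_on (Suc k) f S \<longleftrightarrow>
     (\<exists>f'. (\<forall>x\<in>S. (f has_derivative f' x) (at x within S)) \<and> (\<forall>w. Ck_on k (\<lambda>x. f' x w) S))"

text \<open>Two-dimensional \<open>C\<^sup>k\<close> submanifolds of the phase space, with boundary on \<open>l = 0\<close>: near each of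
  its points the set is mapped onto the slice \<open>x = 0\<close> by a \<open>C\<^sup>k\<close> diffeomorphism (a homeomorphism
  for \<open>k = 0\<close>) between relatively open subsets of the phase space and of a closed half-space.\<close>

definition half_space :: "(real \<times> real \<times> real) set" where
  "half_space = {(x, y, z). z \<ge> 0}"

definition Ck_surface :: "nat \<Rightarrow> (real \<times> real \<times> real) set \<Rightarrow> bool" where
  "Ck_surface k M \<longleftrightarrow> M \<subseteq> phase_space \<and>
     (\<forall>p\<in>M. \<exists>U V \<psi> \<psi>'.
        openin (top_of_set phase_space) U \<and> p \<in> U \<and> openin (top_of_set half_space) V \<and>
        homeomorphism U V \<psi> \<psi>' \<and> Ck_on k \<psi> U \<and> Ck_on k \<psi>' V \<and>
        \<psi> ` (M \<inter> U) = V \<inter> {(x, y, z). x = 0})"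

text \<open>\<open>M\<close> is regularly parametrized by an angle \<open>\<phi> \<in> \<real>/2\<pi>\<int>\<close> and by the phase space coordinate
  \<open>l \<in> [0, l0)\<close>. As \<open>l\<close> is preserved, the immersion condition reduces to a nonvanishing \<open>\<phi>\<close>-derivative;
  it is void for \<open>k = 0\<close>.\<close>

definition angular_param ::
  "nat \<Rightarrow> real \<Rightarrow> (real \<Rightarrow> real \<Rightarrow> real \<times> real \<times> real) \<Rightarrow> (real \<times> real \<times> real) set \<Rightarrow> bool" where
  "angular_param k l0 F M \<longleftrightarrow>
     (\<forall>\<phi>. \<forall>l\<in>{0..<l0}. F (\<phi> + 2 * pi) l = F \<phi> l \<and> snd (snd (F \<phi> l)) = l) \<and>
     bij_betw (\<lambda>(\<phi>, l). F \<phi> l) ({0..<2 * pi} \<times> {0..<l0}) M \<and>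
     (k \<ge> 1 \<longrightarrow> (\<forall>\<phi>. \<forall>l\<in>{0..<l0}. \<exists>D. D \<noteq> 0 \<and> ((\<lambda>s. F s l) has_vector_derivative D) (at \<phi>)))"

end

theory Submission
  imports Defs
begin

text \<open>In the coordinates \<open>1 / r - 1 = e cos \<phi>\<close>, \<open>v = e sin \<phi>\<close>, \<open>\<sigma> = 3 \<delta> l\<^sup>3\<close>, with the angle \<open>\<phi>\<close> as time, \<open>e\<close>
  moves with speed \<open>O(\<sigma>)\<close> and \<open>\<sigma>\<close> decays like \<open>1 / t\<close>. Averaging over the angle \<open>j\<close> times produces a smooth
  function \<open>P\<close> with \<open>P = e\<^sup>2 / 2\<close> on \<open>\<sigma> = 0\<close> whose derivative along the flow is \<open>\<sigma>\<^sup>j\<close> times a smooth function, so the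
  limit of \<open>H\<close> is \<open>P\<close> plus the integral of this derivative along the orbit. The derivatives of the
  flow in the initial value grow only polynomially in time; hence for \<open>j\<close> large this integral
  converges together with its derivatives up to order \<open>k\<close>, and the limit is \<open>C\<^sup>k\<close> up to \<open>l = 0\<close>. There its
  derivative in \<open>e\<close> is \<open>e > 0\<close>, so near \<open>\<Gamma>\<^sub>1(h)\<close> its level sets are graphs \<open>e = E (h, \<phi>, l)\<close> over angle and
  angular momentum. A level set is a stable set because \<open>l \<rightarrow> 0\<close> along every
  solution, so that convergence to \<open>\<Gamma>\<^sub>1(h)\<close> is convergence of \<open>H\<close> to \<open>h\<close>.\<close>

subsection \<open>Functions with polynomially growing derivatives\<close>

text \<open>The orbit \<open>Gamma1 h\<close> is not hyperbolic: l decays only like t^(-1/3),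
  neighbouring orbits do not contract, and no stable manifold theorem with exponential rates
  applies. Smoothness must come from one scalar limit. Taken as it stands, the derivative of H along
  an orbit is of size 1/t and integrable only through its oscillation, while each derivative in the
  initial value costs a power of t; averaging trades the oscillation for powers of 1/t. The growth
  is polynomial because, with the angle as time, the field is a unit rotation plus terms of order
  \<sigma>. Two orbits keep a constant angle difference, and all coefficients of the linearised
  equation are O(1/t) except the one by which an error in \<sigma> drives e; measuring that error
  with the weight 1 + t makes this one O(1/t) too. All function classes carry Lipschitz bounds
  instead of mere continuity. First-order expansions then have quadratic remainders with explicit
  growth in t, and differentiating an improper integral, a flow or an implicit function becomes an
  inequality between remainders.\<close>

text \<open>For functions \<open>y t p\<close> of time and a parameter, \<open>tame m k\<close> means: \<open>k\<close> times differentiable in \<open>p\<close>, and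
  \<open>y\<close>, its derivatives and their Lipschitz constants are \<open>O((1 + t)\<^sup>m)\<close> uniformly in \<open>p\<close>. For \<open>semitame\<close> the
  values of \<open>y\<close> itself may be unbounded, as they are for the angle along the flow. Autonomous functions
  enter as \<open>\<lambda>_. f\<close> with \<open>m = 0\<close>.\<close>

definition gbound ::
  "real \<Rightarrow> (real \<Rightarrow> 'p::euclidean_space \<Rightarrow> 'b::euclidean_space) \<Rightarrow> 'p set \<Rightarrow> bool" where
  "gbound m y S \<longleftrightarrow> (\<exists>C. \<forall>t\<ge>0. \<forall>p\<in>S. norm (y t p) \<le> C * (1 + t) powr m)"

definition glip ::
  "real \<Rightarrow> (real \<Rightarrow> 'p::euclidean_space \<Rightarrow> 'b::euclidean_space) \<Rightarrow> 'p set \<Rightarrow> bool" where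
  "glip m y S \<longleftrightarrow> (\<forall>p\<in>S. continuous_on {0..} (\<lambda>t. y t p)) \<and>
     (\<exists>C. \<forall>t\<ge>0. \<forall>p\<in>S. \<forall>q\<in>S. norm (y t p - y t q) \<le> C * (1 + t) powr m * norm (p - q))"

primrec semitame ::
  "real \<Rightarrow> nat \<Rightarrow> (real \<Rightarrow> 'p::euclidean_space \<Rightarrow> 'b::euclidean_space) \<Rightarrow> 'p set \<Rightarrow> bool" where
  "semitame m 0 y S \<longleftrightarrow> glip m y S"
| "semitame m (Suc k) y S \<longleftrightarrow> glip m y S \<and>
     (\<exists>y'. (\<forall>t\<ge>0. \<forall>p\<in>S. (y t has_derivative y' t p) (at p within S)) \<and>
           (\<forall>b\<in>Basis. gbound m (\<lambda>t p. y' t p b) S \<and> semitame m k (\<lambda>t p. y' t p b) S))"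

definition tame ::
  "real \<Rightarrow> nat \<Rightarrow> (real \<Rightarrow> 'p::euclidean_space \<Rightarrow> 'b::euclidean_space) \<Rightarrow> 'p set \<Rightarrow> bool" where
  "tame m k y S \<longleftrightarrow> gbound m y S \<and> semitame m k y S"

lemma gboundE:
  assumes "gbound m y S"
  obtains C where "C \<ge> 0" "\<And>t p. t \<ge> 0 \<Longrightarrow> p \<in> S \<Longrightarrow> norm (y t p) \<le> C * (1 + t) powr m"
proof -
  obtain C where C: "\<forall>t\<ge>0. \<forall>p\<in>S. norm (y t p) \<le> C * (1 + t) powr m"
    using assms by (auto simp: gbound_def)
  have "norm (y t p) \<le> max C 0 * (1 + t) powr m" if "t \<ge> 0" "p \<in> S" for t p
    using C that by (smt (verit) max.cobounded1 mult_right_mono powr_ge_zero)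
  then show ?thesis using that[of "max C 0"] by auto
qed

lemma glipE:
  assumes "glip m y S"
  obtains C where "C \<ge> 0"
    "\<And>t p q. t \<ge> 0 \<Longrightarrow> p \<in> S \<Longrightarrow> q \<in> S \<Longrightarrow> norm (y t p - y t q) \<le> C * (1 + t) powr m * norm (p - q)"
proof -
  obtain C where C: "\<forall>t\<ge>0. \<forall>p\<in>S. \<forall>q\<in>S. norm (y t p - y t q) \<le> C * (1 + t) powr m * norm (p - q)"
    using assms by (auto simp: glip_def)
  have "norm (y t p - y t q) \<le> max C 0 * (1 + t) powr m * norm (p - q)"
    if "t \<ge> 0" "p \<in> S" "q \<in> S" for t p q
  proof -
    have "C * (1 + t) powr m * norm (p - q) \<le> max C 0 * (1 + t) powr m * norm (p - q)"
      by (intro mult_right_mono) auto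
    moreover have "norm (y t p - y t q) \<le> C * (1 + t) powr m * norm (p - q)" using C that by blast
    ultimately show ?thesis by linarith
  qed
  then show ?thesis using that[of "max C 0"] by auto
qed

lemma gboundI:
  assumes "\<And>t p. t \<ge> 0 \<Longrightarrow> p \<in> S \<Longrightarrow> norm (y t p) \<le> C * (1 + t) powr m"
  shows "gbound m y S"
  using assms by (auto simp: gbound_def)

lemma glipI:
  assumes "\<And>p. p \<in> S \<Longrightarrow> continuous_on {0..} (\<lambda>t. y t p)"
    "\<And>t p q. t \<ge> 0 \<Longrightarrow> p \<in> S \<Longrightarrow> q \<in> S \<Longrightarrow> norm (y t p - y t q) \<le> C * (1 + t) powr m * norm (p - q)"
  shows "glip m y S"
  using assms unfolding glip_def by blast

lemma glip_cont: "glip m y S \<Longrightarrow> p \<in> S \<Longrightarrow> continuous_on {0..} (\<lambda>t. y t p)"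
  by (auto simp: glip_def)

lemma semitame_glip: "semitame m k y S \<Longrightarrow> glip m y S"
  by (cases k) auto

lemma tame_glip: "tame m k y S \<Longrightarrow> glip m y S"
  and tame_gbound: "tame m k y S \<Longrightarrow> gbound m y S"
  and tame_semitame: "tame m k y S \<Longrightarrow> semitame m k y S"
  by (auto simp: tame_def semitame_glip)

lemma tame_0: "tame m 0 y S \<longleftrightarrow> gbound m y S \<and> glip m y S"
  by (simp add: tame_def)

lemma semitame_Suc:
  "semitame m (Suc k) y S \<longleftrightarrow> glip m y S \<and>
     (\<exists>y'. (\<forall>t\<ge>0. \<forall>p\<in>S. (y t has_derivative y' t p) (at p within S)) \<and>
           (\<forall>b\<in>Basis. tame m k (\<lambda>t p. y' t p b) S))"
  by (simp add: tame_def)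

lemma semitame_SucI:
  assumes "glip m y S"
    "\<And>t p. t \<ge> 0 \<Longrightarrow> p \<in> S \<Longrightarrow> (y t has_derivative y' t p) (at p within S)"
    "\<And>b. b \<in> Basis \<Longrightarrow> tame m k (\<lambda>t p. y' t p b) S"
  shows "semitame m (Suc k) y S"
  unfolding semitame_Suc using assms by blast

lemma semitame_SucE:
  assumes "semitame m (Suc k) y S"
  obtains y' where
    "\<And>t p. t \<ge> 0 \<Longrightarrow> p \<in> S \<Longrightarrow> (y t has_derivative y' t p) (at p within S)"
    "\<And>b. b \<in> Basis \<Longrightarrow> tame m k (\<lambda>t p. y' t p b) S"
  using assms unfolding semitame_Suc by blast

declare semitame.simps(2) [simp del]

lemma semitame_cong:
  assumes "semitame m k y S" "\<And>t p. t \<ge> 0 \<Longrightarrow> p \<in> S \<Longrightarrow> y t p = z t p"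
  shows "semitame m k z S"
proof -
  have g: "glip m z S"
  proof -
    obtain C where C: "C \<ge> 0" "\<And>t p q. t \<ge> 0 \<Longrightarrow> p \<in> S \<Longrightarrow> q \<in> S \<Longrightarrow>
        norm (y t p - y t q) \<le> C * (1 + t) powr m * norm (p - q)"
      using glipE[OF semitame_glip[OF assms(1)]] by blast
    show ?thesis
    proof (rule glipI[where C = C])
      show "continuous_on {0..} (\<lambda>t. z t p)" if "p \<in> S" for p
        using glip_cont[OF semitame_glip[OF assms(1)] that] assms(2)[OF _ that]
        by (rule continuous_on_eq) auto
    qed (use C assms(2) in auto)
  qed
  show ?thesis
  proof (cases k)
    case 0 then show ?thesis using g by simp
  next
    case (Suc j)
    obtain y' where y': "\<And>t p. t \<ge> 0 \<Longrightarrow> p \<in> S \<Longrightarrow> (y t has_derivative y' t p) (at p within S)"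
      "\<And>b. b \<in> Basis \<Longrightarrow> tame m j (\<lambda>t p. y' t p b) S"
      using semitame_SucE[OF assms(1)[unfolded Suc]] by blast
    have "(z t has_derivative y' t p) (at p within S)" if "t \<ge> 0" "p \<in> S" for t p
      by (rule has_derivative_transform[OF that(2) _ y'(1)[OF that]]) (use assms(2)[OF that(1)] in simp)
    then show ?thesis unfolding Suc by (intro semitame_SucI[OF g _ y'(2)])
  qed
qed

lemma tame_cong:
  assumes "tame m k y S" "\<And>t p. t \<ge> 0 \<Longrightarrow> p \<in> S \<Longrightarrow> y t p = z t p"
  shows "tame m k z S"
  using assms semitame_cong[of m k y S z] unfolding tame_def gbound_def by simp

lemma gbound_mono: "gbound m y S \<Longrightarrow> m \<le> m' \<Longrightarrow> gbound m' y S"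
proof (erule gboundE)
  fix C assume m: "m \<le> m'" and C: "C \<ge> 0"
    "\<And>t p. t \<ge> 0 \<Longrightarrow> p \<in> S \<Longrightarrow> norm (y t p) \<le> C * (1 + t) powr m"
  show ?thesis
  proof (rule gboundI)
    fix t :: real and p assume tp: "t \<ge> 0" "p \<in> S"
    have "C * (1 + t) powr m \<le> C * (1 + t) powr m'"
      using C(1) m tp by (intro mult_left_mono powr_mono) auto
    then show "norm (y t p) \<le> C * (1 + t) powr m'" using C(2)[OF tp] by linarith
  qed
qed

lemma glip_mono: "glip m y S \<Longrightarrow> m \<le> m' \<Longrightarrow> glip m' y S"
proof -
  assume g: "glip m y S" and m: "m \<le> m'"
  obtain C where C: "C \<ge> 0" "\<And>t p q. t \<ge> 0 \<Longrightarrow> p \<in> S \<Longrightarrow> q \<in> S \<Longrightarrow>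
      norm (y t p - y t q) \<le> C * (1 + t) powr m * norm (p - q)"
    using glipE[OF g] by blast
  show ?thesis
  proof (rule glipI[where C = C])
    fix t :: real and p q assume tp: "t \<ge> 0" "p \<in> S" "q \<in> S"
    have "C * (1 + t) powr m * norm (p - q) \<le> C * (1 + t) powr m' * norm (p - q)"
      using C(1) m tp by (intro mult_left_mono mult_right_mono powr_mono) auto
    then show "norm (y t p - y t q) \<le> C * (1 + t) powr m' * norm (p - q)"
      using C(2)[OF tp] by linarith
  qed (use g glip_cont in blast)
qed

lemma semitame_mono: "semitame m k y S \<Longrightarrow> m \<le> m' \<Longrightarrow> semitame m' k y S"
proof (induction k arbitrary: y)
  case 0 then show ?case by (auto intro: glip_mono)
next
  case (Suc k)
  obtain y' where y': "\<And>t p. t \<ge> 0 \<Longrightarrow> p \<in> S \<Longrightarrow> (y t has_derivative y' t p) (at p within S)"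
    "\<And>b. b \<in> Basis \<Longrightarrow> tame m k (\<lambda>t p. y' t p b) S"
    using semitame_SucE[OF Suc.prems(1)] by blast
  show ?case
  proof (rule semitame_SucI[OF _ y'(1)])
    show "glip m' y S" using Suc.prems glip_mono semitame_glip by blast
  next
    fix b :: 'a assume "b \<in> Basis"
    from y'(2)[OF this] show "tame m' k (\<lambda>t p. y' t p b) S"
      using gbound_mono[OF tame_gbound Suc.prems(2)] Suc.IH[OF tame_semitame Suc.prems(2)]
      by (simp add: tame_def)
  qed auto
qed

lemma tame_mono: "tame m k y S \<Longrightarrow> m \<le> m' \<Longrightarrow> tame m' k y S"
  unfolding tame_def using semitame_mono gbound_mono by blast

lemma semitame_less: "semitame m (Suc k) y S \<Longrightarrow> semitame m k y S"
proof (induction k arbitrary: y)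
  case 0 then show ?case by (auto dest: semitame_glip)
next
  case (Suc k)
  obtain y' where y': "\<And>t p. t \<ge> 0 \<Longrightarrow> p \<in> S \<Longrightarrow> (y t has_derivative y' t p) (at p within S)"
    "\<And>b. b \<in> Basis \<Longrightarrow> tame m (Suc k) (\<lambda>t p. y' t p b) S"
    using semitame_SucE[OF Suc.prems(1)] by blast
  show ?case
  proof (rule semitame_SucI[OF semitame_glip[OF Suc.prems] y'(1)])
    fix b :: 'a assume b: "b \<in> Basis"
    show "tame m k (\<lambda>t p. y' t p b) S"
      using y'(2)[OF b] Suc.IH[of "\<lambda>t p. y' t p b"] by (simp add: tame_def)
  qed
qed

lemma semitame_le: "semitame m k y S \<Longrightarrow> j \<le> k \<Longrightarrow> semitame m j y S"
  by (induction k) (auto simp: le_Suc_eq dest: semitame_less)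

lemma tame_le: "tame m k y S \<Longrightarrow> j \<le> k \<Longrightarrow> tame m j y S"
  by (auto simp: tame_def intro: semitame_le)

lemma gbound_subset: "gbound m y S \<Longrightarrow> T \<subseteq> S \<Longrightarrow> gbound m y T"
  unfolding gbound_def by blast

lemma semitame_subset: "semitame m k y S \<Longrightarrow> T \<subseteq> S \<Longrightarrow> semitame m k y T"
proof (induction k arbitrary: y)
  case 0 then show ?case by (auto simp: glip_def) (meson subset_iff)
next
  case (Suc k)
  obtain y' where y': "\<And>t p. t \<ge> 0 \<Longrightarrow> p \<in> S \<Longrightarrow> (y t has_derivative y' t p) (at p within S)"
    "\<And>b. b \<in> Basis \<Longrightarrow> tame m k (\<lambda>t p. y' t p b) S"
    using semitame_SucE[OF Suc.prems(1)] by blast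
  have "glip m y T" using semitame_glip[OF Suc.prems(1)] Suc.prems(2)
    by (auto simp: glip_def) (meson subset_iff)
  then show ?case
  proof (rule semitame_SucI)
    show "(y t has_derivative y' t p) (at p within T)" if "t \<ge> 0" "p \<in> T" for t p
      using y'(1)[of t p] that Suc.prems(2) has_derivative_subset by blast
    fix b :: 'a assume b: "b \<in> Basis"
    show "tame m k (\<lambda>t p. y' t p b) T"
      using gbound_subset[OF tame_gbound[OF y'(2)[OF b]] Suc.prems(2)]
        Suc.IH[OF tame_semitame[OF y'(2)[OF b]] Suc.prems(2)] by (simp add: tame_def)
  qed
qed

lemma tame_subset: "tame m k y S \<Longrightarrow> T \<subseteq> S \<Longrightarrow> tame m k y T"
  using semitame_subset gbound_subset unfolding tame_def by blast

lemma gbound_add: "gbound m y S \<Longrightarrow> gbound m z S \<Longrightarrow> gbound m (\<lambda>t p. y t p + z t p) S"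
proof -
  assume g: "gbound m y S" "gbound m z S"
  obtain C where C: "C \<ge> 0" "\<And>t p. t \<ge> 0 \<Longrightarrow> p \<in> S \<Longrightarrow> norm (y t p) \<le> C * (1 + t) powr m"
    using gboundE[OF g(1)] by blast
  obtain D where D: "D \<ge> 0" "\<And>t p. t \<ge> 0 \<Longrightarrow> p \<in> S \<Longrightarrow> norm (z t p) \<le> D * (1 + t) powr m"
    using gboundE[OF g(2)] by blast
  show ?thesis
  proof (rule gboundI[where C = "C + D"])
    fix t :: real and p assume tp: "t \<ge> 0" "p \<in> S"
    show "norm (y t p + z t p) \<le> (C + D) * (1 + t) powr m"
      using norm_triangle_ineq[of "y t p" "z t p"] C(2)[OF tp] D(2)[OF tp] by (simp add: distrib_right)
  qed
qed

lemma glip_add: "glip m y S \<Longrightarrow> glip m z S \<Longrightarrow> glip m (\<lambda>t p. y t p + z t p) S"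
proof -
  assume g: "glip m y S" "glip m z S"
  obtain C where C: "C \<ge> 0" "\<And>t p q. t \<ge> 0 \<Longrightarrow> p \<in> S \<Longrightarrow> q \<in> S \<Longrightarrow>
      norm (y t p - y t q) \<le> C * (1 + t) powr m * norm (p - q)"
    using glipE[OF g(1)] by blast
  obtain D where D: "D \<ge> 0" "\<And>t p q. t \<ge> 0 \<Longrightarrow> p \<in> S \<Longrightarrow> q \<in> S \<Longrightarrow>
      norm (z t p - z t q) \<le> D * (1 + t) powr m * norm (p - q)"
    using glipE[OF g(2)] by blast
  show ?thesis
  proof (rule glipI[where C = "C + D"])
    show "continuous_on {0..} (\<lambda>t. y t p + z t p)" if "p \<in> S" for p
      using g that by (intro continuous_intros glip_cont)
    fix t :: real and p q assume tp: "t \<ge> 0" "p \<in> S" "q \<in> S"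
    have "norm (y t p + z t p - (y t q + z t q)) = norm ((y t p - y t q) + (z t p - z t q))"
      by (simp add: algebra_simps)
    also have "\<dots> \<le> norm (y t p - y t q) + norm (z t p - z t q)" by (rule norm_triangle_ineq)
    also have "\<dots> \<le> (C + D) * (1 + t) powr m * norm (p - q)"
      using C(2)[OF tp] D(2)[OF tp] by (simp add: distrib_right)
    finally show "norm (y t p + z t p - (y t q + z t q)) \<le> (C + D) * (1 + t) powr m * norm (p - q)" .
  qed
qed

lemma semitame_add:
  "semitame m k y S \<Longrightarrow> semitame m k z S \<Longrightarrow> semitame m k (\<lambda>t p. y t p + z t p) S"
proof (induction k arbitrary: y z)
  case 0 then show ?case by (auto intro: glip_add)
next
  case (Suc k)
  obtain y' where y': "\<And>t p. t \<ge> 0 \<Longrightarrow> p \<in> S \<Longrightarrow> (y t has_derivative y' t p) (at p within S)"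
    "\<And>b. b \<in> Basis \<Longrightarrow> tame m k (\<lambda>t p. y' t p b) S"
    using semitame_SucE[OF Suc.prems(1)] by blast
  obtain z' where z': "\<And>t p. t \<ge> 0 \<Longrightarrow> p \<in> S \<Longrightarrow> (z t has_derivative z' t p) (at p within S)"
    "\<And>b. b \<in> Basis \<Longrightarrow> tame m k (\<lambda>t p. z' t p b) S"
    using semitame_SucE[OF Suc.prems(2)] by blast
  show ?case
  proof (rule semitame_SucI[where y' = "\<lambda>t p h. y' t p h + z' t p h"])
    show "glip m (\<lambda>t p. y t p + z t p) S" using Suc.prems glip_add semitame_glip by blast
    fix b :: 'a assume b: "b \<in> Basis"
    show "tame m k (\<lambda>t p. y' t p b + z' t p b) S"
      using y'(2)[OF b] z'(2)[OF b] Suc.IH[of "\<lambda>t p. y' t p b" "\<lambda>t p. z' t p b"]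
        gbound_add[of m "\<lambda>t p. y' t p b" S "\<lambda>t p. z' t p b"] by (simp add: tame_def)
  qed (intro derivative_intros y' z'; assumption)
qed

lemma tame_add: "tame m k y S \<Longrightarrow> tame m k z S \<Longrightarrow> tame m k (\<lambda>t p. y t p + z t p) S"
  by (auto simp: tame_def intro: semitame_add gbound_add)

lemma gbound_lin: "bounded_linear f \<Longrightarrow> gbound m y S \<Longrightarrow> gbound m (\<lambda>t p. f (y t p)) S"
proof -
  assume f: "bounded_linear f" and g: "gbound m y S"
  obtain K where K: "K > 0" "\<And>x. norm (f x) \<le> norm x * K"
    using bounded_linear.pos_bounded[OF f] by blast
  obtain C where C: "C \<ge> 0" "\<And>t p. t \<ge> 0 \<Longrightarrow> p \<in> S \<Longrightarrow> norm (y t p) \<le> C * (1 + t) powr m"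
    using gboundE[OF g] by blast
  have "norm (f (y t p)) \<le> (C * K) * (1 + t) powr m" if "t \<ge> 0" "p \<in> S" for t p
  proof -
    have "norm (f (y t p)) \<le> norm (y t p) * K" by (rule K)
    also have "\<dots> \<le> C * (1 + t) powr m * K"
      using C(2)[OF that] K(1) by (intro mult_right_mono) auto
    finally show ?thesis by (simp add: mult_ac)
  qed
  then show ?thesis by (rule gboundI)
qed

lemma glip_lin: "bounded_linear f \<Longrightarrow> glip m y S \<Longrightarrow> glip m (\<lambda>t p. f (y t p)) S"
proof -
  assume f: "bounded_linear f" and g: "glip m y S"
  obtain K where K: "K > 0" "\<And>x. norm (f x) \<le> norm x * K"
    using bounded_linear.pos_bounded[OF f] by blast
  obtain C where C: "C \<ge> 0" "\<And>t p q. t \<ge> 0 \<Longrightarrow> p \<in> S \<Longrightarrow> q \<in> S \<Longrightarrow>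
      norm (y t p - y t q) \<le> C * (1 + t) powr m * norm (p - q)"
    using glipE[OF g] by blast
  show ?thesis
  proof (rule glipI[where C = "C * K"])
    show "continuous_on {0..} (\<lambda>t. f (y t p))" if "p \<in> S" for p
      using g that by (intro bounded_linear.continuous_on[OF f] glip_cont)
    fix t :: real and p q assume tp: "t \<ge> 0" "p \<in> S" "q \<in> S"
    have "norm (f (y t p) - f (y t q)) = norm (f (y t p - y t q))"
      using f by (simp add: bounded_linear.linear linear_diff)
    also have "\<dots> \<le> norm (y t p - y t q) * K" by (rule K)
    also have "\<dots> \<le> C * (1 + t) powr m * norm (p - q) * K"
      using C(2)[OF tp] K(1) by (intro mult_right_mono) auto
    finally show "norm (f (y t p) - f (y t q)) \<le> C * K * (1 + t) powr m * norm (p - q)"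
      by (simp add: algebra_simps)
  qed
qed

lemma semitame_lin:
  "bounded_linear f \<Longrightarrow> semitame m k y S \<Longrightarrow> semitame m k (\<lambda>t p. f (y t p)) S"
proof (induction k arbitrary: y)
  case 0 then show ?case by (auto intro: glip_lin)
next
  case (Suc k y)
  obtain y' where y': "\<And>t p. t \<ge> 0 \<Longrightarrow> p \<in> S \<Longrightarrow> (y t has_derivative y' t p) (at p within S)"
    "\<And>b. b \<in> Basis \<Longrightarrow> tame m k (\<lambda>t p. y' t p b) S"
    using semitame_SucE[OF Suc.prems(2)] by blast
  show ?case
  proof (rule semitame_SucI[where y' = "\<lambda>t p h. f (y' t p h)"])
    show "glip m (\<lambda>t p. f (y t p)) S" using Suc.prems glip_lin semitame_glip by blast
    show "((\<lambda>p. f (y t p)) has_derivative (\<lambda>h. f (y' t p h))) (at p within S)"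
      if "t \<ge> 0" "p \<in> S" for t p
      using bounded_linear.has_derivative[OF Suc.prems(1) y'(1)[OF that]] .
    fix b :: 'c assume b: "b \<in> Basis"
    show "tame m k (\<lambda>t p. f (y' t p b)) S"
      using y'(2)[OF b] Suc.IH[OF Suc.prems(1), of "\<lambda>t p. y' t p b"]
        gbound_lin[OF Suc.prems(1), of m "\<lambda>t p. y' t p b" S] by (simp add: tame_def)
  qed
qed

lemma tame_lin: "bounded_linear f \<Longrightarrow> tame m k y S \<Longrightarrow> tame m k (\<lambda>t p. f (y t p)) S"
  by (auto simp: tame_def intro: semitame_lin gbound_lin)

lemma tame_minus: "tame m k y S \<Longrightarrow> tame m k (\<lambda>t p. - y t p) S"
  by (rule tame_lin[OF bounded_linear_minus[OF bounded_linear_ident]])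

lemma tame_diff: "tame m k y S \<Longrightarrow> tame m k z S \<Longrightarrow> tame m k (\<lambda>t p. y t p - z t p) S"
  using tame_add[OF _ tame_minus, of m k y S z] by simp

lemma tame_inner: "tame m k y S \<Longrightarrow> tame m k (\<lambda>t p. y t p \<bullet> b) S"
  by (rule tame_lin[OF bounded_linear_inner_left])

lemma tame_scale: "tame m k y S \<Longrightarrow> tame m k (\<lambda>t p. c *\<^sub>R y t p) S"
  by (rule tame_lin[OF bounded_linear_scaleR_right])

lemma semitame_Pair:
  assumes "semitame m k y S" "semitame m k z S"
  shows "semitame m k (\<lambda>t p. (y t p, z t p)) S"
proof -
  have "semitame m k (\<lambda>t p. (y t p, 0)) S" "semitame m k (\<lambda>t p. (0, z t p)) S"
    using assms by (auto intro!: semitame_lin[where f = "\<lambda>x. (x, 0)"]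
        semitame_lin[where f = "\<lambda>x. (0, x)"] bounded_linear_Pair bounded_linear_ident bounded_linear_zero)
  from semitame_add[OF this] show ?thesis by simp
qed

lemma tame_time:
  fixes c :: "real \<Rightarrow> 'b::euclidean_space" and S :: "'p::euclidean_space set"
  assumes "continuous_on {0..} c" "\<And>t. t \<ge> 0 \<Longrightarrow> norm (c t) \<le> C * (1 + t) powr m"
  shows "tame m k (\<lambda>t p. c t) S"
  using assms
proof (induction k arbitrary: c C)
  case 0
  then show ?case
    by (auto simp: tame_def intro!: gboundI[where C = C] glipI[where C = 0])
next
  case (Suc k)
  have "tame m k (\<lambda>t p. 0 :: 'b) S" by (rule Suc.IH[where C = 0 and c = "\<lambda>_. 0"]) auto
  moreover have "glip m (\<lambda>t p. c t) S" using Suc.prems by (intro glipI[where C = 0]) auto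
  ultimately have "semitame m (Suc k) (\<lambda>t p. c t) S"
    by (intro semitame_SucI[where y' = "\<lambda>t p h. 0"]) auto
  then show ?case using Suc.prems by (auto simp: tame_def intro!: gboundI[where C = C])
qed

lemma tame_const: "tame 0 k (\<lambda>t p. c) S"
  by (rule tame_time[where C = "norm c" and c = "\<lambda>_. c"]) auto

lemma tame_zero:
  "tame m k (\<lambda>t p. 0 :: 'b::euclidean_space) (S :: 'p::euclidean_space set)"
proof -
  have "tame m k (\<lambda>t (p :: 'p). (\<lambda>_. 0 :: 'b) t) S"
    by (rule tame_time[where C = 0]) auto
  then show ?thesis by simp
qed

lemma tame_sum:
  "(\<And>i. i \<in> I \<Longrightarrow> tame m k (y i) S) \<Longrightarrow> tame m k (\<lambda>t p. \<Sum>i\<in>I. y i t p) S"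
  by (induction I rule: infinite_finite_induct) (auto intro: tame_zero tame_add)

text \<open>The derivative is constant, but the values are unbounded on an unbounded set. The angle
  coordinate enters the later constructions in this way, which is why \<open>semitame\<close> is
  kept apart from \<open>tame\<close>.\<close>

lemma semitame_linear:
  assumes "bounded_linear f"
  shows "semitame 0 k (\<lambda>t p. f p) S"
proof -
  have "semitame 0 k (\<lambda>t p. p) S"
  proof (cases k)
    case 0 then show ?thesis by (auto intro!: glipI[where C = 1])
  next
    case (Suc j)
    show ?thesis unfolding Suc
      by (rule semitame_SucI[where y' = "\<lambda>t p h. h"])
        (auto intro!: glipI[where C = 1] tame_const)
  qed
  from semitame_lin[OF assms this] show ?thesis .
qed

lemma gbound_scaleR:
  assumes "gbound m1 a S" "gbound m2 y S"
  shows "gbound (m1 + m2) (\<lambda>t p. a t p *\<^sub>R y t p) S"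
proof -
  obtain C where C: "C \<ge> 0" "\<And>t p. t \<ge> 0 \<Longrightarrow> p \<in> S \<Longrightarrow> norm (a t p) \<le> C * (1 + t) powr m1"
    using gboundE[OF assms(1)] by blast
  obtain D where D: "D \<ge> 0" "\<And>t p. t \<ge> 0 \<Longrightarrow> p \<in> S \<Longrightarrow> norm (y t p) \<le> D * (1 + t) powr m2"
    using gboundE[OF assms(2)] by blast
  show ?thesis
  proof (rule gboundI[where C = "C * D"])
    fix t :: real and p assume tp: "t \<ge> 0" "p \<in> S"
    have "norm (a t p *\<^sub>R y t p) = norm (a t p) * norm (y t p)" by simp
    also have "\<dots> \<le> (C * (1 + t) powr m1) * (D * (1 + t) powr m2)"
      using C(2)[OF tp] D(2)[OF tp] C(1) D(1) by (intro mult_mono) auto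
    finally show "norm (a t p *\<^sub>R y t p) \<le> C * D * (1 + t) powr (m1 + m2)"
      by (simp add: powr_add mult_ac)
  qed
qed

lemma glip_scaleR:
  assumes "gbound m1 a S" "gbound m2 y S" "glip m1 a S" "glip m2 y S"
  shows "glip (m1 + m2) (\<lambda>t p. a t p *\<^sub>R y t p) S"
proof -
  obtain C where C: "C \<ge> 0" "\<And>t p. t \<ge> 0 \<Longrightarrow> p \<in> S \<Longrightarrow> norm (a t p) \<le> C * (1 + t) powr m1"
    using gboundE[OF assms(1)] by blast
  obtain D where D: "D \<ge> 0" "\<And>t p. t \<ge> 0 \<Longrightarrow> p \<in> S \<Longrightarrow> norm (y t p) \<le> D * (1 + t) powr m2"
    using gboundE[OF assms(2)] by blast
  obtain C' where C': "C' \<ge> 0" "\<And>t p q. t \<ge> 0 \<Longrightarrow> p \<in> S \<Longrightarrow> q \<in> S \<Longrightarrow>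
      norm (a t p - a t q) \<le> C' * (1 + t) powr m1 * norm (p - q)"
    using glipE[OF assms(3)] by blast
  obtain D' where D': "D' \<ge> 0" "\<And>t p q. t \<ge> 0 \<Longrightarrow> p \<in> S \<Longrightarrow> q \<in> S \<Longrightarrow>
      norm (y t p - y t q) \<le> D' * (1 + t) powr m2 * norm (p - q)"
    using glipE[OF assms(4)] by blast
  show ?thesis
  proof (rule glipI[where C = "C' * D + C * D'"])
    show "continuous_on {0..} (\<lambda>t. a t p *\<^sub>R y t p)" if "p \<in> S" for p
      using assms that by (intro continuous_intros glip_cont)
    fix t :: real and p q assume tp: "t \<ge> 0" "p \<in> S" "q \<in> S"
    have "a t p *\<^sub>R y t p - a t q *\<^sub>R y t q = (a t p - a t q) *\<^sub>R y t p + a t q *\<^sub>R (y t p - y t q)"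
      by (simp add: algebra_simps)
    then have "norm (a t p *\<^sub>R y t p - a t q *\<^sub>R y t q)
        \<le> norm (a t p - a t q) * norm (y t p) + norm (a t q) * norm (y t p - y t q)"
      by (metis norm_scaleR norm_triangle_ineq real_norm_def)
    also have "\<dots> \<le> (C' * (1 + t) powr m1 * norm (p - q)) * (D * (1 + t) powr m2)
        + (C * (1 + t) powr m1) * (D' * (1 + t) powr m2 * norm (p - q))"
      using C(2)[of t q] D(2)[of t p] C'(2)[OF tp] D'(2)[OF tp] C(1) D(1) C'(1) D'(1) tp
      by (intro add_mono mult_mono) auto
    finally show "norm (a t p *\<^sub>R y t p - a t q *\<^sub>R y t q)
        \<le> (C' * D + C * D') * (1 + t) powr (m1 + m2) * norm (p - q)"
      by (simp add: powr_add algebra_simps)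
  qed
qed

text \<open>Each term of the Leibniz rule contains one factor of growth \<open>m1\<close> and one of
  growth \<open>m2\<close>, so the exponent stays \<open>m1 + m2\<close> at every order. The
  Lipschitz constant of a product involves the values of both factors, hence \<open>tame\<close> and
  not \<open>semitame\<close>.\<close>

lemma tame_scaleR:
  "tame m1 k a S \<Longrightarrow> tame m2 k y S \<Longrightarrow> tame (m1 + m2) k (\<lambda>t p. a t p *\<^sub>R y t p) S"
proof (induction k arbitrary: a y)
  case 0 then show ?case by (auto simp: tame_0 intro: gbound_scaleR glip_scaleR)
next
  case (Suc k)
  obtain a' where a': "\<And>t p. t \<ge> 0 \<Longrightarrow> p \<in> S \<Longrightarrow> (a t has_derivative a' t p) (at p within S)"
    "\<And>b. b \<in> Basis \<Longrightarrow> tame m1 k (\<lambda>t p. a' t p b) S"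
    using semitame_SucE[OF tame_semitame[OF Suc.prems(1)]] by blast
  obtain y' where y': "\<And>t p. t \<ge> 0 \<Longrightarrow> p \<in> S \<Longrightarrow> (y t has_derivative y' t p) (at p within S)"
    "\<And>b. b \<in> Basis \<Longrightarrow> tame m2 k (\<lambda>t p. y' t p b) S"
    using semitame_SucE[OF tame_semitame[OF Suc.prems(2)]] by blast
  have "semitame (m1 + m2) (Suc k) (\<lambda>t p. a t p *\<^sub>R y t p) S"
  proof (rule semitame_SucI[where y' = "\<lambda>t p h. a t p *\<^sub>R y' t p h + a' t p h *\<^sub>R y t p"])
    show "glip (m1 + m2) (\<lambda>t p. a t p *\<^sub>R y t p) S"
      using Suc.prems by (intro glip_scaleR) (auto dest: tame_glip tame_gbound)
    show "((\<lambda>p. a t p *\<^sub>R y t p) has_derivative (\<lambda>h. a t p *\<^sub>R y' t p h + a' t p h *\<^sub>R y t p)) (at p within S)"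
      if "t \<ge> 0" "p \<in> S" for t p
      using has_derivative_scaleR[OF a'(1)[OF that] y'(1)[OF that]] .
    fix b :: 'a assume b: "b \<in> Basis"
    show "tame (m1 + m2) k (\<lambda>t p. a t p *\<^sub>R y' t p b + a' t p b *\<^sub>R y t p) S"
      using Suc.prems b by (intro tame_add Suc.IH a' y') (auto elim: tame_le)
  qed
  then show ?case using Suc.prems by (auto simp: tame_def intro: gbound_scaleR)
qed

lemma tame_mult:
  fixes a y :: "real \<Rightarrow> 'p::euclidean_space \<Rightarrow> real"
  shows "tame m1 k a S \<Longrightarrow> tame m2 k y S \<Longrightarrow> tame (m1 + m2) k (\<lambda>t p. a t p * y t p) S"
  using tame_scaleR[of m1 k a S m2 y] by simp

lemma tame_mult0:
  fixes a y :: "real \<Rightarrow> 'p::euclidean_space \<Rightarrow> real"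
  shows "tame 0 k a S \<Longrightarrow> tame 0 k y S \<Longrightarrow> tame 0 k (\<lambda>t p. a t p * y t p) S"
  using tame_mult[of 0 k a S 0 y] by simp

lemma tame_power0:
  fixes a :: "real \<Rightarrow> 'p::euclidean_space \<Rightarrow> real"
  shows "tame 0 k a S \<Longrightarrow> tame 0 k (\<lambda>t p. a t p ^ n) S"
  by (induction n) (auto intro: tame_mult0 tame_const)

text \<open>The derivative of 1/a is - (1/a) a' (1/a), which contains 1/a itself one order lower:
  the induction hypothesis is applied to the very function being differentiated.\<close>

lemma tame_inverse:
  fixes a :: "real \<Rightarrow> 'p::euclidean_space \<Rightarrow> real"
  assumes "c > 0" "\<And>t p. t \<ge> 0 \<Longrightarrow> p \<in> S \<Longrightarrow> \<bar>a t p\<bar> \<ge> c" "tame 0 k a S"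
  shows "tame 0 k (\<lambda>t p. inverse (a t p)) S"
  using assms(3)
proof (induction k)
  have gb: "gbound 0 (\<lambda>t p. inverse (a t p)) S"
  proof (rule gboundI[where C = "inverse c"])
    fix t :: real and p assume "t \<ge> 0" "p \<in> S"
    then show "norm (inverse (a t p)) \<le> inverse c * (1 + t) powr 0"
      using assms(1,2) by (auto intro!: le_imp_inverse_le)
  qed
  have gl: "glip 0 (\<lambda>t p. inverse (a t p)) S" if g: "glip 0 a S"
  proof -
    obtain C where C: "C \<ge> 0" "\<And>t p q. t \<ge> 0 \<Longrightarrow> p \<in> S \<Longrightarrow> q \<in> S \<Longrightarrow>
        norm (a t p - a t q) \<le> C * (1 + t) powr 0 * norm (p - q)"
      using glipE[OF g] by blast
    show ?thesis
    proof (rule glipI[where C = "C / c\<^sup>2"])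
      show "continuous_on {0..} (\<lambda>t. inverse (a t p))" if "p \<in> S" for p
        using assms that g by (intro continuous_intros glip_cont) fastforce+
      fix t :: real and p q assume tp: "t \<ge> 0" "p \<in> S" "q \<in> S"
      have n: "\<bar>a t p\<bar> \<ge> c" "\<bar>a t q\<bar> \<ge> c" using assms(2) tp by auto
      then have nz: "a t p \<noteq> 0" "a t q \<noteq> 0" using assms(1) by auto
      have "norm (inverse (a t p) - inverse (a t q)) = norm (a t p - a t q) / (\<bar>a t p\<bar> * \<bar>a t q\<bar>)"
        using nz by (simp add: divide_simps abs_mult[symmetric] abs_minus_commute)
      also have "\<dots> \<le> norm (a t p - a t q) / (c * c)"
        using n assms(1) by (intro divide_left_mono mult_mono mult_pos_pos) auto
      also have "\<dots> \<le> (C * (1 + t) powr 0 * norm (p - q)) / (c * c)"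
        using C(2)[OF tp] assms(1) by (intro divide_right_mono) auto
      finally show "norm (inverse (a t p) - inverse (a t q)) \<le> C / c\<^sup>2 * (1 + t) powr 0 * norm (p - q)"
        by (simp add: power2_eq_square)
    qed
  qed
  {
    case 0 then show ?case using gb gl by (auto simp: tame_0)
  next
    case (Suc k)
    obtain a' where a': "\<And>t p. t \<ge> 0 \<Longrightarrow> p \<in> S \<Longrightarrow> (a t has_derivative a' t p) (at p within S)"
      "\<And>b. b \<in> Basis \<Longrightarrow> tame 0 k (\<lambda>t p. a' t p b) S"
      using semitame_SucE[OF tame_semitame[OF Suc.prems(1)]] by blast
    have IH: "tame 0 k (\<lambda>t p. inverse (a t p)) S" using Suc tame_le by force
    have "semitame 0 (Suc k) (\<lambda>t p. inverse (a t p)) S"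
    proof (rule semitame_SucI[where y' = "\<lambda>t p h. - (inverse (a t p) * a' t p h * inverse (a t p))"])
      show "glip 0 (\<lambda>t p. inverse (a t p)) S" using gl Suc.prems tame_glip by blast
      show "((\<lambda>p. inverse (a t p)) has_derivative (\<lambda>h. - (inverse (a t p) * a' t p h * inverse (a t p)))) (at p within S)"
        if "t \<ge> 0" "p \<in> S" for t p
        using Deriv.has_derivative_inverse[OF _ a'(1)[OF that]] assms(1) assms(2)[OF that] by force
    qed (intro tame_minus tame_mult0 IH a'; assumption)
    then show ?case using gb by (auto simp: tame_def)
  }
qed

lemma tame_divide:
  fixes a :: "real \<Rightarrow> 'p::euclidean_space \<Rightarrow> real"
  assumes "c > 0" "\<And>t p. t \<ge> 0 \<Longrightarrow> p \<in> S \<Longrightarrow> \<bar>a t p\<bar> \<ge> c" "tame 0 k a S" "tame 0 k y S"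
  shows "tame 0 k (\<lambda>t p. y t p / a t p) S"
  using tame_mult0[OF assms(4) tame_inverse[OF assms(1-3)]] by (simp add: divide_inverse)

lemma powr_mono_nonneg:
  fixes t :: real assumes "t \<ge> 0" "m \<le> m'" shows "(1 + t) powr m \<le> (1 + t) powr m'"
  using assms by (intro powr_mono) auto

lemma powr_one_le: "(t::real) \<ge> 0 \<Longrightarrow> m \<ge> 0 \<Longrightarrow> 1 \<le> (1 + t) powr m"
  using powr_mono_nonneg[of t 0 m] by simp

text \<open>The derivative extracted by \<open>semitame_SucE\<close> formally depends on time even
  when the function is autonomous. Freezing it at one instant, always 0 in what follows, removes
  this dependence; for \<open>m \<ge> 0\<close> the constant (1 + s)^m is absorbed in C.\<close>

lemma gbound_at:
  assumes "gbound m f D" "s \<ge> 0" "m \<ge> 0"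
  shows "gbound m (\<lambda>t. f s) D"
proof -
  obtain C where C: "C \<ge> 0" "\<And>t p. t \<ge> 0 \<Longrightarrow> p \<in> D \<Longrightarrow> norm (f t p) \<le> C * (1 + t) powr m"
    using gboundE[OF assms(1)] by blast
  show ?thesis
  proof (rule gboundI[where C = "C * (1 + s) powr m"])
    fix t :: real and p assume tp: "t \<ge> 0" "p \<in> D"
    have "C * (1 + s) powr m * 1 \<le> C * (1 + s) powr m * (1 + t) powr m"
      using C(1) powr_one_le[OF tp(1) assms(3)] by (intro mult_left_mono) auto
    then show "norm (f s p) \<le> C * (1 + s) powr m * (1 + t) powr m"
      using C(2)[OF assms(2) tp(2)] by linarith
  qed
qed

lemma glip_at:
  assumes "glip m f D" "s \<ge> 0" "m \<ge> 0"
  shows "glip m (\<lambda>t. f s) D"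
proof -
  obtain C where C: "C \<ge> 0" "\<And>t p q. t \<ge> 0 \<Longrightarrow> p \<in> D \<Longrightarrow> q \<in> D \<Longrightarrow>
      norm (f t p - f t q) \<le> C * (1 + t) powr m * norm (p - q)"
    using glipE[OF assms(1)] by blast
  show ?thesis
  proof (rule glipI[where C = "C * (1 + s) powr m"])
    fix t :: real and p q assume tp: "t \<ge> 0" "p \<in> D" "q \<in> D"
    have "(C * (1 + s) powr m) * 1 * norm (p - q) \<le> (C * (1 + s) powr m) * (1 + t) powr m * norm (p - q)"
      using C(1) powr_one_le[OF tp(1) assms(3)] by (intro mult_right_mono mult_left_mono) auto
    then show "norm (f s p - f s q) \<le> C * (1 + s) powr m * (1 + t) powr m * norm (p - q)"
      using C(2)[OF assms(2) tp(2,3)] by simp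
  qed auto
qed

lemma semitame_at:
  "semitame m k f D \<Longrightarrow> s \<ge> 0 \<Longrightarrow> m \<ge> 0 \<Longrightarrow> semitame m k (\<lambda>t. f s) D"
proof (induction k arbitrary: f)
  case 0 then show ?case by (auto intro: glip_at)
next
  case (Suc k)
  obtain f' where f': "\<And>t p. t \<ge> 0 \<Longrightarrow> p \<in> D \<Longrightarrow> (f t has_derivative f' t p) (at p within D)"
    "\<And>b. b \<in> Basis \<Longrightarrow> tame m k (\<lambda>t p. f' t p b) D"
    using semitame_SucE[OF Suc.prems(1)] by blast
  show ?case
  proof (rule semitame_SucI[where y' = "\<lambda>t. f' s"])
    show "glip m (\<lambda>t. f s) D" using Suc.prems by (blast intro: glip_at semitame_glip)
    fix b :: 'a assume b: "b \<in> Basis"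
    show "tame m k (\<lambda>t p. f' s p b) D"
      using f'(2)[OF b] gbound_at[of m "\<lambda>t p. f' t p b" D s] Suc.IH[of "\<lambda>t p. f' t p b"] Suc.prems(2,3)
      by (auto simp: tame_def)
  qed (use f' Suc.prems in auto)
qed

lemma tame_at: "tame m k f D \<Longrightarrow> s \<ge> 0 \<Longrightarrow> m \<ge> 0 \<Longrightarrow> tame m k (\<lambda>t. f s) D"
  by (auto simp: tame_def intro: gbound_at semitame_at)

section \<open>Composition with autonomous maps\<close>

lemma gbound_comp:
  assumes "gbound 0 (\<lambda>t. G) D" "\<And>t p. t \<ge> 0 \<Longrightarrow> p \<in> S \<Longrightarrow> x t p \<in> D" "m \<ge> 0"
  shows "gbound m (\<lambda>t p. G (x t p)) S"
proof -
  obtain C where C: "C \<ge> 0" "\<And>t p. t \<ge> 0 \<Longrightarrow> p \<in> D \<Longrightarrow> norm (G p) \<le> C * (1 + t) powr 0"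
    using gboundE[OF assms(1)] by blast
  have "gbound 0 (\<lambda>t p. G (x t p)) S" by (rule gboundI[where C = C]) (use C assms(2) in auto)
  then show ?thesis using assms(3) gbound_mono by blast
qed

lemma glip_comp:
  assumes "glip 0 (\<lambda>t. G) D" "\<And>t p. t \<ge> 0 \<Longrightarrow> p \<in> S \<Longrightarrow> x t p \<in> D" "glip m x S"
  shows "glip m (\<lambda>t p. G (x t p)) S"
proof -
  obtain C where C: "C \<ge> 0" "\<And>t p q. t \<ge> 0 \<Longrightarrow> p \<in> D \<Longrightarrow> q \<in> D \<Longrightarrow>
      norm (G p - G q) \<le> C * (1 + t) powr 0 * norm (p - q)"
    using glipE[OF assms(1)] by blast
  then have CG: "norm (G p - G q) \<le> C * norm (p - q)" if "p \<in> D" "q \<in> D" for p q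
    using that C(2)[of 0 p q] by auto
  obtain B where B: "B \<ge> 0" "\<And>t p q. t \<ge> 0 \<Longrightarrow> p \<in> S \<Longrightarrow> q \<in> S \<Longrightarrow>
      norm (x t p - x t q) \<le> B * (1 + t) powr m * norm (p - q)"
    using glipE[OF assms(3)] by blast
  have "continuous_on D G"
    by (rule lipschitz_on_continuous_on[OF lipschitz_onI[OF _ C(1)]])
      (auto simp: dist_norm intro: CG)
  then show ?thesis
  proof (intro glipI[where C = "C * B"])
    show "continuous_on {0..} (\<lambda>t. G (x t p))" if "p \<in> S" for p
      by (rule continuous_on_compose2[OF \<open>continuous_on D G\<close> glip_cont[OF assms(3) that]])
        (use assms(2) that in auto)
    fix t :: real and p q assume tp: "t \<ge> 0" "p \<in> S" "q \<in> S"
    have "norm (G (x t p) - G (x t q)) \<le> C * norm (x t p - x t q)"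
      using CG assms(2) tp by auto
    also have "\<dots> \<le> C * (B * (1 + t) powr m * norm (p - q))"
      using B(2)[OF tp] C(1) by (intro mult_left_mono) auto
    finally show "norm (G (x t p) - G (x t q)) \<le> C * B * (1 + t) powr m * norm (p - q)"
      by (simp add: mult_ac)
  qed
qed

lemma derivative_Basis_expand:
  fixes f :: "'a::euclidean_space \<Rightarrow> 'b::real_normed_vector"
  assumes "linear f"
  shows "f v = (\<Sum>i\<in>Basis. (v \<bullet> i) *\<^sub>R f i)"
proof -
  have "f v = f (\<Sum>i\<in>Basis. (v \<bullet> i) *\<^sub>R i)" by (simp add: euclidean_representation)
  then show ?thesis by (simp add: linear_sum[OF assms] linear_scale[OF assms])
qed

text \<open>Each differentiation brings out one factor of the derivative of x and costs one m; the
  Lipschitz constant of the last derivative costs one more, hence k + 1. The values of x enter only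
  through membership in D, so x may contain the unbounded angle.\<close>

lemma tame_comp:
  fixes x :: "real \<Rightarrow> 'p::euclidean_space \<Rightarrow> 'b::euclidean_space" and G :: "'b \<Rightarrow> 'c::euclidean_space"
  assumes "tame 0 k (\<lambda>t. G) D" "\<And>t p. t \<ge> 0 \<Longrightarrow> p \<in> S \<Longrightarrow> x t p \<in> D" "semitame m k x S" "m \<ge> 0"
  shows "tame ((real k + 1) * m) k (\<lambda>t p. G (x t p)) S"
  using assms(1,3)
proof (induction k arbitrary: G)
  case 0
  then show ?case using assms(2,4) by (auto simp: tame_0 intro: gbound_comp glip_comp)
next
  case (Suc k)
  let ?M = "(real (Suc k) + 1) * m"
  have mM: "m \<le> ?M" using assms(4) by (simp add: mult_le_cancel_right1 mult_le_cancel_right2 algebra_simps)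
  obtain x' where x': "\<And>t p. t \<ge> 0 \<Longrightarrow> p \<in> S \<Longrightarrow> (x t has_derivative x' t p) (at p within S)"
    "\<And>b. b \<in> Basis \<Longrightarrow> tame m k (\<lambda>t p. x' t p b) S"
    using semitame_SucE[OF Suc.prems(2)] by blast
  obtain G1 where G1: "\<And>t p. t \<ge> 0 \<Longrightarrow> p \<in> D \<Longrightarrow> (G has_derivative G1 t p) (at p within D)"
    "\<And>b. b \<in> Basis \<Longrightarrow> tame 0 k (\<lambda>t p. G1 t p b) D"
    using semitame_SucE[OF tame_semitame[OF Suc.prems(1)]] by blast
  define G' where "G' = G1 0"
  have G': "(G has_derivative G' p) (at p within D)" if "p \<in> D" for p
    using G1(1)[of 0 p] that by (simp add: G'_def)
  have G'b: "tame 0 k (\<lambda>t p. G' p b) D" if "b \<in> Basis" for b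
    using tame_at[OF G1(2)[OF that], of 0] by (simp add: G'_def)
  have sx: "semitame m k x S" using Suc.prems(2) semitame_less by blast
  have "semitame ?M (Suc k) (\<lambda>t p. G (x t p)) S"
  proof (rule semitame_SucI[where y' = "\<lambda>t p h. G' (x t p) (x' t p h)"])
    show "glip ?M (\<lambda>t p. G (x t p)) S"
      using glip_comp[OF tame_glip[OF Suc.prems(1)] assms(2) semitame_glip[OF Suc.prems(2)]] mM
      by (auto intro: glip_mono)
    show "((\<lambda>p. G (x t p)) has_derivative (\<lambda>h. G' (x t p) (x' t p h))) (at p within S)"
      if tp: "t \<ge> 0" "p \<in> S" for t p
      by (rule has_derivative_in_compose2[where t = D]) (use G' assms(2) x'(1)[OF tp] tp in auto)
    fix b :: 'p assume b: "b \<in> Basis"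
    \<comment> \<open>The induction hypothesis covers \<open>G'\<close> at a fixed vector, composed
      with x; here the vector x' b moves as well. Expanding it over the basis separates the two
      dependences.\<close>
    have "tame ?M k (\<lambda>t p. \<Sum>i\<in>Basis. (x' t p b \<bullet> i) *\<^sub>R G' (x t p) i) S"
    proof (rule tame_sum)
      fix i :: 'b assume i: "i \<in> Basis"
      have "tame (m + (real k + 1) * m) k (\<lambda>t p. (x' t p b \<bullet> i) *\<^sub>R G' (x t p) i) S"
        by (intro tame_scaleR tame_inner x' b Suc.IH G'b i sx)
      then show "tame ?M k (\<lambda>t p. (x' t p b \<bullet> i) *\<^sub>R G' (x t p) i) S" by (simp add: algebra_simps)
    qed
    moreover have "(\<Sum>i\<in>Basis. (x' t p b \<bullet> i) *\<^sub>R G' (x t p) i) = G' (x t p) (x' t p b)"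
      if "t \<ge> 0" "p \<in> S" for t p
    proof -
      have "linear (G' (x t p))"
        using G'[OF assms(2)[OF that]] by (rule has_derivative_linear)
      then show ?thesis by (simp add: derivative_Basis_expand[of _ "x' t p b"])
    qed
    ultimately show "tame ?M k (\<lambda>t p. G' (x t p) (x' t p b)) S"
      by (rule tame_cong)
  qed
  moreover have "gbound ?M (\<lambda>t p. G (x t p)) S"
  proof (rule gbound_comp[OF tame_gbound[OF Suc.prems(1)] assms(2)])
    show "0 \<le> ?M" using mM assms(4) by linarith
  qed
  ultimately show ?case by (simp add: tame_def)
qed

lemma tame_comp0:
  assumes "tame 0 k (\<lambda>t. G) D" "\<And>t p. t \<ge> 0 \<Longrightarrow> p \<in> S \<Longrightarrow> x t p \<in> D" "semitame 0 k x S"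
  shows "tame 0 k (\<lambda>t p. G (x t p)) S"
  using tame_comp[OF assms, simplified] by simp

section \<open>Quadratic remainders and differentiation under the integral sign\<close>

lemma linear_Basis_bound:
  fixes f :: "'a::euclidean_space \<Rightarrow> 'b::real_normed_vector"
  assumes "linear f" "\<And>b. b \<in> Basis \<Longrightarrow> norm (f b) \<le> B"
  shows "norm (f h) \<le> real DIM('a) * B * norm h"
proof -
  have "norm (f h) = norm (\<Sum>i\<in>Basis. (h \<bullet> i) *\<^sub>R f i)"
    using derivative_Basis_expand[OF assms(1), of h] by simp
  also have "\<dots> \<le> (\<Sum>i\<in>(Basis :: 'a set). norm h * B)"
  proof (rule sum_norm_le)
    fix i :: 'a assume i: "i \<in> Basis"
    show "norm ((h \<bullet> i) *\<^sub>R f i) \<le> norm h * B"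
      using assms(2)[OF i] Basis_le_norm[OF i, of h] by (simp add: mult_mono)
  qed
  also have "\<dots> = real DIM('a) * B * norm h" by simp
  finally show ?thesis .
qed

lemma glip_Basis_const:
  fixes y' :: "real \<Rightarrow> 'p::euclidean_space \<Rightarrow> 'c::euclidean_space \<Rightarrow> 'b::euclidean_space"
  assumes "\<And>b. b \<in> Basis \<Longrightarrow> glip m (\<lambda>t p. y' t p b) S"
  obtains C where "C \<ge> 0" "\<And>t p q b. t \<ge> 0 \<Longrightarrow> p \<in> S \<Longrightarrow> q \<in> S \<Longrightarrow> b \<in> Basis \<Longrightarrow>
    norm (y' t p b - y' t q b) \<le> C * (1 + t) powr m * norm (p - q)"
proof -
  have "\<forall>b\<in>Basis. \<exists>C. C \<ge> 0 \<and> (\<forall>t\<ge>0. \<forall>p\<in>S. \<forall>q\<in>S.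
      norm (y' t p b - y' t q b) \<le> C * (1 + t) powr m * norm (p - q))"
  proof
    fix b :: 'c assume b: "b \<in> Basis"
    obtain C where C: "C \<ge> 0" "\<And>t p q. t \<ge> 0 \<Longrightarrow> p \<in> S \<Longrightarrow> q \<in> S \<Longrightarrow>
        norm (y' t p b - y' t q b) \<le> C * (1 + t) powr m * norm (p - q)"
      using glipE[OF assms[OF b]] by blast
    then show "\<exists>C. C \<ge> 0 \<and> (\<forall>t\<ge>0. \<forall>p\<in>S. \<forall>q\<in>S.
      norm (y' t p b - y' t q b) \<le> C * (1 + t) powr m * norm (p - q))" by blast
  qed
  then obtain C where C: "\<forall>b\<in>Basis. C b \<ge> 0 \<and> (\<forall>t\<ge>0. \<forall>p\<in>S. \<forall>q\<in>S.
      norm (y' t p b - y' t q b) \<le> C b * (1 + t) powr m * norm (p - q))"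
    by (rule bchoice[THEN exE])
  show ?thesis
  proof (rule that[of "\<Sum>b\<in>Basis. C b"])
    show "0 \<le> (\<Sum>b\<in>Basis. C b)" using C by (intro sum_nonneg) auto
    fix t :: real and p q and b :: 'c
    assume a: "t \<ge> 0" "p \<in> S" "q \<in> S" "b \<in> Basis"
    have "C b \<le> (\<Sum>b\<in>Basis. C b)" using C a by (intro member_le_sum) auto
    then have "C b * (1 + t) powr m * norm (p - q) \<le> (\<Sum>b\<in>Basis. C b) * (1 + t) powr m * norm (p - q)"
      by (intro mult_right_mono) auto
    moreover have "norm (y' t p b - y' t q b) \<le> C b * (1 + t) powr m * norm (p - q)"
      using C a by blast
    ultimately show "norm (y' t p b - y' t q b) \<le> (\<Sum>b\<in>Basis. C b) * (1 + t) powr m * norm (p - q)"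
      by linarith
  qed
qed

lemma gbound_Basis_const:
  fixes y' :: "real \<Rightarrow> 'p::euclidean_space \<Rightarrow> 'c::euclidean_space \<Rightarrow> 'b::euclidean_space"
  assumes "\<And>b. b \<in> Basis \<Longrightarrow> gbound m (\<lambda>t p. y' t p b) S"
  obtains C where "C \<ge> 0" "\<And>t p b. t \<ge> 0 \<Longrightarrow> p \<in> S \<Longrightarrow> b \<in> Basis \<Longrightarrow>
    norm (y' t p b) \<le> C * (1 + t) powr m"
proof -
  have "\<forall>b\<in>Basis. \<exists>C. C \<ge> 0 \<and> (\<forall>t\<ge>0. \<forall>p\<in>S. norm (y' t p b) \<le> C * (1 + t) powr m)"
  proof
    fix b :: 'c assume b: "b \<in> Basis"
    obtain C where C: "C \<ge> 0" "\<And>t p. t \<ge> 0 \<Longrightarrow> p \<in> S \<Longrightarrow> norm (y' t p b) \<le> C * (1 + t) powr m"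
      using gboundE[OF assms[OF b]] by blast
    then show "\<exists>C. C \<ge> 0 \<and> (\<forall>t\<ge>0. \<forall>p\<in>S. norm (y' t p b) \<le> C * (1 + t) powr m)" by blast
  qed
  then obtain C where C: "\<forall>b\<in>Basis. C b \<ge> 0 \<and> (\<forall>t\<ge>0. \<forall>p\<in>S. norm (y' t p b) \<le> C b * (1 + t) powr m)"
    by (rule bchoice[THEN exE])
  show ?thesis
  proof (rule that[of "\<Sum>b\<in>Basis. C b"])
    show "0 \<le> (\<Sum>b\<in>Basis. C b)" using C by (intro sum_nonneg) auto
    fix t :: real and p and b :: 'c
    assume a: "t \<ge> 0" "p \<in> S" "b \<in> Basis"
    have "C b \<le> (\<Sum>b\<in>Basis. C b)" using C a by (intro member_le_sum) auto
    then have "C b * (1 + t) powr m \<le> (\<Sum>b\<in>Basis. C b) * (1 + t) powr m"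
      by (intro mult_right_mono) auto
    moreover have "norm (y' t p b) \<le> C b * (1 + t) powr m" using C a by blast
    ultimately show "norm (y' t p b) \<le> (\<Sum>b\<in>Basis. C b) * (1 + t) powr m"
      by linarith
  qed
qed

text \<open>Mean value inequality for y minus its linearisation at p: along the segment the
  derivative of this difference is at most a Lipschitz constant times norm (q - p). The result is
  uniform in p and explicit in t, which the little-o of differentiability would not give.\<close>

lemma quadratic_remainder:
  fixes y :: "real \<Rightarrow> 'p::euclidean_space \<Rightarrow> 'b::euclidean_space"
  assumes S: "convex S"
    and d: "\<And>t p. t \<ge> 0 \<Longrightarrow> p \<in> S \<Longrightarrow> (y t has_derivative y' t p) (at p within S)"
    and l: "\<And>b. b \<in> Basis \<Longrightarrow> glip m (\<lambda>t p. y' t p b) S"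
  obtains C where "C \<ge> 0" "\<And>t p q. t \<ge> 0 \<Longrightarrow> p \<in> S \<Longrightarrow> q \<in> S \<Longrightarrow>
    norm (y t q - y t p - y' t p (q - p)) \<le> C * (1 + t) powr m * (norm (q - p))\<^sup>2"
proof -
  obtain C where C: "C \<ge> 0" "\<And>t p q b. t \<ge> 0 \<Longrightarrow> p \<in> S \<Longrightarrow> q \<in> S \<Longrightarrow> b \<in> Basis \<Longrightarrow>
    norm (y' t p b - y' t q b) \<le> C * (1 + t) powr m * norm (p - q)"
    using glip_Basis_const[of m y' S, OF l] by blast
  show ?thesis
  proof (rule that[of "real DIM('p) * C"])
    fix t :: real and p q assume a: "t \<ge> 0" "p \<in> S" "q \<in> S"
    let ?B = "real DIM('p) * (C * (1 + t) powr m * norm (q - p))"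
    have seg: "closed_segment p q \<subseteq> S" using S a by (simp add: closed_segment_subset)
    have "norm (y t q - y t p - y' t p (q - p)) \<le> norm (q - p) * ?B"
    proof (rule differentiable_bound_linearization[where S = "closed_segment p q"])
      fix s :: real assume "s \<in> {0..1}"
      then show "p + s *\<^sub>R (q - p) \<in> closed_segment p q"
        by (auto simp: closed_segment_def algebra_simps intro!: exI[of _ s])
    next
      fix x assume x: "x \<in> closed_segment p q"
      then show "(y t has_derivative y' t x) (at x within closed_segment p q)"
        using d[OF a(1), of x] seg by (auto intro: has_derivative_subset)
      have lin: "linear (y' t x)" "linear (y' t p)"
        using d[OF a(1)] x seg a by (auto intro!: has_derivative_linear)
      have xp: "norm (x - p) \<le> norm (q - p)"
        using segment_bound(1)[OF x] by (simp add: norm_minus_commute)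
      show "onorm (y' t x - y' t p) \<le> ?B"
      proof (rule onorm_bound)
        show "0 \<le> ?B" using C(1) by (intro mult_nonneg_nonneg) auto
        fix h
        have "norm ((y' t x - y' t p) h) \<le> real DIM('p) * (C * (1 + t) powr m * norm (q - p)) * norm h"
        proof (rule linear_Basis_bound)
          show "linear (y' t x - y' t p)" using lin by (simp add: fun_diff_def linear_compose_sub)
          fix b :: 'p assume b: "b \<in> Basis"
          have "norm (y' t x b - y' t p b) \<le> C * (1 + t) powr m * norm (x - p)"
            using C(2)[OF a(1) _ a(2) b] x seg by auto
          also have "\<dots> \<le> C * (1 + t) powr m * norm (q - p)"
            using xp C(1) by (intro mult_left_mono) auto
          finally show "norm ((y' t x - y' t p) b) \<le> C * (1 + t) powr m * norm (q - p)" by simp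
        qed
        then show "norm ((y' t x - y' t p) h) \<le> ?B * norm h" .
      qed
    qed auto
    then show "norm (y t q - y t p - y' t p (q - p)) \<le> real DIM('p) * C * (1 + t) powr m * (norm (q - p))\<^sup>2"
      by (simp add: power2_eq_square mult_ac)
  qed (use C in auto)
qed

text \<open>The way back from \<open>quadratic_remainder\<close>: derivatives of integrals,
  solutions and implicit functions are all established by a quadratic remainder at the point in
  question.\<close>

lemma has_derivative_quadratic:
  fixes f :: "'a::euclidean_space \<Rightarrow> 'b::real_normed_vector"
  assumes "linear f'" "p \<in> S"
    "\<And>q. q \<in> S \<Longrightarrow> norm (f q - f p - f' (q - p)) \<le> C * (norm (q - p))\<^sup>2"
  shows "(f has_derivative f') (at p within S)"
  unfolding has_derivative_within_alt
proof (intro conjI allI impI)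
  show "bounded_linear f'" using assms(1) by (simp add: linear_conv_bounded_linear)
  fix e :: real assume e: "e > 0"
  let ?C = "\<bar>C\<bar> + 1"
  show "\<exists>d>0. \<forall>q\<in>S. norm (q - p) < d \<longrightarrow> norm (f q - f p - f' (q - p)) \<le> e * norm (q - p)"
  proof (intro exI[of _ "e / ?C"] conjI ballI impI)
    show "e / ?C > 0" using e by (simp add: add_nonneg_pos)
    fix q assume q: "q \<in> S" "norm (q - p) < e / ?C"
    have "norm (q - p) * ?C \<le> e"
      using q(2) by (simp add: pos_less_divide_eq add_nonneg_pos)
    then have "norm (q - p) * (norm (q - p) * ?C) \<le> norm (q - p) * e"
      by (intro mult_left_mono) auto
    moreover have "C * (norm (q - p))\<^sup>2 \<le> ?C * (norm (q - p))\<^sup>2" by (intro mult_right_mono) auto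
    ultimately show "norm (f q - f p - f' (q - p)) \<le> e * norm (q - p)"
      using assms(3)[OF q(1)] by (simp add: power2_eq_square mult_ac)
  qed
qed

lemma integrable_dominated_continuous:
  fixes f :: "real \<Rightarrow> 'b::euclidean_space"
  assumes "continuous_on I f" "I \<in> sets lebesgue" "g integrable_on I"
    "\<And>t. t \<in> I \<Longrightarrow> norm (f t) \<le> g t"
  shows "f integrable_on I"
  using measurable_bounded_by_integrable_imp_integrable
    [OF continuous_imp_measurable_on_sets_lebesgue[OF assms(1,2)] assms(3,4,2)] .

text \<open>The quadratic remainder of the integrand is integrated. Only integrability of the weight
  on I is asked, so the lemma serves the angular averages over [0, 2\<pi>], where m is 0 or 1, as
  well as the improper integral along an orbit, where m = -2.\<close>

lemma tame_integral:
  fixes y :: "real \<Rightarrow> 'p::euclidean_space \<Rightarrow> 'b::euclidean_space"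
  assumes I: "I \<subseteq> {0..}" "I \<in> sets lebesgue" "(\<lambda>t. (1 + t) powr m) integrable_on I"
    and S: "convex S"
  shows "tame m k y S \<Longrightarrow> tame 0 k (\<lambda>_ p. integral I (\<lambda>t. y t p)) S"
proof (induction k arbitrary: y)
  let ?W = "integral I (\<lambda>t. (1 + t) powr m)"
  have W: "?W \<ge> 0" by (intro integral_nonneg I) auto
  have int: "(\<lambda>t. y t p) integrable_on I" if y: "gbound m y S" "glip m y S" and p: "p \<in> S"
    for p and y :: "real \<Rightarrow> 'p \<Rightarrow> 'b"
  proof -
    obtain C where C: "C \<ge> 0" "\<And>t p. t \<ge> 0 \<Longrightarrow> p \<in> S \<Longrightarrow> norm (y t p) \<le> C * (1 + t) powr m"
      using gboundE[OF y(1)] by blast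
    show ?thesis
    proof (rule integrable_dominated_continuous[OF _ I(2)])
      show "continuous_on I (\<lambda>t. y t p)" using glip_cont[OF y(2) p] I(1) by (rule continuous_on_subset)
      show "(\<lambda>t. C * (1 + t) powr m) integrable_on I" by (intro integrable_on_mult_right I)
    qed (use C p I in auto)
  qed
  have bd: "norm (integral I f) \<le> C * ?W"
    if f: "f integrable_on I" "\<And>t. t \<in> I \<Longrightarrow> norm (f t) \<le> C * (1 + t) powr m" for f :: "real \<Rightarrow> 'b" and C
  proof -
    have "norm (integral I f) \<le> integral I (\<lambda>t. C * (1 + t) powr m)"
      by (intro integral_norm_bound_integral f integrable_on_mult_right I)
    then show ?thesis by simp
  qed
  have gb: "gbound 0 (\<lambda>_ p. integral I (\<lambda>t. y t p)) S" if y: "gbound m y S" "glip m y S"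
    for y :: "real \<Rightarrow> 'p \<Rightarrow> 'b"
  proof -
    obtain C where C: "C \<ge> 0" "\<And>t p. t \<ge> 0 \<Longrightarrow> p \<in> S \<Longrightarrow> norm (y t p) \<le> C * (1 + t) powr m"
      using gboundE[OF y(1)] by blast
    show ?thesis
    proof (rule gboundI)
      fix t :: real and p assume "t \<ge> 0" "p \<in> S"
      have "norm (integral I (\<lambda>t. y t p)) \<le> C * ?W"
        by (rule bd[OF int[OF y \<open>p \<in> S\<close>]]) (use C \<open>p \<in> S\<close> I in auto)
      then show "norm (integral I (\<lambda>t. y t p)) \<le> (C * ?W) * (1 + t) powr 0"
        using \<open>t \<ge> 0\<close> by simp
    qed
  qed
  have gl: "glip 0 (\<lambda>_ p. integral I (\<lambda>t. y t p)) S" if y: "gbound m y S" "glip m y S"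
    for y :: "real \<Rightarrow> 'p \<Rightarrow> 'b"
  proof -
    obtain C where C: "C \<ge> 0" "\<And>t p q. t \<ge> 0 \<Longrightarrow> p \<in> S \<Longrightarrow> q \<in> S \<Longrightarrow>
      norm (y t p - y t q) \<le> C * (1 + t) powr m * norm (p - q)"
      using glipE[OF y(2)] by blast
    show ?thesis
    proof (rule glipI)
      fix t :: real and p q assume a: "t \<ge> 0" "p \<in> S" "q \<in> S"
      have "norm (integral I (\<lambda>t. y t p) - integral I (\<lambda>t. y t q)) = norm (integral I (\<lambda>t. y t p - y t q))"
        by (simp add: integral_diff int[OF y] a)
      also have "\<dots> \<le> (C * norm (p - q)) * ?W"
      proof (rule bd)
        show "(\<lambda>t. y t p - y t q) integrable_on I" by (intro integrable_diff int[OF y] a)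
        show "norm (y t p - y t q) \<le> C * norm (p - q) * (1 + t) powr m" if "t \<in> I" for t
          using C(2)[of t p q] that I(1) a by (auto simp: mult_ac)
      qed
      finally show "norm (integral I (\<lambda>t. y t p) - integral I (\<lambda>t. y t q)) \<le> (C * ?W) * (1 + t) powr 0 * norm (p - q)"
        using a by (simp add: mult_ac)
    qed auto
  qed
  {
    case 0 then show ?case using gb gl by (auto simp: tame_0)
  next
    case (Suc k y)
    obtain y' where y': "\<And>t p. t \<ge> 0 \<Longrightarrow> p \<in> S \<Longrightarrow> (y t has_derivative y' t p) (at p within S)"
      "\<And>b. b \<in> Basis \<Longrightarrow> tame m k (\<lambda>t p. y' t p b) S"
      using semitame_SucE[OF tame_semitame[OF Suc.prems(1)]] by blast
    have lin: "linear (y' t p)" if "t \<ge> 0" "p \<in> S" for t p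
      using y'(1)[OF that] by (rule has_derivative_linear)
    obtain C where C: "C \<ge> 0" "\<And>t p q. t \<ge> 0 \<Longrightarrow> p \<in> S \<Longrightarrow> q \<in> S \<Longrightarrow>
        norm (y t q - y t p - y' t p (q - p)) \<le> C * (1 + t) powr m * (norm (q - p))\<^sup>2"
      using quadratic_remainder[of S y y' m, OF S y'(1) tame_glip[OF y'(2)]] by blast
    \<comment> \<open>The candidate derivative is assembled from the integrals at basis vectors, the
      ones whose integrability is controlled directly.\<close>
    let ?Y = "\<lambda>p h. \<Sum>b\<in>Basis. (h \<bullet> b) *\<^sub>R integral I (\<lambda>t. y' t p b)"
    have inty: "(\<lambda>t. y' t p b) integrable_on I" if "p \<in> S" "b \<in> Basis" for p b
      using y'(2)[OF that(2)] that(1) by (intro int) (auto dest: tame_gbound tame_glip)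
    have Y: "((\<lambda>t. y' t p h) has_integral ?Y p h) I" if "p \<in> S" for p h
    proof -
      have "((\<lambda>t. \<Sum>b\<in>Basis. (h \<bullet> b) *\<^sub>R y' t p b) has_integral ?Y p h) I"
        by (intro has_integral_sum has_integral_cmul integrable_integral inty that) auto
      then show ?thesis
        by (rule has_integral_eq[rotated])
          (use derivative_Basis_expand[OF lin] I that in \<open>auto simp: subset_iff\<close>)
    qed
    note yt = tame_gbound[OF Suc.prems] tame_glip[OF Suc.prems]
    have "semitame 0 (Suc k) (\<lambda>_ p. integral I (\<lambda>t. y t p)) S"
    proof (rule semitame_SucI[where y' = "\<lambda>_ p h. ?Y p h"])
      show "glip 0 (\<lambda>_ p. integral I (\<lambda>t. y t p)) S" by (intro gl yt)
      fix t0 :: real and p assume p: "p \<in> S"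
      show "((\<lambda>p. integral I (\<lambda>t. y t p)) has_derivative ?Y p) (at p within S)"
      proof (rule has_derivative_quadratic[OF _ p, where C = "C * ?W"])
        show "linear (?Y p)"
          by (intro linear_compose_sum linearI ballI) (auto simp: inner_simps algebra_simps)
        fix q assume q: "q \<in> S"
        have hi: "((\<lambda>t. y t q - y t p - y' t p (q - p)) has_integral
            (integral I (\<lambda>t. y t q) - integral I (\<lambda>t. y t p) - ?Y p (q - p))) I"
          by (intro has_integral_diff Y p integrable_integral int yt q)
        have "norm (integral I (\<lambda>t. y t q - y t p - y' t p (q - p))) \<le> (C * (norm (q - p))\<^sup>2) * ?W"
        proof (rule bd)
          show "(\<lambda>t. y t q - y t p - y' t p (q - p)) integrable_on I" using hi by blast
          show "norm (y t q - y t p - y' t p (q - p)) \<le> C * (norm (q - p))\<^sup>2 * (1 + t) powr m" if "t \<in> I" for t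
            using C(2)[of t p q] that I(1) p q by (auto simp: mult_ac)
        qed
        then show "norm (integral I (\<lambda>t. y t q) - integral I (\<lambda>t. y t p) - ?Y p (q - p)) \<le> C * ?W * (norm (q - p))\<^sup>2"
          using integral_unique[OF hi] by (simp add: mult_ac)
      qed
    next
      fix b :: 'p assume b: "b \<in> Basis"
      have "?Y p b = integral I (\<lambda>t. y' t p b)" if "p \<in> S" for p
        using integral_unique[OF Y[OF that, of b]] by simp
      then show "tame 0 k (\<lambda>t p. ?Y p b) S"
        by (intro tame_cong[OF Suc.IH[OF y'(2)[OF b]]]) simp
    qed
    then show ?case using gb[OF yt] by (simp add: tame_def)
  }
qed

subsection \<open>Ordinary differential equations on a half-line\<close>

text \<open>Most differential inequalities below end here. The set A is left free because
  derivatives are taken within [0, \<infinity>) for global solutions and within [0, T] in a priori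
  estimates.\<close>

lemma halfline_nonincreasing:
  fixes g :: "real \<Rightarrow> real"
  assumes "a \<le> b" "\<And>t. a \<le> t \<Longrightarrow> t \<le> b \<Longrightarrow> (g has_real_derivative g' t) (at t within A)"
    "{a..b} \<subseteq> A" "\<And>t. a \<le> t \<Longrightarrow> t \<le> b \<Longrightarrow> g' t \<le> 0"
  shows "g b \<le> g a"
proof -
  have "\<exists>x\<in>{a..b}. g b - g a = (\<lambda>h. g' x * h) (b - a)"
  proof (rule mvt_very_simple[OF assms(1)])
    fix x assume "a \<le> x" "x \<le> b"
    then show "(g has_derivative (*) (g' x)) (at x within {a..b})"
      using assms(2)[of x] assms(3) by (auto simp: has_field_derivative_def intro: has_derivative_subset)
  qed
  then obtain x where "a \<le> x" "x \<le> b" "g b - g a = g' x * (b - a)" by auto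
  moreover have "g' x * (b - a) \<le> 0"
    using assms(1,4) calculation by (intro mult_nonpos_nonneg) auto
  ultimately show ?thesis by linarith
qed

lemma integral_has_vector_derivative_halfline:
  fixes f :: "real \<Rightarrow> 'b::banach"
  assumes "continuous_on {0..} f" "t \<ge> 0"
  shows "((\<lambda>u. integral {0..u} f) has_vector_derivative f t) (at t within {0..})"
proof -
  have "((\<lambda>u. integral {0..u} f) has_vector_derivative f t) (at t within {0..t+1})"
    using assms by (intro integral_has_vector_derivative continuous_on_subset[OF assms(1)]) auto
  moreover have "at t within {0..t+1} = at t within {0..}"
    using assms(2) by (intro at_within_nhd[where S = "{..<t+1}"]) auto
  ultimately show ?thesis by simp
qed

lemma gronwall_zero:
  fixes q :: "real \<Rightarrow> real"
  assumes "\<And>t. 0 \<le> t \<Longrightarrow> t \<le> T \<Longrightarrow> (q has_real_derivative q' t) (at t within {0..T})"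
    "\<And>t. 0 \<le> t \<Longrightarrow> t \<le> T \<Longrightarrow> q' t \<le> L * q t" "q 0 \<le> 0" "T \<ge> 0"
  shows "q T \<le> 0"
proof -
  let ?g = "\<lambda>t. q t * exp (- L * t)"
  have "?g T \<le> ?g 0"
  proof (rule halfline_nonincreasing[where A = "{0..T}" and g = ?g and a = 0 and b = T
        and g' = "\<lambda>t. (q' t - L * q t) * exp (- L * t)"])
    fix t assume t: "0 \<le> t" "t \<le> T"
    show "(?g has_real_derivative (q' t - L * q t) * exp (- L * t)) (at t within {0..T})"
      by (rule derivative_eq_intros assms t refl | simp add: algebra_simps)+
    show "(q' t - L * q t) * exp (- L * t) \<le> 0"
      using assms(2)[OF t] by (intro mult_nonpos_nonneg) auto
  qed (use assms in auto)
  then show ?thesis using assms(3)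
    by (smt (verit) exp_gt_zero mult_nonneg_nonneg mult_pos_pos exp_zero mult_zero_right mult_cancel_left2)
qed

text \<open>Gronwall for the squared distance. The Lipschitz bound is asked only along the two given
  solutions, so that a bound on a compact set containing both is enough.\<close>

lemma ode_unique:
  fixes x y :: "real \<Rightarrow> 'b::euclidean_space"
  assumes "\<And>t. 0 \<le> t \<Longrightarrow> t \<le> T \<Longrightarrow> (x has_vector_derivative f t (x t)) (at t within {0..T})"
    "\<And>t. 0 \<le> t \<Longrightarrow> t \<le> T \<Longrightarrow> (y has_vector_derivative f t (y t)) (at t within {0..T})"
    "\<And>t. 0 \<le> t \<Longrightarrow> t \<le> T \<Longrightarrow> norm (f t (x t) - f t (y t)) \<le> L * norm (x t - y t)"
    "x 0 = y 0" "T \<ge> 0"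
  shows "x T = y T"
proof -
  let ?q = "\<lambda>t. (x t - y t) \<bullet> (x t - y t)"
  have "?q T \<le> 0"
  proof (rule gronwall_zero[where L = "2 * L" and q = ?q and T = T
        and q' = "\<lambda>t. 2 * ((x t - y t) \<bullet> (f t (x t) - f t (y t)))"])
    fix t assume t: "0 \<le> t" "t \<le> T"
    have "((\<lambda>t. x t - y t) has_vector_derivative f t (x t) - f t (y t)) (at t within {0..T})"
      by (intro derivative_intros assms t)
    then have "((\<lambda>t. x t - y t) has_derivative (\<lambda>h. h *\<^sub>R (f t (x t) - f t (y t)))) (at t within {0..T})"
      by (simp add: has_vector_derivative_def)
    from has_derivative_inner[OF this this]
    show "(?q has_real_derivative 2 * ((x t - y t) \<bullet> (f t (x t) - f t (y t)))) (at t within {0..T})"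
      unfolding has_field_derivative_def
      by (rule has_derivative_eq_rhs) (auto simp: fun_eq_iff inner_commute algebra_simps)
    have "(x t - y t) \<bullet> (f t (x t) - f t (y t)) \<le> norm (x t - y t) * norm (f t (x t) - f t (y t))"
      by (rule norm_cauchy_schwarz)
    also have "\<dots> \<le> norm (x t - y t) * (L * norm (x t - y t))"
      by (intro mult_left_mono assms t) auto
    finally show "2 * ((x t - y t) \<bullet> (f t (x t) - f t (y t))) \<le> 2 * L * ?q t"
      by (simp add: power2_norm_eq_inner[symmetric] power2_eq_square mult_ac)
  qed (use assms in auto)
  then show ?thesis by (metis inner_gt_zero_iff linorder_not_less right_minus_eq)
qed

lemma continuous_on_superposition:
  fixes f :: "real \<Rightarrow> 'a::metric_space \<Rightarrow> 'b::real_normed_vector"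
  assumes "\<And>y. y \<in> D \<Longrightarrow> continuous_on {0..} (\<lambda>t. f t y)"
    "\<And>t x y. t \<ge> 0 \<Longrightarrow> x \<in> D \<Longrightarrow> y \<in> D \<Longrightarrow> norm (f t x - f t y) \<le> L * dist x y"
    "continuous_on A x" "A \<subseteq> {0..}" "x ` A \<subseteq> D"
  shows "continuous_on A (\<lambda>t. f t (x t))"
  unfolding continuous_on_def
proof
  fix s assume s: "s \<in> A"
  have "((\<lambda>t. f t (x s)) \<longlongrightarrow> f s (x s)) (at s within A)"
    using continuous_on_subset[OF assms(1)[of "x s"] assms(4)] s assms(5) unfolding continuous_on_def by blast
  moreover have "((\<lambda>t. f t (x t) - f t (x s)) \<longlongrightarrow> 0) (at s within A)"
  proof (rule Lim_null_comparison)
    show "\<forall>\<^sub>F t in at s within A. norm (f t (x t) - f t (x s)) \<le> L * dist (x t) (x s)"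
      using assms(2,4,5) s by (auto simp: eventually_at_filter image_subset_iff subset_iff)
    have "(x \<longlongrightarrow> x s) (at s within A)" using assms(3) s by (auto simp: continuous_on_def)
    then have "((\<lambda>t. L * dist (x t) (x s)) \<longlongrightarrow> L * dist (x s) (x s)) (at s within A)"
      by (intro tendsto_intros)
    then show "((\<lambda>t. L * dist (x t) (x s)) \<longlongrightarrow> 0) (at s within A)" by simp
  qed
  ultimately show "((\<lambda>t. f t (x t)) \<longlongrightarrow> f s (x s)) (at s within A)"
    using tendsto_add by fastforce
qed

text \<open>Picard iteration is a contraction in the sup norm weighted by \<open>exp (- \<mu> t)\<close>.\<close>

lemma ode_global_Lipschitz:
  fixes f :: "real \<Rightarrow> 'b::euclidean_space \<Rightarrow> 'b"
  assumes cont: "\<And>y. continuous_on {0..} (\<lambda>t. f t y)"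
    and lip: "\<And>t x y. t \<ge> 0 \<Longrightarrow> norm (f t x - f t y) \<le> L * norm (x - y)"
    and grow: "\<And>t. t \<ge> 0 \<Longrightarrow> norm (f t 0) \<le> C * exp (\<gamma> * t)"
  obtains x where "x 0 = x0"
    "\<And>t. t \<ge> 0 \<Longrightarrow> (x has_vector_derivative f t (x t)) (at t within {0..})"
proof -
  \<comment> \<open>2 |L| makes the Picard map a contraction by 1/2, |\<gamma>| keeps
    \<open>f t 0\<close> bounded in the weighted norm, and 1 makes the rate positive.\<close>
  define \<mu> where "\<mu> = \<bar>\<gamma>\<bar> + 2 * \<bar>L\<bar> + 1"
  have \<mu>: "\<mu> > 0" "\<gamma> \<le> \<mu>" "2 * \<bar>L\<bar> \<le> \<mu>" by (auto simp: \<mu>_def)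
  define F where "F u t = f t (exp (\<mu> * t) *\<^sub>R apply_bcontfun u t)" for u :: "real \<Rightarrow>\<^sub>C 'b" and t
  have contF: "continuous_on {0..} (F u)" for u
    unfolding F_def
  proof (rule continuous_on_superposition[where D = UNIV and L = L and f = f
        and x = "\<lambda>t. exp (\<mu> * t) *\<^sub>R apply_bcontfun u t"])
    show "continuous_on {0..} (\<lambda>t. exp (\<mu> * t) *\<^sub>R apply_bcontfun u t)"
      by (intro continuous_intros) auto
  qed (use cont lip in \<open>auto simp: dist_norm\<close>)
  have expint: "((\<lambda>r. M * exp (\<mu> * r)) has_integral (M / \<mu> * (exp (\<mu> * s) - 1))) {0..s}" if "s \<ge> 0" for s M
  proof -
    have "((\<lambda>r. M * exp (\<mu> * r)) has_integral (M / \<mu> * exp (\<mu> * s) - M / \<mu> * exp (\<mu> * 0))) {0..s}"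
      using that \<mu> by (intro fundamental_theorem_of_calculus)
        (auto intro!: derivative_eq_intros simp: has_real_derivative_iff_has_vector_derivative[symmetric])
    then show ?thesis by (simp add: algebra_simps)
  qed
  have intF: "F u integrable_on {0..s}" for u s
    by (intro integrable_continuous_real continuous_on_subset[OF contF]) auto
  have intbd: "norm (integral {0..s} g) \<le> M / \<mu> * exp (\<mu> * s)"
    if "s \<ge> 0" "M \<ge> 0" "g integrable_on {0..s}" "\<And>r. 0 \<le> r \<Longrightarrow> norm (g r) \<le> M * exp (\<mu> * r)"
    for g :: "real \<Rightarrow> 'b" and s M
  proof -
    have "norm (integral {0..s} g) \<le> integral {0..s} (\<lambda>r. M * exp (\<mu> * r))"
      using that expint[OF that(1), of M] by (intro integral_norm_bound_integral) auto
    also have "\<dots> = M / \<mu> * (exp (\<mu> * s) - 1)" using expint[OF that(1)] by (rule integral_unique)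
    also have "\<dots> \<le> M / \<mu> * exp (\<mu> * s)" using that \<mu> by (intro mult_left_mono) auto
    finally show ?thesis .
  qed
  \<comment> \<open>The unknown is u = exp (- \<mu> t) x. The Banach space consists of bounded
    continuous functions on the whole line, and \<open>max 0 t\<close> extends the iterate to
    negative times by its value at 0.\<close>
  define P where "P u t = exp (- \<mu> * max 0 t) *\<^sub>R (x0 + integral {0..max 0 t} (F u))" for u t
  have P: "P u \<in> bcontfun" for u
  proof (rule bcontfun_normI)
    have c: "continuous_on {0..} (\<lambda>s. integral {0..s} (F u))"
      using integral_has_vector_derivative_halfline[OF contF, of _ u]
      by (intro continuous_on_vector_derivative) auto
    have "continuous_on UNIV (\<lambda>t. integral {0..max 0 t} (F u))"
      by (rule continuous_on_compose2[OF c]) (auto intro!: continuous_intros)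
    then show "continuous_on UNIV (P u)" unfolding P_def by (intro continuous_intros)
    define M where "M = \<bar>C\<bar> + \<bar>L\<bar> * norm u"
    fix t :: real
    let ?s = "max 0 t"
    have "norm (integral {0..?s} (F u)) \<le> M / \<mu> * exp (\<mu> * ?s)"
    proof (rule intbd)
      show "M \<ge> 0" by (simp add: M_def)
      fix r :: real assume r: "0 \<le> r"
      have "norm (F u r) \<le> norm (F u r - f r 0) + norm (f r 0)"
        by (metis add.commute norm_triangle_sub)
      also have "norm (F u r - f r 0) \<le> L * norm (exp (\<mu> * r) *\<^sub>R apply_bcontfun u r)"
        using lip[OF r, of "exp (\<mu> * r) *\<^sub>R apply_bcontfun u r" 0] by (simp add: F_def)
      also have "\<dots> \<le> \<bar>L\<bar> * (exp (\<mu> * r) * norm u)"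
        using norm_bounded[of u r] by (auto intro!: mult_mono)
      also have "norm (f r 0) \<le> \<bar>C\<bar> * exp (\<mu> * r)"
      proof -
        have "C * exp (\<gamma> * r) \<le> \<bar>C\<bar> * exp (\<mu> * r)"
          using \<mu>(2) r by (intro mult_mono) (auto simp: mult_right_mono)
        then show ?thesis using grow[OF r] by linarith
      qed
      finally show "norm (F u r) \<le> M * exp (\<mu> * r)" by (simp add: M_def algebra_simps)
    qed (use intF in auto)
    then have "norm (P u t) \<le> exp (- \<mu> * ?s) * (norm x0 + M / \<mu> * exp (\<mu> * ?s))"
      unfolding P_def norm_scaleR using norm_triangle_ineq[of x0 "integral {0..?s} (F u)"]
      by (intro mult_mono) auto
    also have "\<dots> = exp (- \<mu> * ?s) * norm x0 + M / \<mu>" by (simp add: algebra_simps flip: exp_add)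
    also have "\<dots> \<le> norm x0 + M / \<mu>"
    proof -
      have "exp (- \<mu> * ?s) \<le> 1" using \<mu> by simp
      then show ?thesis by (simp add: mult_left_le_one_le)
    qed
    finally show "norm (P u t) \<le> norm x0 + M / \<mu>" .
  qed
  have "\<exists>!u. Bcontfun (P u) = u"
  proof (rule banach_fix_type[where c = "1/2"], simp, simp, intro allI)
    fix u v
    show "dist (Bcontfun (P u)) (Bcontfun (P v)) \<le> 1/2 * dist u v"
    proof (rule dist_bound)
      fix t :: real
      let ?s = "max 0 t"
      have "norm (integral {0..?s} (\<lambda>r. F u r - F v r)) \<le> (\<bar>L\<bar> * dist u v) / \<mu> * exp (\<mu> * ?s)"
      proof (rule intbd)
        show "(\<lambda>r. F u r - F v r) integrable_on {0..?s}" by (intro integrable_diff intF)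
        fix r :: real assume r: "0 \<le> r"
        have "norm (F u r - F v r) \<le> L * norm (exp (\<mu> * r) *\<^sub>R (apply_bcontfun u r - apply_bcontfun v r))"
          using lip[OF r] by (simp add: F_def scaleR_diff_right)
        also have "\<dots> \<le> \<bar>L\<bar> * (exp (\<mu> * r) * dist u v)"
          using dist_bounded[of u r v] by (auto intro!: mult_mono simp: dist_norm)
        finally show "norm (F u r - F v r) \<le> \<bar>L\<bar> * dist u v * exp (\<mu> * r)" by (simp add: mult_ac)
      qed auto
      then have "norm (integral {0..?s} (F u) - integral {0..?s} (F v)) \<le> (\<bar>L\<bar> * dist u v) / \<mu> * exp (\<mu> * ?s)"
        by (simp add: integral_diff intF)
      then have "dist (P u t) (P v t) \<le> exp (- \<mu> * ?s) * ((\<bar>L\<bar> * dist u v) / \<mu> * exp (\<mu> * ?s))"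
        using mult_left_mono[of _ _ "exp (- \<mu> * ?s)"]
        by (simp add: P_def dist_norm mult_left_mono flip: scaleR_diff_right times_divide_eq_right)
      also have "\<dots> = \<bar>L\<bar> / \<mu> * dist u v" by (simp flip: exp_add)
      also have "\<dots> \<le> 1/2 * dist u v" using \<mu> by (intro mult_right_mono) (auto simp: field_simps)
      finally show "dist (apply_bcontfun (Bcontfun (P u)) t) (apply_bcontfun (Bcontfun (P v)) t) \<le> 1/2 * dist u v"
        by (simp add: Bcontfun_inverse[OF P])
    qed
  qed
  then obtain u where u: "Bcontfun (P u) = u" by blast
  then have uP: "apply_bcontfun u t = P u t" for t using Bcontfun_inverse[OF P, of u] by simp
  define x where "x t = x0 + integral {0..t} (F u)" for t
  have xF: "f t (x t) = F u t" if "t \<ge> 0" for t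
    using that by (simp add: F_def uP P_def x_def max_def flip: exp_add)
  show ?thesis
  proof (rule that[of x])
    show "x 0 = x0" by (simp add: x_def)
    fix t :: real assume t: "t \<ge> 0"
    have "(x has_vector_derivative 0 + F u t) (at t within {0..})"
      unfolding x_def by (intro derivative_intros integral_has_vector_derivative_halfline contF t)
    then show "(x has_vector_derivative f t (x t)) (at t within {0..})" using xF[OF t] by simp
  qed
qed

text \<open>Composing the field with the nearest-point projection onto D makes it globally
  Lipschitz, so a solution exists for all time. At the first exit time from the interior of D it
  still lies in D, because D is closed, and the a priori estimate puts it in K, inside the interior.
  Hence there is no exit and the projection never acted.\<close>

lemma ode_confined:
  fixes f :: "real \<Rightarrow> 'b::euclidean_space \<Rightarrow> 'b"
  assumes D: "closed D" "convex D"
    and cont: "\<And>y. y \<in> D \<Longrightarrow> continuous_on {0..} (\<lambda>t. f t y)"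
    and lip: "\<And>t x y. t \<ge> 0 \<Longrightarrow> x \<in> D \<Longrightarrow> y \<in> D \<Longrightarrow> norm (f t x - f t y) \<le> L * norm (x - y)"
    and bd: "\<And>t y. t \<ge> 0 \<Longrightarrow> y \<in> D \<Longrightarrow> norm (f t y) \<le> B"
    and x0: "x0 \<in> K" "K \<subseteq> interior D"
    and apriori: "\<And>T x. T \<ge> 0 \<Longrightarrow> x 0 = x0 \<Longrightarrow>
      (\<And>t. 0 \<le> t \<Longrightarrow> t \<le> T \<Longrightarrow> x t \<in> D \<and> (x has_vector_derivative f t (x t)) (at t within {0..T})) \<Longrightarrow>
      x T \<in> K"
  obtains x where "x 0 = x0" "\<And>t. t \<ge> 0 \<Longrightarrow> x t \<in> K"
    "\<And>t. t \<ge> 0 \<Longrightarrow> (x has_vector_derivative f t (x t)) (at t within {0..})"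
proof -
  let ?c = "closest_point D"
  have ne: "D \<noteq> {}" using x0 interior_subset by blast
  have cD: "?c y \<in> D" for y using D ne by (simp add: closest_point_in_set)
  have L: "norm (f t (?c x) - f t (?c y)) \<le> \<bar>L\<bar> * norm (x - y)" if "t \<ge> 0" for t x y
  proof -
    have "norm (f t (?c x) - f t (?c y)) \<le> L * norm (?c x - ?c y)" by (intro lip that cD)
    also have "\<dots> \<le> \<bar>L\<bar> * norm (x - y)"
      using closest_point_lipschitz[OF D(2,1) ne, of x y] by (intro mult_mono) (auto simp: dist_norm)
    finally show ?thesis .
  qed
  obtain x where x: "x 0 = x0"
    "\<And>t. t \<ge> 0 \<Longrightarrow> (x has_vector_derivative f t (?c (x t))) (at t within {0..})"
    by (rule ode_global_Lipschitz[of "\<lambda>t y. f t (?c y)" "\<bar>L\<bar>" B 0 x0])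
      (use cont cD L bd in auto)
  have contx: "continuous_on {0..} x" using x(2) by (intro continuous_on_vector_derivative) auto
  have sol: "x T \<in> K" if T: "T \<ge> 0" "\<And>t. 0 \<le> t \<Longrightarrow> t \<le> T \<Longrightarrow> x t \<in> D" for T
  proof (rule apriori[of T x, OF T(1) x(1)])
    fix t assume t: "0 \<le> t" "t \<le> T"
    have "(x has_vector_derivative f t (x t)) (at t within {0..})"
      using x(2)[OF t(1)] T(2)[OF t] by (simp add: closest_point_self)
    then show "x t \<in> D \<and> (x has_vector_derivative f t (x t)) (at t within {0..T})"
      using T(2)[OF t] by (auto intro: has_vector_derivative_within_subset)
  qed
  have inD: "x t \<in> interior D" if "t \<ge> 0" for t
  proof (rule ccontr)
    assume out: "x t \<notin> interior D"
    define A where "A = {s. s \<ge> 0 \<and> x s \<notin> interior D}"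
    have A: "A \<noteq> {}" "bdd_below A" using out that by (auto simp: A_def intro!: bdd_belowI[of _ 0])
    have "closed ({0..} \<inter> x -` (- interior D))"
      by (rule continuous_closed_preimage[OF contx]) auto
    moreover have "{0..} \<inter> x -` (- interior D) = A" by (auto simp: A_def)
    ultimately have "closed A" by simp
    then have I: "Inf A \<in> A" using A closed_contains_Inf by blast
    have before: "x s \<in> D" if "0 \<le> s" "s < Inf A" for s
      using that cInf_lower[OF _ A(2), of s] interior_subset by (force simp: A_def)
    have pos: "Inf A > 0"
      using I x(1) x0 by (cases "Inf A = 0") (auto simp: A_def)
    have "x ` closure {0..<Inf A} \<subseteq> D"
      by (rule image_closure_subset) (use contx before pos D in \<open>auto intro: continuous_on_subset\<close>)
    then have "x ` {0..Inf A} \<subseteq> D" using pos by simp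
    then have "x (Inf A) \<in> K" by (intro sol) (use pos in auto)
    then show False using I x0 by (auto simp: A_def)
  qed
  show ?thesis
  proof (rule that[of x])
    show "x t \<in> K" if "t \<ge> 0" for t using sol[OF that] inD interior_subset by blast
    show "(x has_vector_derivative f t (x t)) (at t within {0..})" if "t \<ge> 0" for t
      using x(2)[OF that] inD[OF that] interior_subset by (metis closest_point_self subsetD)
  qed (rule x(1))
qed

section \<open>Linear equations with polynomially bounded propagator\<close>

definition propagation_bound ::
  "(real \<Rightarrow> 'p::euclidean_space \<Rightarrow> 'b::euclidean_space \<Rightarrow> 'b) \<Rightarrow> 'p set \<Rightarrow> real \<Rightarrow> real \<Rightarrow> real \<Rightarrow> bool" where
  "propagation_bound A S m C m' \<longleftrightarrow> (\<forall>p\<in>S. \<forall>K\<ge>0. \<forall>z r.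
     (\<forall>t\<ge>0. (z has_vector_derivative (A t p (z t) + r t)) (at t within {0..})) \<longrightarrow>
     (\<forall>t\<ge>0. norm (r t) \<le> K * (1 + t) powr m) \<longrightarrow> norm (z 0) \<le> K \<longrightarrow>
     (\<forall>t\<ge>0. norm (z t) \<le> C * K * (1 + t) powr m'))"

text \<open>The inhomogeneous equation z' = A z + r is measured with one constant K for the source
  and the initial value together. The bound is linear in K, so data of size norm (q - p) or norm (q
  - p)^2 give solutions of the same size. The loss from m to m' is left open: polynomial growth of
  whatever degree is good enough.\<close>

definition propagates ::
  "(real \<Rightarrow> 'p::euclidean_space \<Rightarrow> 'b::euclidean_space \<Rightarrow> 'b) \<Rightarrow> 'p set \<Rightarrow> bool" where
  "propagates A S \<longleftrightarrow> (\<forall>m\<ge>0. \<exists>C\<ge>0. \<exists>m'\<ge>0. propagation_bound A S m C m')"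

lemma propagatesE:
  assumes "propagates A S" "m \<ge> 0"
  obtains C m' where "C \<ge> 0" "m' \<ge> 0" "propagation_bound A S m C m'"
  using assms unfolding propagates_def by blast

lemma propagation_boundD:
  assumes "propagation_bound A S m C m'" "p \<in> S" "K \<ge> 0"
    "\<And>t. t \<ge> 0 \<Longrightarrow> (z has_vector_derivative (A t p (z t) + r t)) (at t within {0..})"
    "\<And>t. t \<ge> 0 \<Longrightarrow> norm (r t) \<le> K * (1 + t) powr m" "norm (z 0) \<le> K" "t \<ge> 0"
  shows "norm (z t) \<le> C * K * (1 + t) powr m'"
  using assms(1)[unfolded propagation_bound_def, rule_format, of p K z r t] assms(2-) by blast

text \<open>The remainder of the first-order expansion of \<open>y\<close> solves the linear equation with a source of
  size \<open>norm (q - p)\<^sup>2\<close>, so that a polynomially bounded propagator makes \<open>Y\<close> the derivative of \<open>y\<close>.\<close>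

lemma propagates_has_derivative:
  fixes y :: "real \<Rightarrow> 'p::euclidean_space \<Rightarrow> 'b::euclidean_space"
    and Y :: "'p \<Rightarrow> real \<Rightarrow> 'p \<Rightarrow> 'b"
  assumes A: "propagates A S" and M: "M \<ge> 0" and K: "K \<ge> 0"
    and r: "\<And>t p q. t \<ge> 0 \<Longrightarrow> p \<in> S \<Longrightarrow> q \<in> S \<Longrightarrow>
      ((\<lambda>t. y t q - y t p - (\<Sum>w\<in>Basis. ((q - p) \<bullet> w) *\<^sub>R Y w t p)) has_vector_derivative
         (A t p (y t q - y t p - (\<Sum>w\<in>Basis. ((q - p) \<bullet> w) *\<^sub>R Y w t p)) + r q p t)) (at t within {0..})"
    and rb: "\<And>t p q. t \<ge> 0 \<Longrightarrow> p \<in> S \<Longrightarrow> q \<in> S \<Longrightarrow>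
      norm (r q p t) \<le> K * (norm (q - p))\<^sup>2 * (1 + t) powr M"
    and ini: "\<And>p q. p \<in> S \<Longrightarrow> q \<in> S \<Longrightarrow>
      norm (y 0 q - y 0 p - (\<Sum>w\<in>Basis. ((q - p) \<bullet> w) *\<^sub>R Y w 0 p)) \<le> K * (norm (q - p))\<^sup>2"
    and t: "t \<ge> 0" and p: "p \<in> S"
  shows "(y t has_derivative (\<lambda>h. \<Sum>w\<in>Basis. (h \<bullet> w) *\<^sub>R Y w t p)) (at p within S)"
proof -
  obtain C m' where C: "C \<ge> 0" "m' \<ge> 0"
    "propagation_bound A S M C m'"
    using propagatesE[OF A M] by blast
  show ?thesis
  proof (rule has_derivative_quadratic[OF _ p, where C = "C * K * (1 + t) powr m'"])
    show "linear (\<lambda>h. \<Sum>w\<in>Basis. (h \<bullet> w) *\<^sub>R Y w t p)"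
      by (intro linear_compose_sum linearI ballI) (auto simp: inner_simps algebra_simps)
    fix q assume q: "q \<in> S"
    have "norm (y t q - y t p - (\<Sum>w\<in>Basis. ((q - p) \<bullet> w) *\<^sub>R Y w t p))
        \<le> C * (K * (norm (q - p))\<^sup>2) * (1 + t) powr m'"
      by (rule propagation_boundD[OF C(3) p, where z = "\<lambda>t. y t q - y t p - (\<Sum>w\<in>Basis. ((q - p) \<bullet> w) *\<^sub>R Y w t p)" and r = "r q p", OF _ r[OF _ p q] rb[OF _ p q] ini[OF p q] t]) (use K in auto)
    then show "norm (y t q - y t p - (\<Sum>w\<in>Basis. ((q - p) \<bullet> w) *\<^sub>R Y w t p))
        \<le> C * K * (1 + t) powr m' * (norm (q - p))\<^sup>2" by (simp add: mult_ac)
  qed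
qed

text \<open>The propagator is used twice. First it bounds y. Then the difference of the solutions at
  q and p solves the equation at p with source (A q - A p) y q + (b q - b p), which by that bound is
  at most norm (q - p) times a power of 1 + t.\<close>

lemma tame_linear_ode_0:
  fixes y b :: "real \<Rightarrow> 'p::euclidean_space \<Rightarrow> 'b::euclidean_space"
  assumes A: "propagates A S" and lin: "\<And>t p. t \<ge> 0 \<Longrightarrow> p \<in> S \<Longrightarrow> linear (A t p)"
    and tA: "\<And>c. c \<in> Basis \<Longrightarrow> glip mA (\<lambda>t p. A t p c) S" and mA: "mA \<ge> 0"
    and b: "tame m 0 b S" and y0: "tame m 0 (\<lambda>_. y0) S" and m: "m \<ge> 0"
    and sol: "\<And>t p. t \<ge> 0 \<Longrightarrow> p \<in> S \<Longrightarrow>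
      ((\<lambda>t. y t p) has_vector_derivative (A t p (y t p) + b t p)) (at t within {0..})"
    and ini: "\<And>p. p \<in> S \<Longrightarrow> y 0 p = y0 p"
  shows "\<exists>m'\<ge>0. tame m' 0 y S"
proof -
  obtain Cb where Cb: "Cb \<ge> 0" "\<And>t p. t \<ge> 0 \<Longrightarrow> p \<in> S \<Longrightarrow> norm (b t p) \<le> Cb * (1 + t) powr m"
    using gboundE[OF tame_gbound[OF b]] by blast
  obtain C0 where C0: "C0 \<ge> 0" "\<And>t p. t \<ge> 0 \<Longrightarrow> p \<in> S \<Longrightarrow> norm (y0 p) \<le> C0 * (1 + t) powr m"
    using gboundE[OF tame_gbound[OF y0]] by blast
  obtain Lb where Lb: "Lb \<ge> 0" "\<And>t p q. t \<ge> 0 \<Longrightarrow> p \<in> S \<Longrightarrow> q \<in> S \<Longrightarrow>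
      norm (b t p - b t q) \<le> Lb * (1 + t) powr m * norm (p - q)"
    using glipE[OF tame_glip[OF b]] by blast
  obtain L0 where L0: "L0 \<ge> 0" "\<And>t p q. t \<ge> 0 \<Longrightarrow> p \<in> S \<Longrightarrow> q \<in> S \<Longrightarrow>
      norm (y0 p - y0 q) \<le> L0 * (1 + t) powr m * norm (p - q)"
    using glipE[OF tame_glip[OF y0]] by blast
  obtain LA where LA: "LA \<ge> 0" "\<And>t p q c. t \<ge> 0 \<Longrightarrow> p \<in> S \<Longrightarrow> q \<in> S \<Longrightarrow> c \<in> Basis \<Longrightarrow>
      norm (A t p c - A t q c) \<le> LA * (1 + t) powr mA * norm (p - q)"
    using glip_Basis_const[of mA A S, OF tA] by blast
  obtain C1 m1 where C1: "C1 \<ge> 0" "m1 \<ge> 0"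
    "propagation_bound A S m C1 m1"
    using propagatesE[OF A m] by blast
  define By where "By = C1 * (Cb + C0)"
  have By: "By \<ge> 0" using C1 Cb C0 by (simp add: By_def)
  have yb: "norm (y t p) \<le> By * (1 + t) powr m1" if "t \<ge> 0" "p \<in> S" for t p
    unfolding By_def
  proof (rule propagation_boundD[OF C1(3) that(2), where z = "\<lambda>t. y t p" and r = "\<lambda>t. b t p", OF _ sol[OF _ that(2)] _ _ that(1)])
    show "norm (b t p) \<le> (Cb + C0) * (1 + t) powr m" if "t \<ge> 0" for t
      using Cb(2)[OF that \<open>p \<in> S\<close>] C0(1) by (simp add: distrib_right add_increasing2)
    show "norm (y 0 p) \<le> Cb + C0" using C0(2)[of 0 p] Cb(1) ini that(2) by simp
  qed (use Cb C0 in auto)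
  define M where "M = mA + m1 + m"
  have M: "M \<ge> 0" using mA m C1(2) by (simp add: M_def)
  obtain C2 m2 where C2: "C2 \<ge> 0" "m2 \<ge> 0"
    "propagation_bound A S M C2 m2"
    using propagatesE[OF A M] by blast
  define K where "K = real DIM('b) * LA * By + Lb + L0"
  have K: "K \<ge> 0" using LA By Lb L0 by (simp add: K_def)
  have yl: "norm (y t q - y t p) \<le> C2 * (K * norm (q - p)) * (1 + t) powr m2"
    if t: "t \<ge> 0" and p: "p \<in> S" and q: "q \<in> S" for t p q
  proof (rule propagation_boundD[OF C2(3) p, where z = "\<lambda>t. y t q - y t p" and r = "\<lambda>t. A t q (y t q) - A t p (y t q) + (b t q - b t p)", OF _ _ _ _ t])
    fix t :: real assume t: "t \<ge> 0"
    have l: "linear (A t p)" "linear (A t q)" using lin t p q by auto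
    have "((\<lambda>t. y t q - y t p) has_vector_derivative (A t q (y t q) + b t q - (A t p (y t p) + b t p))) (at t within {0..})"
      by (intro derivative_intros sol t p q)
    then show "((\<lambda>t. y t q - y t p) has_vector_derivative
        (A t p (y t q - y t p) + (A t q (y t q) - A t p (y t q) + (b t q - b t p)))) (at t within {0..})"
      by (simp add: linear_diff[OF l(1)] algebra_simps)
    have "norm ((\<lambda>v. A t q v - A t p v) (y t q)) \<le> real DIM('b) * (LA * (1 + t) powr mA * norm (q - p)) * norm (y t q)"
      by (rule linear_Basis_bound) (use l LA(2)[OF t q p] in \<open>auto intro: linear_compose_sub\<close>)
    also have "\<dots> \<le> real DIM('b) * (LA * (1 + t) powr mA * norm (q - p)) * (By * (1 + t) powr m1)"
      using LA by (intro mult_left_mono yb t q) auto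
    also have "\<dots> = real DIM('b) * LA * By * norm (q - p) * (1 + t) powr (mA + m1)" by (simp add: powr_add mult_ac)
    also have "\<dots> \<le> real DIM('b) * LA * By * norm (q - p) * (1 + t) powr M"
      using LA By m t by (intro mult_left_mono powr_mono_nonneg mult_nonneg_nonneg) (auto simp: M_def)
    finally have a: "norm (A t q (y t q) - A t p (y t q)) \<le> real DIM('b) * LA * By * norm (q - p) * (1 + t) powr M" .
    have "norm (b t q - b t p) \<le> Lb * (1 + t) powr m * norm (q - p)" by (rule Lb(2)[OF t q p])
    also have "\<dots> \<le> Lb * (1 + t) powr M * norm (q - p)"
      using Lb C1(2) mA t by (intro mult_left_mono mult_right_mono powr_mono_nonneg) (auto simp: M_def)
    finally have b: "norm (b t q - b t p) \<le> Lb * (1 + t) powr M * norm (q - p)" .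
    have "norm (A t q (y t q) - A t p (y t q) + (b t q - b t p)) \<le>
        (real DIM('b) * LA * By + Lb) * norm (q - p) * (1 + t) powr M"
      using norm_triangle_ineq[of "A t q (y t q) - A t p (y t q)" "b t q - b t p"] a b
      by (simp add: algebra_simps)
    also have "\<dots> \<le> K * norm (q - p) * (1 + t) powr M"
      using L0 by (intro mult_right_mono) (auto simp: K_def)
    finally show "norm (A t q (y t q) - A t p (y t q) + (b t q - b t p)) \<le> K * norm (q - p) * (1 + t) powr M" .
  next
    have "norm (y 0 q - y 0 p) \<le> L0 * norm (q - p)" using L0(2)[of 0 q p] ini p q by simp
    also have "\<dots> \<le> K * norm (q - p)" using LA By Lb by (intro mult_right_mono) (auto simp: K_def)
    finally show "norm (y 0 q - y 0 p) \<le> K * norm (q - p)" .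
  qed (use K in auto)
  have "gbound m1 y S" by (rule gboundI[OF yb])
  moreover have "glip m2 y S"
  proof (rule glipI[where C = "C2 * K"])
    show "continuous_on {0..} (\<lambda>t. y t p)" if "p \<in> S" for p
      using sol[OF _ that] by (intro continuous_on_vector_derivative) auto
    fix t :: real and p q assume "t \<ge> 0" "p \<in> S" "q \<in> S"
    then show "norm (y t p - y t q) \<le> C2 * K * (1 + t) powr m2 * norm (p - q)"
      using yl[of t q p] by (simp add: mult_ac)
  qed
  ultimately have "tame (max m1 m2) 0 y S"
    by (auto simp: tame_0 intro: gbound_mono glip_mono)
  then show ?thesis using C1(2) by (intro exI[of _ "max m1 m2"]) auto
qed

lemma powr_le_exp: "(t::real) \<ge> 0 \<Longrightarrow> m \<ge> 0 \<Longrightarrow> (1 + t) powr m \<le> exp (m * t)"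
  by (simp add: powr_def ln_add_one_self_le_self mult_left_mono)

text \<open>A polynomially growing source is admissible in \<open>ode_global_Lipschitz\<close>
  because (1 + t)^m \<le> exp (m t).\<close>

lemma linear_ode_solution:
  fixes A :: "real \<Rightarrow> 'b::euclidean_space \<Rightarrow> 'b"
  assumes lin: "\<And>t. t \<ge> 0 \<Longrightarrow> linear (A t)"
    and bdd: "\<And>t v. t \<ge> 0 \<Longrightarrow> norm (A t v) \<le> L * norm v"
    and cA: "\<And>c. c \<in> Basis \<Longrightarrow> continuous_on {0..} (\<lambda>t. A t c)"
    and cb: "continuous_on {0..} b" and m: "m \<ge> 0"
    and gb: "\<And>t. t \<ge> 0 \<Longrightarrow> norm (b t) \<le> C * (1 + t) powr m"
  obtains y where "y 0 = y0"
    "\<And>t. t \<ge> 0 \<Longrightarrow> (y has_vector_derivative (A t (y t) + b t)) (at t within {0..})"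
proof -
  show ?thesis
  proof (rule ode_global_Lipschitz[of "\<lambda>t v. A t v + b t" L "\<bar>C\<bar>" m y0])
    fix v
    have "continuous_on {0..} (\<lambda>t. (\<Sum>c\<in>Basis. (v \<bullet> c) *\<^sub>R A t c) + b t)"
      by (intro continuous_intros cA cb) auto
    then show "continuous_on {0..} (\<lambda>t. A t v + b t)"
      by (rule continuous_on_eq) (use derivative_Basis_expand[OF lin, of _ v] in auto)
  next
    fix t :: real and v w assume t: "t \<ge> 0"
    show "norm (A t v + b t - (A t w + b t)) \<le> L * norm (v - w)"
      using bdd[OF t, of "v - w"] by (simp add: linear_diff[OF lin[OF t]])
    have "C * (1 + t) powr m \<le> \<bar>C\<bar> * exp (m * t)"
      using powr_le_exp[OF t m] by (intro mult_mono) auto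
    then show "norm (A t 0 + b t) \<le> \<bar>C\<bar> * exp (m * t)"
      using gb[OF t] by (simp add: linear_0[OF lin[OF t]])
  qed (use that in blast)
qed

lemma finite_uniform_constant:
  fixes f :: "'i \<Rightarrow> 'x \<Rightarrow> real"
  assumes "finite I" "\<And>c. c \<in> I \<Longrightarrow> \<exists>C. \<forall>x\<in>X. f c x \<le> C * g x" "\<And>x. x \<in> X \<Longrightarrow> g x \<ge> 0"
  obtains C where "C \<ge> 0" "\<And>c x. c \<in> I \<Longrightarrow> x \<in> X \<Longrightarrow> f c x \<le> C * g x"
proof -
  obtain C where C: "\<forall>c\<in>I. \<forall>x\<in>X. f c x \<le> C c * g x"
    using bchoice[of I "\<lambda>c C. \<forall>x\<in>X. f c x \<le> C * g x"] assms(2) by blast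
  show ?thesis
  proof (rule that[of "\<Sum>c\<in>I. \<bar>C c\<bar>"])
    show "0 \<le> (\<Sum>c\<in>I. \<bar>C c\<bar>)" by (intro sum_nonneg) auto
    fix c x assume a: "c \<in> I" "x \<in> X"
    have "C c \<le> \<bar>C c\<bar>" by simp
    also have "\<dots> \<le> (\<Sum>c\<in>I. \<bar>C c\<bar>)" using assms(1) a by (intro member_le_sum) auto
    finally have "C c * g x \<le> (\<Sum>c\<in>I. \<bar>C c\<bar>) * g x" using assms(3) a by (intro mult_right_mono) auto
    then show "f c x \<le> (\<Sum>c\<in>I. \<bar>C c\<bar>) * g x" using C a by fastforce
  qed
qed

lemma sum_Basis_inner_scaleR:
  fixes f :: "'a::euclidean_space \<Rightarrow> 'b::real_vector"
  assumes "b \<in> Basis"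
  shows "(\<Sum>w\<in>Basis. (b \<bullet> w) *\<^sub>R f w) = f b"
proof -
  have "(\<Sum>w\<in>Basis. (b \<bullet> w) *\<^sub>R f w) = (\<Sum>w\<in>Basis. if w = b then f b else 0)"
    by (rule sum.cong) (use assms in \<open>auto simp: inner_Basis\<close>)
  then show ?thesis using assms by simp
qed

text \<open>The derivative of y in direction w must solve the same equation with source A'(w) y +
  b'(w). By induction y is tame of order k, hence so is this source; the corresponding solution
  exists, is tame of order k by the induction hypothesis applied a second time, and is the
  derivative by \<open>propagates_has_derivative\<close>. The exponent of growth may rise with each
  order, which is harmless.\<close>

lemma tame_linear_ode:
  fixes y b :: "real \<Rightarrow> 'p::euclidean_space \<Rightarrow> 'b::euclidean_space"
  assumes S: "convex S" and A: "propagates A S"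
    and lin: "\<And>t p. t \<ge> 0 \<Longrightarrow> p \<in> S \<Longrightarrow> linear (A t p)"
    and bdd: "\<And>t p v. t \<ge> 0 \<Longrightarrow> p \<in> S \<Longrightarrow> norm (A t p v) \<le> L * norm v"
    and mA: "mA \<ge> 0"
  shows "(\<And>c. c \<in> Basis \<Longrightarrow> tame mA k (\<lambda>t p. A t p c) S) \<Longrightarrow>
    tame m k b S \<Longrightarrow> tame m k (\<lambda>_. y0) S \<Longrightarrow> m \<ge> 0 \<Longrightarrow>
    (\<And>t p. t \<ge> 0 \<Longrightarrow> p \<in> S \<Longrightarrow>
      ((\<lambda>t. y t p) has_vector_derivative (A t p (y t p) + b t p)) (at t within {0..})) \<Longrightarrow>
    (\<And>p. p \<in> S \<Longrightarrow> y 0 p = y0 p) \<Longrightarrow> \<exists>m'\<ge>0. tame m' k y S"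
proof (induction k arbitrary: b y y0 m)
  case 0
  show ?case
    by (rule tame_linear_ode_0[OF A lin _ mA 0(2,3,4,5,6)]) (use tame_glip[OF 0(1)] in auto)
next
  case (Suc k)
  note sol = Suc.prems(5) and ini = Suc.prems(6)
  have tA: "tame mA k (\<lambda>t p. A t p c) S" if "c \<in> Basis" for c
    using Suc.prems(1)[OF that] by (rule tame_le) simp
  obtain m1 where m1: "m1 \<ge> 0" "tame m1 k y S"
    using Suc.IH[of m b y0 y, OF tA tame_le[OF Suc.prems(2)] tame_le[OF Suc.prems(3)] Suc.prems(4) sol ini] by auto
  obtain m0 where m0: "m0 \<ge> 0" "tame m0 0 y S"
    using tame_linear_ode_0[OF A lin tame_glip[OF tA] mA tame_le[OF Suc.prems(2)] tame_le[OF Suc.prems(3)] Suc.prems(4) sol ini]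
    by auto
  have "\<forall>c\<in>Basis. \<exists>A'. (\<forall>t\<ge>0. \<forall>p\<in>S. ((\<lambda>p. A t p c) has_derivative A' t p) (at p within S)) \<and>
      (\<forall>w\<in>Basis. tame mA k (\<lambda>t p. A' t p w) S)"
    using tame_semitame[OF Suc.prems(1)] unfolding semitame_Suc by blast
  then obtain AD where AD: "\<forall>c\<in>Basis. (\<forall>t\<ge>0. \<forall>p\<in>S. ((\<lambda>p. A t p c) has_derivative AD c t p) (at p within S)) \<and>
      (\<forall>w\<in>Basis. tame mA k (\<lambda>t p. AD c t p w) S)"
    by (rule bchoice[THEN exE])
  then have AD1: "\<And>c t p. c \<in> Basis \<Longrightarrow> t \<ge> 0 \<Longrightarrow> p \<in> S \<Longrightarrow> ((\<lambda>p. A t p c) has_derivative AD c t p) (at p within S)"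
    and AD2: "\<And>c w. c \<in> Basis \<Longrightarrow> w \<in> Basis \<Longrightarrow> tame mA k (\<lambda>t p. AD c t p w) S" by auto
  obtain b' where b': "\<And>t p. t \<ge> 0 \<Longrightarrow> p \<in> S \<Longrightarrow> (b t has_derivative b' t p) (at p within S)"
    "\<And>w. w \<in> Basis \<Longrightarrow> tame m k (\<lambda>t p. b' t p w) S"
    using semitame_SucE[OF tame_semitame[OF Suc.prems(2)]] by blast
  obtain yd where yd: "\<And>t p. t \<ge> 0 \<Longrightarrow> p \<in> S \<Longrightarrow> (y0 has_derivative yd t p) (at p within S)"
    "\<And>w. w \<in> Basis \<Longrightarrow> tame m k (\<lambda>t p. yd t p w) S"
    using semitame_SucE[OF tame_semitame[OF Suc.prems(3)]] by blast
  have linAD: "linear (AD c t p)" if "c \<in> Basis" "t \<ge> 0" "p \<in> S" for c t p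
    using AD1[OF that] by (rule has_derivative_linear)
  have linb: "linear (b' t p)" if "t \<ge> 0" "p \<in> S" for t p
    using b'(1)[OF that] by (rule has_derivative_linear)
  have linyd: "linear (yd t p)" if "t \<ge> 0" "p \<in> S" for t p
    using yd(1)[OF that] by (rule has_derivative_linear)
  have yd0: "tame m k (\<lambda>_ p. yd 0 p w) S" if w: "w \<in> Basis" for w
    using tame_at[OF yd(2)[OF w] _ Suc.prems(4), of 0] by simp
  \<comment> \<open>Source of the variational equation. The derivative of A applied to y is expanded
    over the basis, since \<open>AD c\<close> is the derivative of A evaluated at the basis vector
    c.\<close>
  define s where "s w t p = (\<Sum>c\<in>Basis. (y t p \<bullet> c) *\<^sub>R AD c t p w) + b' t p w" for w t p
  define M where "M = mA + 2 * max m0 m1 + m"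
  have M: "M \<ge> 0" using mA m1 Suc.prems(4) by (simp add: M_def)
  have ts: "tame M k (s w) S" if w: "w \<in> Basis" for w
    unfolding s_def
  proof (rule tame_add[OF tame_sum])
    show "tame M k (\<lambda>t p. b' t p w) S"
      by (rule tame_mono[OF b'(2)[OF w]]) (use m1 m0 mA in \<open>auto simp: M_def\<close>)
    fix c :: 'b assume c: "c \<in> Basis"
    have "tame (m1 + mA) k (\<lambda>t p. (y t p \<bullet> c) *\<^sub>R AD c t p w) S"
      by (intro tame_scaleR tame_inner m1 AD2 c w)
    then show "tame M k (\<lambda>t p. (y t p \<bullet> c) *\<^sub>R AD c t p w) S"
      by (rule tame_mono) (use m1 m0 Suc.prems(4) in \<open>auto simp: M_def\<close>)
  qed
  have ex: "\<exists>f. f 0 = yd 0 p w \<and> (\<forall>t\<ge>0. (f has_vector_derivative (A t p (f t) + s w t p)) (at t within {0..}))"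
    if p: "p \<in> S" and w: "w \<in> Basis" for p w
  proof -
    obtain C where C: "C \<ge> 0" "\<And>t p. t \<ge> 0 \<Longrightarrow> p \<in> S \<Longrightarrow> norm (s w t p) \<le> C * (1 + t) powr M"
      using gboundE[OF tame_gbound[OF ts[OF w]]] by blast
    obtain f where "f 0 = yd 0 p w" "\<And>t. t \<ge> 0 \<Longrightarrow> (f has_vector_derivative (A t p (f t) + s w t p)) (at t within {0..})"
      by (rule linear_ode_solution[of "\<lambda>t. A t p" L "\<lambda>t. s w t p" M C "yd 0 p w"])
        (use p lin bdd glip_cont[OF tame_glip[OF tA] p] glip_cont[OF tame_glip[OF ts[OF w]] p] M C in auto)
    then show ?thesis by blast
  qed
  define Y where "Y w p = (SOME f. f 0 = yd 0 p w \<and>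
      (\<forall>t\<ge>0. (f has_vector_derivative (A t p (f t) + s w t p)) (at t within {0..})))" for w p
  have Y: "Y w p 0 = yd 0 p w \<and>
      (\<forall>t\<ge>0. (Y w p has_vector_derivative (A t p (Y w p t) + s w t p)) (at t within {0..}))"
    if "p \<in> S" "w \<in> Basis" for p w
    unfolding Y_def using someI_ex[OF ex[OF that]] .
  have "\<forall>w\<in>Basis. \<exists>m'. m' \<ge> 0 \<and> tame m' k (\<lambda>t p. Y w p t) S"
  proof
    fix w :: 'p assume w: "w \<in> Basis"
    have "tame M k (\<lambda>_ p. yd 0 p w) S"
      by (rule tame_mono[OF yd0[OF w]]) (use m1 m0 mA in \<open>auto simp: M_def\<close>)
    from Suc.IH[of M "s w" "\<lambda>p. yd 0 p w" "\<lambda>t p. Y w p t", OF tA ts[OF w] this M] Y w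
    show "\<exists>m'. m' \<ge> 0 \<and> tame m' k (\<lambda>t p. Y w p t) S" by auto
  qed
  then obtain mw where mw: "\<forall>w\<in>Basis. mw w \<ge> 0 \<and> tame (mw w) k (\<lambda>t p. Y w p t) S"
    by (rule bchoice[THEN exE])
  obtain By where By: "By \<ge> 0" "\<And>t p. t \<ge> 0 \<Longrightarrow> p \<in> S \<Longrightarrow> norm (y t p) \<le> By * (1 + t) powr m0"
    using gboundE[OF tame_gbound[OF m0(2)]] by blast
  obtain Ly where Ly: "Ly \<ge> 0" "\<And>t p q. t \<ge> 0 \<Longrightarrow> p \<in> S \<Longrightarrow> q \<in> S \<Longrightarrow>
      norm (y t p - y t q) \<le> Ly * (1 + t) powr m0 * norm (p - q)"
    using glipE[OF tame_glip[OF m0(2)]] by blast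
  obtain Cb where Cb: "Cb \<ge> 0" "\<And>t p q. t \<ge> 0 \<Longrightarrow> p \<in> S \<Longrightarrow> q \<in> S \<Longrightarrow>
      norm (b t q - b t p - b' t p (q - p)) \<le> Cb * (1 + t) powr m * (norm (q - p))\<^sup>2"
    using quadratic_remainder[of S b b' m, OF S b'(1) tame_glip[OF b'(2)]] by blast
  obtain C0 where C0: "C0 \<ge> 0" "\<And>t p q. t \<ge> 0 \<Longrightarrow> p \<in> S \<Longrightarrow> q \<in> S \<Longrightarrow>
      norm (y0 q - y0 p - yd t p (q - p)) \<le> C0 * (1 + t) powr m * (norm (q - p))\<^sup>2"
    using quadratic_remainder[of S "\<lambda>_. y0" yd m, OF S yd(1) tame_glip[OF yd(2)]] by blast
  obtain CA where CA: "CA \<ge> 0" "\<And>c t p q. c \<in> Basis \<Longrightarrow> t \<ge> 0 \<Longrightarrow> p \<in> S \<Longrightarrow> q \<in> S \<Longrightarrow>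
      norm (A t q c - A t p c - AD c t p (q - p)) \<le> CA * (1 + t) powr mA * (norm (q - p))\<^sup>2"
  proof (rule finite_uniform_constant[of "Basis :: 'b set" "{0..} \<times> S \<times> S"
        "\<lambda>c (t, p, q). norm (A t q c - A t p c - AD c t p (q - p))"
        "\<lambda>(t, p, q). (1 + t) powr mA * (norm (q - p))\<^sup>2"])
    fix c :: 'b assume c: "c \<in> Basis"
    obtain C where C: "C \<ge> 0" "\<And>t p q. t \<ge> 0 \<Longrightarrow> p \<in> S \<Longrightarrow> q \<in> S \<Longrightarrow>
        norm (A t q c - A t p c - AD c t p (q - p)) \<le> C * (1 + t) powr mA * (norm (q - p))\<^sup>2"
      using quadratic_remainder[of S "\<lambda>t p. A t p c" "AD c" mA, OF S AD1[OF c] tame_glip[OF AD2[OF c]]] by blast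
    show "\<exists>C. \<forall>x\<in>{0..} \<times> S \<times> S. (case x of (t, p, q) \<Rightarrow> norm (A t q c - A t p c - AD c t p (q - p)))
        \<le> C * (case x of (t, p, q) \<Rightarrow> (1 + t) powr mA * (norm (q - p))\<^sup>2)"
      by (rule exI[of _ C]) (use C in \<open>auto simp: mult_ac\<close>)
  qed (auto simp: mult_ac)
  obtain DA where DA: "DA \<ge> 0" "\<And>c w t p. c \<in> Basis \<Longrightarrow> w \<in> Basis \<Longrightarrow> t \<ge> 0 \<Longrightarrow> p \<in> S \<Longrightarrow>
      norm (AD c t p w) \<le> DA * (1 + t) powr mA"
  proof (rule finite_uniform_constant[of "(Basis :: 'b set) \<times> (Basis :: 'p set)" "{0..} \<times> S"
        "\<lambda>(c, w) (t, p). norm (AD c t p w)" "\<lambda>(t, p). (1 + t) powr mA"])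
    fix cw assume cw: "cw \<in> (Basis :: 'b set) \<times> (Basis :: 'p set)"
    obtain c w where [simp]: "cw = (c, w)" by (cases cw)
    obtain C where C: "C \<ge> 0" "\<And>t p. t \<ge> 0 \<Longrightarrow> p \<in> S \<Longrightarrow> norm (AD c t p w) \<le> C * (1 + t) powr mA"
      using gboundE[OF tame_gbound[OF AD2[of c w]]] cw by auto
    show "\<exists>C. \<forall>x\<in>{0..} \<times> S. (case cw of (c, w) \<Rightarrow> \<lambda>(t, p). norm (AD c t p w)) x
        \<le> C * (case x of (t, p) \<Rightarrow> (1 + t) powr mA)"
      by (rule exI[of _ C]) (use C in auto)
  qed auto
  define K where "K = real DIM('b) * (By * CA + Ly * (real DIM('p) * DA)) + Cb + C0"
  have K: "K \<ge> 0" using By CA Ly DA Cb C0 by (simp add: K_def)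
  \<comment> \<open>What the first-order expansion leaves over: the remainder of A against y q, the
    first-order change of A against the change of y, and the remainder of b. Each is quadratic in q
    - p.\<close>
  define r where "r q p t = (\<Sum>c\<in>Basis. (y t q \<bullet> c) *\<^sub>R (A t q c - A t p c - AD c t p (q - p))
      + ((y t q - y t p) \<bullet> c) *\<^sub>R AD c t p (q - p)) + (b t q - b t p - b' t p (q - p))" for q p t
  have deriv: "(y t has_derivative (\<lambda>h. \<Sum>w\<in>Basis. (h \<bullet> w) *\<^sub>R Y w p t)) (at p within S)"
    if t: "t \<ge> 0" and p: "p \<in> S" for t p
  proof (rule propagates_has_derivative[OF A M K _ _ _ t p, where Y = "\<lambda>w t p. Y w p t" and r = r])
    fix t :: real and p q assume t: "t \<ge> 0" and p: "p \<in> S" and q: "q \<in> S"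
    let ?h = "q - p"
    let ?Z = "\<Sum>w\<in>Basis. (?h \<bullet> w) *\<^sub>R Y w p t"
    have la: "linear (A t p)" "linear (A t q)" using lin t p q by auto
    have d: "((\<lambda>t. y t q - y t p - (\<Sum>w\<in>Basis. (?h \<bullet> w) *\<^sub>R Y w p t)) has_vector_derivative
        (A t q (y t q) + b t q - (A t p (y t p) + b t p) - (\<Sum>w\<in>Basis. (?h \<bullet> w) *\<^sub>R (A t p (Y w p t) + s w t p)))) (at t within {0..})"
      using Y[OF p] t
      by (intro derivative_intros bounded_linear.has_vector_derivative[OF bounded_linear_scaleR_right] sol t p q) auto
    have e1: "A t q (y t q) = (\<Sum>c\<in>Basis. (y t q \<bullet> c) *\<^sub>R A t q c)"
      and e2: "A t p (y t q) = (\<Sum>c\<in>Basis. (y t q \<bullet> c) *\<^sub>R A t p c)"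
      using derivative_Basis_expand la by blast+
    have e3: "(\<Sum>w\<in>Basis. (?h \<bullet> w) *\<^sub>R s w t p) = (\<Sum>c\<in>Basis. (y t p \<bullet> c) *\<^sub>R AD c t p ?h) + b' t p ?h"
    proof -
      have "(\<Sum>w\<in>Basis. (?h \<bullet> w) *\<^sub>R s w t p) =
          (\<Sum>w\<in>Basis. \<Sum>c\<in>Basis. (?h \<bullet> w) *\<^sub>R (y t p \<bullet> c) *\<^sub>R AD c t p w) + (\<Sum>w\<in>Basis. (?h \<bullet> w) *\<^sub>R b' t p w)"
        by (simp add: s_def scaleR_right_distrib sum.distrib scaleR_sum_right)
      also have "(\<Sum>w\<in>Basis. (?h \<bullet> w) *\<^sub>R b' t p w) = b' t p ?h"
        using derivative_Basis_expand[OF linb[OF t p]] by metis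
      also have "(\<Sum>w\<in>Basis. \<Sum>c\<in>Basis. (?h \<bullet> w) *\<^sub>R (y t p \<bullet> c) *\<^sub>R AD c t p w)
          = (\<Sum>c\<in>Basis. \<Sum>w\<in>Basis. (?h \<bullet> w) *\<^sub>R (y t p \<bullet> c) *\<^sub>R AD c t p w)" by (rule sum.swap)
      also have "\<dots> = (\<Sum>c\<in>Basis. (y t p \<bullet> c) *\<^sub>R AD c t p ?h)"
      proof (rule sum.cong[OF refl])
        fix c :: 'b assume c: "c \<in> Basis"
        show "(\<Sum>w\<in>Basis. (?h \<bullet> w) *\<^sub>R (y t p \<bullet> c) *\<^sub>R AD c t p w) = (y t p \<bullet> c) *\<^sub>R AD c t p ?h"
          by (subst derivative_Basis_expand[OF linAD[OF c t p], of ?h])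
            (simp add: scaleR_sum_right scaleR_scaleR mult.commute)
      qed
      finally show ?thesis .
    qed
    have e4: "A t p (y t q - y t p - ?Z) = A t p (y t q) - A t p (y t p) - (\<Sum>w\<in>Basis. (?h \<bullet> w) *\<^sub>R A t p (Y w p t))"
      by (simp add: linear_diff[OF la(1)] linear_sum[OF la(1)] linear_scale[OF la(1)])
    have e5: "r q p t = (A t q (y t q) - A t p (y t q)) - (\<Sum>c\<in>Basis. (y t p \<bullet> c) *\<^sub>R AD c t p ?h) + (b t q - b t p - b' t p ?h)"
      unfolding r_def e1 e2
      by (simp add: sum.distrib[symmetric] sum_subtractf[symmetric] algebra_simps inner_diff_left)
    have "A t q (y t q) + b t q - (A t p (y t p) + b t p) - (\<Sum>w\<in>Basis. (?h \<bullet> w) *\<^sub>R (A t p (Y w p t) + s w t p))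
        = A t p (y t q - y t p - ?Z) + r q p t"
    proof -
      have split: "(\<Sum>w\<in>Basis. (?h \<bullet> w) *\<^sub>R (A t p (Y w p t) + s w t p))
          = (\<Sum>w\<in>Basis. (?h \<bullet> w) *\<^sub>R A t p (Y w p t)) + (\<Sum>w\<in>Basis. (?h \<bullet> w) *\<^sub>R s w t p)"
        by (simp add: scaleR_right_distrib sum.distrib)
      have group: "a + b - (a' + b') - (s1 + (u + v)) = a2 - a' - s1 + (a - a2 - u + (b - b' - v))"
        for a b a' b' s1 u v a2 :: 'b by simp
      show ?thesis unfolding split e3 e4 e5 by (rule group)
    qed
    then show "((\<lambda>t. y t q - y t p - (\<Sum>w\<in>Basis. (?h \<bullet> w) *\<^sub>R Y w p t)) has_vector_derivative
        (A t p (y t q - y t p - ?Z) + r q p t)) (at t within {0..})" using d by (simp only:)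
    let ?u = "1 + t"
    have uM: "?u powr a \<le> ?u powr M" if "a \<le> M" for a using powr_mono_nonneg[OF t that] .
    have ADh: "norm (AD c t p ?h) \<le> real DIM('p) * (DA * ?u powr mA) * norm ?h" if c: "c \<in> Basis" for c
      by (rule linear_Basis_bound[OF linAD[OF c t p]]) (rule DA(2)[OF c _ t p])
    have summand: "norm ((y t q \<bullet> c) *\<^sub>R (A t q c - A t p c - AD c t p ?h) + ((y t q - y t p) \<bullet> c) *\<^sub>R AD c t p ?h)
        \<le> (By * CA + Ly * (real DIM('p) * DA)) * (norm ?h)\<^sup>2 * ?u powr M" if c: "c \<in> Basis" for c
    proof -
      have "norm ((y t q \<bullet> c) *\<^sub>R (A t q c - A t p c - AD c t p ?h)) = \<bar>y t q \<bullet> c\<bar> * norm (A t q c - A t p c - AD c t p ?h)"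
        by simp
      also have "\<dots> \<le> (By * ?u powr m0) * (CA * ?u powr mA * (norm ?h)\<^sup>2)"
        using Basis_le_norm[OF c, of "y t q"] By(2)[OF t q] CA(2)[OF c t p q] By(1) by (intro mult_mono) auto
      also have "\<dots> = By * CA * (norm ?h)\<^sup>2 * ?u powr (m0 + mA)" by (simp add: powr_add mult_ac)
      also have "\<dots> \<le> By * CA * (norm ?h)\<^sup>2 * ?u powr M"
        using By CA Suc.prems(4) m0 m1 by (intro mult_left_mono uM) (auto simp: M_def)
      finally have 1: "norm ((y t q \<bullet> c) *\<^sub>R (A t q c - A t p c - AD c t p ?h)) \<le> By * CA * (norm ?h)\<^sup>2 * ?u powr M" .
      have "norm (((y t q - y t p) \<bullet> c) *\<^sub>R AD c t p ?h) = \<bar>(y t q - y t p) \<bullet> c\<bar> * norm (AD c t p ?h)" by simp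
      also have "\<dots> \<le> (Ly * ?u powr m0 * norm ?h) * (real DIM('p) * (DA * ?u powr mA) * norm ?h)"
        using order_trans[OF Basis_le_norm[OF c] Ly(2)[OF t q p]] ADh[OF c] Ly(1) by (intro mult_mono) auto
      also have "\<dots> = Ly * (real DIM('p) * DA) * (norm ?h)\<^sup>2 * ?u powr (m0 + mA)"
        by (simp add: powr_add power2_eq_square mult_ac)
      also have "\<dots> \<le> Ly * (real DIM('p) * DA) * (norm ?h)\<^sup>2 * ?u powr M"
        using Ly DA Suc.prems(4) m0 m1 by (intro mult_left_mono uM) (auto simp: M_def)
      finally have 2: "norm (((y t q - y t p) \<bullet> c) *\<^sub>R AD c t p ?h) \<le> Ly * (real DIM('p) * DA) * (norm ?h)\<^sup>2 * ?u powr M" .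
      show ?thesis
        using norm_triangle_ineq[of "(y t q \<bullet> c) *\<^sub>R (A t q c - A t p c - AD c t p ?h)" "((y t q - y t p) \<bullet> c) *\<^sub>R AD c t p ?h"] 1 2
        by (simp add: distrib_right)
    qed
    have "norm (b t q - b t p - b' t p ?h) \<le> Cb * ?u powr m * (norm ?h)\<^sup>2" by (rule Cb(2)[OF t p q])
    also have "\<dots> \<le> Cb * ?u powr M * (norm ?h)\<^sup>2"
      using Cb mA m0 m1 by (intro mult_left_mono mult_right_mono uM) (auto simp: M_def)
    finally have bb: "norm (b t q - b t p - b' t p ?h) \<le> Cb * ?u powr M * (norm ?h)\<^sup>2" .
    have "norm (r q p t) \<le> (\<Sum>c\<in>(Basis::'b set). (By * CA + Ly * (real DIM('p) * DA)) * (norm ?h)\<^sup>2 * ?u powr M) + Cb * ?u powr M * (norm ?h)\<^sup>2"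
      unfolding r_def using bb by (intro order_trans[OF norm_triangle_ineq] add_mono sum_norm_le summand) auto
    also have "\<dots> = (real DIM('b) * (By * CA + Ly * (real DIM('p) * DA)) + Cb) * (norm ?h)\<^sup>2 * ?u powr M"
      by (simp add: algebra_simps)
    also have "\<dots> \<le> K * (norm ?h)\<^sup>2 * ?u powr M"
      using C0 by (intro mult_right_mono) (auto simp: K_def)
    finally show "norm (r q p t) \<le> K * (norm ?h)\<^sup>2 * ?u powr M" .
  next
    fix p q assume p: "p \<in> S" and q: "q \<in> S"
    have "(\<Sum>w\<in>Basis. ((q - p) \<bullet> w) *\<^sub>R Y w p 0) = yd 0 p (q - p)"
      using Y[OF p] derivative_Basis_expand[OF linyd[of 0 p], of "q - p"] p by simp
    then have "norm (y 0 q - y 0 p - (\<Sum>w\<in>Basis. ((q - p) \<bullet> w) *\<^sub>R Y w p 0)) \<le> C0 * (norm (q - p))\<^sup>2"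
      using C0(2)[of 0 p q] ini p q by simp
    also have "\<dots> \<le> K * (norm (q - p))\<^sup>2" using By CA Ly DA Cb by (intro mult_right_mono) (auto simp: K_def)
    finally show "norm (y 0 q - y 0 p - (\<Sum>w\<in>Basis. ((q - p) \<bullet> w) *\<^sub>R Y w p 0)) \<le> K * (norm (q - p))\<^sup>2" .
  qed
  define m2 where "m2 = m0 + (\<Sum>w\<in>Basis. mw w)"
  have m2: "mw w \<le> m2" if "w \<in> Basis" for w
  proof -
    have "mw w \<le> (\<Sum>w\<in>Basis. mw w)" using mw that by (intro member_le_sum) auto
    then show ?thesis using m0(1) by (simp add: m2_def)
  qed
  have m02: "m0 \<le> m2" using mw by (auto simp: m2_def intro: sum_nonneg)
  have "semitame m2 (Suc k) y S"
  proof (rule semitame_SucI[OF _ deriv])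
    show "glip m2 y S" using m0 m02 by (auto simp: tame_0 intro: glip_mono)
    fix w :: 'p assume w: "w \<in> Basis"
    have "tame m2 k (\<lambda>t p. Y w p t) S" using mw m2[OF w] w tame_mono by blast
    then show "tame m2 k (\<lambda>t p. \<Sum>wa\<in>Basis. (w \<bullet> wa) *\<^sub>R Y wa p t) S"
      by (simp add: sum_Basis_inner_scaleR[OF w])
  qed
  then have "tame m2 (Suc k) y S" using m0 m02 by (auto simp: tame_def intro: gbound_mono)
  then show ?case using m02 m0(1) by (intro exI[of _ m2]) auto
qed

text \<open>Order k for X makes the coefficient \<open>G'\<close> along X tame of order k. The
  variational equation then has tame solutions, which are the derivatives of X, so X gains an order.
  The Lipschitz bound on X has to be supplied from outside: it starts the induction and turns the
  Taylor remainder of G into a quadratic one in q - p.\<close>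

lemma tame_flow:
  fixes X :: "real \<Rightarrow> 'p::euclidean_space \<Rightarrow> 'p"
  assumes S: "convex S" and D: "convex D"
    and XD: "\<And>t p. t \<ge> 0 \<Longrightarrow> p \<in> S \<Longrightarrow> X t p \<in> D"
    and sol: "\<And>t p. t \<ge> 0 \<Longrightarrow> p \<in> S \<Longrightarrow>
      ((\<lambda>t. X t p) has_vector_derivative G (X t p)) (at t within {0..})"
    and ini: "\<And>p. p \<in> S \<Longrightarrow> X 0 p = p"
    and G: "\<And>x. x \<in> D \<Longrightarrow> (G has_derivative G' x) (at x within D)"
    and G': "\<And>k c. c \<in> Basis \<Longrightarrow> tame 0 k (\<lambda>_ x. G' x c) D"
    and A: "propagates (\<lambda>t p. G' (X t p)) S"
    and X: "glip mX X S" "mX \<ge> 0"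
  shows "\<exists>m\<ge>0. semitame m k X S"
proof (induction k)
  case 0
  then show ?case using X by auto
next
  case (Suc k)
  then obtain m where m: "m \<ge> 0" "semitame m k X S" by blast
  have linG: "linear (G' x)" if "x \<in> D" for x using G[OF that] by (rule has_derivative_linear)
  let ?mA = "(real k + 1) * m"
  have mA: "?mA \<ge> 0" using m by simp
  have tA: "tame ?mA k (\<lambda>t p. G' (X t p) c) S" if "c \<in> Basis" for c
    by (rule tame_comp[OF G'[OF that] XD m(2,1)])
  obtain B where B: "B \<ge> 0" "\<And>t x c. t \<ge> 0 \<Longrightarrow> x \<in> D \<Longrightarrow> c \<in> Basis \<Longrightarrow> norm (G' x c) \<le> B * (1 + t) powr 0"
    using gbound_Basis_const[of 0 "\<lambda>_. G'" D, OF tame_gbound[OF G'[of _ 0]]] by blast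
  have bdd: "norm (G' (X t p) v) \<le> real DIM('p) * B * norm v" if "t \<ge> 0" "p \<in> S" for t p v
    by (rule linear_Basis_bound[OF linG[OF XD[OF that]]]) (use B(2)[of 0] XD[OF that] in auto)
  have ex: "\<exists>f. f 0 = w \<and> (\<forall>t\<ge>0. (f has_vector_derivative (G' (X t p) (f t) + 0)) (at t within {0..}))"
    if p: "p \<in> S" for p w
  proof -
    obtain f where "f 0 = w" "\<And>t. t \<ge> 0 \<Longrightarrow> (f has_vector_derivative (G' (X t p) (f t) + 0)) (at t within {0..})"
      by (rule linear_ode_solution[of "\<lambda>t. G' (X t p)" "real DIM('p) * B" "\<lambda>t. 0" 0 0 w])
        (use p linG XD bdd glip_cont[OF tame_glip[OF tA] p] in auto)
    then show ?thesis by blast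
  qed
  define Y where "Y w p = (SOME f. f 0 = w \<and>
      (\<forall>t\<ge>0. (f has_vector_derivative (G' (X t p) (f t) + 0)) (at t within {0..})))" for w p
  have Y: "Y w p 0 = w \<and>
      (\<forall>t\<ge>0. (Y w p has_vector_derivative (G' (X t p) (Y w p t) + 0)) (at t within {0..}))"
    if "p \<in> S" for p w
    unfolding Y_def using someI_ex[OF ex[OF that]] .
  have "\<forall>w\<in>Basis. \<exists>m'. m' \<ge> 0 \<and> tame m' k (\<lambda>t p. Y w p t) S"
  proof
    fix w :: 'p
    have "\<exists>m'\<ge>0. tame m' k (\<lambda>t p. Y w p t) S"
      by (rule tame_linear_ode[OF S A linG[OF XD] bdd mA tA, where m = 0 and b = "\<lambda>t p. 0" and ?y0.0 = "\<lambda>p. w"])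
        (use Y in \<open>auto intro: tame_zero tame_const\<close>)
    then show "\<exists>m'. m' \<ge> 0 \<and> tame m' k (\<lambda>t p. Y w p t) S" by blast
  qed
  then obtain mw where mw: "\<forall>w\<in>Basis. mw w \<ge> 0 \<and> tame (mw w) k (\<lambda>t p. Y w p t) S"
    by (rule bchoice[THEN exE])
  obtain L where L: "L \<ge> 0" "\<And>t p q. t \<ge> 0 \<Longrightarrow> p \<in> S \<Longrightarrow> q \<in> S \<Longrightarrow>
      norm (X t p - X t q) \<le> L * (1 + t) powr mX * norm (p - q)"
    using glipE[OF X(1)] by blast
  obtain C where C: "C \<ge> 0" "\<And>t p q. t \<ge> 0 \<Longrightarrow> p \<in> D \<Longrightarrow> q \<in> D \<Longrightarrow>
      norm (G q - G p - G' p (q - p)) \<le> C * (1 + t) powr 0 * (norm (q - p))\<^sup>2"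
    using quadratic_remainder[of D "\<lambda>_. G" "\<lambda>_. G'" 0, OF D G tame_glip[OF G'[of _ 0]]] by blast
  \<comment> \<open>The Taylor remainder of G is at most C norm (X t q - X t p)^2; inserting the
    Lipschitz bound of X yields the exponent 2 mX and the constant C L^2.\<close>
  have M: "2 * mX \<ge> 0" and K: "C * L\<^sup>2 \<ge> 0" using X C by auto
  have deriv: "(X t has_derivative (\<lambda>h. \<Sum>w\<in>Basis. (h \<bullet> w) *\<^sub>R Y w p t)) (at p within S)"
    if t: "t \<ge> 0" and p: "p \<in> S" for t p
  proof (rule propagates_has_derivative[OF A M K _ _ _ t p, where Y = "\<lambda>w t p. Y w p t"
        and r = "\<lambda>q p t. G (X t q) - G (X t p) - G' (X t p) (X t q - X t p)"])
    fix t :: real and p q assume t: "t \<ge> 0" and p: "p \<in> S" and q: "q \<in> S"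
    let ?h = "q - p"
    let ?Z = "\<Sum>w\<in>Basis. (?h \<bullet> w) *\<^sub>R Y w p t"
    note la = linG[OF XD[OF t p]]
    have d: "((\<lambda>t. X t q - X t p - (\<Sum>w\<in>Basis. (?h \<bullet> w) *\<^sub>R Y w p t)) has_vector_derivative
        (G (X t q) - G (X t p) - (\<Sum>w\<in>Basis. (?h \<bullet> w) *\<^sub>R (G' (X t p) (Y w p t) + 0)))) (at t within {0..})"
      using Y[OF p] t
      by (intro derivative_intros bounded_linear.has_vector_derivative[OF bounded_linear_scaleR_right] sol t p q) auto
    have "G (X t q) - G (X t p) - (\<Sum>w\<in>Basis. (?h \<bullet> w) *\<^sub>R (G' (X t p) (Y w p t) + 0))
        = G' (X t p) (X t q - X t p - ?Z) + (G (X t q) - G (X t p) - G' (X t p) (X t q - X t p))"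
    proof -
      have "G' (X t p) (X t q - X t p - ?Z)
          = G' (X t p) (X t q - X t p) - (\<Sum>w\<in>Basis. (?h \<bullet> w) *\<^sub>R G' (X t p) (Y w p t))"
        by (simp only: linear_diff[OF la] linear_sum[OF la] linear_scale[OF la])
      then show ?thesis by simp
    qed
    then show "((\<lambda>t. X t q - X t p - (\<Sum>w\<in>Basis. (?h \<bullet> w) *\<^sub>R Y w p t)) has_vector_derivative
        (G' (X t p) (X t q - X t p - ?Z) + (G (X t q) - G (X t p) - G' (X t p) (X t q - X t p)))) (at t within {0..})"
      using d by (simp only:)
    have "norm (G (X t q) - G (X t p) - G' (X t p) (X t q - X t p)) \<le> C * (norm (X t q - X t p))\<^sup>2"
      using C(2)[of 0, OF _ XD[OF t p] XD[OF t q]] by simp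
    also have "\<dots> \<le> C * (L * (1 + t) powr mX * norm ?h)\<^sup>2"
      using L(2)[OF t q p] C(1) by (intro mult_left_mono power_mono) auto
    also have "\<dots> = C * L\<^sup>2 * (norm ?h)\<^sup>2 * (1 + t) powr (2 * mX)"
      using t by (simp add: power_mult_distrib powr_power mult_ac)
    finally show "norm (G (X t q) - G (X t p) - G' (X t p) (X t q - X t p)) \<le> C * L\<^sup>2 * (norm ?h)\<^sup>2 * (1 + t) powr (2 * mX)" .
  next
    fix p q assume p: "p \<in> S" and q: "q \<in> S"
    have "(\<Sum>w\<in>Basis. ((q - p) \<bullet> w) *\<^sub>R Y w p 0) = q - p" using Y[OF p] by (simp add: euclidean_representation)
    then show "norm (X 0 q - X 0 p - (\<Sum>w\<in>Basis. ((q - p) \<bullet> w) *\<^sub>R Y w p 0)) \<le> C * L\<^sup>2 * (norm (q - p))\<^sup>2"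
      using ini p q K by simp
  qed
  define m2 where "m2 = mX + (\<Sum>w\<in>Basis. mw w)"
  have m2: "mw w \<le> m2" if "w \<in> Basis" for w
  proof -
    have "mw w \<le> (\<Sum>w\<in>Basis. mw w)" using mw that by (intro member_le_sum) auto
    then show ?thesis using X(2) by (simp add: m2_def)
  qed
  have m02: "mX \<le> m2" using mw by (auto simp: m2_def intro: sum_nonneg)
  have "semitame m2 (Suc k) X S"
  proof (rule semitame_SucI[OF _ deriv])
    show "glip m2 X S" using X m02 by (auto intro: glip_mono)
    fix w :: 'p assume w: "w \<in> Basis"
    have "tame m2 k (\<lambda>t p. Y w p t) S" using mw m2[OF w] w tame_mono by blast
    then show "tame m2 k (\<lambda>t p. \<Sum>wa\<in>Basis. (w \<bullet> wa) *\<^sub>R Y wa p t) S"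
      by (simp add: sum_Basis_inner_scaleR[OF w])
  qed
  then show ?case using m02 X(2) by (intro exI[of _ m2]) auto
qed

subsection \<open>Decay and growth estimates\<close>

text \<open>\<open>Ck_on\<close> evaluates derivatives at all vectors, \<open>semitame\<close>
  controls them at basis vectors; linearity of the derivative bridges the two at every
  order.\<close>

lemma semitame_Ck_on:
  fixes f :: "'p::euclidean_space \<Rightarrow> 'b::euclidean_space"
  shows "semitame 0 k (\<lambda>_. f) S \<Longrightarrow> Ck_on k f S"
proof (induction k arbitrary: f)
  case 0
  obtain C where C: "C \<ge> 0" "\<And>t p q. t \<ge> 0 \<Longrightarrow> p \<in> S \<Longrightarrow> q \<in> S \<Longrightarrow>
      norm (f p - f q) \<le> C * (1 + t) powr 0 * norm (p - q)"
    using glipE[OF semitame_glip[OF 0]] by blast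
  have "continuous_on S f"
    by (rule lipschitz_on_continuous_on[OF lipschitz_onI[OF _ C(1)]])
      (use C(2)[of 0] in \<open>auto simp: dist_norm\<close>)
  then show ?case by simp
next
  case (Suc k)
  obtain f1 where f1: "\<And>t p. t \<ge> 0 \<Longrightarrow> p \<in> S \<Longrightarrow> (f has_derivative f1 t p) (at p within S)"
    "\<And>b. b \<in> Basis \<Longrightarrow> tame 0 k (\<lambda>t p. f1 t p b) S"
    using semitame_SucE[OF Suc.prems] by blast
  have "tame 0 k (\<lambda>_ p. \<Sum>b\<in>Basis. (w \<bullet> b) *\<^sub>R f1 0 p b) S" for w
    by (intro tame_sum tame_scale tame_at[OF f1(2), of _ 0]) auto
  moreover have "(\<Sum>b\<in>Basis. (w \<bullet> b) *\<^sub>R f1 0 p b) = f1 0 p w" if "p \<in> S" for p w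
    using derivative_Basis_expand[of "f1 0 p" w] has_derivative_linear[OF f1(1)[of 0 p]] that by simp
  ultimately have "tame 0 k (\<lambda>_ p. f1 0 p w) S" for w
    by (rule tame_cong)
  then show ?case using f1(1)[of 0] Suc.IH[OF tame_semitame] by auto
qed

section \<open>Sine, cosine and powers\<close>

lemma glip_sin_cos: "glip 0 (\<lambda>_. sin) (UNIV :: real set)" "glip 0 (\<lambda>_. cos) (UNIV :: real set)"
proof -
  have "norm (sin x - sin y) \<le> 1 * norm (x - y)" for x y :: real
    by (rule field_differentiable_bound[where S = UNIV and f' = cos])
      (auto intro!: derivative_eq_intros)
  then show "glip 0 (\<lambda>_. sin) (UNIV :: real set)" by (intro glipI[where C = 1]) auto
  have "norm (cos x - cos y) \<le> 1 * norm (x - y)" for x y :: real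
    by (rule field_differentiable_bound[where S = UNIV and f' = "\<lambda>x. - sin x"])
      (auto intro!: derivative_eq_intros)
  then show "glip 0 (\<lambda>_. cos) (UNIV :: real set)" by (intro glipI[where C = 1]) auto
qed

lemma tame_sin_cos: "tame 0 k (\<lambda>_. sin) (UNIV :: real set) \<and> tame 0 k (\<lambda>_. cos) (UNIV :: real set)"
proof (induction k)
  have g: "gbound 0 (\<lambda>_. sin) (UNIV :: real set)" "gbound 0 (\<lambda>_. cos) (UNIV :: real set)"
    by (auto intro!: gboundI[where C = 1])
  {
    case 0 show ?case using g glip_sin_cos by (simp add: tame_0)
  next
    case (Suc k)
    have "semitame 0 (Suc k) (\<lambda>_. sin) (UNIV :: real set)"
      by (rule semitame_SucI[where y' = "\<lambda>_ x h. cos x * h", OF glip_sin_cos(1)])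
        (use Suc in \<open>auto simp: has_field_derivative_def[symmetric] intro!: derivative_eq_intros\<close>)
    moreover have "semitame 0 (Suc k) (\<lambda>_. cos) (UNIV :: real set)"
      by (rule semitame_SucI[where y' = "\<lambda>_ x h. - sin x * h", OF glip_sin_cos(2)])
        (use Suc tame_minus[of 0 k "\<lambda>_. sin" UNIV] in
          \<open>auto simp: has_field_derivative_def[symmetric] intro!: derivative_eq_intros\<close>)
    ultimately show ?case using g by (simp add: tame_def)
  }
qed

lemma tame_sin: "semitame 0 k x S \<Longrightarrow> tame 0 k (\<lambda>t p. sin (x t p :: real)) S"
  and tame_cos: "semitame 0 k x S \<Longrightarrow> tame 0 k (\<lambda>t p. cos (x t p :: real)) S"
  using tame_comp0[of k sin UNIV S x] tame_comp0[of k cos UNIV S x] tame_sin_cos by auto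

lemma power_diff_bound:
  fixes a b :: real
  assumes "\<bar>a\<bar> \<le> B" "\<bar>b\<bar> \<le> B"
  shows "\<bar>a ^ Suc n - b ^ Suc n\<bar> \<le> real (Suc n) * B ^ n * \<bar>a - b\<bar>"
proof -
  have "\<bar>a ^ p * b ^ (n - p)\<bar> \<le> B ^ n" if "p < Suc n" for p
  proof -
    have "\<bar>a ^ p * b ^ (n - p)\<bar> = \<bar>a\<bar> ^ p * \<bar>b\<bar> ^ (n - p)" by (simp add: abs_mult power_abs)
    also have "\<dots> \<le> B ^ p * B ^ (n - p)" using assms by (intro mult_mono power_mono) auto
    also have "\<dots> = B ^ n" using that by (simp flip: power_add)
    finally show ?thesis .
  qed
  then have "\<bar>\<Sum>p<Suc n. a ^ p * b ^ (n - p)\<bar> \<le> (\<Sum>p<Suc n. B ^ n)"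
    by (intro order_trans[OF sum_abs] sum_mono) auto
  then have "\<bar>a - b\<bar> * \<bar>\<Sum>p<Suc n. a ^ p * b ^ (n - p)\<bar> \<le> \<bar>a - b\<bar> * (real (Suc n) * B ^ n)"
    by (intro mult_left_mono) (auto simp: algebra_simps)
  then show ?thesis unfolding diff_power_eq_sum abs_mult by (simp add: mult_ac)
qed

text \<open>Each derivative of \<open>\<sigma> ^ M\<close> costs one factor \<open>\<sigma>\<close>, hence one power of decay, and a fixed amount of
  growth; a large \<open>M\<close> pays for \<open>k\<close> derivatives.\<close>

lemma tame_decay:
  fixes \<sigma> :: "real \<Rightarrow> 'p::euclidean_space \<Rightarrow> real"
  assumes \<sigma>: "\<And>t p. t \<ge> 0 \<Longrightarrow> p \<in> S \<Longrightarrow> 0 \<le> \<sigma> t p \<and> \<sigma> t p \<le> c / (1 + t)" and m: "m \<ge> 0"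
  shows "semitame m k \<sigma> S \<Longrightarrow>
    \<exists>M0. \<forall>M\<ge>M0. \<forall>y. tame m' k y S \<longrightarrow> tame (-2) k (\<lambda>t p. \<sigma> t p ^ M * y t p :: real) S"
proof (induction k arbitrary: m')
  define c' where "c' = \<bar>c\<bar>"
  have sb: "\<bar>\<sigma> t p\<bar> \<le> c' / (1 + t)" if "t \<ge> 0" "p \<in> S" for t p
  proof -
    have "c / (1 + t) \<le> c' / (1 + t)" using that by (intro divide_right_mono) (auto simp: c'_def)
    then show ?thesis using \<sigma>[OF that] by auto
  qed
  have c': "c' \<ge> 0" by (simp add: c'_def)
  have powb: "(c' / (1 + t)) ^ M * (1 + t) powr a \<le> c' ^ M * (1 + t) powr (-2)"
    if "t \<ge> 0" "real M \<ge> a + 2" for t M a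
  proof -
    have "(c' / (1 + t)) ^ M * (1 + t) powr a = c' ^ M * ((1 + t) powr (- real M) * (1 + t) powr a)"
      using that(1) by (simp add: power_divide powr_minus powr_realpow divide_inverse power_mult_distrib power_inverse)
    also have "\<dots> = c' ^ M * (1 + t) powr (a - real M)" by (simp flip: powr_add)
    also have "\<dots> \<le> c' ^ M * (1 + t) powr (-2)"
      using that c' by (intro mult_left_mono powr_mono_nonneg) auto
    finally show ?thesis .
  qed
  have base: "\<exists>M0. \<forall>M\<ge>M0. \<forall>y. tame m' 0 y S \<longrightarrow> tame (-2) 0 (\<lambda>t p. \<sigma> t p ^ M * y t p) S"
    if g: "glip m \<sigma> S" for m'
  proof (intro exI allI impI)
    \<comment> \<open>A difference of M-th powers spends one factor \<sigma>, so already \<sigma>^(M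
      - 1) has to beat the growth m + m' and leave a decay of order 2.\<close>
    fix M and y :: "real \<Rightarrow> 'p \<Rightarrow> real" assume M: "nat \<lceil>\<bar>m'\<bar> + m + 4\<rceil> \<le> M" and y: "tame m' 0 y S"
    have M': "real M \<ge> \<bar>m'\<bar> + m + 4" using M by linarith
    obtain n where n: "M = Suc n" using M' m by (cases M) auto
    obtain C where C: "C \<ge> 0" "\<And>t p. t \<ge> 0 \<Longrightarrow> p \<in> S \<Longrightarrow> norm (y t p) \<le> C * (1 + t) powr m'"
      using gboundE[OF tame_gbound[OF y]] by blast
    obtain L where L: "L \<ge> 0" "\<And>t p q. t \<ge> 0 \<Longrightarrow> p \<in> S \<Longrightarrow> q \<in> S \<Longrightarrow>
        norm (y t p - y t q) \<le> L * (1 + t) powr m' * norm (p - q)"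
      using glipE[OF tame_glip[OF y]] by blast
    obtain Ls where Ls: "Ls \<ge> 0" "\<And>t p q. t \<ge> 0 \<Longrightarrow> p \<in> S \<Longrightarrow> q \<in> S \<Longrightarrow>
        norm (\<sigma> t p - \<sigma> t q) \<le> Ls * (1 + t) powr m * norm (p - q)"
      using glipE[OF g] by blast
    have sp: "\<bar>\<sigma> t p ^ M\<bar> \<le> (c' / (1 + t)) ^ M" if "t \<ge> 0" "p \<in> S" for t p
      using sb[OF that] by (simp add: power_abs power_mono)
    have "gbound (-2) (\<lambda>t p. \<sigma> t p ^ M * y t p) S"
    proof (rule gboundI[where C = "C * c' ^ M"])
      fix t :: real and p assume tp: "t \<ge> 0" "p \<in> S"
      have "norm (\<sigma> t p ^ M * y t p) \<le> (c' / (1 + t)) ^ M * (C * (1 + t) powr m')"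
        unfolding norm_mult using sp[OF tp] C(2)[OF tp] C(1) by (intro mult_mono) (auto intro: order_trans[OF _ sp[OF tp]])
      also have "\<dots> = C * ((c' / (1 + t)) ^ M * (1 + t) powr m')" by simp
      also have "\<dots> \<le> C * (c' ^ M * (1 + t) powr (-2))"
        using C(1) M' m tp by (intro mult_left_mono powb) auto
      finally show "norm (\<sigma> t p ^ M * y t p) \<le> C * c' ^ M * (1 + t) powr (-2)" by (simp add: mult_ac)
    qed
    moreover have "glip (-2) (\<lambda>t p. \<sigma> t p ^ M * y t p) S"
    proof (rule glipI[where C = "real M * Ls * C * c' ^ n + L * c' ^ M"])
      show "continuous_on {0..} (\<lambda>t. \<sigma> t p ^ M * y t p)" if "p \<in> S" for p
        by (intro continuous_intros glip_cont[OF g that] glip_cont[OF tame_glip[OF y] that])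
      fix t :: real and p q assume tp: "t \<ge> 0" "p \<in> S" "q \<in> S"
      have "\<bar>\<sigma> t p ^ M - \<sigma> t q ^ M\<bar> \<le> real M * (c' / (1 + t)) ^ n * \<bar>\<sigma> t p - \<sigma> t q\<bar>"
        unfolding n by (intro power_diff_bound sb tp)
      also have "\<dots> \<le> real M * (c' / (1 + t)) ^ n * (Ls * (1 + t) powr m * norm (p - q))"
        using Ls(2)[OF tp] tp c' by (intro mult_left_mono) auto
      finally have "\<bar>\<sigma> t p ^ M - \<sigma> t q ^ M\<bar> * \<bar>y t p\<bar> \<le>
          (real M * (c' / (1 + t)) ^ n * (Ls * (1 + t) powr m * norm (p - q))) * (C * (1 + t) powr m')"
        using C(2)[OF tp(1,2)] by (intro mult_mono) (use Ls C c' tp in auto)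
      also have "\<dots> = real M * Ls * C * ((c' / (1 + t)) ^ n * (1 + t) powr (m + m')) * norm (p - q)"
        by (simp add: powr_add mult_ac)
      also have "\<dots> \<le> real M * Ls * C * (c' ^ n * (1 + t) powr (-2)) * norm (p - q)"
        using M' n tp m Ls C by (intro mult_left_mono mult_right_mono powb) auto
      finally have 1: "\<bar>\<sigma> t p ^ M - \<sigma> t q ^ M\<bar> * \<bar>y t p\<bar> \<le> real M * Ls * C * (c' ^ n * (1 + t) powr (-2)) * norm (p - q)" .
      have "\<bar>\<sigma> t q ^ M\<bar> * \<bar>y t p - y t q\<bar> \<le> (c' / (1 + t)) ^ M * (L * (1 + t) powr m' * norm (p - q))"
        using sp[OF tp(1,3)] L(2)[OF tp] by (intro mult_mono) (use c' tp in auto)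
      also have "\<dots> = L * ((c' / (1 + t)) ^ M * (1 + t) powr m') * norm (p - q)" by simp
      also have "\<dots> \<le> L * (c' ^ M * (1 + t) powr (-2)) * norm (p - q)"
        using M' m tp L by (intro mult_left_mono mult_right_mono powb) auto
      finally have 2: "\<bar>\<sigma> t q ^ M\<bar> * \<bar>y t p - y t q\<bar> \<le> L * (c' ^ M * (1 + t) powr (-2)) * norm (p - q)" .
      have "\<sigma> t p ^ M * y t p - \<sigma> t q ^ M * y t q = (\<sigma> t p ^ M - \<sigma> t q ^ M) * y t p + \<sigma> t q ^ M * (y t p - y t q)"
        by (simp add: algebra_simps)
      then have "norm (\<sigma> t p ^ M * y t p - \<sigma> t q ^ M * y t q) \<le>
          \<bar>\<sigma> t p ^ M - \<sigma> t q ^ M\<bar> * \<bar>y t p\<bar> + \<bar>\<sigma> t q ^ M\<bar> * \<bar>y t p - y t q\<bar>"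
        by (metis abs_mult abs_triangle_ineq real_norm_def)
      then show "norm (\<sigma> t p ^ M * y t p - \<sigma> t q ^ M * y t q) \<le>
          (real M * Ls * C * c' ^ n + L * c' ^ M) * (1 + t) powr (-2) * norm (p - q)"
        using 1 2 by (simp add: algebra_simps)
    qed
    ultimately show "tame (-2) 0 (\<lambda>t p. \<sigma> t p ^ M * y t p) S" by (simp add: tame_0)
  qed
  {
    case 0
    then show ?case using base by simp
  next
    case (Suc k)
    obtain s' where s': "\<And>t p. t \<ge> 0 \<Longrightarrow> p \<in> S \<Longrightarrow> (\<sigma> t has_derivative s' t p) (at p within S)"
      "\<And>b. b \<in> Basis \<Longrightarrow> tame m k (\<lambda>t p. s' t p b) S"
      using semitame_SucE[OF Suc.prems] by blast
    have sk: "semitame m k \<sigma> S" using Suc.prems by (rule semitame_less)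
    obtain M1 where M1: "\<And>M y. M \<ge> M1 \<Longrightarrow> tame m' k y S \<Longrightarrow> tame (-2) k (\<lambda>t p. \<sigma> t p ^ M * y t p) S"
      using Suc.IH[OF sk] by blast
    obtain M2 where M2: "\<And>M y. M \<ge> M2 \<Longrightarrow> tame (m + m') k y S \<Longrightarrow> tame (-2) k (\<lambda>t p. \<sigma> t p ^ M * y t p) S"
      using Suc.IH[OF sk] by blast
    obtain M3 where M3: "\<And>M y. M \<ge> M3 \<Longrightarrow> tame m' 0 y S \<Longrightarrow> tame (-2) 0 (\<lambda>t p. \<sigma> t p ^ M * y t p) S"
      using base[OF semitame_glip[OF sk]] by blast
    show ?case
    proof (intro exI allI impI)
      \<comment> \<open>The sum exceeds each of the three thresholds, and the extra 1 leaves M - 1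
        \<ge> M2 for the term in which one factor \<sigma> has been differentiated.\<close>
      fix M and y :: "real \<Rightarrow> 'p \<Rightarrow> real" assume M: "M1 + M2 + M3 + 1 \<le> M" and y: "tame m' (Suc k) y S"
      obtain y' where y': "\<And>t p. t \<ge> 0 \<Longrightarrow> p \<in> S \<Longrightarrow> (y t has_derivative y' t p) (at p within S)"
        "\<And>b. b \<in> Basis \<Longrightarrow> tame m' k (\<lambda>t p. y' t p b) S"
        using semitame_SucE[OF tame_semitame[OF y]] by blast
      have z: "tame (-2) 0 (\<lambda>t p. \<sigma> t p ^ M * y t p) S"
        using M tame_le[OF y] by (intro M3) auto
      have "semitame (-2) (Suc k) (\<lambda>t p. \<sigma> t p ^ M * y t p) S"
      proof (rule semitame_SucI[where y' = "\<lambda>t p h. \<sigma> t p ^ M * y' t p h + real M *\<^sub>R (\<sigma> t p ^ (M - 1) * (s' t p h * y t p))"])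
        show "glip (-2) (\<lambda>t p. \<sigma> t p ^ M * y t p) S" using z by (simp add: tame_0)
        show "((\<lambda>p. \<sigma> t p ^ M * y t p) has_derivative
            (\<lambda>h. \<sigma> t p ^ M * y' t p h + real M *\<^sub>R (\<sigma> t p ^ (M - 1) * (s' t p h * y t p)))) (at p within S)"
          if "t \<ge> 0" "p \<in> S" for t p
          by (rule has_derivative_eq_rhs[OF has_derivative_mult[OF has_derivative_power[OF s'(1)[OF that]] y'(1)[OF that]]])
            (auto simp: fun_eq_iff mult_ac)
        fix b :: 'p assume b: "b \<in> Basis"
        show "tame (-2) k (\<lambda>t p. \<sigma> t p ^ M * y' t p b + real M *\<^sub>R (\<sigma> t p ^ (M - 1) * (s' t p b * y t p))) S"
        proof -
          have "tame (m + m') k (\<lambda>t p. s' t p b * y t p) S"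
            using tame_mult[OF s'(2)[OF b] tame_le[OF y]] by simp
          then show ?thesis using M by (intro tame_add[OF M1[OF _ y'(2)[OF b]] tame_scale[OF M2]]) auto
        qed
      qed
      then show "tame (-2) (Suc k) (\<lambda>t p. \<sigma> t p ^ M * y t p) S" using z by (simp add: tame_def)
    qed
  }
qed

text \<open>The quantity \<open>z1\<^sup>2 + z2\<^sup>2 + ((1 + t) z3)\<^sup>2\<close> satisfies \<open>q' \<le> c q / (1 + t) + \<dots>\<close>, hence grows polynomially.\<close>

lemma weighted_growth:
  fixes z1 z2 z3 d1 d2 d3 :: "real \<Rightarrow> real"
  assumes d: "\<And>t. t \<ge> 0 \<Longrightarrow> (z1 has_real_derivative d1 t) (at t within {0..})"
    "\<And>t. t \<ge> 0 \<Longrightarrow> (z2 has_real_derivative d2 t) (at t within {0..})"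
    "\<And>t. t \<ge> 0 \<Longrightarrow> (z3 has_real_derivative d3 t) (at t within {0..})"
    and b: "\<And>t. t \<ge> 0 \<Longrightarrow> \<bar>d1 t\<bar> \<le> a / (1 + t) * (\<bar>z1 t\<bar> + \<bar>z2 t\<bar>) + a * \<bar>z3 t\<bar> + K * (1 + t) powr m"
    "\<And>t. t \<ge> 0 \<Longrightarrow> \<bar>d2 t\<bar> \<le> K * (1 + t) powr m"
    "\<And>t. t \<ge> 0 \<Longrightarrow> \<bar>d3 t\<bar> \<le> a / (1 + t)\<^sup>2 * (\<bar>z1 t\<bar> + \<bar>z2 t\<bar>) + a / (1 + t) * \<bar>z3 t\<bar> + K * (1 + t) powr m"
    and ini: "\<bar>z1 0\<bar> \<le> K" "\<bar>z2 0\<bar> \<le> K" "\<bar>z3 0\<bar> \<le> K"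
    and a: "a \<ge> 0" and m: "m \<ge> 0" and K: "K \<ge> 0" and t: "t \<ge> 0"
  shows "(z1 t)\<^sup>2 + (z2 t)\<^sup>2 + (z3 t)\<^sup>2 \<le> 3 * K\<^sup>2 * (1 + t) powr (6 * a + 2 * m + 13)"
proof -
  \<comment> \<open>c = 3 (2 a + 3): the quadratic terms amount to (2 a + 3) S^2 / (1 + t), where S
    is the sum of the three weighted absolute values and S^2 \<le> 3 q. The exponent M satisfies M -
    c \<ge> 1, and (1 + t)^(M - 1) dominates the squared source of order 2 m + 3.\<close>
  define c where "c = 6 * a + 9"
  define M where "M = c + 2 * m + 4"
  let ?q = "\<lambda>t. (z1 t)\<^sup>2 + (z2 t)\<^sup>2 + ((1 + t) * z3 t)\<^sup>2"
  let ?q' = "\<lambda>t. 2 * z1 t * d1 t + 2 * z2 t * d2 t + 2 * ((1 + t) * z3 t) * (z3 t + (1 + t) * d3 t)"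
  \<comment> \<open>Integrating factor (1 + t)^(- c), after subtraction of the supersolution 3 K^2
    (1 + t)^M; its factor 3 absorbs the three initial values.\<close>
  let ?g = "\<lambda>t. (?q t - 3 * K\<^sup>2 * (1 + t) powr M) * (1 + t) powr (- c)"
  have "?g t \<le> ?g 0"
  proof (rule halfline_nonincreasing[where A = "{0..}" and a = 0 and b = t and g = ?g and
        g' = "\<lambda>t. (?q' t - 3 * K\<^sup>2 * (M * (1 + t) powr (M - 1))) * (1 + t) powr (- c)
          + (?q t - 3 * K\<^sup>2 * (1 + t) powr M) * (- c * (1 + t) powr (- c - 1))"])
    fix s assume s: "0 \<le> s" "s \<le> t"
    show "(?g has_real_derivative (?q' s - 3 * K\<^sup>2 * (M * (1 + s) powr (M - 1))) * (1 + s) powr (- c)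
          + (?q s - 3 * K\<^sup>2 * (1 + s) powr M) * (- c * (1 + s) powr (- c - 1))) (at s within {0..})"
    proof -
      have p: "((\<lambda>t. (1 + t) powr r) has_real_derivative r * (1 + s) powr (r - 1)) (at s within {0..})" for r
        using s by (auto intro!: derivative_eq_intros simp: powr_diff)
      show ?thesis
        by (rule derivative_eq_intros d s p refl | use s in \<open>simp add: algebra_simps\<close>)+
    qed
    let ?u = "1 + s"
    have u: "?u \<ge> 1" "?u > 0" using s by auto
    define \<rho> where "\<rho> = K * ?u powr m"
    have \<rho>: "\<rho> \<ge> 0" using K by (simp add: \<rho>_def)
    define Z where "Z = ?u * \<bar>z3 s\<bar>"
    define S where "S = \<bar>z1 s\<bar> + \<bar>z2 s\<bar> + Z"
    have Z: "Z \<ge> 0" using u by (simp add: Z_def)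
    have S: "S \<ge> 0" "\<bar>z1 s\<bar> \<le> S" "\<bar>z2 s\<bar> \<le> S" "Z \<le> S" using Z by (auto simp: S_def)
    have z3: "a * \<bar>z3 s\<bar> = a / ?u * Z" using u by (simp add: Z_def)
    have D1: "\<bar>d1 s\<bar> \<le> a / ?u * S + \<rho>"
      using b(1)[OF s(1)] unfolding z3 \<rho>_def S_def by (simp add: distrib_left)
    have D2: "\<bar>d2 s\<bar> \<le> \<rho>" using b(2)[OF s(1)] by (simp add: \<rho>_def)
    have "?u * \<bar>d3 s\<bar> \<le> ?u * (a / ?u\<^sup>2 * (\<bar>z1 s\<bar> + \<bar>z2 s\<bar>) + a / ?u * \<bar>z3 s\<bar> + \<rho>)"
      using b(3)[OF s(1)] u unfolding \<rho>_def by (intro mult_left_mono) auto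
    also have "\<dots> = a / ?u * (\<bar>z1 s\<bar> + \<bar>z2 s\<bar>) + a / ?u * Z + ?u * \<rho>"
    proof -
      have "u * (a / u\<^sup>2 * x + a / u * y + z) = a / u * x + a / u * (u * y) + u * z" if "u > 0" for u x y z :: real
        using that by (simp add: power2_eq_square field_simps)
      then show ?thesis using u unfolding Z_def by blast
    qed
    finally have D3: "?u * \<bar>d3 s\<bar> \<le> a / ?u * S + ?u * \<rho>" by (simp add: S_def distrib_left)
    have au: "a / ?u \<ge> 0" using a u by simp
    have zz: "\<bar>z3 s\<bar> = Z / ?u" using u by (simp add: Z_def)
    have "?q' s \<le> 2 * (\<bar>z1 s\<bar> * \<bar>d1 s\<bar>) + 2 * (\<bar>z2 s\<bar> * \<bar>d2 s\<bar>) + 2 * (Z * (\<bar>z3 s\<bar> + ?u * \<bar>d3 s\<bar>))"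
    proof -
      have "z1 s * d1 s \<le> \<bar>z1 s\<bar> * \<bar>d1 s\<bar>" "z2 s * d2 s \<le> \<bar>z2 s\<bar> * \<bar>d2 s\<bar>"
        by (metis abs_ge_self abs_mult)+
      moreover have "?u * z3 s * (z3 s + ?u * d3 s) \<le> Z * (\<bar>z3 s\<bar> + ?u * \<bar>d3 s\<bar>)"
      proof -
        have "?u * z3 s * (z3 s + ?u * d3 s) \<le> \<bar>?u * z3 s\<bar> * \<bar>z3 s + ?u * d3 s\<bar>"
          by (metis abs_ge_self abs_mult)
        also have "\<dots> \<le> Z * (\<bar>z3 s\<bar> + ?u * \<bar>d3 s\<bar>)"
        proof (intro mult_mono)
          show "\<bar>z3 s + ?u * d3 s\<bar> \<le> \<bar>z3 s\<bar> + ?u * \<bar>d3 s\<bar>"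
            using abs_triangle_ineq[of "z3 s" "?u * d3 s"] u by (simp add: abs_mult)
        qed (use u Z in \<open>auto simp: Z_def abs_mult\<close>)
        finally show ?thesis .
      qed
      ultimately show ?thesis by linarith
    qed
    also have "\<dots> \<le> 2 * (\<bar>z1 s\<bar> * (a / ?u * S + \<rho>)) + 2 * (\<bar>z2 s\<bar> * \<rho>) + 2 * (Z * (Z / ?u + (a / ?u * S + ?u * \<rho>)))"
      using D1 D2 D3 Z zz by (intro add_mono mult_left_mono) auto
    also have "\<dots> \<le> (2 * (a / ?u) + 2 / ?u) * S\<^sup>2 + 2 * (?u * \<rho> * S)"
    proof -
      have "2 * (\<bar>z1 s\<bar> * (a / ?u * S + \<rho>)) + 2 * (\<bar>z2 s\<bar> * \<rho>) + 2 * (Z * (Z / ?u + (a / ?u * S + ?u * \<rho>)))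
         = 2 * (a / ?u) * ((\<bar>z1 s\<bar> + Z) * S) + 2 * ((\<bar>z1 s\<bar> + \<bar>z2 s\<bar>) * \<rho> + Z * (?u * \<rho>)) + 2 / ?u * (Z * Z)"
        by (simp add: algebra_simps add_divide_distrib)
      also have "\<dots> \<le> 2 * (a / ?u) * (S * S) + 2 * ((\<bar>z1 s\<bar> + \<bar>z2 s\<bar>) * (?u * \<rho>) + Z * (?u * \<rho>)) + 2 / ?u * (S * S)"
      proof (intro add_mono mult_left_mono mult_mono)
        show "\<rho> \<le> ?u * \<rho>" using mult_right_mono[OF u(1) \<rho>] by simp
      qed (use au S u Z \<rho> in \<open>auto simp: S_def\<close>)
      also have "\<dots> = (2 * (a / ?u) + 2 / ?u) * S\<^sup>2 + 2 * (?u * \<rho> * S)"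
        by (simp add: S_def power2_eq_square algebra_simps add_divide_distrib)
      finally show ?thesis .
    qed
    \<comment> \<open>Young's inequality, weighted so that the part with S^2 keeps the rate 1 / (1 +
      t); a constant rate would lead to exponential growth.\<close>
    also have "2 * (?u * \<rho> * S) \<le> S\<^sup>2 / ?u + ?u ^ 3 * \<rho>\<^sup>2"
    proof -
      have "0 \<le> (S - ?u\<^sup>2 * \<rho>)\<^sup>2 / ?u" using u by simp
      also have "\<dots> = S\<^sup>2 / ?u + ?u ^ 3 * \<rho>\<^sup>2 - 2 * (?u * \<rho> * S)"
        using u by (simp add: power2_eq_square power3_eq_cube field_simps)
      finally show ?thesis by simp
    qed
    also have "(2 * (a / ?u) + 2 / ?u) * S\<^sup>2 + (S\<^sup>2 / ?u + ?u ^ 3 * \<rho>\<^sup>2) = (2 * a + 3) / ?u * S\<^sup>2 + ?u ^ 3 * \<rho>\<^sup>2"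
      by (simp add: add_divide_distrib algebra_simps)
    also have "\<dots> \<le> (2 * a + 3) / ?u * (3 * ?q s) + ?u ^ 3 * \<rho>\<^sup>2"
    proof -
      have "S\<^sup>2 \<le> 3 * ?q s"
      proof -
        have "0 \<le> (\<bar>z1 s\<bar> - \<bar>z2 s\<bar>)\<^sup>2 + (\<bar>z1 s\<bar> - Z)\<^sup>2 + (\<bar>z2 s\<bar> - Z)\<^sup>2" by simp
        then have "S\<^sup>2 \<le> 3 * (\<bar>z1 s\<bar>\<^sup>2 + \<bar>z2 s\<bar>\<^sup>2 + Z\<^sup>2)"
          unfolding S_def by (simp only: power2_eq_square algebra_simps)
        then show ?thesis by (simp add: Z_def power_mult_distrib)
      qed
      then show ?thesis using a u by (intro add_mono mult_left_mono) auto
    qed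
    finally have Q: "?q' s \<le> c / ?u * ?q s + ?u ^ 3 * \<rho>\<^sup>2" by (simp add: c_def field_simps)
    have pr: "?u ^ 3 * \<rho>\<^sup>2 \<le> K\<^sup>2 * ?u powr (M - 1)"
    proof -
      have "?u ^ 3 * \<rho>\<^sup>2 = K\<^sup>2 * (?u powr 3 * ?u powr (2 * m))"
        using u by (simp add: \<rho>_def power_mult_distrib powr_power powr_numeral)
      also have "\<dots> = K\<^sup>2 * ?u powr (3 + 2 * m)" by (simp add: powr_add)
      also have "\<dots> \<le> K\<^sup>2 * ?u powr (M - 1)"
        using s a by (intro mult_left_mono powr_mono_nonneg) (auto simp: M_def c_def)
      finally show ?thesis .
    qed
    have "(?q' s - 3 * K\<^sup>2 * (M * ?u powr (M - 1))) - c / ?u * (?q s - 3 * K\<^sup>2 * ?u powr M)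
        \<le> ?u ^ 3 * \<rho>\<^sup>2 - 3 * K\<^sup>2 * ((M - c) * ?u powr (M - 1))"
    proof -
      have e: "?u powr M = ?u * ?u powr (M - 1)" using u by (simp add: powr_diff)
      have "c / ?u * (?q s - 3 * K\<^sup>2 * ?u powr M) = c / ?u * ?q s - 3 * K\<^sup>2 * (c * ?u powr (M - 1))"
        unfolding e using u by (simp add: field_simps)
      then show ?thesis using Q by (simp add: algebra_simps)
    qed
    also have "\<dots> \<le> 0"
    proof -
      have "1 * ?u powr (M - 1) \<le> (M - c) * ?u powr (M - 1)"
        using m by (intro mult_right_mono) (auto simp: M_def)
      then have *: "?u powr (M - 1) \<le> 3 * ((M - c) * ?u powr (M - 1))"
        by (smt (verit) powr_ge_zero)
      have "K\<^sup>2 * ?u powr (M - 1) \<le> K\<^sup>2 * (3 * ((M - c) * ?u powr (M - 1)))"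
        by (intro mult_left_mono *) auto
      then show ?thesis using pr by linarith
    qed
    finally have neg: "(?q' s - 3 * K\<^sup>2 * (M * ?u powr (M - 1))) - c / ?u * (?q s - 3 * K\<^sup>2 * ?u powr M) \<le> 0" .
    have e: "?u powr (- c - 1) = ?u powr (- c) / ?u" using u by (simp add: powr_diff)
    have "(?q' s - 3 * K\<^sup>2 * (M * ?u powr (M - 1))) * ?u powr (- c)
          + (?q s - 3 * K\<^sup>2 * ?u powr M) * (- c * ?u powr (- c - 1))
        = ((?q' s - 3 * K\<^sup>2 * (M * ?u powr (M - 1))) - c / ?u * (?q s - 3 * K\<^sup>2 * ?u powr M)) * ?u powr (- c)"
      unfolding e by (simp add: algebra_simps)
    also have "\<dots> \<le> 0" using neg by (intro mult_nonpos_nonneg) auto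
    finally show "(?q' s - 3 * K\<^sup>2 * (M * ?u powr (M - 1))) * ?u powr (- c)
          + (?q s - 3 * K\<^sup>2 * ?u powr M) * (- c * ?u powr (- c - 1)) \<le> 0" .
  qed (use t in auto)
  also have "?g 0 \<le> 0"
  proof -
    have "(z1 0)\<^sup>2 \<le> K\<^sup>2" "(z2 0)\<^sup>2 \<le> K\<^sup>2" "(z3 0)\<^sup>2 \<le> K\<^sup>2"
      using ini K by (auto simp: abs_le_square_iff[symmetric])
    then show ?thesis by simp
  qed
  finally have "?q t - 3 * K\<^sup>2 * (1 + t) powr M \<le> 0"
    using t by (simp add: mult_le_0_iff)
  moreover have "(z3 t)\<^sup>2 \<le> ((1 + t) * z3 t)\<^sup>2"
  proof -
    have "1 * (z3 t)\<^sup>2 \<le> (1 + t)\<^sup>2 * (z3 t)\<^sup>2" using t by (intro mult_right_mono) auto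
    then show ?thesis by (simp add: power_mult_distrib)
  qed
  moreover have "M = 6 * a + 2 * m + 13" by (simp add: M_def c_def)
  ultimately show ?thesis by simp
qed

subsection \<open>The flow with the angle as time\<close>

lemma tame_bounded_linear:
  assumes "bounded_linear f" "\<And>x. x \<in> S \<Longrightarrow> norm (f x) \<le> B"
  shows "tame 0 k (\<lambda>_. f) S"
  unfolding tame_def using assms by (auto intro!: gboundI[where C = B] semitame_linear)

lemma tame_Pair:
  assumes "tame m k y S" "tame m k z S"
  shows "tame m k (\<lambda>t p. (y t p, z t p)) S"
proof -
  have "tame m k (\<lambda>t p. (y t p, 0)) S" "tame m k (\<lambda>t p. (0, z t p)) S"
    using assms by (auto intro!: tame_lin[where f = "\<lambda>x. (x, 0)"]
        tame_lin[where f = "\<lambda>x. (0, x)"] bounded_linear_Pair bounded_linear_ident bounded_linear_zero)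
  from tame_add[OF this] show ?thesis by simp
qed

text \<open>Each order k comes with its own derivative. On an open set the derivative is unique, so
  the Frechet derivative is one choice that serves all orders.\<close>

lemma smooth_derivative_open:
  fixes f :: "'p::euclidean_space \<Rightarrow> 'b::euclidean_space"
  assumes D: "open D" and f: "\<And>k. tame 0 k (\<lambda>_. f) D"
  obtains f' where "\<And>x. x \<in> D \<Longrightarrow> (f has_derivative f' x) (at x within D)"
    "\<And>k b. b \<in> Basis \<Longrightarrow> tame 0 k (\<lambda>_ x. f' x b) D"
proof (rule that[of "\<lambda>x. frechet_derivative f (at x)"])
  have k: "\<exists>f'. (\<forall>x\<in>D. (f has_derivative f' x) (at x within D)) \<and> (\<forall>b\<in>Basis. tame 0 k (\<lambda>_ x. f' x b) D)" for k
  proof -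
    obtain f1 where f1: "\<And>t p. t \<ge> 0 \<Longrightarrow> p \<in> D \<Longrightarrow> (f has_derivative f1 t p) (at p within D)"
      "\<And>b. b \<in> Basis \<Longrightarrow> tame 0 k (\<lambda>t p. f1 t p b) D"
      using semitame_SucE[OF tame_semitame[OF f[of "Suc k"]]] by blast
    show ?thesis
      by (rule exI[of _ "f1 0"]) (use f1(1)[of 0] tame_at[OF f1(2), of _ 0] in auto)
  qed
  have eq: "frechet_derivative f (at x) = f' x" if "(f has_derivative f' x) (at x within D)" "x \<in> D" for f' x
    using that frechet_derivative_at[of f "f' x" x] at_within_open[OF that(2) D] by simp
  show "(f has_derivative frechet_derivative f (at x)) (at x within D)" if "x \<in> D" for x
    using k[of 0] eq[OF _ that] that by metis
  fix k and b :: 'p assume b: "b \<in> Basis"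
  obtain f' where f': "\<forall>x\<in>D. (f has_derivative f' x) (at x within D)" "\<forall>b\<in>Basis. tame 0 k (\<lambda>_ x. f' x b) D"
    using k by blast
  show "tame 0 k (\<lambda>_ x. frechet_derivative f (at x) b) D"
    by (rule tame_cong[OF f'(2)[rule_format, OF b]]) (use f'(1) eq in auto)
qed

text \<open>A source of signs and identities without estimates: the solution keeps the sign of its
  initial value, and vanishes if that does. It gives \<sigma> \<ge> 0, the closed form of \<sigma>,
  and 1 + w > 0.\<close>

lemma homogeneous_linear_solution:
  fixes y m :: "real \<Rightarrow> real"
  assumes "\<And>t. 0 \<le> t \<Longrightarrow> t \<le> T \<Longrightarrow> (y has_real_derivative m t * y t) (at t within {0..T})"
    "continuous_on {0..T} m" "T \<ge> 0"
  shows "y T = y 0 * exp (integral {0..T} m)"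
proof -
  define g where "g t = y t * exp (- integral {0..t} m)" for t
  have d: "(g has_real_derivative 0) (at t within {0..T})" if t: "t \<in> {0..T}" for t
  proof -
    have "((\<lambda>u. integral {0..u} m) has_real_derivative m t) (at t within {0..T})"
      using integral_has_vector_derivative[OF assms(2) t]
      by (simp add: has_real_derivative_iff_has_vector_derivative)
    then show ?thesis unfolding g_def
      using assms(1)[of t] t by (auto intro!: derivative_eq_intros)
  qed
  have "g T = g 0"
    by (rule has_derivative_zero_unique[of "{0..T}" g])
      (use assms(3) d in \<open>auto simp: has_field_derivative_def lambda_zero\<close>)
  then have "y T * exp (- integral {0..T} m) = y 0" by (simp add: g_def)
  then have "y T * exp (- integral {0..T} m) * exp (integral {0..T} m) = y 0 * exp (integral {0..T} m)" by simp
  then show ?thesis by (simp add: mult.assoc flip: exp_add)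
qed

abbreviation ecc :: "real \<times> real \<times> real \<Rightarrow> real" where "ecc \<equiv> fst"
abbreviation ang :: "real \<times> real \<times> real \<Rightarrow> real" where "ang x \<equiv> fst (snd x)"
abbreviation sig :: "real \<times> real \<times> real \<Rightarrow> real" where "sig x \<equiv> snd (snd x)"

text \<open>With \<open>1 / r - 1 = e cos \<phi>\<close>, \<open>v = e sin \<phi>\<close> and \<open>\<sigma> = 3 \<delta> l\<^sup>3\<close> the system reads
  \<open>e' = - 2/3 \<sigma> (e + cos \<phi>)\<close>, \<open>\<phi>' = Om\<close>, \<open>\<sigma>' = - \<sigma>\<^sup>2\<close>; \<open>angle_field\<close> is this field divided by \<open>Om\<close>,
  that is, with the angle as time.\<close>

definition Om :: "real \<times> real \<times> real \<Rightarrow> real" where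
  "Om x = (1 + ecc x * cos (ang x))\<^sup>2 + 2/3 * sig x * sin (ang x) / ecc x"

definition f1 :: "real \<times> real \<times> real \<Rightarrow> real" where
  "f1 x = - (2/3) * (ecc x + cos (ang x)) / Om x"

definition f2 :: "real \<times> real \<times> real \<Rightarrow> real" where
  "f2 x = 1 / Om x"

definition angle_field :: "real \<times> real \<times> real \<Rightarrow> real \<times> real \<times> real" where
  "angle_field x = (sig x * f1 x, 1, - (sig x)\<^sup>2 * f2 x)"

text \<open>In the original variables this is H + 2 \<delta> l^3 r v. The correction cancels the
  order \<sigma> part of the derivative of H, so that this function is conserved up to order
  \<sigma>^2; it starts the averaging and gives the a priori bounds.\<close>

definition first_integral :: "real \<times> real \<times> real \<Rightarrow> real" where
  "first_integral x = (ecc x)\<^sup>2 / 2 + 2/3 * sig x * (ecc x * sin (ang x) / (1 + ecc x * cos (ang x)))"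

text \<open>Negative \<sigma> is included to make the set open, so that derivatives at \<sigma> = 0
  are two-sided and unique. Orbits of interest start with \<sigma> \<ge> 0.\<close>

definition slab :: "real \<Rightarrow> real \<Rightarrow> real \<Rightarrow> (real \<times> real \<times> real) set" where
  "slab a b s = {a<..<b} \<times> UNIV \<times> {-s<..<s}"

definition cslab :: "real \<Rightarrow> real \<Rightarrow> real \<Rightarrow> (real \<times> real \<times> real) set" where
  "cslab a b s = {a..b} \<times> UNIV \<times> {-s..s}"

lemma mem_slab: "x \<in> slab a b s \<longleftrightarrow> a < ecc x \<and> ecc x < b \<and> \<bar>sig x\<bar> < s"
  by (cases x) (auto simp: slab_def)

lemma open_slab [simp]: "open (slab a b s)" and convex_slab [simp]: "convex (slab a b s)"
  by (auto simp: slab_def intro!: open_Times convex_Times)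

lemma norm_triple_le: "norm (x :: real \<times> real \<times> real) \<le> \<bar>ecc x\<bar> + \<bar>ang x\<bar> + \<bar>sig x\<bar>"
  using norm_Pair_le[of "fst x" "snd x"] norm_Pair_le[of "fst (snd x)" "snd (snd x)"] by simp

lemma triple_le_norm:
  "\<bar>ecc x\<bar> \<le> norm x" "\<bar>ang x\<bar> \<le> norm x" "\<bar>sig x\<bar> \<le> norm (x :: real \<times> real \<times> real)"
  using norm_fst_le[of "fst x" "snd x"] norm_snd_le[of "snd x" "fst x"]
    norm_fst_le[of "fst (snd x)" "snd (snd x)"] norm_snd_le[of "snd (snd x)" "fst (snd x)"] by auto

text \<open>The radii keep e away from 0, where the angle degenerates, and from 1, where 1 + e cos
  \<phi> can vanish. The condition on \<open>s1\<close> makes the perturbation of the angular speed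
  at most half of (1 - b)^2, a lower bound for the unperturbed speed: the angle increases strictly
  and can serve as time.\<close>

locale annulus =
  fixes a b s1 :: real
  assumes ab: "0 < a" "a < b" "b < 1" and s1: "0 < s1" "2/3 * s1 / a \<le> (1 - b)\<^sup>2 / 2" "s1 \<le> 1"
begin

abbreviation D where "D \<equiv> slab a b s1"

lemma one_plus_ecos:
  assumes "\<bar>e\<bar> < b" shows "1 - b \<le> 1 + e * cos \<phi>" "1 + e * cos \<phi> \<le> 2"
proof -
  have "\<bar>e * cos \<phi>\<bar> \<le> b * 1" unfolding abs_mult using assms by (intro mult_mono) auto
  then show "1 - b \<le> 1 + e * cos \<phi>" "1 + e * cos \<phi> \<le> 2" using ab by auto
qed

text \<open>The unperturbed speed lies between (1 - b)^2 and 4, the perturbation is at most (1 -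
  b)^2 / 2. The upper bound 4 + 1/2 is rounded to 5, the source of the 5 in the decay of
  \<sigma>.\<close>

lemma Om_bounds:
  assumes "x \<in> D" shows "(1 - b)\<^sup>2 / 2 \<le> Om x" "Om x \<le> 5"
proof -
  have x: "a < ecc x" "ecc x < b" "\<bar>sig x\<bar> < s1" using assms by (auto simp: mem_slab)
  have e: "\<bar>ecc x\<bar> < b" using x ab by auto
  have "(1 - b)\<^sup>2 \<le> (1 + ecc x * cos (ang x))\<^sup>2" "(1 + ecc x * cos (ang x))\<^sup>2 \<le> 2\<^sup>2"
    by (rule power_mono; use one_plus_ecos[OF e, of "ang x"] ab in linarith)+
  moreover have "\<bar>2/3 * sig x * sin (ang x) / ecc x\<bar> \<le> (1 - b)\<^sup>2 / 2"
  proof -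
    have "\<bar>2/3 * sig x * sin (ang x) / ecc x\<bar> = 2/3 * \<bar>sig x\<bar> * \<bar>sin (ang x)\<bar> / ecc x"
      using x ab by (simp add: abs_mult)
    also have "\<dots> \<le> 2/3 * s1 * 1 / a" using x ab by (intro frac_le mult_mono) auto
    finally show ?thesis using s1 by simp
  qed
  moreover have "(1 - b)\<^sup>2 \<le> 1" using ab by (simp add: power_le_one)
  moreover have "(2::real)\<^sup>2 = 4" by simp
  ultimately show "(1 - b)\<^sup>2 / 2 \<le> Om x" "Om x \<le> 5" unfolding Om_def abs_le_iff by linarith+
qed

lemma Om_pos: "x \<in> D \<Longrightarrow> Om x > 0"
  using Om_bounds(1)[of x] ab by (smt (verit) half_gt_zero zero_less_power)

lemma f2_bounds: "x \<in> D \<Longrightarrow> 1/5 \<le> f2 x"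
  unfolding f2_def using Om_bounds(2)[of x] Om_pos[of x] by (intro frac_le) auto

lemma tame_coords:
  "tame 0 k (\<lambda>_. ecc) D" "tame 0 k (\<lambda>_. sig) D"
  "tame 0 k (\<lambda>_ x. sin (ang x)) D" "tame 0 k (\<lambda>_ x. cos (ang x)) D"
proof -
  show "tame 0 k (\<lambda>_. ecc) D"
    by (rule tame_bounded_linear[where B = 1]) (use ab in \<open>auto simp: mem_slab bounded_linear_fst\<close>)
  show "tame 0 k (\<lambda>_. sig) D"
    by (rule tame_bounded_linear[where B = s1])
      (auto simp: mem_slab intro!: bounded_linear_compose[OF bounded_linear_snd bounded_linear_snd])
  have *: "semitame 0 k (\<lambda>_. ang) D"
    by (rule semitame_linear[OF bounded_linear_compose[OF bounded_linear_fst bounded_linear_snd]])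
  show "tame 0 k (\<lambda>_ x. sin (ang x)) D" "tame 0 k (\<lambda>_ x. cos (ang x)) D"
    using tame_sin[OF *] tame_cos[OF *] .
qed

lemma tame_Om: "tame 0 k (\<lambda>_. Om) D"
proof -
  have "tame 0 k (\<lambda>_ x. (1 + ecc x * cos (ang x)) ^ 2 + (2/3 * sig x * sin (ang x)) / ecc x) D"
    by (intro tame_add tame_power0 tame_mult0 tame_const tame_coords tame_divide[where c = a])
      (use ab in \<open>auto simp: mem_slab\<close>)
  then show ?thesis by (rule tame_cong) (simp add: Om_def)
qed

lemma tame_f: "tame 0 k (\<lambda>_. f1) D" "tame 0 k (\<lambda>_. f2) D"
proof -
  have c: "(1 - b)\<^sup>2 / 2 > 0" using ab by simp
  have Om: "\<bar>Om x\<bar> \<ge> (1 - b)\<^sup>2 / 2" if "x \<in> D" for x using Om_bounds(1)[OF that] by linarith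
  have "tame 0 k (\<lambda>_ x. (- (2/3) * (ecc x + cos (ang x))) / Om x) D"
    by (intro tame_divide[OF c] tame_Om tame_mult0 tame_add tame_const tame_coords) (use Om in auto)
  then show "tame 0 k (\<lambda>_. f1) D" by (rule tame_cong) (simp add: f1_def)
  have "tame 0 k (\<lambda>_ x. 1 / Om x) D"
    by (intro tame_divide[OF c] tame_Om tame_const) (use Om in auto)
  then show "tame 0 k (\<lambda>_. f2) D" by (rule tame_cong) (simp add: f2_def)
qed

lemma tame_angle_field: "tame 0 k (\<lambda>_. angle_field) D"
proof -
  have t: "tame 0 k (\<lambda>_ x. sig x * f1 x) D" "tame 0 k (\<lambda>_ x. (- ((sig x) ^ 2)) * f2 x) D"
    by (intro tame_mult0 tame_f tame_coords tame_minus tame_power0)+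
  have "tame 0 k (\<lambda>_ x. (sig x * f1 x, 1 :: real, (- ((sig x) ^ 2)) * f2 x)) D"
    by (intro tame_Pair t tame_const)
  then show ?thesis by (rule tame_cong) (simp add: angle_field_def)
qed

text \<open>Only the prefactor \<sigma> contributes: e times the rate of e plus 2/3 \<sigma> times
  the rate of e sin \<phi> / (1 + e cos \<phi>) vanishes exactly, not just to leading order. Behind
  the cancellation is the definition of \<open>Om\<close>, by which \<sigma> \<open>f1\<close>
  \<open>Om\<close> = - 2/3 \<sigma> (e + cos \<phi>).\<close>

lemma first_integral_derivative:
  assumes x: "x t \<in> D" and d: "(x has_vector_derivative angle_field (x t)) (at t within A)"
  shows "((\<lambda>t. first_integral (x t)) has_real_derivative
    - (2/3) * (sig (x t))\<^sup>2 * (ecc (x t) * sin (ang (x t)) / (1 + ecc (x t) * cos (ang (x t)))) * f2 (x t)) (at t within A)"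
proof -
  have "((\<lambda>t. ecc (x t)) has_vector_derivative ecc (angle_field (x t))) (at t within A)"
    by (rule bounded_linear.has_vector_derivative[OF bounded_linear_fst d])
  then have de: "((\<lambda>t. ecc (x t)) has_real_derivative sig (x t) * f1 (x t)) (at t within A)"
    by (simp add: has_real_derivative_iff_has_vector_derivative angle_field_def)
  have "((\<lambda>t. ang (x t)) has_vector_derivative ang (angle_field (x t))) (at t within A)"
    by (rule bounded_linear.has_vector_derivative[OF bounded_linear_compose[OF bounded_linear_fst bounded_linear_snd] d])
  then have da: "((\<lambda>t. ang (x t)) has_real_derivative 1) (at t within A)"
    by (simp add: has_real_derivative_iff_has_vector_derivative angle_field_def)
  have "((\<lambda>t. sig (x t)) has_vector_derivative sig (angle_field (x t))) (at t within A)"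
    by (rule bounded_linear.has_vector_derivative[OF bounded_linear_compose[OF bounded_linear_snd bounded_linear_snd] d])
  then have ds: "((\<lambda>t. sig (x t)) has_real_derivative - (sig (x t))\<^sup>2 * f2 (x t)) (at t within A)"
    by (simp add: has_real_derivative_iff_has_vector_derivative angle_field_def)
  define e c s \<sigma> where "e = ecc (x t)" "c = cos (ang (x t))" "s = sin (ang (x t))" "\<sigma> = sig (x t)"
  note ecs = e_c_s_\<sigma>_def
  have e: "e > 0" "\<bar>e\<bar> < b" using x ab by (auto simp: ecs mem_slab)
  have q: "1 + e * c > 0" using one_plus_ecos(1)[OF e(2), of "ang (x t)"] ab by (auto simp: ecs)
  have O: "Om (x t) > 0" by (rule Om_pos[OF x])
  have Oeq: "Om (x t) = (1 + e * c)\<^sup>2 + 2/3 * \<sigma> * s / e" by (simp add: Om_def ecs)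
  have cs: "s\<^sup>2 = 1 - c\<^sup>2" by (simp add: ecs sin_squared_eq)
  let ?E = "\<sigma> * f1 (x t)" and ?F = "f2 (x t)"
  have "((\<lambda>t. first_integral (x t)) has_real_derivative
      e * ?E + 2/3 * (- \<sigma>\<^sup>2 * ?F) * (e * s / (1 + e * c))
      + 2/3 * \<sigma> * (((?E * s + e * c) * (1 + e * c) - (e * s) * (?E * c - e * s)) / (1 + e * c)\<^sup>2)) (at t within A)"
    unfolding first_integral_def
    by (rule derivative_eq_intros de da ds refl | use q in \<open>simp add: ecs power2_eq_square field_simps\<close>)+
  moreover have "e * ?E + 2/3 * \<sigma> * (((?E * s + e * c) * (1 + e * c) - (e * s) * (?E * c - e * s)) / (1 + e * c)\<^sup>2) = 0"
  proof -
    have E: "?E = - (2/3) * \<sigma> * (e + c) / Om (x t)" by (simp add: f1_def ecs)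
    have num: "(?E * s + e * c) * (1 + e * c) - (e * s) * (?E * c - e * s) = ?E * s + e * (c + e)"
    proof -
      have "(?E * s + e * c) * (1 + e * c) - (e * s) * (?E * c - e * s) = ?E * s + e * c + e\<^sup>2 * (c\<^sup>2 + s\<^sup>2)"
        by (simp add: power2_eq_square algebra_simps)
      also have "c\<^sup>2 + s\<^sup>2 = 1" by (simp add: cs)
      finally show ?thesis by (simp add: power2_eq_square algebra_simps)
    qed
    have "?E * Om (x t) = - (2/3) * \<sigma> * (e + c)" using O unfolding E by simp
    then have "?E * ((1 + e * c)\<^sup>2 * e + 2/3 * \<sigma> * s) = - (2/3) * \<sigma> * (e + c) * e"
      unfolding Oeq using e by (simp add: field_simps)
    then have "e * ?E * (1 + e * c)\<^sup>2 + 2/3 * \<sigma> * (?E * s + e * (c + e)) = 0"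
      by (simp add: algebra_simps)
    moreover have "x + y * (N / Q) = (x * Q + y * N) / Q" if "Q > 0" for x y N Q :: real
      using that by (simp add: field_simps)
    ultimately show ?thesis unfolding num using q by simp
  qed
  ultimately show ?thesis
    by (elim DERIV_cong) (simp add: ecs algebra_simps)
qed

lemma angle_field_components:
  assumes "(x has_vector_derivative angle_field (x t)) (at t within A)"
  shows "((\<lambda>t. ecc (x t)) has_real_derivative sig (x t) * f1 (x t)) (at t within A)"
    "((\<lambda>t. ang (x t)) has_real_derivative 1) (at t within A)"
    "((\<lambda>t. sig (x t)) has_real_derivative - (sig (x t))\<^sup>2 * f2 (x t)) (at t within A)"
  using bounded_linear.has_vector_derivative[OF bounded_linear_fst assms]
    bounded_linear.has_vector_derivative[OF bounded_linear_compose[OF bounded_linear_fst bounded_linear_snd] assms]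
    bounded_linear.has_vector_derivative[OF bounded_linear_compose[OF bounded_linear_snd bounded_linear_snd] assms]
  by (simp_all add: has_real_derivative_iff_has_vector_derivative angle_field_def)

lemma continuous_on_tame:
  assumes "tame 0 k (\<lambda>_. f) S" shows "continuous_on S f"
  using semitame_Ck_on[OF tame_semitame[OF tame_le[OF assms, of 0]]] by simp

text \<open>The derivative of \<open>first_integral\<close> is at most C \<sigma>^2 f2 in absolute
  value, and \<sigma>^2 f2 is minus the rate of \<sigma>. Hence both \<open>first_integral\<close> +
  C \<sigma> and - \<open>first_integral\<close> + C \<sigma> are nonincreasing, and the total drift
  is at most C \<sigma>(0). This confines e^2 for all time, although \<sigma> alone decays too
  slowly to be integrated.\<close>

lemma confinement:
  assumes T: "T \<ge> 0" and p: "sig (x 0) \<ge> 0"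
    and x: "\<And>t. 0 \<le> t \<Longrightarrow> t \<le> T \<Longrightarrow> x t \<in> D"
    and d: "\<And>t. 0 \<le> t \<Longrightarrow> t \<le> T \<Longrightarrow> (x has_vector_derivative angle_field (x t)) (at t within {0..T})"
  shows "0 \<le> sig (x T)" "sig (x T) \<le> sig (x 0)" "\<bar>(ecc (x T))\<^sup>2 - (ecc (x 0))\<^sup>2\<bar> \<le> 3 * sig (x 0) / (1 - b)"
proof -
  note comp = angle_field_components[OF d]
  have cx: "continuous_on {0..T} x" using d by (intro continuous_on_vector_derivative) auto
  have cf: "continuous_on {0..T} (\<lambda>t. - sig (x t) * f2 (x t))"
    by (intro continuous_intros cx continuous_on_compose2[OF continuous_on_tame[OF tame_f(2)[of 0]] cx]) (use x in auto)
  have "sig (x T) = sig (x 0) * exp (integral {0..T} (\<lambda>t. - sig (x t) * f2 (x t)))"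
    by (rule homogeneous_linear_solution[OF _ cf T])
      (rule DERIV_cong[OF comp(3)]; simp add: power2_eq_square mult_ac)
  then show s0: "0 \<le> sig (x T)" using p by simp
  have f2: "f2 (x t) > 0" if "0 \<le> t" "t \<le> T" for t using f2_bounds[OF x[OF that]] by simp
  show sT: "sig (x T) \<le> sig (x 0)"
    by (rule halfline_nonincreasing[OF T comp(3)]) (auto simp: f2[THEN less_imp_le])
  define w where "w t = ecc (x t) * sin (ang (x t)) / (1 + ecc (x t) * cos (ang (x t)))" for t
  have wb: "\<bar>w t\<bar> \<le> 1 / (1 - b)" if "0 \<le> t" "t \<le> T" for t
  proof -
    have e: "\<bar>ecc (x t)\<bar> < b" using x[OF that] ab by (auto simp: mem_slab)
    have "\<bar>ecc (x t) * sin (ang (x t))\<bar> \<le> 1 * 1" unfolding abs_mult using e ab by (intro mult_mono) auto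
    then show ?thesis unfolding w_def abs_divide using one_plus_ecos(1)[OF e, of "ang (x t)"] ab by (intro frac_le) auto
  qed
  define C where "C = 2/3 * (1 / (1 - b))"
  have C: "C \<ge> 0" using ab by (simp add: C_def)
  have near: "\<bar>first_integral (x t) - (ecc (x t))\<^sup>2 / 2\<bar> \<le> C * \<bar>sig (x t)\<bar>" if "0 \<le> t" "t \<le> T" for t
  proof -
    have eq: "first_integral (x t) - (ecc (x t))\<^sup>2 / 2 = 2/3 * sig (x t) * w t" by (simp add: first_integral_def w_def)
    have "\<bar>first_integral (x t) - (ecc (x t))\<^sup>2 / 2\<bar> = 2/3 * \<bar>w t\<bar> * \<bar>sig (x t)\<bar>" unfolding eq by (simp add: abs_mult)
    also have "\<dots> \<le> C * \<bar>sig (x t)\<bar>" unfolding C_def using wb[OF that] by (intro mult_right_mono mult_left_mono) auto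
    finally show ?thesis .
  qed
  have dP: "((\<lambda>t. first_integral (x t)) has_real_derivative - (2/3) * (sig (x t))\<^sup>2 * w t * f2 (x t)) (at t within {0..T})"
    if "0 \<le> t" "t \<le> T" for t
    unfolding w_def using first_integral_derivative[OF x d, OF that that] .
  have bound: "\<bar>2/3 * (sig (x t))\<^sup>2 * w t * f2 (x t)\<bar> \<le> C * ((sig (x t))\<^sup>2 * f2 (x t))" if "0 \<le> t" "t \<le> T" for t
  proof -
    have "\<bar>2/3 * (sig (x t))\<^sup>2 * w t * f2 (x t)\<bar> = 2/3 * \<bar>w t\<bar> * ((sig (x t))\<^sup>2 * f2 (x t))"
      using f2[OF that] by (simp add: abs_mult)
    also have "\<dots> \<le> C * ((sig (x t))\<^sup>2 * f2 (x t))"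
      unfolding C_def using wb[OF that] f2[OF that] by (intro mult_right_mono mult_left_mono) auto
    finally show ?thesis .
  qed
  have "first_integral (x T) + C * sig (x T) \<le> first_integral (x 0) + C * sig (x 0)"
  proof (rule halfline_nonincreasing[OF T, where A = "{0..T}"])
    fix t assume t: "0 \<le> t" "t \<le> T"
    show "((\<lambda>t. first_integral (x t) + C * sig (x t)) has_real_derivative
      - (2/3) * (sig (x t))\<^sup>2 * w t * f2 (x t) + C * (- (sig (x t))\<^sup>2 * f2 (x t))) (at t within {0..T})"
      by (intro derivative_intros dP comp t DERIV_cmult)
    show "- (2/3) * (sig (x t))\<^sup>2 * w t * f2 (x t) + C * (- (sig (x t))\<^sup>2 * f2 (x t)) \<le> 0"
      using bound[OF t] by (simp add: abs_le_iff)
  qed auto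
  moreover have "- first_integral (x T) + C * sig (x T) \<le> - first_integral (x 0) + C * sig (x 0)"
  proof (rule halfline_nonincreasing[OF T, where A = "{0..T}"])
    fix t assume t: "0 \<le> t" "t \<le> T"
    show "((\<lambda>t. - first_integral (x t) + C * sig (x t)) has_real_derivative
      - (- (2/3) * (sig (x t))\<^sup>2 * w t * f2 (x t)) + C * (- (sig (x t))\<^sup>2 * f2 (x t))) (at t within {0..T})"
      by (intro derivative_intros dP comp t DERIV_cmult)
    show "- (- (2/3) * (sig (x t))\<^sup>2 * w t * f2 (x t)) + C * (- (sig (x t))\<^sup>2 * f2 (x t)) \<le> 0"
      using bound[OF t] by (simp add: abs_le_iff)
  qed auto
  \<comment> \<open>The drift and the correction at the final time cost C \<sigma>(0) together, the
    correction at time 0 another C \<sigma>(0). The factor 8/3 that results for e^2 is rounded up to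
    3.\<close>
  ultimately have "\<bar>(ecc (x T))\<^sup>2 / 2 - (ecc (x 0))\<^sup>2 / 2\<bar> \<le> 2 * (C * sig (x 0))"
    using near[of T] near[of 0] T p s0 by (auto simp: abs_le_iff)
  then have "\<bar>(ecc (x T))\<^sup>2 - (ecc (x 0))\<^sup>2\<bar> \<le> 4 * (C * sig (x 0))" by (auto simp: abs_le_iff)
  also have "\<dots> = 8/3 * (sig (x 0) / (1 - b))" by (simp add: C_def)
  also have "\<dots> \<le> 3 * (sig (x 0) / (1 - b))" using ab p by (intro mult_right_mono) auto
  also have "\<dots> = 3 * sig (x 0) / (1 - b)" by simp
  finally show "\<bar>(ecc (x T))\<^sup>2 - (ecc (x 0))\<^sup>2\<bar> \<le> 3 * sig (x 0) / (1 - b)" .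
qed

end

text \<open>Three nested slabs: initial values in (a1, b1) with \<sigma> < s0, orbits in (a2, b2)
  with |\<sigma>| < s2, the field on (a, b) with |\<sigma>| < s1. By the margins, the drift of e^2
  permitted by \<open>confinement\<close> is smaller than the gaps between the first two, so orbits
  never reach the boundary of the middle slab.\<close>

locale annulus_flow = annulus +
  fixes a2 a1 b1 b2 s2 s0 :: real
  assumes order: "a < a2" "a2 < a1" "a1 < b1" "b1 < b2" "b2 < b" "0 < s0" "s0 < s2" "s2 < s1"
    and margin: "3 * s0 / (1 - b) < a1\<^sup>2 - a2\<^sup>2" "3 * s0 / (1 - b) < b2\<^sup>2 - b1\<^sup>2"
begin

definition S :: "(real \<times> real \<times> real) set" where
  "S = {a1<..<b1} \<times> UNIV \<times> {0..<s0}"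

lemma mem_S: "p \<in> S \<longleftrightarrow> a1 < ecc p \<and> ecc p < b1 \<and> 0 \<le> sig p \<and> sig p < s0"
  by (cases p) (auto simp: S_def)

lemma convex_S: "convex S"
  by (auto simp: S_def intro!: convex_Times)

lemma solution_exists:
  assumes p: "p \<in> S"
  shows "\<exists>x. x 0 = p \<and> (\<forall>t\<ge>0. x t \<in> D \<and> (x has_vector_derivative angle_field (x t)) (at t within {0..}))"
proof -
  have sub: "cslab a2 b2 s2 \<subseteq> D" using order by (auto simp: cslab_def slab_def)
  obtain B where B: "B \<ge> 0" "\<And>t x. t \<ge> 0 \<Longrightarrow> x \<in> D \<Longrightarrow> norm (angle_field x) \<le> B * (1 + t) powr 0"
    using gboundE[OF tame_gbound[OF tame_angle_field[of 0]]] by blast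
  obtain L where L: "L \<ge> 0" "\<And>t x y. t \<ge> 0 \<Longrightarrow> x \<in> D \<Longrightarrow> y \<in> D \<Longrightarrow>
      norm (angle_field x - angle_field y) \<le> L * (1 + t) powr 0 * norm (x - y)"
    using glipE[OF tame_glip[OF tame_angle_field[of 0]]] by blast
  obtain x where x: "x 0 = p" "\<And>t. t \<ge> 0 \<Longrightarrow> x t \<in> slab a2 b2 s2"
    "\<And>t. t \<ge> 0 \<Longrightarrow> (x has_vector_derivative angle_field (x t)) (at t within {0..})"
  proof (rule ode_confined[of "cslab a2 b2 s2" "\<lambda>t. angle_field" L B p "slab a2 b2 s2"])
    show "closed (cslab a2 b2 s2)" "convex (cslab a2 b2 s2)"
      by (auto simp: cslab_def intro!: closed_Times convex_Times)
    show "norm (angle_field x - angle_field y) \<le> L * norm (x - y)"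
      if "x \<in> cslab a2 b2 s2" "y \<in> cslab a2 b2 s2" for x y
      using L(2)[of 0 x y] that sub by auto
    show "norm (angle_field y) \<le> B" if "y \<in> cslab a2 b2 s2" for y
      using B(2)[of 0 y] that sub by auto
    show "p \<in> slab a2 b2 s2" using p order by (auto simp: mem_slab mem_S)
    show "slab a2 b2 s2 \<subseteq> interior (cslab a2 b2 s2)"
      by (rule interior_maximal[OF _ open_slab]) (auto simp: slab_def cslab_def)
  next
    fix T :: real and x
    assume T: "T \<ge> 0" and x0: "x 0 = p"
      and x: "\<And>t. 0 \<le> t \<Longrightarrow> t \<le> T \<Longrightarrow> x t \<in> cslab a2 b2 s2 \<and> (x has_vector_derivative angle_field (x t)) (at t within {0..T})"
    have p': "sig (x 0) \<ge> 0" "sig (x 0) < s0" "a1 < ecc (x 0)" "ecc (x 0) < b1" using p x0 by (auto simp: mem_S)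
    have xD: "x t \<in> D" if "0 \<le> t" "t \<le> T" for t using x that sub by blast
    have c: "0 \<le> sig (x T)" "sig (x T) \<le> sig (x 0)" "\<bar>(ecc (x T))\<^sup>2 - (ecc (x 0))\<^sup>2\<bar> \<le> 3 * sig (x 0) / (1 - b)"
      using confinement[of T x] T p'(1) xD x by auto
    have "3 * sig (x 0) / (1 - b) \<le> 3 * s0 / (1 - b)" using p' ab by (intro divide_right_mono) auto
    then have m: "(ecc (x 0))\<^sup>2 - (ecc (x T))\<^sup>2 < a1\<^sup>2 - a2\<^sup>2" "(ecc (x T))\<^sup>2 - (ecc (x 0))\<^sup>2 < b2\<^sup>2 - b1\<^sup>2"
      using c(3) margin by (auto simp: abs_le_iff)
    have eT: "ecc (x T) > 0" using xD[of T] T ab by (auto simp: mem_slab)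
    have "a1\<^sup>2 \<le> (ecc (x 0))\<^sup>2" "(ecc (x 0))\<^sup>2 \<le> b1\<^sup>2" using p' ab order by (auto intro!: power_mono)
    then have "a2\<^sup>2 < (ecc (x T))\<^sup>2" "(ecc (x T))\<^sup>2 < b2\<^sup>2" using m by auto
    then have "a2 < ecc (x T)" "ecc (x T) < b2"
      using eT ab order by (auto intro: power_less_imp_less_base[of _ 2])
    then show "x T \<in> slab a2 b2 s2" using c(1,2) p' order by (auto simp: mem_slab)
  qed auto
  have "slab a2 b2 s2 \<subseteq> D" using order by (auto simp: mem_slab)
  then show ?thesis using x by blast
qed

section \<open>The flow, the exact decay of \<sigma>, and the growth of derivatives\<close>

definition X :: "real \<Rightarrow> real \<times> real \<times> real \<Rightarrow> real \<times> real \<times> real" where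
  "X t p = (SOME x. x 0 = p \<and> (\<forall>t\<ge>0. x t \<in> D \<and> (x has_vector_derivative angle_field (x t)) (at t within {0..}))) t"

lemma X:
  assumes "p \<in> S"
  shows X_0: "X 0 p = p" and X_D: "\<And>t. t \<ge> 0 \<Longrightarrow> X t p \<in> D"
    and X_deriv: "\<And>t. t \<ge> 0 \<Longrightarrow> ((\<lambda>t. X t p) has_vector_derivative angle_field (X t p)) (at t within {0..})"
proof -
  have "(\<lambda>t. X t p) 0 = p \<and> (\<forall>t\<ge>0. (\<lambda>t. X t p) t \<in> D \<and> ((\<lambda>t. X t p) has_vector_derivative angle_field ((\<lambda>t. X t p) t)) (at t within {0..}))"
    unfolding X_def using someI_ex[OF solution_exists[OF assms]] by simp
  then show "X 0 p = p" "\<And>t. t \<ge> 0 \<Longrightarrow> X t p \<in> D"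
    "\<And>t. t \<ge> 0 \<Longrightarrow> ((\<lambda>t. X t p) has_vector_derivative angle_field (X t p)) (at t within {0..})" by auto
qed

lemma X_components:
  assumes "p \<in> S" "t \<ge> 0"
  shows "((\<lambda>t. ecc (X t p)) has_real_derivative sig (X t p) * f1 (X t p)) (at t within {0..})"
    "((\<lambda>t. ang (X t p)) has_real_derivative 1) (at t within {0..})"
    "((\<lambda>t. sig (X t p)) has_real_derivative - (sig (X t p))\<^sup>2 * f2 (X t p)) (at t within {0..})"
  using angle_field_components[OF X_deriv[OF assms]] by auto

lemma X_cont: "p \<in> S \<Longrightarrow> continuous_on {0..} (\<lambda>t. X t p)"
  by (rule continuous_on_vector_derivative[OF X_deriv]) auto

text \<open>\<open>f2\<close> = 1 / \<open>Om\<close> is the time spent per unit of angle, so this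
  is the original time at which the orbit has turned by the angle t.\<close>

definition \<rho> :: "real \<Rightarrow> real \<times> real \<times> real \<Rightarrow> real" where
  "\<rho> t p = integral {0..t} (\<lambda>s. f2 (X s p))"

lemma f2_cont: "p \<in> S \<Longrightarrow> continuous_on {0..} (\<lambda>s. f2 (X s p))"
  by (intro continuous_on_compose2[OF continuous_on_tame[OF tame_f(2)[of 0]] X_cont]) (auto simp: X_D)

lemma \<rho>_deriv:
  "p \<in> S \<Longrightarrow> t \<ge> 0 \<Longrightarrow> ((\<lambda>t. \<rho> t p) has_real_derivative f2 (X t p)) (at t within {0..})"
  unfolding \<rho>_def has_real_derivative_iff_has_vector_derivative
  by (intro integral_has_vector_derivative_halfline f2_cont)

lemma \<rho>_ge: assumes "p \<in> S" "t \<ge> 0" shows "t / 5 \<le> \<rho> t p"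
proof -
  have "integral {0..t} (\<lambda>s. 1/5) \<le> \<rho> t p" unfolding \<rho>_def
    by (intro integral_le integrable_continuous_real continuous_on_subset[OF f2_cont[OF assms(1)]])
      (use f2_bounds[OF X_D[OF assms(1)]] in auto)
  then show ?thesis using assms(2) by simp
qed

text \<open>\<sigma>' = - \<sigma>^2 f2 is a Riccati equation with solution \<sigma>(0) / (1 +
  \<sigma>(0) \<rho>). The defect of the claimed identity solves a homogeneous linear equation and
  is 0 at time 0.\<close>

lemma X_sig: assumes "p \<in> S" "t \<ge> 0" shows "sig (X t p) * (1 + sig p * \<rho> t p) = sig p"
proof -
  let ?y = "\<lambda>t. sig (X t p) * (1 + sig p * \<rho> t p) - sig p"
  let ?m = "\<lambda>t. - sig (X t p) * f2 (X t p)"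
  have "?y t = ?y 0 * exp (integral {0..t} ?m)"
  proof (rule homogeneous_linear_solution[where y = ?y and m = ?m])
    fix s assume s: "0 \<le> s" "s \<le> t"
    have "(?y has_real_derivative ?m s * ?y s) (at s within {0..})"
      by (rule derivative_eq_intros X_components \<rho>_deriv assms s refl | simp add: power2_eq_square algebra_simps)+
    then show "(?y has_real_derivative ?m s * ?y s) (at s within {0..t})"
      by (rule DERIV_subset) auto
  next
    have "continuous_on {0..} ?m" by (intro continuous_intros X_cont f2_cont assms)
    then show "continuous_on {0..t} ?m" by (rule continuous_on_subset) auto
  qed (use assms in auto)
  moreover have "?y 0 = 0" using X_0[OF assms(1)] by (simp add: \<rho>_def)
  ultimately show ?thesis by simp
qed

lemma X_sig_bounds:
  assumes "p \<in> S" "t \<ge> 0" shows "0 \<le> sig (X t p)" "sig (X t p) \<le> 5 / (1 + t)" "sig (X t p) = sig p / (1 + sig p * \<rho> t p)"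
proof -
  have p: "0 \<le> sig p" "sig p < 1" using assms order s1 by (auto simp: mem_S)
  have r: "t / 5 \<le> \<rho> t p" "\<rho> t p \<ge> 0" using \<rho>_ge[OF assms] assms(2) by auto
  have pos: "1 + sig p * \<rho> t p > 0" using p r by (simp add: add_pos_nonneg)
  show eq: "sig (X t p) = sig p / (1 + sig p * \<rho> t p)" using X_sig[OF assms] pos by (simp add: field_simps)
  show "0 \<le> sig (X t p)" unfolding eq using p pos by simp
  \<comment> \<open>Uniform down to \<sigma> = 0: the bound \<rho> \<ge> t / 5 takes care of t, and
    \<sigma> < 1 of the summand 1.\<close>
  have "sig p * (1 + t) \<le> 5 * (1 + sig p * \<rho> t p)"
    using mult_left_mono[OF r(1) p(1)] p by (simp add: algebra_simps)
  then show "sig (X t p) \<le> 5 / (1 + t)" unfolding eq using pos assms(2) by (simp add: divide_simps mult_ac)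
qed

lemma f_Lipschitz:
  obtains B L where "B \<ge> 0" "L \<ge> 0" "\<And>x. x \<in> D \<Longrightarrow> \<bar>f1 x\<bar> \<le> B" "\<And>x. x \<in> D \<Longrightarrow> \<bar>f2 x\<bar> \<le> B"
    "\<And>x y. x \<in> D \<Longrightarrow> y \<in> D \<Longrightarrow> \<bar>f1 x - f1 y\<bar> \<le> L * norm (x - y)"
    "\<And>x y. x \<in> D \<Longrightarrow> y \<in> D \<Longrightarrow> \<bar>f2 x - f2 y\<bar> \<le> L * norm (x - y)"
proof -
  obtain B1 where B1: "B1 \<ge> 0" "\<And>t x. t \<ge> 0 \<Longrightarrow> x \<in> D \<Longrightarrow> norm (f1 x) \<le> B1 * (1 + t) powr 0"
    using gboundE[OF tame_gbound[OF tame_f(1)[of 0]]] by blast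
  obtain B2 where B2: "B2 \<ge> 0" "\<And>t x. t \<ge> 0 \<Longrightarrow> x \<in> D \<Longrightarrow> norm (f2 x) \<le> B2 * (1 + t) powr 0"
    using gboundE[OF tame_gbound[OF tame_f(2)[of 0]]] by blast
  obtain L1 where L1: "L1 \<ge> 0" "\<And>t x y. t \<ge> 0 \<Longrightarrow> x \<in> D \<Longrightarrow> y \<in> D \<Longrightarrow>
      norm (f1 x - f1 y) \<le> L1 * (1 + t) powr 0 * norm (x - y)"
    using glipE[OF tame_glip[OF tame_f(1)[of 0]]] by blast
  obtain L2 where L2: "L2 \<ge> 0" "\<And>t x y. t \<ge> 0 \<Longrightarrow> x \<in> D \<Longrightarrow> y \<in> D \<Longrightarrow>
      norm (f2 x - f2 y) \<le> L2 * (1 + t) powr 0 * norm (x - y)"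
    using glipE[OF tame_glip[OF tame_f(2)[of 0]]] by blast
  show ?thesis
  proof (rule that[of "B1 + B2" "L1 + L2"])
    show "\<bar>f1 x\<bar> \<le> B1 + B2" "\<bar>f2 x\<bar> \<le> B1 + B2" if "x \<in> D" for x
      using B1(2)[of 0 x] B2(2)[of 0 x] B1(1) B2(1) that by auto
    show "\<bar>f1 x - f1 y\<bar> \<le> (L1 + L2) * norm (x - y)" "\<bar>f2 x - f2 y\<bar> \<le> (L1 + L2) * norm (x - y)"
      if "x \<in> D" "y \<in> D" for x y
      using L1(2)[of 0 x y] L2(2)[of 0 x y] mult_right_mono[of L1 "L1 + L2" "norm (x - y)"]
        mult_right_mono[of L2 "L1 + L2" "norm (x - y)"] L1(1) L2(1) that by auto
  qed (use B1 B2 L1 L2 in auto)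
qed

lemma norm_triple_power2: "(norm (x :: real \<times> real \<times> real))\<^sup>2 = (ecc x)\<^sup>2 + (ang x)\<^sup>2 + (sig x)\<^sup>2"
  by (simp add: norm_prod_def)

lemma norm_triple_growth:
  fixes z :: "real \<times> real \<times> real"
  assumes "(ecc z)\<^sup>2 + (ang z)\<^sup>2 + (sig z)\<^sup>2 \<le> 3 * K\<^sup>2 * (1 + t) powr M" "K \<ge> 0" "t \<ge> 0"
  shows "norm z \<le> 2 * K * (1 + t) powr (M / 2)"
proof (rule power2_le_imp_le)
  have "((1 + t) powr (M / 2))\<^sup>2 = (1 + t) powr M" using assms(3) by (simp add: powr_power)
  then have "(2 * K * (1 + t) powr (M / 2))\<^sup>2 = 4 * K\<^sup>2 * (1 + t) powr M" by (simp add: power_mult_distrib)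
  moreover have "3 * K\<^sup>2 * (1 + t) powr M \<le> 4 * K\<^sup>2 * (1 + t) powr M" by (intro mult_right_mono) auto
  ultimately show "(norm z)\<^sup>2 \<le> (2 * K * (1 + t) powr (M / 2))\<^sup>2"
    using assms(1) unfolding norm_triple_power2 by linarith
qed (use assms in auto)

text \<open>Both the differences of two solutions and the linearised equation have the structure required
  by \<open>weighted_growth\<close>: \<open>\<sigma>\<close> multiplies everything except the influence of \<open>\<sigma>\<close> itself on \<open>e\<close>.\<close>

lemma sigma_weights:
  fixes s s' t g1 g2 h1 h2 z1 z2 z3 :: real
  assumes s: "0 \<le> s" "s \<le> 5 / (1 + t)" and s': "0 \<le> s'" "s' \<le> 5 / (1 + t)" and t: "t \<ge> 0"
    and g: "\<bar>g1\<bar> \<le> L * n" "\<bar>g2\<bar> \<le> L * n" and h: "\<bar>h1\<bar> \<le> B" "\<bar>h2\<bar> \<le> B"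
    and n: "n \<le> \<bar>z1\<bar> + \<bar>z2\<bar> + \<bar>z3\<bar>" and BL: "B \<ge> 0" "L \<ge> 0"
  shows "\<bar>s * g1 + z3 * h1\<bar> \<le> (25 * L + 10 * B) / (1 + t) * (\<bar>z1\<bar> + \<bar>z2\<bar>) + (25 * L + 10 * B) * \<bar>z3\<bar>"
    "\<bar>s\<^sup>2 * g2 + (s + s') * z3 * h2\<bar> \<le> (25 * L + 10 * B) / (1 + t)\<^sup>2 * (\<bar>z1\<bar> + \<bar>z2\<bar>) + (25 * L + 10 * B) / (1 + t) * \<bar>z3\<bar>"
proof -
  define m where "m = \<bar>z1\<bar> + \<bar>z2\<bar>"
  define y where "y = \<bar>z3\<bar>"
  define r where "r = 1 / (1 + t)"
  have r: "0 \<le> r" "r \<le> 1" using t by (simp_all add: r_def)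
  have m: "m \<ge> 0" "y \<ge> 0" "n \<le> m + y" using n by (auto simp: m_def y_def)
  have s5: "s \<le> 5 * r" "s' \<le> 5 * r" using s s' by (auto simp: r_def)
  have "L * n \<le> L * (m + y)" using m BL by (intro mult_left_mono) auto
  then have G: "\<bar>g1\<bar> \<le> L * (m + y)" "\<bar>g2\<bar> \<le> L * (m + y)" using g by linarith+
  have ss: "s + s' \<le> 10 * r" using s5 by linarith
  have "\<bar>s * g1 + z3 * h1\<bar> \<le> s * \<bar>g1\<bar> + y * \<bar>h1\<bar>"
    using abs_triangle_ineq[of "s * g1" "z3 * h1"] s by (simp add: abs_mult y_def)
  also have "\<dots> \<le> (5 * r) * (L * (m + y)) + y * B"
    by (intro add_mono mult_mono s5 G h order_refl) (use r m in auto)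
  also have "\<dots> \<le> (25 * L + 10 * B) * r * m + (25 * L + 10 * B) * y"
  proof -
    have "r * (L * y) \<le> 1 * (L * y)" using r BL m by (intro mult_right_mono) auto
    moreover have "0 \<le> r * (L * m)" "0 \<le> L * y" "0 \<le> B * y" "0 \<le> B * r * m" using r BL m by auto
    ultimately show ?thesis by (simp add: algebra_simps)
  qed
  finally show "\<bar>s * g1 + z3 * h1\<bar> \<le> (25 * L + 10 * B) / (1 + t) * (\<bar>z1\<bar> + \<bar>z2\<bar>) + (25 * L + 10 * B) * \<bar>z3\<bar>"
    by (simp add: r_def m_def y_def)
  have s2: "s\<^sup>2 \<le> (5 * r)\<^sup>2" using s s5 by (intro power_mono) auto
  have "\<bar>s\<^sup>2 * g2 + (s + s') * z3 * h2\<bar> \<le> s\<^sup>2 * \<bar>g2\<bar> + (s + s') * y * \<bar>h2\<bar>"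
    using abs_triangle_ineq[of "s\<^sup>2 * g2" "(s + s') * z3 * h2"] s s' by (simp add: abs_mult y_def)
  also have "\<dots> \<le> (5 * r)\<^sup>2 * (L * (m + y)) + (10 * r) * y * B"
    by (intro add_mono mult_mono s2 ss G h order_refl) (use r m in auto)
  also have "\<dots> \<le> (25 * L + 10 * B) * r\<^sup>2 * m + (25 * L + 10 * B) * r * y"
  proof -
    have "r * (r * (L * y)) \<le> 1 * (r * (L * y))" using r BL m by (intro mult_right_mono) auto
    moreover have "0 \<le> r * (r * (B * m))" using r BL m by auto
    ultimately show ?thesis by (simp add: power2_eq_square algebra_simps)
  qed
  finally show "\<bar>s\<^sup>2 * g2 + (s + s') * z3 * h2\<bar> \<le> (25 * L + 10 * B) / (1 + t)\<^sup>2 * (\<bar>z1\<bar> + \<bar>z2\<bar>) + (25 * L + 10 * B) / (1 + t) * \<bar>z3\<bar>"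
    by (simp add: r_def m_def y_def power_divide)
qed

text \<open>\<open>weighted_growth\<close> for the difference of two orbits at the same angle time,
  with K the initial distance. Both angles advance at unit speed, so the second component of the
  difference is constant.\<close>

lemma glip_X: "\<exists>m\<ge>0. glip m X S"
proof -
  obtain B L where BL: "B \<ge> 0" "L \<ge> 0" "\<And>x. x \<in> D \<Longrightarrow> \<bar>f1 x\<bar> \<le> B" "\<And>x. x \<in> D \<Longrightarrow> \<bar>f2 x\<bar> \<le> B"
    "\<And>x y. x \<in> D \<Longrightarrow> y \<in> D \<Longrightarrow> \<bar>f1 x - f1 y\<bar> \<le> L * norm (x - y)"
    "\<And>x y. x \<in> D \<Longrightarrow> y \<in> D \<Longrightarrow> \<bar>f2 x - f2 y\<bar> \<le> L * norm (x - y)"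
    using f_Lipschitz by blast
  define M where "M = 6 * (25 * L + 10 * B) + 2 * 0 + 13"
  have "glip (M / 2) X S"
  proof (rule glipI[where C = 2])
    fix t :: real and p q assume t: "t \<ge> 0" and p: "p \<in> S" and q: "q \<in> S"
    let ?K = "norm (p - q)"
    have w: "(ecc (X t p) - ecc (X t q))\<^sup>2 + (ang (X t p) - ang (X t q))\<^sup>2 + (sig (X t p) - sig (X t q))\<^sup>2
        \<le> 3 * ?K\<^sup>2 * (1 + t) powr (6 * (25 * L + 10 * B) + 2 * 0 + 13)"
    proof (rule weighted_growth[where ?z1.0 = "\<lambda>t. ecc (X t p) - ecc (X t q)" and ?z2.0 = "\<lambda>t. ang (X t p) - ang (X t q)"
          and ?z3.0 = "\<lambda>t. sig (X t p) - sig (X t q)" and m = 0 and K = ?K,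
          OF DERIV_diff[OF X_components(1)[OF p] X_components(1)[OF q]] DERIV_diff[OF X_components(2)[OF p] X_components(2)[OF q]]
          DERIV_diff[OF X_components(3)[OF p] X_components(3)[OF q]]])
      fix t :: real assume t: "t \<ge> 0"
      let ?x = "X t p" and ?y = "X t q"
      note xy = X_D[OF p t] X_D[OF q t]
      note sg = sigma_weights[OF X_sig_bounds(1,2)[OF p t] X_sig_bounds(1,2)[OF q t] t BL(5,6)[OF xy] BL(3,4)[OF xy(2)]
          norm_triple_le[of "?x - ?y"] BL(1,2)]
      have "sig ?x * f1 ?x - sig ?y * f1 ?y = sig ?x * (f1 ?x - f1 ?y) + sig (?x - ?y) * f1 ?y"
        by (simp add: algebra_simps)
      then have "\<bar>sig ?x * f1 ?x - sig ?y * f1 ?y\<bar> \<le> (25 * L + 10 * B) / (1 + t) * (\<bar>ecc (?x - ?y)\<bar> + \<bar>ang (?x - ?y)\<bar>) + (25 * L + 10 * B) * \<bar>sig (?x - ?y)\<bar>"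
        using sg(1) by simp
      then show "\<bar>sig ?x * f1 ?x - sig ?y * f1 ?y\<bar> \<le> (25 * L + 10 * B) / (1 + t) * (\<bar>ecc ?x - ecc ?y\<bar> + \<bar>ang ?x - ang ?y\<bar>)
          + (25 * L + 10 * B) * \<bar>sig ?x - sig ?y\<bar> + ?K * (1 + t) powr 0"
        by (simp add: add_increasing2)
      have "- (sig ?x)\<^sup>2 * f2 ?x - - (sig ?y)\<^sup>2 * f2 ?y = - ((sig ?x)\<^sup>2 * (f2 ?x - f2 ?y) + (sig ?x + sig ?y) * sig (?x - ?y) * f2 ?y)"
        by (simp add: algebra_simps power2_eq_square)
      then have "\<bar>- (sig ?x)\<^sup>2 * f2 ?x - - (sig ?y)\<^sup>2 * f2 ?y\<bar> \<le> (25 * L + 10 * B) / (1 + t)\<^sup>2 * (\<bar>ecc (?x - ?y)\<bar> + \<bar>ang (?x - ?y)\<bar>)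
          + (25 * L + 10 * B) / (1 + t) * \<bar>sig (?x - ?y)\<bar>"
        using sg(2) by (simp only: abs_minus_cancel)
      then show "\<bar>- (sig ?x)\<^sup>2 * f2 ?x - - (sig ?y)\<^sup>2 * f2 ?y\<bar> \<le> (25 * L + 10 * B) / (1 + t)\<^sup>2 * (\<bar>ecc ?x - ecc ?y\<bar> + \<bar>ang ?x - ang ?y\<bar>)
          + (25 * L + 10 * B) / (1 + t) * \<bar>sig ?x - sig ?y\<bar> + ?K * (1 + t) powr 0"
        by (simp add: add_increasing2)
    qed (use BL t triple_le_norm[of "p - q"] X_0[OF p] X_0[OF q] in auto)
    have w': "(ecc (X t p - X t q))\<^sup>2 + (ang (X t p - X t q))\<^sup>2 + (sig (X t p - X t q))\<^sup>2 \<le> 3 * ?K\<^sup>2 * (1 + t) powr M"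
      using w by (simp add: M_def)
    show "norm (X t p - X t q) \<le> 2 * (1 + t) powr (M / 2) * norm (p - q)"
      using norm_triple_growth[OF w' _ t] by (simp add: mult_ac)
  qed (rule X_cont)
  moreover have "M / 2 \<ge> 0" using BL by (simp add: M_def)
  ultimately show ?thesis by blast
qed

lemma semitame_X: "\<exists>m\<ge>0. semitame m k X S"
proof -
  obtain f1' where f1': "\<And>x. x \<in> D \<Longrightarrow> (f1 has_derivative f1' x) (at x within D)"
    "\<And>k c. c \<in> Basis \<Longrightarrow> tame 0 k (\<lambda>_ x. f1' x c) D"
    using smooth_derivative_open[OF open_slab tame_f(1)] by blast
  obtain f2' where f2': "\<And>x. x \<in> D \<Longrightarrow> (f2 has_derivative f2' x) (at x within D)"
    "\<And>k c. c \<in> Basis \<Longrightarrow> tame 0 k (\<lambda>_ x. f2' x c) D"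
    using smooth_derivative_open[OF open_slab tame_f(2)] by blast
  \<comment> \<open>The derivative of \<sigma>^2 is written with \<open>sig x + sig x\<close> to
    match the factor s + s' that arises from a difference of squares; \<open>sigma_weights\<close>
    then covers the linearised equation as well.\<close>
  define G' where "G' x y = (sig x * f1' x y + sig y * f1 x, 0 :: real, - ((sig x)\<^sup>2 * f2' x y + (sig x + sig x) * sig y * f2 x))" for x y
  have dsig: "(sig has_derivative sig) (at x within D)" for x
    by (rule bounded_linear_imp_has_derivative[OF bounded_linear_compose[OF bounded_linear_snd bounded_linear_snd]])
  have dG: "(angle_field has_derivative G' x) (at x within D)" if x: "x \<in> D" for x
  proof -
    have "((\<lambda>x. (sig x * f1 x, 1, - (sig x)\<^sup>2 * f2 x)) has_derivative G' x) (at x within D)"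
      unfolding G'_def
      by (rule derivative_eq_intros dsig f1'(1)[OF x] f2'(1)[OF x] refl | simp add: fun_eq_iff algebra_simps power2_eq_square)+
    then show ?thesis by (simp add: angle_field_def[abs_def])
  qed
  have tG: "tame 0 k (\<lambda>_ x. G' x c) D" if c: "c \<in> Basis" for k c
    unfolding G'_def
    by (intro tame_Pair tame_add tame_minus tame_mult0 tame_power0 tame_coords tame_f f1'(2)[OF c] f2'(2)[OF c] tame_const)
  obtain B L0 where B: "B \<ge> 0" and "L0 \<ge> 0" and B2: "\<And>x. x \<in> D \<Longrightarrow> \<bar>f1 x\<bar> \<le> B" "\<And>x. x \<in> D \<Longrightarrow> \<bar>f2 x\<bar> \<le> B"
    and "\<And>x y. x \<in> D \<Longrightarrow> y \<in> D \<Longrightarrow> \<bar>f1 x - f1 y\<bar> \<le> L0 * norm (x - y)"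
    and "\<And>x y. x \<in> D \<Longrightarrow> y \<in> D \<Longrightarrow> \<bar>f2 x - f2 y\<bar> \<le> L0 * norm (x - y)"
    using f_Lipschitz by blast
  have "\<exists>L\<ge>0. \<forall>x\<in>D. \<forall>y. norm (f' x y) \<le> L * norm y"
    if f': "\<And>x. x \<in> D \<Longrightarrow> (f has_derivative f' x) (at x within D)" "\<And>c. c \<in> Basis \<Longrightarrow> tame 0 0 (\<lambda>_ x. f' x c) D"
    for f :: "real \<times> real \<times> real \<Rightarrow> real" and f'
  proof -
    obtain C where C: "C \<ge> 0" "\<And>t x c. t \<ge> 0 \<Longrightarrow> x \<in> D \<Longrightarrow> c \<in> Basis \<Longrightarrow> norm (f' x c) \<le> C * (1 + t) powr 0"
      using gbound_Basis_const[of 0 "\<lambda>_. f'" D, OF tame_gbound[OF f'(2)]] by blast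
    have "norm (f' x y) \<le> real DIM(real \<times> real \<times> real) * C * norm y" if "x \<in> D" for x y
      by (rule linear_Basis_bound[OF has_derivative_linear[OF f'(1)[OF that]]]) (use C(2)[of 0 x] that in auto)
    then show ?thesis using C(1) by (intro exI[of _ "real DIM(real \<times> real \<times> real) * C"]) auto
  qed
  from this[of f1 f1', OF f1'(1) f1'(2)[of _ 0]] this[of f2 f2', OF f2'(1) f2'(2)[of _ 0]]
  obtain L1 L2 where L12: "L1 \<ge> 0" "L2 \<ge> 0" "\<And>x y. x \<in> D \<Longrightarrow> norm (f1' x y) \<le> L1 * norm y"
    "\<And>x y. x \<in> D \<Longrightarrow> norm (f2' x y) \<le> L2 * norm y" by metis
  define L where "L = L1 + L2"
  have L: "L \<ge> 0" "\<And>x y. x \<in> D \<Longrightarrow> \<bar>f1' x y\<bar> \<le> L * norm y" "\<And>x y. x \<in> D \<Longrightarrow> \<bar>f2' x y\<bar> \<le> L * norm y"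
  proof -
    show "L \<ge> 0" using L12 by (simp add: L_def)
    show "\<bar>f1' x y\<bar> \<le> L * norm y" "\<bar>f2' x y\<bar> \<le> L * norm y" if "x \<in> D" for x y
      using L12(3,4)[OF that, of y] L12(1,2) mult_right_mono[of L1 L "norm y"] mult_right_mono[of L2 L "norm y"]
      by (auto simp: L_def)
  qed
  \<comment> \<open>The linearised equation with a source has the structure of a difference of two
    orbits, now with the same \<sigma> in both places. The exponent depends on m and on bounds for
    \<open>f1\<close>, \<open>f2\<close> and their derivatives over D, hence not on p.\<close>
  have propag: "propagates (\<lambda>t p. G' (X t p)) S"
    unfolding propagates_def
  proof (intro allI impI)
    fix m :: real assume m: "m \<ge> 0"
    define M where "M = 6 * (25 * L + 10 * B) + 2 * m + 13"
    have "propagation_bound (\<lambda>t p. G' (X t p)) S m 2 (M / 2)"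
      unfolding propagation_bound_def
    proof (intro ballI allI impI)
      fix p K z r and t :: real
      assume p: "p \<in> S" and K: "0 \<le> K" and z: "\<forall>t\<ge>0. (z has_vector_derivative (G' (X t p) (z t) + r t)) (at t within {0..})"
        and r: "\<forall>t\<ge>0. norm (r t) \<le> K * (1 + t) powr m" and z0: "norm (z 0) \<le> K" and t: "0 \<le> t"
      have dz: "((\<lambda>t. ecc (z t)) has_real_derivative (sig (X t p) * f1' (X t p) (z t) + sig (z t) * f1 (X t p)) + ecc (r t)) (at t within {0..})"
        "((\<lambda>t. ang (z t)) has_real_derivative ang (r t)) (at t within {0..})"
        "((\<lambda>t. sig (z t)) has_real_derivative - ((sig (X t p))\<^sup>2 * f2' (X t p) (z t) + (sig (X t p) + sig (X t p)) * sig (z t) * f2 (X t p)) + sig (r t)) (at t within {0..})"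
        if "t \<ge> 0" for t
        using bounded_linear.has_vector_derivative[OF bounded_linear_fst z[rule_format, OF that]]
          bounded_linear.has_vector_derivative[OF bounded_linear_compose[OF bounded_linear_fst bounded_linear_snd] z[rule_format, OF that]]
          bounded_linear.has_vector_derivative[OF bounded_linear_compose[OF bounded_linear_snd bounded_linear_snd] z[rule_format, OF that]]
        by (simp_all add: has_real_derivative_iff_has_vector_derivative G'_def)
      have w: "(ecc (z t))\<^sup>2 + (ang (z t))\<^sup>2 + (sig (z t))\<^sup>2 \<le> 3 * K\<^sup>2 * (1 + t) powr (6 * (25 * L + 10 * B) + 2 * m + 13)"
      proof (rule weighted_growth[where ?z1.0 = "\<lambda>t. ecc (z t)" and ?z2.0 = "\<lambda>t. ang (z t)"
            and ?z3.0 = "\<lambda>t. sig (z t)" and m = m and K = K, OF dz])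
        fix t :: real assume t: "t \<ge> 0"
        note x = X_D[OF p t]
        note rt = triple_le_norm[of "r t"] r[rule_format, OF t]
        note sg = sigma_weights[OF X_sig_bounds(1,2)[OF p t] X_sig_bounds(1,2)[OF p t] t L(2,3)[OF x] B2[OF x]
            norm_triple_le[of "z t"] B L(1)]
        show "\<bar>sig (X t p) * f1' (X t p) (z t) + sig (z t) * f1 (X t p) + ecc (r t)\<bar>
            \<le> (25 * L + 10 * B) / (1 + t) * (\<bar>ecc (z t)\<bar> + \<bar>ang (z t)\<bar>) + (25 * L + 10 * B) * \<bar>sig (z t)\<bar> + K * (1 + t) powr m"
          using sg(1) rt abs_triangle_ineq[of "sig (X t p) * f1' (X t p) (z t) + sig (z t) * f1 (X t p)" "ecc (r t)"] by linarith
        show "\<bar>ang (r t)\<bar> \<le> K * (1 + t) powr m" using rt by linarith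
        show "\<bar>- ((sig (X t p))\<^sup>2 * f2' (X t p) (z t) + (sig (X t p) + sig (X t p)) * sig (z t) * f2 (X t p)) + sig (r t)\<bar>
            \<le> (25 * L + 10 * B) / (1 + t)\<^sup>2 * (\<bar>ecc (z t)\<bar> + \<bar>ang (z t)\<bar>) + (25 * L + 10 * B) / (1 + t) * \<bar>sig (z t)\<bar> + K * (1 + t) powr m"
          using sg(2) rt by linarith
      qed (use B L m K t z0 triple_le_norm[of "z 0"] in auto)
      show "norm (z t) \<le> 2 * K * (1 + t) powr (M / 2)"
        using norm_triple_growth[OF w K t] by (simp add: M_def)
    qed
    moreover have "M / 2 \<ge> 0" using B L m by (simp add: M_def)
    ultimately show "\<exists>C\<ge>0. \<exists>m'\<ge>0. propagation_bound (\<lambda>t p. G' (X t p)) S m C m'"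
      by (intro exI[of _ 2] conjI exI[of _ "M / 2"]) auto
  qed
  obtain mX where mX: "mX \<ge> 0" "glip mX X S" using glip_X by blast
  show ?thesis
    by (rule tame_flow[OF convex_S convex_slab X_D X_deriv X_0 dG tG propag mX(2,1)]) auto
qed

end

subsection \<open>Normal form by averaging\<close>

lemma semitame_time:
  fixes c :: "real \<Rightarrow> 'b::euclidean_space" and S :: "'p::euclidean_space set"
  assumes "continuous_on {0..} c"
  shows "semitame 0 k (\<lambda>t p. c t) S"
proof (cases k)
  case 0 then show ?thesis using assms by (auto intro!: glipI[where C = 0])
next
  case (Suc j)
  show ?thesis unfolding Suc
    by (rule semitame_SucI[where y' = "\<lambda>t p h. 0"]) (use assms in \<open>auto intro!: glipI[where C = 0] tame_zero\<close>)
qed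

lemma antiderivative_exists:
  fixes f :: "real \<Rightarrow> real"
  assumes "continuous_on UNIV f"
  obtains F where "\<And>x. (F has_real_derivative f x) (at x)"
proof
  fix x :: real
  let ?F = "\<lambda>u. LBINT y=ereal 0..ereal u. f y"
  have "(?F has_vector_derivative f x) (at x within {- \<bar>x\<bar> - 1..\<bar>x\<bar> + 1})"
    by (rule interval_integral_FTC2[where a = "- \<bar>x\<bar> - 1" and b = "\<bar>x\<bar> + 1"])
      (use assms continuous_on_subset in auto)
  moreover have "at x within {- \<bar>x\<bar> - 1..\<bar>x\<bar> + 1} = at x"
    by (rule at_within_interior) (auto simp: interior_atLeastAtMost_real)
  ultimately show "(?F has_real_derivative f x) (at x)"
    by (simp add: has_real_derivative_iff_has_vector_derivative)
qed

text \<open>The average is over a shift s added to the angle: e and \<phi> enter only through a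
  translate of g, which suits differentiation under the integral. For periodic g the value is
  independent of \<phi>; both arguments are kept so that the mean stays in the class of g.\<close>

definition mean :: "(real \<times> real \<Rightarrow> real) \<Rightarrow> real \<times> real \<Rightarrow> real" where
  "mean g q = integral {0..2 * pi} (\<lambda>s. g (fst q, snd q + s)) / (2 * pi)"

text \<open>Convolution with a sawtooth: for \<open>2\<pi>\<close>-periodic \<open>g\<close> this is a periodic primitive of
  \<open>g - mean g\<close>, and it visibly commutes with all derivatives.\<close>

definition primit :: "(real \<times> real \<Rightarrow> real) \<Rightarrow> real \<times> real \<Rightarrow> real" where
  "primit g q = integral {0..2 * pi} (\<lambda>s. s * g (fst q, snd q + s)) / (2 * pi)"

text \<open>Integration by parts in s. With G a primitive of g and J a primitive of G, both averages
  are expressed by boundary values, and their angular derivatives can be read off directly.\<close>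

lemma mean_primit_antiderivative:
  assumes c: "continuous_on UNIV (\<lambda>s. g (e, s))"
  obtains G J where "\<And>s. (G has_real_derivative g (e, s)) (at s)" "\<And>s. (J has_real_derivative G s) (at s)"
    "\<And>\<phi>. mean g (e, \<phi>) = (G (\<phi> + 2 * pi) - G \<phi>) / (2 * pi)"
    "\<And>\<phi>. primit g (e, \<phi>) = G (\<phi> + 2 * pi) - (J (\<phi> + 2 * pi) - J \<phi>) / (2 * pi)"
proof -
  obtain G where G: "\<And>s. (G has_real_derivative g (e, s)) (at s)" using antiderivative_exists[OF c] by blast
  then have "continuous_on UNIV G" by (meson DERIV_continuous_on has_field_derivative_at_within)
  then obtain J where J: "\<And>s. (J has_real_derivative G s) (at s)" using antiderivative_exists by blast
  have sh: "((\<lambda>s. F (\<phi> + s)) has_real_derivative F' (\<phi> + s)) (at s within I)"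
    if "\<And>s. (F has_real_derivative F' s) (at s)" for F F' :: "real \<Rightarrow> real" and \<phi> s I
  proof -
    have "((\<lambda>s. F (s + \<phi>)) has_real_derivative F' (s + \<phi>)) (at s)"
      using that[of "s + \<phi>"] by (simp add: DERIV_shift)
    then show ?thesis by (simp add: add.commute has_field_derivative_at_within)
  qed
  have "mean g (e, \<phi>) = (G (\<phi> + 2 * pi) - G \<phi>) / (2 * pi)" for \<phi>
  proof -
    have "((\<lambda>s. g (e, \<phi> + s)) has_integral (G (\<phi> + 2 * pi) - G (\<phi> + 0))) {0..2 * pi}"
      using sh[OF G] by (intro fundamental_theorem_of_calculus)
        (auto simp: has_real_derivative_iff_has_vector_derivative[symmetric])
    then show ?thesis by (simp add: mean_def integral_unique)
  qed
  moreover have "primit g (e, \<phi>) = G (\<phi> + 2 * pi) - (J (\<phi> + 2 * pi) - J \<phi>) / (2 * pi)" for \<phi>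
  proof -
    have "((\<lambda>s. s * G (\<phi> + s) - J (\<phi> + s)) has_real_derivative (s * g (e, \<phi> + s))) (at s within {0..2 * pi})" for s
      by (rule derivative_eq_intros sh[OF G] sh[OF J] refl | simp)+
    then have "((\<lambda>s. s * g (e, \<phi> + s)) has_integral
        ((2 * pi) * G (\<phi> + 2 * pi) - J (\<phi> + 2 * pi) - (0 * G (\<phi> + 0) - J (\<phi> + 0)))) {0..2 * pi}"
      by (intro fundamental_theorem_of_calculus)
        (auto simp: has_real_derivative_iff_has_vector_derivative[symmetric])
    then have "primit g (e, \<phi>) = ((2 * pi) * G (\<phi> + 2 * pi) - J (\<phi> + 2 * pi) + J \<phi>) / (2 * pi)"
      by (simp add: primit_def integral_unique)
    then show ?thesis by (simp add: diff_divide_distrib add_divide_distrib)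
  qed
  ultimately show ?thesis using that G J by blast
qed

lemma mean_const:
  assumes c: "continuous_on UNIV (\<lambda>s. g (e, s))" and per: "\<And>\<phi>. g (e, \<phi> + 2 * pi) = g (e, \<phi>)"
  shows "mean g (e, \<phi>) = mean g (e, 0)"
proof -
  obtain G J where G: "\<And>s. (G has_real_derivative g (e, s)) (at s)"
    and m: "\<And>\<phi>. mean g (e, \<phi>) = (G (\<phi> + 2 * pi) - G \<phi>) / (2 * pi)"
    using mean_primit_antiderivative[OF c] by metis
  have "((\<lambda>\<phi>. G (\<phi> + 2 * pi) - G \<phi>) has_real_derivative (g (e, s + 2 * pi) - g (e, s))) (at s)" for s
    using DERIV_diff[OF DERIV_shift[THEN iffD1, OF G] G] .
  then have "((\<lambda>\<phi>. G (\<phi> + 2 * pi) - G \<phi>) has_derivative (\<lambda>h. 0)) (at s within UNIV)" for s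
    by (simp add: per has_field_derivative_def lambda_zero)
  from has_derivative_zero_unique[OF convex_UNIV this, of \<phi> 0] show ?thesis by (simp add: m)
qed

lemma primit_derivative:
  assumes c: "continuous_on UNIV (\<lambda>s. g (e, s))" and per: "\<And>\<phi>. g (e, \<phi> + 2 * pi) = g (e, \<phi>)"
  shows "((\<lambda>\<phi>. primit g (e, \<phi>)) has_real_derivative (g (e, \<phi>) - mean g (e, \<phi>))) (at \<phi>)"
proof -
  obtain G J where G: "\<And>s. (G has_real_derivative g (e, s)) (at s)" "\<And>s. (J has_real_derivative G s) (at s)"
    and m: "\<And>\<phi>. mean g (e, \<phi>) = (G (\<phi> + 2 * pi) - G \<phi>) / (2 * pi)"
    and V: "\<And>\<phi>. primit g (e, \<phi>) = G (\<phi> + 2 * pi) - (J (\<phi> + 2 * pi) - J \<phi>) / (2 * pi)"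
    using mean_primit_antiderivative[OF c] by metis
  have "((\<lambda>\<phi>. G (\<phi> + 2 * pi) - (J (\<phi> + 2 * pi) - J \<phi>) / (2 * pi)) has_real_derivative
      (g (e, \<phi> + 2 * pi) - (G (\<phi> + 2 * pi) - G \<phi>) / (2 * pi))) (at \<phi>)"
    by (intro DERIV_diff DERIV_cdivide DERIV_shift[THEN iffD1] G)
  then show ?thesis unfolding V m by (simp add: per)
qed

section \<open>Smooth periodic functions of eccentricity and angle\<close>

context annulus
begin

definition A :: "(real \<times> real) set" where "A = {a<..<b} \<times> UNIV"

lemma mem_A: "q \<in> A \<longleftrightarrow> a < fst q \<and> fst q < b" by (cases q) (auto simp: A_def)

lemma open_A: "open A" and convex_A: "convex A"
  by (auto simp: A_def intro!: open_Times convex_Times)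

text \<open>All orders at once, because every averaging step differentiates in e and would use up a
  finite order. The bounds hold on the whole annulus, so that products, quotients and integrals stay
  in the class.\<close>

definition sp :: "(real \<times> real \<Rightarrow> real) \<Rightarrow> bool" where
  "sp g \<longleftrightarrow> (\<forall>k. tame 0 k (\<lambda>_. g) A) \<and> (\<forall>e \<phi>. a < e \<longrightarrow> e < b \<longrightarrow> g (e, \<phi> + 2 * pi) = g (e, \<phi>))"

lemma sp_tame: "sp g \<Longrightarrow> tame 0 k (\<lambda>_. g) A"
  and sp_per: "sp g \<Longrightarrow> a < e \<Longrightarrow> e < b \<Longrightarrow> g (e, \<phi> + 2 * pi) = g (e, \<phi>)"
  by (auto simp: sp_def)

lemma spI: "(\<And>k. tame 0 k (\<lambda>_. g) A) \<Longrightarrow> (\<And>e \<phi>. a < e \<Longrightarrow> e < b \<Longrightarrow> g (e, \<phi> + 2 * pi) = g (e, \<phi>)) \<Longrightarrow> sp g"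
  by (auto simp: sp_def)

lemma sp_cont: assumes "sp g" "a < e" "e < b" shows "continuous_on UNIV (\<lambda>s. g (e, s))"
  by (rule continuous_on_compose2[OF continuous_on_tame[OF sp_tame[OF assms(1), of 0]]])
    (use assms in \<open>auto simp: mem_A intro!: continuous_intros\<close>)

lemma tame_shift: assumes "tame 0 k (\<lambda>_. g) A" shows "tame 0 k (\<lambda>s q. g (fst q, snd q + s)) A"
proof (rule tame_comp0[OF assms])
  show "semitame 0 k (\<lambda>s q. (fst q, snd q + s)) A"
    by (intro semitame_Pair semitame_add semitame_linear bounded_linear_fst bounded_linear_snd semitame_time) auto
qed (auto simp: mem_A)

lemma sp_mean: assumes "sp g" shows "sp (mean g)"
proof (rule spI)
  fix k
  have "tame 0 k (\<lambda>_ q. integral {0..2 * pi} (\<lambda>s. g (fst q, snd q + s))) A"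
  proof (rule tame_integral[OF _ _ _ convex_A tame_shift[OF sp_tame[OF assms]]])
    show "(\<lambda>t :: real. (1 + t) powr 0) integrable_on {0..2 * pi}"
      by (intro integrable_continuous_real continuous_intros) auto
  qed auto
  from tame_scale[OF this, of "1 / (2 * pi)"] show "tame 0 k (\<lambda>_. mean g) A"
    by (rule tame_cong) (simp add: mean_def)
next
  fix e \<phi> assume e: "a < e" "e < b"
  show "mean g (e, \<phi> + 2 * pi) = mean g (e, \<phi>)"
    using mean_const[OF sp_cont[OF assms e] sp_per[OF assms e], of "\<phi> + 2 * pi"]
      mean_const[OF sp_cont[OF assms e] sp_per[OF assms e], of \<phi>] by simp
qed

lemma sp_primit: assumes "sp g" shows "sp (primit g)"
proof (rule spI)
  fix k
  \<comment> \<open>The shift s plays the role of time, and the factor s accounts for the exponent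
    1.\<close>
  have "tame 1 k (\<lambda>s q. s * g (fst q, snd q + s)) A"
  proof -
    have "tame 1 k (\<lambda>s q. s :: real) A"
      by (rule tame_time[where C = 1 and c = "\<lambda>s. s"]) (auto intro!: continuous_intros)
    from tame_mult[OF this tame_shift[OF sp_tame[OF assms]]] show ?thesis by simp
  qed
  then have "tame 0 k (\<lambda>_ q. integral {0..2 * pi} (\<lambda>s. s * g (fst q, snd q + s))) A"
  proof (rule tame_integral[rotated 4])
    show "(\<lambda>t :: real. (1 + t) powr 1) integrable_on {0..2 * pi}"
      by (intro integrable_continuous_real continuous_intros) auto
  qed (auto simp: convex_A)
  from tame_scale[OF this, of "1 / (2 * pi)"] show "tame 0 k (\<lambda>_. primit g) A"
    by (rule tame_cong) (simp add: primit_def)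
next
  fix e \<phi> assume e: "a < e" "e < b"
  have "g (e, \<phi> + 2 * pi + s) = g (e, \<phi> + s)" for s
    using sp_per[OF assms e, of "\<phi> + s"] by (simp add: add_ac)
  then show "primit g (e, \<phi> + 2 * pi) = primit g (e, \<phi>)" by (simp add: primit_def)
qed

lemma sp_add: "sp g \<Longrightarrow> sp h \<Longrightarrow> sp (\<lambda>q. g q + h q)"
  and sp_mult: "sp g \<Longrightarrow> sp h \<Longrightarrow> sp (\<lambda>q. g q * h q)"
  and sp_minus: "sp g \<Longrightarrow> sp (\<lambda>q. - g q)"
  and sp_diff: "sp g \<Longrightarrow> sp h \<Longrightarrow> sp (\<lambda>q. g q - h q)"
  and sp_const: "sp (\<lambda>q. c)"
  by (auto simp: sp_def intro: tame_add tame_mult0 tame_minus tame_diff tame_const)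

lemma sp_divide:
  assumes "sp g" "sp h" "c > 0" "\<And>q. q \<in> A \<Longrightarrow> \<bar>h q\<bar> \<ge> c"
  shows "sp (\<lambda>q. g q / h q)"
  using assms by (auto simp: sp_def intro!: tame_divide[where c = c])

lemma sp_coords: "sp fst" "sp (\<lambda>q. sin (snd q))" "sp (\<lambda>q. cos (snd q))"
proof -
  show "sp fst"
    by (rule spI, rule tame_bounded_linear[where B = 1]) (use ab in \<open>auto simp: mem_A bounded_linear_fst\<close>)
  have *: "semitame 0 k (\<lambda>_. snd :: real \<times> real \<Rightarrow> real) A" for k
    by (rule semitame_linear[OF bounded_linear_snd])
  show "sp (\<lambda>q. sin (snd q))" "sp (\<lambda>q. cos (snd q))"
    using tame_sin[OF *] tame_cos[OF *] by (auto intro!: spI)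
qed

text \<open>That a mean does not depend on \<phi> is known only as an equation. Evaluation at \<phi>
  = 0 produces a function that is radial by construction, with a derivative that has no angular
  component.\<close>

lemma sp_radial:
  assumes "sp g"
  obtains gd where "sp (\<lambda>q. gd (fst q))"
    "\<And>q. q \<in> A \<Longrightarrow> ((\<lambda>q. g (fst q, 0)) has_derivative (\<lambda>h. fst h * gd (fst q))) (at q within A)"
    "sp (\<lambda>q. g (fst q, 0))"
proof -
  have lin: "semitame 0 k (\<lambda>_ q. (fst q, 0 :: real)) A" for k
    by (intro semitame_linear bounded_linear_Pair bounded_linear_fst bounded_linear_zero)
  have rad: "sp (\<lambda>q. f (fst q, 0))" if "\<And>k. tame 0 k (\<lambda>_. f) A" for f
  proof (rule spI)
    show "tame 0 k (\<lambda>_ q. f (fst q, 0)) A" for k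
      by (rule tame_comp0[OF that _ lin]) (auto simp: mem_A)
  qed simp
  obtain g' where g': "\<And>x. x \<in> A \<Longrightarrow> (g has_derivative g' x) (at x within A)"
    "\<And>k b. b \<in> Basis \<Longrightarrow> tame 0 k (\<lambda>_ x. g' x b) A"
    using smooth_derivative_open[OF open_A sp_tame[OF assms]] by blast
  show ?thesis
  proof (rule that[of "\<lambda>e. g' (e, 0) (1, 0)"])
    show "sp (\<lambda>q. g' (fst q, 0) (1, 0))"
      by (rule rad[of "\<lambda>x. g' x (1, 0)"]) (intro g'(2), simp add: Basis_prod_def)
    show "sp (\<lambda>q. g (fst q, 0))" by (rule rad[OF sp_tame[OF assms]])
    fix q assume q: "q \<in> A"
    then have q0: "(fst q, 0) \<in> A" by (simp add: mem_A)
    have "((\<lambda>q. g (fst q, 0)) has_derivative (\<lambda>h. g' (fst q, 0) (fst h, 0))) (at q within A)"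
      by (rule has_derivative_in_compose2[where t = A and g = g and f = "\<lambda>q. (fst q, 0)"])
        (use g' q in \<open>auto simp: mem_A intro!: derivative_eq_intros\<close>)
    moreover have "g' (fst q, 0) (fst h, 0) = fst h * g' (fst q, 0) (1, 0)" for h :: "real \<times> real"
      using linear_scale[OF has_derivative_linear[OF g'(1)[OF q0]], of "fst h" "(1, 0)"] by simp
    ultimately show "((\<lambda>q. g (fst q, 0)) has_derivative (\<lambda>h. fst h * g' (fst q, 0) (1, 0))) (at q within A)"
      by simp
  qed
qed

text \<open>The e-derivative inherits periodicity by uniqueness of derivatives. The angular
  derivative is returned with its one-variable characterisation, by which it can later be identified
  with a known function.\<close>

lemma sp_partials:
  assumes "sp g"
  obtains ge gp where "sp ge" "\<And>q. q \<in> A \<Longrightarrow> (g has_derivative (\<lambda>h. fst h * ge q + snd h * gp q)) (at q within A)"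
    "\<And>q. q \<in> A \<Longrightarrow> ((\<lambda>s. g (fst q, s)) has_real_derivative gp q) (at (snd q))"
proof -
  obtain g' where g': "\<And>x. x \<in> A \<Longrightarrow> (g has_derivative g' x) (at x within A)"
    "\<And>k b. b \<in> Basis \<Longrightarrow> tame 0 k (\<lambda>_ x. g' x b) A"
    using smooth_derivative_open[OF open_A sp_tame[OF assms]] by blast
  have g'at: "(g has_derivative g' x) (at x)" if "x \<in> A" for x
    using g'(1)[OF that] at_within_open[OF that open_A] by simp
  have lin: "g' q h = fst h * g' q (1, 0) + snd h * g' q (0, 1)" if "q \<in> A" for q h
  proof -
    have l: "linear (g' q)" using g'(1)[OF that] by (rule has_derivative_linear)
    have "h = fst h *\<^sub>R (1, 0) + snd h *\<^sub>R (0, 1)" by (cases h) simp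
    then have "g' q h = g' q (fst h *\<^sub>R (1, 0) + snd h *\<^sub>R (0, 1))" by simp
    then show ?thesis by (simp only: linear_add[OF l] linear_scale[OF l] real_scaleR_def)
  qed
  show ?thesis
  proof (rule that[of "\<lambda>q. g' q (1, 0)" "\<lambda>q. g' q (0, 1)"])
    show "(g has_derivative (\<lambda>h. fst h * g' q (1, 0) + snd h * g' q (0, 1))) (at q within A)" if "q \<in> A" for q
      by (rule has_derivative_eq_rhs[OF g'(1)[OF that]], rule ext, rule lin[OF that])
    have part1: "((\<lambda>s. g (s, \<phi>)) has_real_derivative g' (e, \<phi>) (1, 0)) (at e)" if "a < e" "e < b" for e \<phi>
    proof -
      have "((\<lambda>s. g (s, \<phi>)) has_derivative (\<lambda>h. g' (e, \<phi>) (h, 0))) (at e)"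
        by (rule has_derivative_compose[of "\<lambda>s. (s, \<phi>)" "\<lambda>h. (h, 0)" e UNIV g "g' (e, \<phi>)"])
          (use g'at that in \<open>auto simp: mem_A intro!: derivative_eq_intros\<close>)
      moreover have "(\<lambda>h. g' (e, \<phi>) (h, 0)) = (*) (g' (e, \<phi>) (1, 0))"
      proof
        fix h
        have "(e, \<phi>) \<in> A" using that by (simp add: mem_A)
        from lin[OF this, of "(h, 0)"] show "g' (e, \<phi>) (h, 0) = g' (e, \<phi>) (1, 0) * h" by simp
      qed
      ultimately show ?thesis by (simp add: has_field_derivative_def)
    qed
    show "((\<lambda>s. g (fst q, s)) has_real_derivative g' q (0, 1)) (at (snd q))" if "q \<in> A" for q
    proof -
      have "((\<lambda>s. g (fst q, s)) has_derivative (\<lambda>h. g' q (0, h))) (at (snd q))"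
        by (rule has_derivative_compose[of "\<lambda>s. (fst q, s)" "\<lambda>h. (0, h)" "snd q" UNIV g "g' q"])
          (use g'at that in \<open>auto simp: mem_A intro!: derivative_eq_intros\<close>)
      moreover have "(\<lambda>h. g' q (0, h)) = (*) (g' q (0, 1))"
      proof
        fix h
        from lin[OF that, of "(0, h)"] show "g' q (0, h) = g' q (0, 1) * h" by simp
      qed
      ultimately show ?thesis by (simp add: has_field_derivative_def)
    qed
    show "sp (\<lambda>q. g' q (1, 0))"
    proof (rule spI)
      show "tame 0 k (\<lambda>_ q. g' q (1, 0)) A" for k by (rule g'(2)) (simp add: Basis_prod_def)
      fix e \<phi> assume e: "a < e" "e < b"
      have "((\<lambda>s. g (s, \<phi>)) has_real_derivative g' (e, \<phi> + 2 * pi) (1, 0)) (at e)"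
        by (rule has_field_derivative_transform_within_open[OF part1[OF e, of "\<phi> + 2 * pi"], of "{a<..<b}"])
          (use e sp_per[OF assms] in auto)
      from DERIV_unique[OF this part1[OF e]] show "g' (e, \<phi> + 2 * pi) (1, 0) = g' (e, \<phi>) (1, 0)" .
    qed
  qed
qed

text \<open>The value of 1 / \<open>Om\<close> at \<sigma> = 0: the weight that converts time
  averages along an unperturbed orbit into averages over the angle.\<close>

definition W :: "real \<times> real \<Rightarrow> real" where "W q = 1 / (1 + fst q * cos (snd q))\<^sup>2"

lemma W_base: assumes "q \<in> A" shows "1 - b \<le> 1 + fst q * cos (snd q)" "1 + fst q * cos (snd q) \<le> 2"
  using one_plus_ecos[of "fst q" "snd q"] assms ab by (auto simp: mem_A)

lemma sp_base: "sp (\<lambda>q. 1 + fst q * cos (snd q))"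
  by (intro sp_add sp_mult sp_const sp_coords)

lemma sp_W: "sp W"
proof -
  have b: "1 - b > 0" using ab by simp
  have "sp (\<lambda>q. 1 / ((1 + fst q * cos (snd q)) * (1 + fst q * cos (snd q))))"
  proof (rule sp_divide[where c = "(1 - b) * (1 - b)"])
    show "(1 - b) * (1 - b) \<le> \<bar>(1 + fst q * cos (snd q)) * (1 + fst q * cos (snd q))\<bar>" if "q \<in> A" for q
      using W_base[OF that] b by (simp add: abs_mult mult_mono)
  qed (use b in \<open>auto intro: sp_mult sp_base sp_const\<close>)
  then show ?thesis by (simp add: W_def[abs_def] power2_eq_square)
qed

lemma mean_lin:
  assumes g: "sp g" "sp h" and e: "a < e" "e < b"
  shows "mean (\<lambda>q. g q - h q) (e, \<phi>) = mean g (e, \<phi>) - mean h (e, \<phi>)"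
proof -
  have i: "(\<lambda>s. f (e, \<phi> + s)) integrable_on {0..2 * pi}" if "sp f" for f
    by (intro integrable_continuous_real continuous_on_compose2[OF sp_cont[OF that e]] continuous_intros) auto
  show ?thesis by (simp add: mean_def integral_diff[OF i i] g diff_divide_distrib)
qed

lemma mean_radial: "mean (\<lambda>q. c (fst q) * g q) (e, \<phi>) = c e * mean g (e, \<phi>)"
  by (simp add: mean_def)

lemma mean_W_pos: assumes e: "a < e" "e < b" shows "mean W (e, 0) \<ge> 1/4"
proof -
  have "integral {0..2 * pi} (\<lambda>s. 1/4) \<le> integral {0..2 * pi} (\<lambda>s. W (e, 0 + s))"
  proof (rule integral_le)
    show "(\<lambda>s. W (e, 0 + s)) integrable_on {0..2 * pi}"
      by (intro integrable_continuous_real continuous_on_compose2[OF sp_cont[OF sp_W e]] continuous_intros) auto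
    fix s :: real
    have A: "(e, 0 + s) \<in> A" using e by (simp add: mem_A)
    have "(1 + e * cos s)\<^sup>2 \<le> 2\<^sup>2" using W_base[OF A] ab by (intro power_mono) auto
    moreover have "(1 + e * cos s)\<^sup>2 > 0" using W_base(1)[OF A] ab by simp
    ultimately show "1/4 \<le> W (e, 0 + s)" by (simp add: W_def divide_simps)
  qed auto
  then show ?thesis by (simp add: mean_def divide_simps)
qed

lemma mean_ecos_W: assumes e: "a < e" "e < b" shows "mean (\<lambda>q. (fst q + cos (snd q)) * W q) (e, \<phi>) = 0"
proof -
  have nz: "1 + e * cos s \<noteq> 0" for s using W_base(1)[of "(e, s)"] e ab by (auto simp: mem_A)
  \<comment> \<open>(e + cos \<phi>) W is the angular derivative of the periodic function sin \<phi>
    / (1 + e cos \<phi>). To leading order in \<sigma>, therefore, e has no mean drift.\<close>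
  have "((\<lambda>s. (e + cos (\<phi> + s)) * W (e, \<phi> + s)) has_integral
      (sin (\<phi> + 2 * pi) / (1 + e * cos (\<phi> + 2 * pi)) - sin (\<phi> + 0) / (1 + e * cos (\<phi> + 0)))) {0..2 * pi}"
  proof (rule fundamental_theorem_of_calculus)
    fix s :: real
    have "((\<lambda>s. sin (\<phi> + s) / (1 + e * cos (\<phi> + s))) has_real_derivative
        (cos (\<phi> + s) * (1 + e * cos (\<phi> + s)) - sin (\<phi> + s) * (e * (- sin (\<phi> + s)))) / ((1 + e * cos (\<phi> + s)) * (1 + e * cos (\<phi> + s)))) (at s within {0..2 * pi})"
      using nz by (auto intro!: derivative_eq_intros)
    moreover have "cos (\<phi> + s) * (1 + e * cos (\<phi> + s)) - sin (\<phi> + s) * (e * (- sin (\<phi> + s))) = e + cos (\<phi> + s)"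
    proof -
      have "c * (1 + e * c) - n * (e * (- n)) = c + e * (c\<^sup>2 + n\<^sup>2)" for c n :: real
        by (simp add: power2_eq_square algebra_simps)
      from this[of "cos (\<phi> + s)" "sin (\<phi> + s)"] show ?thesis
        by (simp add: sin_cos_squared_add2)
    qed
    ultimately show "((\<lambda>s. sin (\<phi> + s) / (1 + e * cos (\<phi> + s))) has_vector_derivative (e + cos (\<phi> + s)) * W (e, \<phi> + s)) (at s within {0..2 * pi})"
      by (simp add: has_real_derivative_iff_has_vector_derivative W_def power2_eq_square)
  qed simp
  then show ?thesis by (simp add: mean_def integral_unique)
qed

text \<open>One step of averaging: the angular mean of \<open>g\<close> is removed by the radial term \<open>C\<close>, the rest by
  the angular primitive \<open>u\<close>. Removing the mean is possible because \<open>\<sigma> ^ (j - 1) C\<close> has derivative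
  \<open>- (j - 1) \<sigma> ^ j C\<close> and because \<open>e + cos \<phi>\<close>, the rate of change of \<open>e\<close>, has mean zero.\<close>

lemma homological_step:
  assumes g: "sp g" and j: "j \<ge> 2"
  shows "\<exists>C Ce u ue up. (sp C \<and> sp u \<and> sp ue \<and> sp up) \<and> (\<forall>q\<in>A.
    (C has_derivative (\<lambda>h. fst h * Ce q)) (at q within A) \<and>
    (u has_derivative (\<lambda>h. fst h * ue q + snd h * up q)) (at q within A) \<and>
    g q - (real j - 1) * C q - 2/3 * (fst q + cos (snd q)) * Ce q + up q * (1 + fst q * cos (snd q))\<^sup>2 = 0)"
proof -
  let ?gW = "\<lambda>q. g q * W q"
  have gW: "sp ?gW" by (intro sp_mult g sp_W)
  define j1 where "j1 = real j - 1"
  have j1: "j1 > 0" using j by (simp add: j1_def)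
  let ?c = "\<lambda>q. mean ?gW q / mean W q / j1"
  have mW: "mean W q \<ge> 1/4" if "q \<in> A" for q
    using mean_const[OF sp_cont[OF sp_W] sp_per[OF sp_W], of "fst q" "snd q"] mean_W_pos[of "fst q"] that
    by (simp add: mem_A)
  have c: "sp ?c"
  proof (rule sp_divide[where c = j1])
    show "sp (\<lambda>q. mean ?gW q / mean W q)"
    proof (rule sp_divide[where c = "1/4"])
      show "1/4 \<le> \<bar>mean W q\<bar>" if "q \<in> A" for q using mW[OF that] by linarith
    qed (auto intro: sp_mean gW sp_W)
  qed (use j1 sp_const in auto)
  obtain cd where cd: "sp (\<lambda>q. cd (fst q))"
    "\<And>q. q \<in> A \<Longrightarrow> ((\<lambda>q. ?c (fst q, 0)) has_derivative (\<lambda>h. fst h * cd (fst q))) (at q within A)"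
    "sp (\<lambda>q. ?c (fst q, 0))"
    using sp_radial[OF c] by blast
  define C where "C q = ?c (fst q, 0)" for q :: "real \<times> real"
  have C: "sp C" "\<And>q. q \<in> A \<Longrightarrow> (C has_derivative (\<lambda>h. fst h * cd (fst q))) (at q within A)"
    using cd by (simp_all add: C_def[abs_def])
  \<comment> \<open>Multiplied by W, the required equation reads \<open>up\<close> = - f, which has
    a periodic solution u once f has mean zero. The term with \<open>cd\<close> has mean zero by
    \<open>mean_ecos_W\<close>, and the means of the other two cancel by the choice of C.\<close>
  define f where "f q = ?gW q - (j1 * C q) * W q - (2/3 * cd (fst q)) * ((fst q + cos (snd q)) * W q)" for q
  have spf: "sp f" unfolding f_def
    by (intro sp_diff sp_mult gW sp_const C(1) sp_W cd(1) sp_add sp_coords)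
  have mf: "mean f (e, \<phi>) = 0" if e: "a < e" "e < b" for e \<phi>
  proof -
    have 1: "sp (\<lambda>q. (j1 * C q) * W q)" "sp (\<lambda>q. (2/3 * cd (fst q)) * ((fst q + cos (snd q)) * W q))"
      "sp (\<lambda>q. ?gW q - (j1 * C q) * W q)"
      by (intro sp_diff sp_mult gW sp_const C(1) sp_W cd(1) sp_add sp_coords)+
    have "mean f (e, \<phi>) = mean ?gW (e, \<phi>) - mean (\<lambda>q. (j1 * C q) * W q) (e, \<phi>)
        - mean (\<lambda>q. (2/3 * cd (fst q)) * ((fst q + cos (snd q)) * W q)) (e, \<phi>)"
      unfolding f_def using mean_lin[OF 1(3,2) e] mean_lin[OF gW 1(1) e] by simp
    also have "mean (\<lambda>q. (2/3 * cd (fst q)) * ((fst q + cos (snd q)) * W q)) (e, \<phi>) = 0"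
      unfolding mean_radial[of "\<lambda>e. 2/3 * cd e" "\<lambda>q. (fst q + cos (snd q)) * W q"] mean_ecos_W[OF e] by simp
    also have "mean (\<lambda>q. (j1 * C q) * W q) (e, \<phi>) = j1 * C (e, \<phi>) * mean W (e, \<phi>)"
      using mean_radial[of "\<lambda>e. j1 * ?c (e, 0)" W e \<phi>] by (simp add: C_def)
    also have "\<dots> = mean ?gW (e, 0)"
      using mW[of "(e, 0)"] mean_const[OF sp_cont[OF sp_W e] sp_per[OF sp_W e], of \<phi>] e j1
      by (simp add: C_def mem_A)
    finally show ?thesis using mean_const[OF sp_cont[OF gW e] sp_per[OF gW e], of \<phi>] by simp
  qed
  obtain ve vp where v: "sp ve" "\<And>q. q \<in> A \<Longrightarrow> (primit f has_derivative (\<lambda>h. fst h * ve q + snd h * vp q)) (at q within A)"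
    "\<And>q. q \<in> A \<Longrightarrow> ((\<lambda>s. primit f (fst q, s)) has_real_derivative vp q) (at (snd q))"
    using sp_partials[OF sp_primit[OF spf]] by blast
  have vp: "vp q = f q" if "q \<in> A" for q
  proof -
    have e: "a < fst q" "fst q < b" using that by (auto simp: mem_A)
    have "((\<lambda>s. primit f (fst q, s)) has_real_derivative (f (fst q, snd q) - mean f (fst q, snd q))) (at (snd q))"
      by (rule primit_derivative[OF sp_cont[OF spf e] sp_per[OF spf e]])
    from DERIV_unique[OF v(3)[OF that] this] show ?thesis using mf[OF e, of "snd q"] by simp
  qed
  show ?thesis
  proof (rule exI[of _ C], rule exI[of _ "\<lambda>q. cd (fst q)"], rule exI[of _ "\<lambda>q. - primit f q"],
      rule exI[of _ "\<lambda>q. - ve q"], rule exI[of _ "\<lambda>q. - f q"], intro conjI ballI)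
    fix q assume q: "q \<in> A"
    show "((\<lambda>q. - primit f q) has_derivative (\<lambda>h. fst h * - ve q + snd h * - f q)) (at q within A)"
      using has_derivative_minus[OF v(2)[OF q]] vp[OF q] by (simp add: algebra_simps)
    have nz: "(1 + fst q * cos (snd q))\<^sup>2 \<noteq> 0" using W_base(1)[OF q] ab by simp
    have "f q * (1 + fst q * cos (snd q))\<^sup>2 = g q - j1 * C q - 2/3 * cd (fst q) * (fst q + cos (snd q))"
      unfolding f_def W_def using nz by (simp add: field_simps)
    then show "g q - (real j - 1) * C q - 2/3 * (fst q + cos (snd q)) * cd (fst q) + - f q * (1 + fst q * cos (snd q))\<^sup>2 = 0"
      by (simp add: j1_def mult_ac)
  qed (use C sp_minus[OF sp_primit[OF spf]] sp_minus[OF v(1)] sp_minus[OF spf] in auto)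
qed

section \<open>Iterated normal forms\<close>

lemma tame_lift: assumes "sp g" shows "tame 0 k (\<lambda>_ x. g (ecc x, ang x)) D"
proof (rule tame_comp0[OF sp_tame[OF assms], where x = "\<lambda>_ x. (ecc x, ang x)"])
  show "semitame 0 k (\<lambda>_ x :: real \<times> real \<times> real. (ecc x, ang x)) D"
    by (intro semitame_linear bounded_linear_Pair bounded_linear_fst bounded_linear_compose[OF bounded_linear_fst bounded_linear_snd])
qed (auto simp: mem_A mem_slab)

text \<open>The derivative along the field is \<sigma>^j times a function of e and \<phi> alone,
  times \<open>f2\<close>. Keeping \<sigma> out of g allows each step to be solved on the annulus A;
  the factor \<open>f2\<close> is common to all terms because the field is the original one divided
  by \<open>Om\<close>.\<close>

definition normal_form :: "nat \<Rightarrow> (real \<times> real \<times> real \<Rightarrow> real) \<Rightarrow> (real \<times> real \<Rightarrow> real) \<Rightarrow> bool" where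
  "normal_form j P g \<longleftrightarrow> (\<forall>k. tame 0 k (\<lambda>_. P) D) \<and> sp g \<and>
     (\<forall>x\<in>D. \<exists>P'. (P has_derivative P') (at x within D) \<and>
        P' (angle_field x) = sig x ^ j * g (ecc x, ang x) * f2 x) \<and>
     (\<forall>x\<in>D. sig x = 0 \<longrightarrow> P x = (ecc x)\<^sup>2 / 2) \<and>
     (\<forall>e \<phi> s. (e, \<phi>, s) \<in> D \<longrightarrow> P (e, \<phi> + 2 * pi, s) = P (e, \<phi>, s))"

lemma normal_form_2: "\<exists>P g. normal_form 2 P g"
proof -
  define g where "g q = - (2/3) * (fst q * sin (snd q) / (1 + fst q * cos (snd q)))" for q :: "real \<times> real"
  have b: "1 - b > 0" using ab by simp
  have w: "sp (\<lambda>q. fst q * sin (snd q) / (1 + fst q * cos (snd q)))"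
    by (intro sp_divide[OF _ _ b] sp_mult sp_coords sp_base) (use W_base(1) b in force)
  have g: "sp g" unfolding g_def by (intro sp_mult sp_const w)
  have tP: "tame 0 k (\<lambda>_. first_integral) D" for k
  proof -
    have "tame 0 k (\<lambda>_ x. (1/2) * (ecc x) ^ 2 + 2/3 * sig x * (ecc x * sin (ang x) / (1 + ecc x * cos (ang x)))) D"
      using tame_lift[OF w, of k] by (intro tame_add tame_mult0 tame_const tame_power0 tame_coords) simp
    then show ?thesis by (rule tame_cong) (simp add: first_integral_def)
  qed
  obtain P' where P': "\<And>x. x \<in> D \<Longrightarrow> (first_integral has_derivative P' x) (at x within D)"
    "\<And>k c. c \<in> Basis \<Longrightarrow> tame 0 k (\<lambda>_ x. P' x c) D"
    using smooth_derivative_open[OF open_slab tP] by blast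
  have "P' x (angle_field x) = (sig x)\<^sup>2 * g (ecc x, ang x) * f2 x" if x: "x \<in> D" for x
  proof -
    \<comment> \<open>\<open>first_integral_derivative\<close> uses the velocity of a curve at one
      instant only, so the straight line through x in the direction of the field can stand in for
      the orbit.\<close>
    define c where "c t = x + t *\<^sub>R angle_field x" for t :: real
    have d: "(c has_vector_derivative angle_field (c 0)) (at 0)"
      unfolding c_def by (auto intro!: derivative_eq_intros)
    have c0: "c 0 = x" by (simp add: c_def)
    have 1: "((\<lambda>t. first_integral (c t)) has_real_derivative (sig x)\<^sup>2 * g (ecc x, ang x) * f2 x) (at 0)"
      using first_integral_derivative[of c 0 UNIV] d x c0 by (simp add: g_def mult_ac)
    have "(first_integral has_derivative P' x) (at (c 0))"
      using P'(1)[OF x] at_within_open[OF x open_slab] c0 by simp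
    then have "((\<lambda>t. first_integral (c t)) has_derivative (\<lambda>h. P' x (h *\<^sub>R angle_field x))) (at 0)"
      using has_derivative_compose[of c "\<lambda>h. h *\<^sub>R angle_field x" 0 UNIV first_integral "P' x"] d c0
      by (simp add: has_vector_derivative_def)
    moreover have "(\<lambda>h. P' x (h *\<^sub>R angle_field x)) = (*) (P' x (angle_field x))"
      using linear_scale[OF has_derivative_linear[OF P'(1)[OF x]]] by (auto simp: fun_eq_iff)
    ultimately have "((\<lambda>t. first_integral (c t)) has_real_derivative P' x (angle_field x)) (at 0)"
      by (simp add: has_field_derivative_def)
    from DERIV_unique[OF this 1] show ?thesis .
  qed
  then have "\<forall>x\<in>D. \<exists>P'. (first_integral has_derivative P') (at x within D) \<and>
      P' (angle_field x) = (sig x)\<^sup>2 * g (ecc x, ang x) * f2 x"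
    using P'(1) by blast
  then have "normal_form 2 first_integral g"
    unfolding normal_form_def using tP g by (simp add: first_integral_def)
  then show ?thesis by blast
qed

text \<open>C carries \<sigma>^(j - 1), because it depends on e only and both e and \<sigma> move
  slowly, which adds one power; u carries \<sigma>^j, because the angle moves at unit speed. The
  terms of order \<sigma>^j then cancel by \<open>homological_step\<close>.\<close>

lemma normal_form_Suc:
  assumes nf: "normal_form j P g" and j: "j \<ge> 2"
  shows "\<exists>P g. normal_form (Suc j) P g"
proof -
  have g: "sp g" using nf by (simp add: normal_form_def)
  obtain C Ce u ue up where C: "sp C \<and> sp u \<and> sp ue \<and> sp up"
    and step: "\<forall>q\<in>A. (C has_derivative (\<lambda>h. fst h * Ce q)) (at q within A) \<and>
    (u has_derivative (\<lambda>h. fst h * ue q + snd h * up q)) (at q within A) \<and>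
    g q - (real j - 1) * C q - 2/3 * (fst q + cos (snd q)) * Ce q + up q * (1 + fst q * cos (snd q))\<^sup>2 = 0"
    using homological_step[OF g j] by blast
  from C have C: "sp C" "sp u" "sp ue" "sp up" by auto
  from step have dC: "\<And>q. q \<in> A \<Longrightarrow> (C has_derivative (\<lambda>h. fst h * Ce q)) (at q within A)"
    and du: "\<And>q. q \<in> A \<Longrightarrow> (u has_derivative (\<lambda>h. fst h * ue q + snd h * up q)) (at q within A)"
    and hom: "\<And>q. q \<in> A \<Longrightarrow> g q - (real j - 1) * C q - 2/3 * (fst q + cos (snd q)) * Ce q + up q * (1 + fst q * cos (snd q))\<^sup>2 = 0"
    by auto
  define Q where "Q x = P x + (sig x ^ (j - 1) * C (ecc x, ang x) + sig x ^ j * u (ecc x, ang x))" for x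
  \<comment> \<open>The terms of order \<sigma>^(j + 1) that are left: from differentiating
    \<sigma>^j, from the motion of e inside u, and from the \<sigma>-part of \<open>Om\<close> in
    the angular derivative of u.\<close>
  define g' where "g' q = - real j * u q - 2/3 * (fst q + cos (snd q)) * ue q + 2/3 * (sin (snd q) / fst q) * up q" for q
  have "sp (\<lambda>q. sin (snd q) / fst q)"
    by (rule sp_divide[OF sp_coords(2,1), of a]) (use ab in \<open>auto simp: mem_A\<close>)
  then have g': "sp g'" unfolding g'_def by (intro sp_add sp_diff sp_mult sp_const C sp_coords)
  have tQ: "tame 0 k (\<lambda>_. Q) D" for k
    unfolding Q_def using nf tame_lift[OF C(1)] tame_lift[OF C(2)]
    by (intro tame_add tame_mult0 tame_power0 tame_coords) (auto simp: normal_form_def)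
  have main: "\<exists>Q'. (Q has_derivative Q') (at x within D) \<and> Q' (angle_field x) = sig x ^ Suc j * g' (ecc x, ang x) * f2 x"
    if x: "x \<in> D" for x
  proof -
    obtain P' where P': "(P has_derivative P') (at x within D)" "P' (angle_field x) = sig x ^ j * g (ecc x, ang x) * f2 x"
      using nf x unfolding normal_form_def by blast
    let ?q = "(ecc x, ang x)"
    have q: "?q \<in> A" using x by (auto simp: mem_A mem_slab)
    have lin: "((\<lambda>x. (ecc x, ang x)) has_derivative (\<lambda>h. (ecc h, ang h))) (at x within D)"
      by (intro bounded_linear_imp_has_derivative bounded_linear_Pair bounded_linear_fst bounded_linear_compose[OF bounded_linear_fst bounded_linear_snd])
    have dsig: "(sig has_derivative sig) (at x within D)"
      by (rule bounded_linear_imp_has_derivative[OF bounded_linear_compose[OF bounded_linear_snd bounded_linear_snd]])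
    have im: "(\<lambda>x. (ecc x, ang x)) ` D \<subseteq> A" by (auto simp: mem_A mem_slab)
    have C': "((\<lambda>x. C (ecc x, ang x)) has_derivative (\<lambda>h. ecc h * Ce ?q)) (at x within D)"
      using has_derivative_in_compose2[OF dC im x lin] by simp
    have u': "((\<lambda>x. u (ecc x, ang x)) has_derivative (\<lambda>h. ecc h * ue ?q + ang h * up ?q)) (at x within D)"
      using has_derivative_in_compose2[OF du im x lin] by simp
    let ?R = "\<lambda>h. sig x ^ (j - 1) * (ecc h * Ce ?q) + real (j - 1) * sig h * sig x ^ (j - 1 - 1) * C ?q
        + (sig x ^ j * (ecc h * ue ?q + ang h * up ?q) + real j * sig h * sig x ^ (j - 1) * u ?q)"
    have "(Q has_derivative (\<lambda>h. P' h + ?R h)) (at x within D)"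
      unfolding Q_def
      by (intro has_derivative_add P' has_derivative_mult C' u' has_derivative_eq_rhs[OF has_derivative_power[OF dsig]])
        (auto simp: fun_eq_iff mult_ac)
    moreover have "P' (angle_field x) + ?R (angle_field x) = sig x ^ Suc j * g' ?q * f2 x"
    proof -
      define s e c n F where "s = sig x" "e = ecc x" "c = cos (ang x)" "n = sin (ang x)" "F = f2 x"
      note d = s_e_c_n_F_def
      obtain i where i: "j = Suc (Suc i)" using j by (metis Suc_diff_Suc numeral_2_eq_2 Suc_le_D le_add_diff_inverse plus_nat.simps add_Suc)
      have F1: "f1 x = - (2/3) * (e + c) * F" by (simp add: f1_def f2_def d)
      \<comment> \<open>The angular speed 1 is written as \<open>Om\<close> times \<open>f2\<close>;
        every term then has the factor \<open>f2\<close>, and powers of \<sigma> can be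
        compared.\<close>
      have F2: "Om x * F = 1" using Om_pos[OF x] by (simp add: f2_def d)
      have O: "Om x = (1 + e * c)\<^sup>2 + 2/3 * s * (n / e)" by (simp add: Om_def d)
      have h: "g ?q - (real j - 1) * C ?q - 2/3 * (e + c) * Ce ?q + up ?q * (1 + e * c)\<^sup>2 = 0"
        using hom[OF q] by (simp add: d)
      have "P' (angle_field x) + ?R (angle_field x) =
          s ^ j * g ?q * F + (s ^ Suc i * (s * (- (2/3) * (e + c) * F) * Ce ?q) + real (Suc i) * (- s\<^sup>2 * F) * s ^ i * C ?q
          + (s ^ j * (s * (- (2/3) * (e + c) * F) * ue ?q + (Om x * F) * up ?q) + real j * (- s\<^sup>2 * F) * s ^ Suc i * u ?q))"
        unfolding P'(2) F2 by (simp add: angle_field_def F1 i d)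
      also have "\<dots> = s ^ j * F * (g ?q - (real j - 1) * C ?q - 2/3 * (e + c) * Ce ?q + up ?q * (1 + e * c)\<^sup>2)
          + s ^ Suc j * F * (- real j * u ?q - 2/3 * (e + c) * ue ?q + 2/3 * (n / e) * up ?q)"
        unfolding O i by (simp add: power2_eq_square algebra_simps)
      also have "\<dots> = s ^ Suc j * g' ?q * F" unfolding h g'_def by (simp add: d)
      finally show ?thesis by (simp add: d)
    qed
    ultimately show ?thesis by blast
  qed
  have "normal_form (Suc j) Q g'"
    unfolding normal_form_def
  proof (intro conjI allI ballI impI)
    fix e \<phi> s assume x: "(e, \<phi>, s) \<in> D"
    then have "a < e" "e < b" by (auto simp: mem_slab)
    then show "Q (e, \<phi> + 2 * pi, s) = Q (e, \<phi>, s)"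
      using nf x sp_per[OF C(1), of e \<phi>] sp_per[OF C(2), of e \<phi>] by (simp add: Q_def normal_form_def)
  next
    fix x assume "x \<in> D" "sig x = 0"
    moreover have "(0::real) ^ (j - 1) = 0" "(0::real) ^ j = 0" using j by (simp_all add: power_0_left)
    ultimately have "Q x = P x" by (simp only: Q_def mult_zero_left add_0_right)
    then show "Q x = (ecc x)\<^sup>2 / 2" using nf \<open>x \<in> D\<close> \<open>sig x = 0\<close> by (simp add: normal_form_def)
  qed (use tQ g' main in auto)
  then show ?thesis by blast
qed

lemma normal_form_exists: "j \<ge> 2 \<Longrightarrow> \<exists>P g. normal_form j P g"
  by (induction j rule: nat_induct_at_least) (use normal_form_2 normal_form_Suc in blast)+

end

subsection \<open>The limit energy as a smooth function\<close>

lemma integrable_inverse_square: "(\<lambda>t :: real. (1 + t) powr (-2)) integrable_on {0..}"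
proof -
  let ?h = "\<lambda>t :: real. if t \<ge> 0 then (1 + t) powr (-2) else 0"
  have i: "(?h has_integral (1 - 1 / (1 + y))) {0..y}" if "y \<ge> 0" for y :: real
  proof -
    have "((\<lambda>t. (1 + t) powr (-2)) has_integral (- 1 / (1 + y) - (- 1 / (1 + 0)))) {0..y}"
    proof (rule fundamental_theorem_of_calculus)
      fix t :: real assume "t \<in> {0..y}"
      then show "((\<lambda>t. - 1 / (1 + t)) has_vector_derivative (1 + t) powr (-2)) (at t within {0..y})"
        unfolding has_real_derivative_iff_has_vector_derivative[symmetric]
        by (auto intro!: derivative_eq_intros simp: powr_minus powr_numeral divide_inverse power2_eq_square)
    qed (use that in auto)
    then have "((\<lambda>t. (1 + t) powr (-2)) has_integral (1 - 1 / (1 + y))) {0..y}" by simp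
    then show ?thesis by (rule has_integral_eq[rotated]) auto
  qed
  have "(?h has_integral 1) {0..}"
  proof (rule has_integral_to_inf)
    show "?h integrable_on {0..y}" for y using i[of y] by (cases "y \<ge> 0") auto
    have "((\<lambda>y :: real. 1 - 1 / (1 + y)) \<longlongrightarrow> 1 - 0) at_top"
      by (intro tendsto_intros tendsto_divide_0[OF tendsto_const] filterlim_at_top_imp_at_infinity
          filterlim_tendsto_add_at_top[OF tendsto_const] filterlim_ident)
    moreover have "\<forall>\<^sub>F y in at_top. 1 - 1 / (1 + y) = integral {0..y} ?h"
      using eventually_ge_at_top[of 0]
    proof eventually_elim
      case (elim y)
      show ?case by (rule integral_unique[OF i[OF elim], symmetric])
    qed
    ultimately have "((\<lambda>y. integral {0..y} ?h) \<longlongrightarrow> 1 - 0) at_top"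
      by (rule Lim_transform_eventually)
    then show "((\<lambda>y. integral {0..y} ?h) \<longlongrightarrow> 1) at_top" by simp
  qed auto
  then have "?h integrable_on {0..}" by blast
  then show ?thesis by (rule integrable_eq) auto
qed

text \<open>The integral over [0, \<infinity>) that \<open>tame_integral\<close> handles is
  identified, through absolute integrability, with the limit of the integrals over [0, t] that occur
  along an orbit.\<close>

lemma integral_tendsto_decay:
  fixes f :: "real \<Rightarrow> real"
  assumes "continuous_on {0..} f" "\<And>t. t \<ge> 0 \<Longrightarrow> norm (f t) \<le> C * (1 + t) powr (-2)"
  shows "((\<lambda>t. integral {0..t} f) \<longlongrightarrow> integral {0..} f) at_top"
proof -
  have g: "(\<lambda>t :: real. C * (1 + t) powr (-2)) integrable_on {0..}"
    by (rule integrable_on_mult_right[OF integrable_inverse_square])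
  have "f integrable_on {0..}"
    by (rule integrable_dominated_continuous[OF assms(1) _ g]) (use assms in auto)
  then have a: "f absolutely_integrable_on {0..}"
    by (intro absolutely_integrable_integrable_bound[OF _ _ g]) (use assms in auto)
  have "((\<lambda>b. LINT x:{0..b}|lebesgue. f x) \<longlongrightarrow> (LINT x:{0..}|lebesgue. f x)) at_top"
    by (rule tendsto_set_lebesgue_integral_at_top[OF _ a]) auto
  moreover have "(LINT x:{0..b}|lebesgue. f x) = integral {0..b} f" for b
    by (intro set_lebesgue_integral_eq_integral set_integrable_subset[OF a]) auto
  ultimately show ?thesis using set_lebesgue_integral_eq_integral(2)[OF a] by simp
qed

text \<open>The implicit function theorem in the class of tame functions; the quadratic remainder of \<open>K\<close>
  gives that of the solution directly.\<close>

lemma implicit_tame: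
  fixes K :: "real \<times> 'q::euclidean_space \<Rightarrow> real" and E :: "real \<times> 'q \<Rightarrow> real"
  assumes T: "convex T" and c: "c > 0"
    and K: "glip 0 (\<lambda>_. K) ({a<..<b} \<times> T)"
    and K': "\<And>x. x \<in> {a<..<b} \<times> T \<Longrightarrow> (K has_derivative K' x) (at x within {a<..<b} \<times> T)"
      "\<And>i. i \<in> Basis \<Longrightarrow> tame 0 k (\<lambda>_ x. K' x i) ({a<..<b} \<times> T)"
    and mono: "\<And>x. x \<in> {a<..<b} \<times> T \<Longrightarrow> K' x (1, 0) \<ge> c"
    and E: "\<And>h \<tau>. h \<in> J \<Longrightarrow> \<tau> \<in> T \<Longrightarrow> a < E (h, \<tau>) \<and> E (h, \<tau>) < b \<and> K (E (h, \<tau>), \<tau>) = h"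
  shows "semitame 0 (Suc k) (\<lambda>_. E) (J \<times> T)"
    and "\<And>e e' \<tau>. a < e \<Longrightarrow> e \<le> e' \<Longrightarrow> e' < b \<Longrightarrow> \<tau> \<in> T \<Longrightarrow> c * (e' - e) \<le> K (e', \<tau>) - K (e, \<tau>)"
proof -
  let ?S = "{a<..<b} \<times> T"
  have S: "convex ?S" using T by (intro convex_Times) auto
  have lin: "linear (K' x)" if "x \<in> ?S" for x using K'(1)[OF that] by (rule has_derivative_linear)
  have split: "K' x (u, v) = u * K' x (1, 0) + K' x (0, v)" if "x \<in> ?S" for x u v
  proof -
    have "(u, v) = u *\<^sub>R (1, 0) + (0, v)" by simp
    then have "K' x (u, v) = K' x (u *\<^sub>R (1, 0) + (0, v))" by simp
    then show ?thesis by (simp only: linear_add[OF lin[OF that]] linear_scale[OF lin[OF that]] real_scaleR_def)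
  qed
  show inc: "c * (e' - e) \<le> K (e', \<tau>) - K (e, \<tau>)" if e: "a < e" "e \<le> e'" "e' < b" and \<tau>: "\<tau> \<in> T" for e e' \<tau>
  proof -
    have "\<exists>x\<in>{e..e'}. K (e', \<tau>) - K (e, \<tau>) = (\<lambda>h. K' (x, \<tau>) (h, 0)) (e' - e)"
    proof (rule mvt_very_simple[OF e(2), of "\<lambda>s. K (s, \<tau>)"])
      fix x assume x: "e \<le> x" "x \<le> e'"
      show "((\<lambda>s. K (s, \<tau>)) has_derivative (\<lambda>h. K' (x, \<tau>) (h, 0))) (at x within {e..e'})"
        by (rule has_derivative_in_compose2[where t = ?S and g = K and f = "\<lambda>s. (s, \<tau>)" and g' = K'])
          (use K'(1) e \<tau> x in \<open>auto intro!: derivative_eq_intros\<close>)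
    qed
    then obtain x where x: "e \<le> x" "x \<le> e'" "K (e', \<tau>) - K (e, \<tau>) = K' (x, \<tau>) (e' - e, 0)" by auto
    have xS: "(x, \<tau>) \<in> ?S" using x e \<tau> by auto
    have "K' (x, \<tau>) (0, 0) = 0" using linear_0[OF lin[OF xS]] by (simp add: zero_prod_def)
    then have "K (e', \<tau>) - K (e, \<tau>) = (e' - e) * K' (x, \<tau>) (1, 0)" using x(3) split[OF xS, of "e' - e" 0] by simp
    then show ?thesis using mult_left_mono[OF mono[OF xS], of "e' - e"] e by (simp add: mult.commute)
  qed
  obtain L where L: "L \<ge> 0" "\<And>t x y. t \<ge> 0 \<Longrightarrow> x \<in> ?S \<Longrightarrow> y \<in> ?S \<Longrightarrow> norm (K x - K y) \<le> L * (1 + t) powr 0 * norm (x - y)"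
    using glipE[OF K] by blast
  define x where "x q = (E q, snd q)" for q
  have xS: "x q \<in> ?S" "K (x q) = fst q" if "q \<in> J \<times> T" for q
    using E[of "fst q" "snd q"] that by (auto simp: x_def)
  \<comment> \<open>c |E q - E p| is at most the change of K in its first variable, and this is
    bounded by the change of the level plus L times the change of \<tau>; both changes are at most
    norm (q - p).\<close>
  define LE where "LE = (1 + L) / c"
  have LE: "LE \<ge> 0" using L c by (simp add: LE_def)
  have Elip: "\<bar>E q - E p\<bar> \<le> LE * norm (q - p)" if p: "p \<in> J \<times> T" and q: "q \<in> J \<times> T" for p q
  proof -
    have pq: "(E p, snd q) \<in> ?S" "x p \<in> ?S" "x q \<in> ?S" using xS[OF p] xS[OF q] q by (auto simp: x_def)
    have "c * \<bar>E q - E p\<bar> \<le> \<bar>K (x q) - K (E p, snd q)\<bar>"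
      using inc[of "E p" "E q" "snd q"] inc[of "E q" "E p" "snd q"] pq q
      by (cases "E p \<le> E q") (auto simp: x_def abs_if)
    also have "\<dots> \<le> \<bar>fst q - fst p\<bar> + \<bar>K (x p) - K (E p, snd q)\<bar>"
      using xS(2)[OF p] xS(2)[OF q] by simp
    also have "\<bar>K (x p) - K (E p, snd q)\<bar> \<le> L * norm (x p - (E p, snd q))"
      using L(2)[of 0 "x p" "(E p, snd q)"] pq by simp
    also have "norm (x p - (E p, snd q)) \<le> norm (q - p)"
      using norm_snd_le[of "snd (q - p)" "fst (q - p)"] by (simp add: x_def norm_Pair1 norm_Pair2 norm_minus_commute norm_prod_def)
    also have "\<bar>fst q - fst p\<bar> \<le> norm (q - p)"
    proof -
      have "norm (fst z) \<le> norm z" for z :: "real \<times> 'q" by (cases z) (metis norm_fst_le fst_conv)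
      from this[of "q - p"] show ?thesis by simp
    qed
    finally have "c * \<bar>E q - E p\<bar> \<le> norm (q - p) + L * norm (q - p)" using L(1) by (simp add: mult_left_mono)
    then show ?thesis using c by (simp add: LE_def field_simps)
  qed
  have glE: "glip 0 (\<lambda>_. E) (J \<times> T)"
    by (rule glipI[where C = LE]) (use Elip in auto)
  obtain C where C: "C \<ge> 0" "\<And>t p q. t \<ge> 0 \<Longrightarrow> p \<in> ?S \<Longrightarrow> q \<in> ?S \<Longrightarrow>
      norm (K q - K p - K' p (q - p)) \<le> C * (1 + t) powr 0 * (norm (q - p))\<^sup>2"
    using quadratic_remainder[of ?S "\<lambda>_. K" "\<lambda>_. K'" 0, OF S K'(1) tame_glip[OF K'(2)]] by blast
  \<comment> \<open>Implicit differentiation of K (E (h, \<tau>), \<tau>) = h.\<close>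
  define D where "D q h = (fst h - K' (x q) (0, snd h)) / K' (x q) (1, 0)" for q h
  have derE: "(E has_derivative D p) (at p within J \<times> T)" if p: "p \<in> J \<times> T" for p
  proof (rule has_derivative_quadratic[OF _ p, where C = "C / c * (LE + 1)\<^sup>2"])
    note l = lin[OF xS(1)[OF p]]
    show "linear (D p)"
    proof (rule linearI)
      fix u v :: "real \<times> 'q" and r :: real
      have "(0 :: real, snd (u + v)) = (0, snd u) + (0, snd v)" "(0 :: real, snd (r *\<^sub>R u)) = r *\<^sub>R (0, snd u)" by auto
      then have "K' (x p) (0, snd (u + v)) = K' (x p) (0, snd u) + K' (x p) (0, snd v)"
        "K' (x p) (0, snd (r *\<^sub>R u)) = r * K' (x p) (0, snd u)"
        by (simp_all only: linear_add[OF l] linear_scale[OF l] real_scaleR_def)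
      then show "D p (u + v) = D p u + D p v" "D p (r *\<^sub>R u) = r *\<^sub>R D p u"
        by (simp_all add: D_def diff_divide_distrib add_divide_distrib algebra_simps)
    qed
    fix q assume q: "q \<in> J \<times> T"
    let ?k = "K' (x p) (1, 0)"
    have k: "?k \<ge> c" by (rule mono[OF xS(1)[OF p]])
    let ?R = "K (x q) - K (x p) - K' (x p) (x q - x p)"
    have xx: "x q - x p = (E q - E p, snd (q - p))" by (simp add: x_def)
    have kD: "?k * D p (q - p) = fst (q - p) - K' (x p) (0, snd (q - p))"
      using k c by (simp add: D_def)
    have "?k * (E q - E p - D p (q - p)) = - ?R"
      unfolding right_diff_distrib kD xx split[OF xS(1)[OF p], of "E q - E p" "snd (q - p)"]
      using xS(2)[OF p] xS(2)[OF q] by (simp add: algebra_simps)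
    then have "?k * \<bar>E q - E p - D p (q - p)\<bar> = \<bar>?R\<bar>"
      using k c by (metis abs_minus_cancel abs_mult abs_of_pos less_le_trans)
    then have "c * \<bar>E q - E p - D p (q - p)\<bar> \<le> \<bar>?R\<bar>"
      using mult_right_mono[OF k, of "\<bar>E q - E p - D p (q - p)\<bar>"] by simp
    also have "\<dots> \<le> C * (norm (x q - x p))\<^sup>2" using C(2)[of 0, OF _ xS(1)[OF p] xS(1)[OF q]] by simp
    also have "\<dots> \<le> C * ((LE + 1) * norm (q - p))\<^sup>2"
    proof (intro mult_left_mono power_mono C)
      have "norm (x q - x p) \<le> \<bar>E q - E p\<bar> + norm (snd (q - p))"
        unfolding xx using norm_Pair_le[of "E q - E p" "snd (q - p)"] by simp
      also have "\<dots> \<le> LE * norm (q - p) + norm (q - p)"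
      proof -
        have "norm (snd z) \<le> norm z" for z :: "real \<times> 'q" by (cases z) (metis norm_snd_le snd_conv)
        from this[of "q - p"] show ?thesis using Elip[OF p q] by simp
      qed
      finally show "norm (x q - x p) \<le> (LE + 1) * norm (q - p)" by (simp add: algebra_simps)
    qed auto
    finally have "\<bar>E q - E p - D p (q - p)\<bar> \<le> C * ((LE + 1) * norm (q - p))\<^sup>2 / c"
      using c by (simp add: field_simps)
    then show "norm (E q - E p - D p (q - p)) \<le> C / c * (LE + 1)\<^sup>2 * (norm (q - p))\<^sup>2"
      by (simp add: power_mult_distrib mult_ac)
  qed
  \<comment> \<open>Bootstrap: order j of E gives order j of \<open>K'\<close> along the graph,
    hence of the formula D, hence order j + 1 of E.\<close>
  have "j \<le> Suc k \<Longrightarrow> semitame 0 j (\<lambda>_. E) (J \<times> T)" for j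
  proof (induction j)
    case 0 then show ?case using glE by simp
  next
    case (Suc j)
    then have Ej: "semitame 0 j (\<lambda>_. E) (J \<times> T)" and j: "j \<le> k" by auto
    have xj: "semitame 0 j (\<lambda>_. x) (J \<times> T)"
      unfolding x_def by (intro semitame_Pair Ej semitame_linear bounded_linear_snd)
    have Kx: "tame 0 j (\<lambda>_ q. K' (x q) i) (J \<times> T)" if "i \<in> Basis" for i
      by (rule tame_comp0[OF tame_le[OF K'(2)[OF that] j] _ xj]) (use xS in auto)
    show ?case
    proof (rule semitame_SucI[OF glE derE])
      fix i :: "real \<times> 'q" assume i: "i \<in> Basis"
      have K0: "tame 0 j (\<lambda>_ q. K' (x q) (0, snd i)) (J \<times> T)"
      proof (cases "snd i = 0")
        case True
        have "tame 0 j (\<lambda>_ q. 0 :: real) (J \<times> T)" by (rule tame_zero)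
        then show ?thesis
          by (rule tame_cong) (use linear_0[OF lin[OF xS(1)]] True in \<open>simp add: zero_prod_def\<close>)
      next
        case False
        then have "(0, snd i) \<in> (Basis :: (real \<times> 'q) set)" using i by (auto simp: Basis_prod_def)
        then show ?thesis by (rule Kx)
      qed
      have one: "(1, 0) \<in> (Basis :: (real \<times> 'q) set)" by (simp add: Basis_prod_def)
      show "tame 0 j (\<lambda>_ q. D q i) (J \<times> T)"
        unfolding D_def
        by (rule tame_divide[OF c _ Kx[OF one] tame_diff[OF tame_const K0]]) (use mono[OF xS(1)] in force)
    qed auto
  qed
  then show "semitame 0 (Suc k) (\<lambda>_. E) (J \<times> T)" by blast
qed

section \<open>The limit along the flow in angle time\<close>

context annulus_flow
begin

lemma S_D: "p \<in> S \<Longrightarrow> p \<in> D"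
  using order by (auto simp: mem_S mem_slab)

lemma X_confined: assumes p: "p \<in> S" and t: "t \<ge> 0"
  shows "\<bar>(ecc (X t p))\<^sup>2 - (ecc p)\<^sup>2\<bar> \<le> 3 * sig p / (1 - b)"
proof -
  have "\<bar>(ecc (X t p))\<^sup>2 - (ecc (X 0 p))\<^sup>2\<bar> \<le> 3 * sig (X 0 p) / (1 - b)"
  proof (rule confinement(3)[OF t, of "\<lambda>t. X t p"])
    show "0 \<le> sig (X 0 p)" using p by (simp add: X_0 mem_S)
    fix s assume s: "0 \<le> s" "s \<le> t"
    show "X s p \<in> D" using X_D[OF p s(1)] .
    show "((\<lambda>t. X t p) has_vector_derivative angle_field (X s p)) (at s within {0..t})"
      using X_deriv[OF p s(1)] by (rule has_vector_derivative_within_subset) auto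
  qed
  then show ?thesis using X_0[OF p] by simp
qed

lemma energy_limit_tame:
  "\<exists>K. tame 0 k (\<lambda>_. K) S \<and> (\<forall>p\<in>S. ((\<lambda>t. (ecc (X t p))\<^sup>2 / 2) \<longlongrightarrow> K p) at_top)"
proof -
  obtain m where m: "m \<ge> 0" "semitame m k X S" using semitame_X by blast
  have sm: "semitame m k (\<lambda>t p. sig (X t p)) S"
    by (rule semitame_lin[OF bounded_linear_compose[OF bounded_linear_snd bounded_linear_snd] m(2)])
  have "\<exists>M0. \<forall>M\<ge>M0. \<forall>y. tame ((real k + 1) * m) k y S \<longrightarrow> tame (-2) k (\<lambda>t p. sig (X t p) ^ M * y t p) S"
    by (rule tame_decay[OF _ m(1) sm, where c = 5]) (use X_sig_bounds in auto)
  then obtain M0 where M0: "\<forall>M\<ge>M0. \<forall>y. tame ((real k + 1) * m) k y S \<longrightarrow> tame (-2) k (\<lambda>t p. sig (X t p) ^ M * y t p) S"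
    by blast
  \<comment> \<open>The order of choices matters: k fixes the growth exponent m of the flow, these
    fix a threshold M0 valid for all y at once, and only then is the normal form constructed, on
    which y depends. The summand 2 ensures j \<ge> 2.\<close>
  define j where "j = M0 + 2"
  obtain P g where nf: "normal_form j P g" using normal_form_exists[of j] by (auto simp: j_def)
  have P: "tame 0 k' (\<lambda>_. P) D" and g: "sp g" for k' using nf by (auto simp: normal_form_def)
  define G where "G x = g (ecc x, ang x) * f2 x" for x
  have G: "tame 0 k' (\<lambda>_. G) D" for k' unfolding G_def by (intro tame_mult0 tame_lift g tame_f)
  define y where "y t p = sig (X t p) ^ j * G (X t p)" for t p
  have y: "tame (-2) k y S"
  proof -
    have "tame ((real k + 1) * m) k (\<lambda>t p. G (X t p)) S"
      by (rule tame_comp[OF G _ m(2,1)]) (rule X_D)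
    moreover have "M0 \<le> j" by (simp add: j_def)
    ultimately show ?thesis unfolding y_def using M0 by blast
  qed
  define R where "R p = integral {0..} (\<lambda>t. y t p)" for p
  have R: "tame 0 k (\<lambda>_. R) S"
    unfolding R_def by (rule tame_integral[OF _ _ integrable_inverse_square convex_S y]) auto
  have PS: "tame 0 k (\<lambda>_. P) S" by (rule tame_subset[OF P]) (use S_D in auto)
  obtain Cy where Cy: "Cy \<ge> 0" "\<And>t p. t \<ge> 0 \<Longrightarrow> p \<in> S \<Longrightarrow> norm (y t p) \<le> Cy * (1 + t) powr (-2)"
    using gboundE[OF tame_gbound[OF y]] by blast
  obtain LP where LP: "LP \<ge> 0" "\<And>t p q. t \<ge> 0 \<Longrightarrow> p \<in> D \<Longrightarrow> q \<in> D \<Longrightarrow> norm (P p - P q) \<le> LP * (1 + t) powr 0 * norm (p - q)"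
    using glipE[OF tame_glip[OF P[of 0]]] by blast
  have "((\<lambda>t. (ecc (X t p))\<^sup>2 / 2) \<longlongrightarrow> P p + R p) at_top" if p: "p \<in> S" for p
  proof -
    have yc: "continuous_on {0..} (\<lambda>t. y t p)" by (rule glip_cont[OF tame_glip[OF y] p])
    have dP: "((\<lambda>t. P (X t p)) has_vector_derivative y t p) (at t within {0..})" if t: "t \<ge> 0" for t
    proof -
      note XD = X_D[OF p t]
      obtain P' where P': "(P has_derivative P') (at (X t p) within D)"
        "P' (angle_field (X t p)) = sig (X t p) ^ j * g (ecc (X t p), ang (X t p)) * f2 (X t p)"
        using nf XD unfolding normal_form_def by blast
      have "((\<lambda>t. P (X t p)) has_derivative (\<lambda>h. P' (h *\<^sub>R angle_field (X t p)))) (at t within {0..})"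
      proof (rule has_derivative_in_compose[where f = "\<lambda>t. X t p" and f' = "\<lambda>h. h *\<^sub>R angle_field (X t p)"
            and g = P and g' = P'])
        show "((\<lambda>t. X t p) has_derivative (\<lambda>h. h *\<^sub>R angle_field (X t p))) (at t within {0..})"
          using X_deriv[OF p t] by (simp add: has_vector_derivative_def)
        show "(P has_derivative P') (at (X t p) within (\<lambda>t. X t p) ` {0..})"
          by (rule has_derivative_subset[OF P'(1)]) (use X_D[OF p] in auto)
      qed
      moreover have "(\<lambda>h. P' (h *\<^sub>R angle_field (X t p))) = (\<lambda>h. h *\<^sub>R y t p)"
        using linear_scale[OF has_derivative_linear[OF P'(1)]] P'(2) by (simp add: fun_eq_iff y_def G_def)
      ultimately show ?thesis by (simp add: has_vector_derivative_def)
    qed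
    have PE: "P (X t p) = P p + integral {0..t} (\<lambda>t. y t p)" if t: "t \<ge> 0" for t
    proof -
      have "((\<lambda>t. y t p) has_integral (P (X t p) - P (X 0 p))) {0..t}"
        by (rule fundamental_theorem_of_calculus[OF t], rule has_vector_derivative_within_subset[OF dP]) auto
      then show ?thesis using X_0[OF p] by (simp add: integral_unique)
    qed
    have "((\<lambda>t. P p + integral {0..t} (\<lambda>t. y t p)) \<longlongrightarrow> P p + R p) at_top"
      unfolding R_def by (intro tendsto_intros integral_tendsto_decay[OF yc Cy(2)[OF _ p]])
    moreover have "\<forall>\<^sub>F t in at_top. P p + integral {0..t} (\<lambda>t. y t p) = P (X t p)"
      using eventually_ge_at_top[of 0] by eventually_elim (simp add: PE)
    ultimately have 1: "((\<lambda>t. P (X t p)) \<longlongrightarrow> P p + R p) at_top"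
      by (rule Lim_transform_eventually)
    \<comment> \<open>P equals e^2 / 2 where \<sigma> = 0 and is Lipschitz on D, and \<sigma> tends
      to 0 along the orbit; so P and e^2 / 2 have the same limit.\<close>
    have "((\<lambda>t. (ecc (X t p))\<^sup>2 / 2 - P (X t p)) \<longlongrightarrow> 0) at_top"
    proof (rule Lim_null_comparison)
      show "\<forall>\<^sub>F t in at_top. norm ((ecc (X t p))\<^sup>2 / 2 - P (X t p)) \<le> LP * (5 / (1 + t))"
        using eventually_ge_at_top[of 0]
      proof eventually_elim
        case (elim t)
        let ?x = "X t p" and ?y = "(ecc (X t p), ang (X t p), 0 :: real)"
        have x: "?x \<in> D" by (rule X_D[OF p elim])
        from x have "a < ecc ?x" "ecc ?x < b" by (simp_all add: mem_slab)
        with s1(1) have x0: "?y \<in> D" unfolding mem_slab by simp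
        then have "P ?y = (ecc ?x)\<^sup>2 / 2" using nf by (auto simp: normal_form_def)
        then have "norm ((ecc ?x)\<^sup>2 / 2 - P ?x) \<le> LP * norm (?y - ?x)" using LP(2)[of 0 ?y ?x] x x0 by simp
        also have "norm (?y - ?x) \<le> 5 / (1 + t)"
          using X_sig_bounds(1,2)[OF p elim] norm_triple_le[of "?y - ?x"] by simp
        finally show ?case using LP(1) by (simp add: mult_left_mono)
      qed
      have "((\<lambda>t :: real. LP * (5 / (1 + t))) \<longlongrightarrow> LP * 0) at_top"
        by (intro tendsto_intros tendsto_divide_0[OF tendsto_const] filterlim_at_top_imp_at_infinity
            filterlim_tendsto_add_at_top[OF tendsto_const] filterlim_ident)
      then show "((\<lambda>t :: real. LP * (5 / (1 + t))) \<longlongrightarrow> 0) at_top" by simp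
    qed
    from tendsto_add[OF this 1] show ?thesis by simp
  qed
  then show ?thesis using tame_add[OF PS R] by blast
qed

definition Kinf :: "real \<times> real \<times> real \<Rightarrow> real" where
  "Kinf p = Lim at_top (\<lambda>t. (ecc (X t p))\<^sup>2 / 2)"

lemma Kinf_tendsto: assumes "p \<in> S" shows "((\<lambda>t. (ecc (X t p))\<^sup>2 / 2) \<longlongrightarrow> Kinf p) at_top"
proof -
  obtain K where "((\<lambda>t. (ecc (X t p))\<^sup>2 / 2) \<longlongrightarrow> K) at_top" using energy_limit_tame[of 0] assms by blast
  then show ?thesis unfolding Kinf_def using tendsto_Lim[OF trivial_limit_at_top_linorder] by metis
qed

text \<open>The representation of the limit as P plus an integral depends on k through j, but the
  limit does not. By uniqueness of limits one function on one set S has every finite order.\<close>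

lemma tame_Kinf: "tame 0 k (\<lambda>_. Kinf) S"
proof -
  obtain K where K: "tame 0 k (\<lambda>_. K) S" "\<forall>p\<in>S. ((\<lambda>t. (ecc (X t p))\<^sup>2 / 2) \<longlongrightarrow> K p) at_top"
    using energy_limit_tame[of k] by blast
  show ?thesis
    by (rule tame_cong[OF K(1)])
      (use K(2) Kinf_tendsto tendsto_unique[OF trivial_limit_at_top_linorder] in blast)
qed

text \<open>The bound of \<open>confinement\<close> passed to the limit, with 3/2 rounded up to 2.
  It determines the limit on \<sigma> = 0 and brackets it for small \<sigma>; the implicit function
  argument uses both.\<close>

lemma Kinf_near: assumes "p \<in> S" shows "\<bar>Kinf p - (ecc p)\<^sup>2 / 2\<bar> \<le> 2 * sig p / (1 - b)"
proof -
  have "((\<lambda>t. \<bar>(ecc (X t p))\<^sup>2 / 2 - (ecc p)\<^sup>2 / 2\<bar>) \<longlongrightarrow> \<bar>Kinf p - (ecc p)\<^sup>2 / 2\<bar>) at_top"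
    by (intro tendsto_intros Kinf_tendsto assms)
  moreover have "\<forall>\<^sub>F t in at_top. \<bar>(ecc (X t p))\<^sup>2 / 2 - (ecc p)\<^sup>2 / 2\<bar> \<le> 2 * sig p / (1 - b)"
    using eventually_ge_at_top[of 0]
  proof eventually_elim
    case (elim t)
    have "sig p / (1 - b) \<ge> 0" using assms ab by (simp add: mem_S)
    then have "3 / 2 * (sig p / (1 - b)) \<le> 2 * (sig p / (1 - b))" by linarith
    moreover have "\<bar>(ecc (X t p))\<^sup>2 / 2 - (ecc p)\<^sup>2 / 2\<bar> = \<bar>(ecc (X t p))\<^sup>2 - (ecc p)\<^sup>2\<bar> / 2"
      by (simp flip: diff_divide_distrib)
    ultimately show ?case using X_confined[OF assms elim] by simp
  qed
  ultimately show ?thesis by (rule tendsto_upperbound[OF _ _ trivial_limit_at_top_linorder])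
qed

end

subsection \<open>The system in Cartesian eccentricity coordinates\<close>

lemma Lipschitz_vector_field:
  assumes "c > 0"
  shows "tame 0 0 (\<lambda>_. vector_field \<delta>) ({c..R} \<times> {-R..R} \<times> {-R..R})" (is "tame 0 0 _ ?K")
proof -
  have b: "tame 0 0 (\<lambda>_ x. fst x) ?K" "tame 0 0 (\<lambda>_ x. fst (snd x)) ?K" "tame 0 0 (\<lambda>_ x. snd (snd x)) ?K"
    using assms by (auto intro!: tame_bounded_linear[where B = "\<bar>R\<bar>"] bounded_linear_fst bounded_linear_snd
      bounded_linear_compose[OF bounded_linear_fst bounded_linear_snd] bounded_linear_compose[OF bounded_linear_snd bounded_linear_snd])
  have "tame 0 0 (\<lambda>_ x. (fst (snd x) + 2 * \<delta> * fst x * snd (snd x) ^ 3,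
      - (fst x - 1) / fst x ^ 3 - 2 * \<delta> * fst (snd x) * snd (snd x) ^ 3, - \<delta> * snd (snd x) ^ 4)) ?K"
    using assms
    by (intro tame_Pair tame_add tame_diff tame_minus tame_mult0 tame_power0 tame_const b tame_divide[where c = "c ^ 3"])
      (auto simp: power_mono)
  then show ?thesis by (rule tame_cong) (simp add: vector_field_def split: prod.splits)
qed

lemma is_solution_cont: "is_solution \<delta> p x \<Longrightarrow> continuous_on {0..} x"
  by (rule continuous_on_vector_derivative[where f' = "\<lambda>t. vector_field \<delta> (x t)"]) (auto simp: is_solution_def)

lemma is_solution_bounds:
  assumes x: "is_solution \<delta> p x" and T: "T \<ge> 0"
  obtains c R where "c > 0" "\<And>t. 0 \<le> t \<Longrightarrow> t \<le> T \<Longrightarrow> c \<le> fst (x t)" "\<And>t. 0 \<le> t \<Longrightarrow> t \<le> T \<Longrightarrow> norm (x t) \<le> R"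
proof -
  have cx: "continuous_on {0..T} x" using is_solution_cont[OF x] by (rule continuous_on_subset) auto
  have "\<exists>t0\<in>{0..T}. \<forall>t\<in>{0..T}. fst (x t0) \<le> fst (x t)"
    by (rule continuous_attains_inf) (use T in \<open>auto intro!: continuous_intros cx\<close>)
  then obtain t0 where t0: "t0 \<in> {0..T}" "\<forall>t\<in>{0..T}. fst (x t0) \<le> fst (x t)" by blast
  have "bounded (x ` {0..T})" by (intro compact_imp_bounded compact_continuous_image cx) auto
  then obtain R where "\<forall>y\<in>x ` {0..T}. norm y \<le> R" by (auto simp: bounded_iff)
  moreover have "fst (x t0) > 0" using x t0(1) by (auto simp: is_solution_def phase_space_def split: prod.splits)
  ultimately show ?thesis using that[of "fst (x t0)" R] t0(2) by auto
qed

text \<open>On [0, T] both solutions lie in a common compact box on which r is bounded below, and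
  there the vector field is Lipschitz.\<close>

lemma is_solution_unique:
  assumes x: "is_solution \<delta> p x" and y: "is_solution \<delta> p y" and T: "T \<ge> 0"
  shows "x T = y T"
proof -
  obtain c1 R1 where 1: "c1 > 0" "\<And>t. 0 \<le> t \<Longrightarrow> t \<le> T \<Longrightarrow> c1 \<le> fst (x t)" "\<And>t. 0 \<le> t \<Longrightarrow> t \<le> T \<Longrightarrow> norm (x t) \<le> R1"
    using is_solution_bounds[OF x T] by blast
  obtain c2 R2 where 2: "c2 > 0" "\<And>t. 0 \<le> t \<Longrightarrow> t \<le> T \<Longrightarrow> c2 \<le> fst (y t)" "\<And>t. 0 \<le> t \<Longrightarrow> t \<le> T \<Longrightarrow> norm (y t) \<le> R2"
    using is_solution_bounds[OF y T] by blast
  define c R where "c = min c1 c2" and "R = max R1 R2"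
  let ?K = "{c..R} \<times> {-R..R} \<times> {-R..R}"
  have c: "c > 0" using 1 2 by (simp add: c_def)
  have K: "z \<in> ?K" if "c \<le> fst z" "norm z \<le> R" for z
    using that triple_le_norm[of z] by (cases z) (auto simp: abs_le_iff)
  have xy: "x t \<in> ?K" "y t \<in> ?K" if "0 \<le> t" "t \<le> T" for t
    by (rule K; use 1(2,3)[OF that] 2(2,3)[OF that] in \<open>simp add: c_def R_def min_le_iff_disj le_max_iff_disj\<close>)+
  obtain L where L: "L \<ge> 0" "\<And>t z z'. t \<ge> 0 \<Longrightarrow> z \<in> ?K \<Longrightarrow> z' \<in> ?K \<Longrightarrow>
      norm (vector_field \<delta> z - vector_field \<delta> z') \<le> L * (1 + t) powr 0 * norm (z - z')"
    using glipE[OF tame_glip[OF Lipschitz_vector_field[OF c]]] by blast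
  show ?thesis
  proof (rule ode_unique[where f = "\<lambda>_. vector_field \<delta>" and L = L])
    fix t assume t: "0 \<le> t" "t \<le> T"
    show "(x has_vector_derivative vector_field \<delta> (x t)) (at t within {0..T})"
      "(y has_vector_derivative vector_field \<delta> (y t)) (at t within {0..T})"
      using x y t by (auto simp: is_solution_def intro: has_vector_derivative_within_subset)
    show "norm (vector_field \<delta> (x t) - vector_field \<delta> (y t)) \<le> L * norm (x t - y t)"
      using L(2)[of 0, OF _ xy[OF t]] by simp
  qed (use x y T in \<open>auto simp: is_solution_def\<close>)
qed

lemma flow_eq:
  assumes "is_solution \<delta> p x" "t \<ge> 0"
  shows "flow \<delta> t p = x t"
  unfolding flow_def by (rule the_equality) (use assms is_solution_unique in blast)+

text \<open>The derivative is known to be nonpositive only where g \<ge> B, so g may well fail to be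
  monotone. After the last time with g \<le> B, however, it stays above B and cannot
  increase.\<close>

lemma barrier:
  fixes g :: "real \<Rightarrow> real"
  assumes T: "T \<ge> 0" and g0: "g 0 \<le> B"
    and d: "\<And>t. 0 \<le> t \<Longrightarrow> t \<le> T \<Longrightarrow> (g has_real_derivative g' t) (at t within {0..T})"
    and neg: "\<And>t. 0 \<le> t \<Longrightarrow> t \<le> T \<Longrightarrow> g t \<ge> B \<Longrightarrow> g' t \<le> 0"
  shows "g T \<le> B"
proof (rule ccontr)
  assume gT: "\<not> g T \<le> B"
  have cg: "continuous_on {0..T} g" using d by (intro DERIV_continuous_on) auto
  have "compact ({0..T} \<inter> g -` {..B})"
    unfolding compact_eq_bounded_closed
    by (intro conjI continuous_closed_preimage[OF cg] bounded_subset[OF bounded_closed_interval[of 0 T]]) auto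
  moreover have "{0..T} \<inter> g -` {..B} \<noteq> {}" using g0 T by auto
  ultimately obtain t0 where t0: "t0 \<in> {0..T} \<inter> g -` {..B}" "\<forall>t\<in>{0..T} \<inter> g -` {..B}. t \<le> t0"
    using compact_attains_sup by blast
  have lt: "t0 < T" using t0 gT by (cases "t0 = T") auto
  obtain \<xi> where \<xi>: "t0 < \<xi>" "\<xi> < T" "g T - g t0 = g' \<xi> * (T - t0)"
  proof (rule mvt[OF lt, where f = g and f' = "\<lambda>x. (*) (g' x)"])
    show "continuous_on {t0..T} g" by (rule continuous_on_subset[OF cg]) (use t0 in auto)
    fix x assume x: "t0 < x" "x < T"
    have "at x within {0..T} = at x" by (rule at_within_interior) (use x t0 in auto)
    then show "(g has_derivative (*) (g' x)) (at x)" using d[of x] x t0 by (simp add: has_field_derivative_def)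
  qed (rule that)
  have "g \<xi> > B"
  proof (rule ccontr)
    assume "\<not> g \<xi> > B"
    then have "\<xi> \<in> {0..T} \<inter> g -` {..B}" using \<xi> t0(1) by auto
    then show False using t0(2) \<xi> by force
  qed
  then have "g' \<xi> \<le> 0" using neg[of \<xi>] \<xi> t0(1) by auto
  then have "g T \<le> g t0" using \<xi> lt by (smt (verit) mult_nonpos_nonneg)
  then show False using t0(1) gT by auto
qed

lemma nonincreasing_convergent:
  fixes f :: "real \<Rightarrow> real"
  assumes "\<And>s t. a \<le> s \<Longrightarrow> s \<le> t \<Longrightarrow> f t \<le> f s" "\<And>t. a \<le> t \<Longrightarrow> B \<le> f t"
  obtains L where "(f \<longlongrightarrow> L) at_top"
proof
  have bdd: "bdd_below (f ` {a..})" using assms(2) by (auto intro!: bdd_belowI[of _ B])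
  show "(f \<longlongrightarrow> Inf (f ` {a..})) at_top"
  proof (rule order_tendstoI)
    fix y assume y: "y < Inf (f ` {a..})"
    show "\<forall>\<^sub>F t in at_top. y < f t" using eventually_ge_at_top[of a]
    proof eventually_elim
      case (elim t)
      have "Inf (f ` {a..}) \<le> f t" by (rule cInf_lower) (use elim bdd in auto)
      then show ?case using y by simp
    qed
  next
    fix y assume y: "Inf (f ` {a..}) < y"
    obtain t0 where t0: "a \<le> t0" "f t0 < y" using cInf_lessD[OF _ y] by auto
    show "\<forall>\<^sub>F t in at_top. f t < y" using eventually_ge_at_top[of t0]
      by eventually_elim (use assms(1)[OF t0(1)] t0(2) in force)
  qed
qed

definition sigma_of :: "real \<Rightarrow> real \<Rightarrow> real" where "sigma_of \<delta> l = 3 * \<delta> * l ^ 3"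

text \<open>The solution of l' = - \<delta> l^4 in closed form. For \<sigma> = 3 \<delta> l^3 the
  equation is \<sigma>' = - \<sigma>^2, with solution \<sigma>(0) / (1 + \<sigma>(0) t).\<close>

definition l_of :: "real \<Rightarrow> real \<Rightarrow> real \<Rightarrow> real" where
  "l_of \<delta> l t = l * (1 + sigma_of \<delta> l * t) powr (-1/3)"

lemma sigma_l_of:
  assumes "\<delta> > 0" "l \<ge> 0" "t \<ge> 0"
  shows "sigma_of \<delta> (l_of \<delta> l t) = sigma_of \<delta> l / (1 + sigma_of \<delta> l * t)"
    and "l_of \<delta> l t \<ge> 0"
    and "(l_of \<delta> l has_real_derivative - \<delta> * l_of \<delta> l t ^ 4) (at t within X)"
proof -
  let ?s = "sigma_of \<delta> l"
  have s: "?s \<ge> 0" using assms by (simp add: sigma_of_def)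
  have p: "1 + ?s * t > 0" using s assms by (simp add: add_pos_nonneg)
  have "((1 + ?s * t) powr (-1/3)) ^ 3 = (1 + ?s * t) powr (- 1)" using p by (simp add: powr_power)
  also have "\<dots> = 1 / (1 + ?s * t)" using p by (simp add: powr_minus_divide)
  finally have c: "l_of \<delta> l t ^ 3 = l ^ 3 / (1 + ?s * t)" by (simp add: l_of_def power_mult_distrib)
  then show "sigma_of \<delta> (l_of \<delta> l t) = ?s / (1 + ?s * t)" by (simp add: sigma_of_def)
  show "l_of \<delta> l t \<ge> 0" using assms by (simp add: l_of_def)
  have "(l_of \<delta> l has_real_derivative l * ((-1/3) * (1 + ?s * t) powr (-1/3 - 1) * ?s)) (at t within X)"
    unfolding l_of_def using p
    by (auto intro!: derivative_eq_intros simp: powr_diff)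
  moreover have "l * ((-1/3) * (1 + ?s * t) powr (-1/3 - 1) * ?s) = - \<delta> * l_of \<delta> l t ^ 4"
  proof -
    have "l_of \<delta> l t ^ 4 = l_of \<delta> l t ^ 3 * l_of \<delta> l t" by (simp add: power_numeral_reduce)
    also have "\<dots> = l ^ 3 / (1 + ?s * t) * (l * (1 + ?s * t) powr (-1/3))" unfolding c by (simp add: l_of_def)
    finally have "- \<delta> * l_of \<delta> l t ^ 4 = - \<delta> * l ^ 3 * l * ((1 + ?s * t) powr (-1/3) / (1 + ?s * t))" by simp
    also have "(1 + ?s * t) powr (-1/3) / (1 + ?s * t) = (1 + ?s * t) powr (-1/3 - 1)"
      using powr_diff[of "1 + ?s * t" "-1/3" 1] p by simp
    finally have e: "- \<delta> * l_of \<delta> l t ^ 4 = - \<delta> * l ^ 3 * l * (1 + ?s * t) powr (-1/3 - 1)" .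
    show ?thesis unfolding e by (simp add: sigma_of_def mult_ac)
  qed
  ultimately show "(l_of \<delta> l has_real_derivative - \<delta> * l_of \<delta> l t ^ 4) (at t within X)" by simp
qed

lemma l_of_tendsto:
  assumes "\<delta> > 0" "l \<ge> 0" shows "(l_of \<delta> l \<longlongrightarrow> 0) at_top"
proof (cases "l = 0")
  case True then show ?thesis by (simp add: l_of_def[abs_def])
next
  case False
  then have s: "sigma_of \<delta> l > 0" using assms by (simp add: sigma_of_def)
  have "((\<lambda>t. (1 + sigma_of \<delta> l * t) powr (-1/3)) \<longlongrightarrow> 0) at_top"
    by (intro tendsto_neg_powr filterlim_tendsto_add_at_top[OF tendsto_const]
        filterlim_tendsto_pos_mult_at_top[OF tendsto_const s] filterlim_ident) auto
  from tendsto_mult_right_zero[OF this, of l] show ?thesis by (simp add: l_of_def[abs_def])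
qed

text \<open>The equations for w = 1 / r - 1 and v, with \<open>s t\<close> standing for \<sigma>
  along the solution. The uniform bounds on a ball serve both the existence of solutions and the
  comparison with the flow in angle time.\<close>

lemma tame_polynomial_field:
  fixes s :: "real \<Rightarrow> real"
  assumes cs: "continuous_on {0..} s" and B: "\<And>t. t \<ge> 0 \<Longrightarrow> \<bar>s t\<bar> \<le> B"
  shows "tame 0 0 (\<lambda>t z. (- (1 + fst z)\<^sup>2 * snd z - 2/3 * s t * (1 + fst z), (1 + fst z)\<^sup>2 * fst z - 2/3 * s t * snd z))
    (cball 0 R :: (real \<times> real) set)"
proof -
  let ?D = "cball 0 R :: (real \<times> real) set"
  have n: "norm (fst z) \<le> R \<and> norm (snd z) \<le> R" if "z \<in> ?D" for z
    using that norm_fst_le[of "fst z" "snd z"] norm_snd_le[of "snd z" "fst z"] by simp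
  have b: "tame 0 0 (\<lambda>_. fst) ?D" "tame 0 0 (\<lambda>_. snd) ?D"
    by (rule tame_bounded_linear[where B = R]; use n bounded_linear_fst bounded_linear_snd in blast)+
  have ts: "tame 0 0 (\<lambda>t z. s t) ?D"
    by (rule tame_time[OF cs, where C = B]) (use B in auto)
  show ?thesis
    by (intro tame_Pair tame_diff tame_mult0 tame_minus tame_power0 tame_add tame_const b ts)
qed

text \<open>\<open>w = 1 / r - 1\<close> turns the equations for \<open>(r, v)\<close> into a polynomial system which differs from a
  rotation (with angular speed \<open>(1 + w)\<^sup>2\<close>) by a perturbation of size \<open>\<sigma>\<close>.\<close>

lemma phase_solution:
  assumes \<delta>: "\<delta> > 0" and r0: "r0 > 0" and l0: "l0 \<ge> 0"
  obtains w v where "w 0 = 1 / r0 - 1" "v 0 = v0"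
    "\<And>t. t \<ge> 0 \<Longrightarrow> (w has_real_derivative - (1 + w t)\<^sup>2 * v t - 2/3 * sigma_of \<delta> (l_of \<delta> l0 t) * (1 + w t)) (at t within {0..})"
    "\<And>t. t \<ge> 0 \<Longrightarrow> (v has_real_derivative (1 + w t)\<^sup>2 * w t - 2/3 * sigma_of \<delta> (l_of \<delta> l0 t) * v t) (at t within {0..})"
    "\<And>t. t \<ge> 0 \<Longrightarrow> 1 + w t > 0"
    "\<And>t. t \<ge> 0 \<Longrightarrow> flow \<delta> t (r0, v0, l0) = (1 / (1 + w t), v t, l_of \<delta> l0 t)"
proof -
  define s where "s t = sigma_of \<delta> (l_of \<delta> l0 t)" for t
  have s: "s t \<ge> 0" "s t \<le> sigma_of \<delta> l0" if "t \<ge> 0" for t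
  proof -
    have s0: "sigma_of \<delta> l0 \<ge> 0" using \<delta> l0 by (simp add: sigma_of_def)
    have "1 + sigma_of \<delta> l0 * t \<ge> 1" using s0 that by simp
    then show "s t \<ge> 0" "s t \<le> sigma_of \<delta> l0" unfolding s_def sigma_l_of(1)[OF \<delta> l0 that] using s0
      by (auto simp: divide_le_eq mult_le_cancel_left1)
  qed
  have cs: "continuous_on {0..} s"
  proof -
    have "continuous_on {0..} (l_of \<delta> l0)"
      using sigma_l_of(3)[OF \<delta> l0] by (intro DERIV_continuous_on) auto
    then show ?thesis unfolding s_def sigma_of_def by (intro continuous_intros)
  qed
  define f where "f t z = (- (1 + fst z)\<^sup>2 * snd z - 2/3 * s t * (1 + fst z), (1 + fst z)\<^sup>2 * fst z - 2/3 * s t * snd z)"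
    for t and z :: "real \<times> real"
  define z0 where "z0 = (1 / r0 - 1, v0)"
  \<comment> \<open>The derivative of w^2 + v^2 is - 4/3 s (w^2 + v^2 + w), which is nonpositive as
    soon as w^2 + v^2 \<ge> 1. Balls of radius at least 1 are therefore forward invariant.\<close>
  define R where "R = max 1 (norm z0)"
  let ?D = "cball 0 (R + 1) :: (real \<times> real) set"
  have tf: "tame 0 0 f ?D"
    unfolding f_def by (rule tame_polynomial_field[OF cs, where B = "sigma_of \<delta> l0"]) (use s in auto)
  obtain B where B: "B \<ge> 0" "\<And>t z. t \<ge> 0 \<Longrightarrow> z \<in> ?D \<Longrightarrow> norm (f t z) \<le> B * (1 + t) powr 0"
    using gboundE[OF tame_gbound[OF tf]] by blast
  obtain L where L: "L \<ge> 0" "\<And>t x y. t \<ge> 0 \<Longrightarrow> x \<in> ?D \<Longrightarrow> y \<in> ?D \<Longrightarrow>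
      norm (f t x - f t y) \<le> L * (1 + t) powr 0 * norm (x - y)"
    using glipE[OF tame_glip[OF tf]] by blast
  obtain z where z: "z 0 = z0" "\<And>t. t \<ge> 0 \<Longrightarrow> z t \<in> cball 0 R"
    "\<And>t. t \<ge> 0 \<Longrightarrow> (z has_vector_derivative f t (z t)) (at t within {0..})"
  proof (rule ode_confined[of ?D f L B z0 "cball 0 R"])
    show "continuous_on {0..} (\<lambda>t. f t y)" if "y \<in> ?D" for y by (rule glip_cont[OF tame_glip[OF tf] that])
    show "norm (f t x - f t y) \<le> L * norm (x - y)" if "t \<ge> 0" "x \<in> ?D" "y \<in> ?D" for t x y
      using L(2)[OF that] that(1) by simp
    show "norm (f t y) \<le> B" if "t \<ge> 0" "y \<in> ?D" for t y using B(2)[OF that] that(1) by simp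
    show "cball 0 R \<subseteq> interior ?D" by (auto simp: R_def)
  next
    fix T :: real and x
    assume T: "T \<ge> 0" and x0: "x 0 = z0"
      and x: "\<And>t. 0 \<le> t \<Longrightarrow> t \<le> T \<Longrightarrow> x t \<in> ?D \<and> (x has_vector_derivative f t (x t)) (at t within {0..T})"
    let ?g = "\<lambda>t. (fst (x t))\<^sup>2 + (snd (x t))\<^sup>2"
    have "?g T \<le> R\<^sup>2"
    proof (rule barrier[OF T])
      show "?g 0 \<le> R\<^sup>2" using power_mono[of "norm z0" R 2] by (simp add: x0 R_def norm_prod_def)
      fix t assume t: "0 \<le> t" "t \<le> T"
      note dx = x[OF t, THEN conjunct2]
      have d1: "((\<lambda>t. fst (x t)) has_real_derivative fst (f t (x t))) (at t within {0..T})"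
        using bounded_linear.has_vector_derivative[OF bounded_linear_fst dx]
        by (simp add: has_real_derivative_iff_has_vector_derivative)
      have d2: "((\<lambda>t. snd (x t)) has_real_derivative snd (f t (x t))) (at t within {0..T})"
        using bounded_linear.has_vector_derivative[OF bounded_linear_snd dx]
        by (simp add: has_real_derivative_iff_has_vector_derivative)
      show "(?g has_real_derivative - 2 * (2/3 * s t) * (?g t + fst (x t))) (at t within {0..T})"
      proof -
        have "(?g has_real_derivative 2 * fst (x t) * fst (f t (x t)) + 2 * snd (x t) * snd (f t (x t))) (at t within {0..T})"
          by (auto intro!: derivative_eq_intros d1 d2)
        then show ?thesis by (rule DERIV_cong) (simp add: f_def power2_eq_square field_simps)
      qed
      assume "R\<^sup>2 \<le> ?g t"
      moreover have "1\<^sup>2 \<le> R\<^sup>2" by (rule power_mono) (auto simp: R_def)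
      ultimately have g1: "1 \<le> ?g t" by simp
      have "- fst (x t) \<le> ?g t"
      proof (rule power2_le_imp_le)
        have "(- fst (x t))\<^sup>2 \<le> ?g t" by simp
        also have "\<dots> \<le> (?g t)\<^sup>2" using mult_right_mono[OF g1, of "?g t"] by (simp add: power2_eq_square)
        finally show "(- fst (x t))\<^sup>2 \<le> (?g t)\<^sup>2" .
      qed simp
      then show "- 2 * (2/3 * s t) * (?g t + fst (x t)) \<le> 0"
        using s[OF t(1)] by (auto intro!: mult_nonpos_nonneg)
    qed
    then have "norm (x T) \<le> R" by (simp add: norm_prod_def real_le_lsqrt R_def)
    then show "x T \<in> cball 0 R" by simp
  qed (auto simp: R_def)
  define w v where "w t = fst (z t)" and "v t = snd (z t)" for t
  have dw: "(w has_real_derivative - (1 + w t)\<^sup>2 * v t - 2/3 * s t * (1 + w t)) (at t within {0..})" if "t \<ge> 0" for t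
    using bounded_linear.has_vector_derivative[OF bounded_linear_fst z(3)[OF that]]
    by (simp add: has_real_derivative_iff_has_vector_derivative w_def[abs_def] v_def f_def)
  have dv: "(v has_real_derivative (1 + w t)\<^sup>2 * w t - 2/3 * s t * v t) (at t within {0..})" if "t \<ge> 0" for t
    using bounded_linear.has_vector_derivative[OF bounded_linear_snd z(3)[OF that]]
    by (simp add: has_real_derivative_iff_has_vector_derivative v_def[abs_def] w_def f_def)
  have cw: "continuous_on {0..} w" and cv: "continuous_on {0..} v"
    by (rule DERIV_continuous_on[OF dw], simp) (rule DERIV_continuous_on[OF dv], simp)
  \<comment> \<open>1 + w is 1 / r and solves a homogeneous linear equation, so r stays positive and
    finite.\<close>
  have pos: "1 + w t > 0" if t: "t \<ge> 0" for t
  proof -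
    have "1 + w t = (1 + w 0) * exp (integral {0..t} (\<lambda>t. - ((1 + w t) * v t + 2/3 * s t)))"
    proof (rule homogeneous_linear_solution[where y = "\<lambda>t. 1 + w t" and m = "\<lambda>t. - ((1 + w t) * v t + 2/3 * s t)"])
      fix u assume u: "0 \<le> u" "u \<le> t"
      have "((\<lambda>t. 1 + w t) has_real_derivative 0 + (- (1 + w u)\<^sup>2 * v u - 2/3 * s u * (1 + w u))) (at u within {0..t})"
        by (rule DERIV_add[OF DERIV_const DERIV_subset[OF dw]]) (use u in auto)
      then show "((\<lambda>t. 1 + w t) has_real_derivative - ((1 + w u) * v u + 2/3 * s u) * (1 + w u)) (at u within {0..t})"
        by (rule DERIV_cong) (simp add: power2_eq_square algebra_simps)
    next
      have "continuous_on {0..} (\<lambda>t. - ((1 + w t) * v t + 2/3 * s t))" by (intro continuous_intros cw cv cs)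
      then show "continuous_on {0..t} (\<lambda>t. - ((1 + w t) * v t + 2/3 * s t))" by (rule continuous_on_subset) auto
    qed (rule t)
    moreover have "1 + w 0 > 0" using r0 by (simp add: w_def z(1) z0_def)
    ultimately show ?thesis by simp
  qed
  have sol: "is_solution \<delta> (r0, v0, l0) (\<lambda>t. (1 / (1 + w t), v t, l_of \<delta> l0 t))"
    unfolding is_solution_def
  proof (intro conjI allI impI)
    show "(1 / (1 + w 0), v 0, l_of \<delta> l0 0) = (r0, v0, l0)"
      using r0 by (simp add: w_def v_def z(1) z0_def l_of_def)
    fix t :: real assume t: "0 \<le> t"
    have p: "1 + w t > 0" by (rule pos[OF t])
    show "(1 / (1 + w t), v t, l_of \<delta> l0 t) \<in> phase_space"
      using p sigma_l_of(2)[OF \<delta> l0 t] by (simp add: phase_space_def)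
    let ?l = "l_of \<delta> l0 t"
    have k: "2/3 * s t = 2 * \<delta> * ?l ^ 3" by (simp add: s_def sigma_of_def)
    have "((\<lambda>t. 1 / (1 + w t)) has_real_derivative - (- (1 + w t)\<^sup>2 * v t - 2/3 * s t * (1 + w t)) / (1 + w t)\<^sup>2) (at t within {0..})"
      using p by (auto intro!: derivative_eq_intros dw t simp: power2_eq_square)
    moreover have "- (- (1 + w t)\<^sup>2 * v t - 2/3 * s t * (1 + w t)) / (1 + w t)\<^sup>2 = v t + 2 * \<delta> * (1 / (1 + w t)) * ?l ^ 3"
      unfolding k using p by (simp add: power2_eq_square add_divide_distrib) 
    ultimately have 1: "((\<lambda>t. 1 / (1 + w t)) has_real_derivative v t + 2 * \<delta> * (1 / (1 + w t)) * ?l ^ 3) (at t within {0..})"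
      by simp
    have "(1 + w t)\<^sup>2 * w t - 2/3 * s t * v t = - (1 / (1 + w t) - 1) / (1 / (1 + w t)) ^ 3 - 2 * \<delta> * v t * ?l ^ 3"
    proof -
      have "- (1 / y - 1) / (1 / y) ^ 3 = y\<^sup>2 * (y - 1)" if "y > 0" for y :: real
        using that by (simp add: field_simps power2_eq_square power3_eq_cube)
      from this[OF p] show ?thesis unfolding k by simp
    qed
    then have 2: "(v has_real_derivative - (1 / (1 + w t) - 1) / (1 / (1 + w t)) ^ 3 - 2 * \<delta> * v t * ?l ^ 3) (at t within {0..})"
      using dv[OF t] by simp
    have "((\<lambda>t. (1 / (1 + w t), v t, l_of \<delta> l0 t)) has_vector_derivative
        (v t + 2 * \<delta> * (1 / (1 + w t)) * ?l ^ 3, - (1 / (1 + w t) - 1) / (1 / (1 + w t)) ^ 3 - 2 * \<delta> * v t * ?l ^ 3, - \<delta> * ?l ^ 4)) (at t within {0..})"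
      using 1 2 sigma_l_of(3)[OF \<delta> l0 t]
      by (intro has_vector_derivative_Pair) (auto simp: has_real_derivative_iff_has_vector_derivative)
    then show "((\<lambda>t. (1 / (1 + w t), v t, l_of \<delta> l0 t)) has_vector_derivative
        vector_field \<delta> (1 / (1 + w t), v t, l_of \<delta> l0 t)) (at t within {0..})"
      by (simp add: vector_field_def)
  qed
  show ?thesis
  proof (rule that[of w v])
    show "w 0 = 1 / r0 - 1" "v 0 = v0" by (simp_all add: w_def v_def z(1) z0_def)
  qed (use dw dv pos flow_eq[OF sol] in \<open>simp_all add: s_def\<close>)
qed

text \<open>Up to sign, w and v are the radial and tangential components of the eccentricity vector,
  so H is half its squared norm.\<close>

lemma H_of_w: "1 + w > 0 \<Longrightarrow> H (1 / (1 + w)) v = (w\<^sup>2 + v\<^sup>2) / 2"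
proof -
  assume w: "1 + w > 0"
  have "(1 / (1 + w) - 1)\<^sup>2 / (2 * (1 / (1 + w))\<^sup>2) = ((1 / (1 + w) - 1) / (1 / (1 + w)))\<^sup>2 / 2"
  proof -
    have "q\<^sup>2 / (2 * p\<^sup>2) = (q / p)\<^sup>2 / 2" for p q :: real by (simp add: power_divide)
    then show ?thesis .
  qed
  also have "(1 / (1 + w) - 1) / (1 / (1 + w)) = - w" using w by (simp add: field_simps)
  finally show ?thesis unfolding H_def by (simp add: add_divide_distrib)
qed

text \<open>If \<open>H\<close> ever falls below \<open>1/2\<close>, the energy of the Kepler ellipse is negative from then on, which
  bounds \<open>r l\<^sup>2\<close>, and \<open>H + 2 \<delta> l\<^sup>3 r v\<close> has an integrable derivative; otherwise \<open>H\<close> is nonincreasing.\<close>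

lemma energy_converges:
  assumes \<delta>: "\<delta> > 0" and l0: "l0 \<ge> 0"
    and dw: "\<And>t. t \<ge> 0 \<Longrightarrow> (w has_real_derivative - (1 + w t)\<^sup>2 * v t - 2/3 * sigma_of \<delta> (l_of \<delta> l0 t) * (1 + w t)) (at t within {0..})"
    and dv: "\<And>t. t \<ge> 0 \<Longrightarrow> (v has_real_derivative (1 + w t)\<^sup>2 * w t - 2/3 * sigma_of \<delta> (l_of \<delta> l0 t) * v t) (at t within {0..})"
    and pos: "\<And>t. t \<ge> 0 \<Longrightarrow> 1 + w t > 0"
  shows "\<exists>L. ((\<lambda>t. ((w t)\<^sup>2 + (v t)\<^sup>2) / 2) \<longlongrightarrow> L) at_top"
proof -
  define s where "s t = sigma_of \<delta> (l_of \<delta> l0 t)" for t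
  define g where "g t = (w t)\<^sup>2 + (v t)\<^sup>2" for t
  define l where "l = l_of \<delta> l0"
  have l: "l t \<ge> 0" "(l has_real_derivative - \<delta> * l t ^ 4) (at t within {0..})" if "t \<ge> 0" for t
    using sigma_l_of[OF \<delta> l0 that] by (auto simp: l_def)
  have sl: "s t = 3 * \<delta> * l t ^ 3" for t by (simp add: s_def sigma_of_def l_def)
  have s0: "s t \<ge> 0" if "t \<ge> 0" for t using l(1)[OF that] \<delta> by (simp add: sl)
  note dw' = dw[folded s_def] and dv' = dv[folded s_def]
  have dg: "(g has_real_derivative - 2 * (2/3 * s t) * (g t + w t)) (at t within {0..})" if t: "t \<ge> 0" for t
  proof -
    have "(g has_real_derivative 2 * w t * (- (1 + w t)\<^sup>2 * v t - 2/3 * s t * (1 + w t)) + 2 * v t * ((1 + w t)\<^sup>2 * w t - 2/3 * s t * v t)) (at t within {0..})"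
      unfolding g_def by (auto intro!: derivative_eq_intros dw' dv' t)
    then show ?thesis by (rule DERIV_cong) (simp add: g_def power2_eq_square field_simps)
  qed
  show ?thesis
  \<comment> \<open>g = 2 H has derivative - 4/3 s (g + w). This is 0 if l0 = 0, and nonpositive
    while g \<ge> 1, since then - w \<le> g. The other case is an orbit with l0 > 0 that is
    elliptic, g < 1, at some time.\<close>
  proof (cases "l0 = 0 \<or> (\<forall>t\<ge>0. g t \<ge> 1)")
    case True
    have "- 2 * (2/3 * s t) * (g t + w t) \<le> 0" if t: "t \<ge> 0" for t
    proof (cases "l0 = 0")
      case True then show ?thesis by (simp add: s_def sigma_of_def l_of_def)
    next
      case False
      then have g1: "1 \<le> g t" using \<open>l0 = 0 \<or> _\<close> t by blast
      have "- w t \<le> g t"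
      proof (rule power2_le_imp_le)
        have "(- w t)\<^sup>2 \<le> g t" by (simp add: g_def)
        also have "\<dots> \<le> (g t)\<^sup>2" using mult_right_mono[OF g1, of "g t"] g1 by (simp add: power2_eq_square)
        finally show "(- w t)\<^sup>2 \<le> (g t)\<^sup>2" .
      qed (use g1 in simp)
      then show ?thesis using s0[OF t] by (auto intro!: mult_nonpos_nonneg)
    qed
    then have mono: "g t \<le> g u" if "0 \<le> u" "u \<le> t" for u t
      using that by (intro halfline_nonincreasing[OF that(2), where A = "{0..}", OF dg]) auto
    obtain L where "(g \<longlongrightarrow> L) at_top"
      using nonincreasing_convergent[of 0 g 0] mono by (auto simp: g_def)
    then have "((\<lambda>t. g t / 2) \<longlongrightarrow> L / 2) at_top" by (intro tendsto_intros) auto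
    then show ?thesis unfolding g_def by blast
  next
    case False
    then obtain t0 where l0': "l0 > 0" and t0: "t0 \<ge> 0" "g t0 < 1" using l0 by (auto simp: not_le)
    have lp: "l t > 0" if "t \<ge> 0" for t
    proof -
      have "1 + sigma_of \<delta> l0 * t > 0" using \<delta> l0 that by (simp add: sigma_of_def add_pos_nonneg)
      then show ?thesis using l0' by (simp add: l_def l_of_def)
    qed
    \<comment> \<open>J is -2 times the Kepler energy, by e^2 = 1 + 2 (energy) l^2; drag dissipates
      energy, so J increases.\<close>
    define J where "J t = (1 - g t) / (l t)\<^sup>2" for t
    have dJ: "(J has_real_derivative 2 * \<delta> * l t * ((1 + w t)\<^sup>2 + (v t)\<^sup>2)) (at t within {0..})" if t: "t \<ge> 0" for t
    proof -
      have "(J has_real_derivative ((0 - (- 2 * (2/3 * s t) * (g t + w t))) * (l t)\<^sup>2 - (1 - g t) * (2 * l t * (- \<delta> * l t ^ 4))) / ((l t)\<^sup>2 * (l t)\<^sup>2)) (at t within {0..})"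
        unfolding J_def using lp[OF t] by (auto intro!: derivative_eq_intros dg l t)
      moreover have "((0 - (- 2 * (2/3 * (3 * \<delta> * y ^ 3)) * (G + W))) * y\<^sup>2 - (1 - G) * (2 * y * (- \<delta> * y ^ 4))) / (y\<^sup>2 * y\<^sup>2)
          = 2 * \<delta> * y * (1 + 2 * W + G)" if "y > 0" for y G W :: real
        using that by (simp add: field_simps power2_eq_square power3_eq_cube power4_eq_xxxx)
      moreover have "1 + 2 * w t + g t = (1 + w t)\<^sup>2 + (v t)\<^sup>2" by (simp add: g_def power2_eq_square algebra_simps)
      ultimately show ?thesis using lp[OF t] by (simp add: sl)
    qed
    define J0 where "J0 = J t0"
    have J0: "J0 > 0" using t0 lp[OF t0(1)] by (simp add: J0_def J_def)
    have Jge: "J0 * (l t)\<^sup>2 \<le> 1 - g t" if t: "t0 \<le> t" for t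
    proof -
      have "- J t \<le> - J t0"
      proof (rule halfline_nonincreasing[OF t, where A = "{0..}" and g = "\<lambda>t. - J t"
            and g' = "\<lambda>t. - (2 * \<delta> * l t * ((1 + w t)\<^sup>2 + (v t)\<^sup>2))"])
        fix u assume u: "t0 \<le> u" "u \<le> t"
        then show "((\<lambda>t. - J t) has_real_derivative - (2 * \<delta> * l u * ((1 + w u)\<^sup>2 + (v u)\<^sup>2))) (at u within {0..})"
          using t0 by (intro DERIV_minus dJ) auto
        show "- (2 * \<delta> * l u * ((1 + w u)\<^sup>2 + (v u)\<^sup>2)) \<le> 0" using u t0 \<delta> l(1)[of u] by simp
      qed (use t0 in auto)
      then show ?thesis using lp[of t] t t0 by (simp add: J0_def J_def field_simps)
    qed
    \<comment> \<open>The distance to the centre is at most twice the semimajor axis: r l^2 \<le> 2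
      / J0. This controls the product l^3 r v in \<open>H1\<close>, although no bound on r alone is
      available here.\<close>
    have wge: "J0 * (l t)\<^sup>2 / 2 \<le> 1 + w t" and vle: "\<bar>v t\<bar> \<le> 1" if t: "t0 \<le> t" for t
    proof -
      have "0 \<le> (1 + w t)\<^sup>2 + (v t)\<^sup>2" by simp
      then have "1 - g t \<le> 2 * (1 + w t)" by (simp add: g_def power2_eq_square algebra_simps)
      then show "J0 * (l t)\<^sup>2 / 2 \<le> 1 + w t" using Jge[OF t] by simp
      have "0 \<le> J0 * (l t)\<^sup>2" using J0 by simp
      then have "(v t)\<^sup>2 \<le> 1" using Jge[OF t] by (simp add: g_def) (smt (verit) zero_le_power2)
      then show "\<bar>v t\<bar> \<le> 1" by (simp add: abs_square_le_1)
    qed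
    have rv: "\<bar>v t / (1 + w t)\<bar> \<le> 2 / (J0 * (l t)\<^sup>2)" if t: "t0 \<le> t" for t
    proof -
      have p: "0 < J0 * (l t)\<^sup>2 / 2" using J0 lp[of t] t t0 by simp
      have "\<bar>v t / (1 + w t)\<bar> = \<bar>v t\<bar> / (1 + w t)" using pos[of t] t t0 by simp
      also have "\<dots> \<le> 1 / (J0 * (l t)\<^sup>2 / 2)" using vle[OF t] wge[OF t] p by (intro frac_le) auto
      finally show ?thesis by simp
    qed
    define H1 where "H1 t = g t / 2 + 2/3 * s t * (v t / (1 + w t))" for t
    have ds: "(s has_real_derivative - (s t)\<^sup>2) (at t within {0..})" if t: "t \<ge> 0" for t
    proof -
      have "(s has_real_derivative 3 * \<delta> * (3 * (- \<delta> * l t ^ 4) * (l t)\<^sup>2)) (at t within {0..})"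
        unfolding sl[abs_def] by (auto intro!: derivative_eq_intros l t)
      then show ?thesis by (rule DERIV_cong) (simp add: sl power2_eq_square power3_eq_cube power4_eq_xxxx)
    qed
    have dr: "((\<lambda>t. v t / (1 + w t)) has_real_derivative g t + w t) (at t within {0..})" if t: "t \<ge> 0" for t
    proof -
      have p: "1 + w t > 0" by (rule pos[OF t])
      have "((\<lambda>t. v t / (1 + w t)) has_real_derivative
          (((1 + w t)\<^sup>2 * w t - 2/3 * s t * v t) * (1 + w t) - v t * (0 + (- (1 + w t)\<^sup>2 * v t - 2/3 * s t * (1 + w t)))) / ((1 + w t) * (1 + w t))) (at t within {0..})"
        by (intro DERIV_divide dv' DERIV_add DERIV_const dw' t) (use p in simp)
      moreover have "((y\<^sup>2 * W - k * V) * y - V * (0 + (- y\<^sup>2 * V - k * y))) / (y * y) = y * W + V\<^sup>2" if "y > 0" for y W V k :: real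
      proof -
        have "(y\<^sup>2 * W - k * V) * y - V * (0 + (- y\<^sup>2 * V - k * y)) = (y * y) * (y * W + V\<^sup>2)"
          by (simp add: power2_eq_square algebra_simps)
        then show ?thesis using that by simp
      qed
      from this[OF p, of "w t" "2/3 * s t" "v t"] have
        "(((1 + w t)\<^sup>2 * w t - 2/3 * s t * v t) * (1 + w t) - v t * (0 + (- (1 + w t)\<^sup>2 * v t - 2/3 * s t * (1 + w t)))) / ((1 + w t) * (1 + w t)) = g t + w t"
        by (simp add: g_def power2_eq_square algebra_simps)
      ultimately show ?thesis by simp
    qed
    have dH1: "(H1 has_real_derivative - (2/3) * (s t)\<^sup>2 * (v t / (1 + w t))) (at t within {0..})" if t: "t \<ge> 0" for t
    proof -
      have "(H1 has_real_derivative (- 2 * (2/3 * s t) * (g t + w t)) / 2 + (2/3 * (- (s t)\<^sup>2) * (v t / (1 + w t)) + (g t + w t) * (2/3 * s t))) (at t within {0..})"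
        unfolding H1_def by (intro DERIV_add DERIV_mult DERIV_cdivide DERIV_cmult dg ds dr t)
      moreover have "(- 2 * (2/3 * S) * (G + W)) / 2 + (2/3 * (- S\<^sup>2) * q + (G + W) * (2/3 * S)) = - (2/3) * S\<^sup>2 * q"
        for S G W q :: real by (simp add: field_simps)
      ultimately show ?thesis by (rule DERIV_cong)
    qed
    \<comment> \<open>2/3 (3 \<delta> l^3)^2 times 2 / (J0 l^2) equals C \<delta> l^4 = - C l', so
      that \<open>H1\<close> + C l is nonincreasing.\<close>
    define C where "C = 12 * \<delta> / J0"
    define F where "F t = H1 t + C * l t" for t
    have sv: "\<bar>2/3 * (s t)\<^sup>2 * (v t / (1 + w t))\<bar> \<le> C * \<delta> * l t ^ 4"
      "\<bar>2/3 * s t * (v t / (1 + w t))\<bar> \<le> 4 * \<delta> / J0 * l t" if t: "t0 \<le> t" for t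
    proof -
      have lt: "l t > 0" using lp t t0 by simp
      have "\<bar>2/3 * (s t)\<^sup>2 * (v t / (1 + w t))\<bar> = 2/3 * (s t)\<^sup>2 * \<bar>v t / (1 + w t)\<bar>"
        unfolding abs_mult by simp
      also have "\<dots> \<le> 2/3 * (s t)\<^sup>2 * (2 / (J0 * (l t)\<^sup>2))" by (intro mult_left_mono rv t) auto
      also have "\<dots> = C * \<delta> * l t ^ 4" unfolding sl C_def using lt J0
        by (simp add: field_simps power2_eq_square power3_eq_cube power4_eq_xxxx)
      finally show "\<bar>2/3 * (s t)\<^sup>2 * (v t / (1 + w t))\<bar> \<le> C * \<delta> * l t ^ 4" .
      have "\<bar>2/3 * s t * (v t / (1 + w t))\<bar> = 2/3 * s t * \<bar>v t / (1 + w t)\<bar>"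
        unfolding abs_mult using s0[of t] t t0 by simp
      also have "\<dots> \<le> 2/3 * s t * (2 / (J0 * (l t)\<^sup>2))" using s0[of t] t t0 by (intro mult_left_mono rv) auto
      also have "\<dots> = 4 * \<delta> / J0 * l t" unfolding sl using lt J0
        by (simp add: field_simps power2_eq_square power3_eq_cube)
      finally show "\<bar>2/3 * s t * (v t / (1 + w t))\<bar> \<le> 4 * \<delta> / J0 * l t" .
    qed
    have mono: "F t \<le> F u" if "t0 \<le> u" "u \<le> t" for u t
    proof (rule halfline_nonincreasing[OF that(2), where A = "{0..}" and g = F
          and g' = "\<lambda>t. - (2/3) * (s t)\<^sup>2 * (v t / (1 + w t)) + C * (- \<delta> * l t ^ 4)"])
      fix x assume x: "u \<le> x" "x \<le> t"
      show "(F has_real_derivative - (2/3) * (s x)\<^sup>2 * (v x / (1 + w x)) + C * (- \<delta> * l x ^ 4)) (at x within {0..})"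
        unfolding F_def by (intro DERIV_add dH1 DERIV_cmult l) (use x that t0 in auto)
      show "- (2/3) * (s x)\<^sup>2 * (v x / (1 + w x)) + C * (- \<delta> * l x ^ 4) \<le> 0"
        using sv(1)[of x] x that unfolding abs_le_iff by linarith
    qed (use that t0 in auto)
    have C0: "C \<ge> 0" using \<delta> J0 by (simp add: C_def)
    have llim: "(l \<longlongrightarrow> 0) at_top" unfolding l_def by (rule l_of_tendsto[OF \<delta> l0])
    have lmono: "l t \<le> l t0" if "t0 \<le> t" for t
      by (rule halfline_nonincreasing[OF that, where A = "{0..}" and g' = "\<lambda>t. - \<delta> * l t ^ 4"]) (use l t0 \<delta> in auto)
    obtain L where L: "(F \<longlongrightarrow> L) at_top"
    proof (rule nonincreasing_convergent[of t0 F "- (4 * \<delta> / J0 * l t0)", OF mono])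
      fix t assume t: "t0 \<le> t"
      have "4 * \<delta> / J0 * l t \<le> 4 * \<delta> / J0 * l t0" using lmono[OF t] \<delta> J0 by (intro mult_left_mono) auto
      moreover have "0 \<le> g t / 2" by (simp add: g_def)
      moreover have "0 \<le> C * l t" using C0 l(1)[of t] t t0 by simp
      ultimately show "- (4 * \<delta> / J0 * l t0) \<le> F t"
        using sv(2)[OF t] unfolding F_def H1_def abs_le_iff by linarith
    qed auto
    have "((\<lambda>t. 2/3 * s t * (v t / (1 + w t))) \<longlongrightarrow> 0) at_top"
    proof (rule Lim_null_comparison)
      show "\<forall>\<^sub>F t in at_top. norm (2/3 * s t * (v t / (1 + w t))) \<le> 4 * \<delta> / J0 * l t"
        using eventually_ge_at_top[of t0] by eventually_elim (use sv(2) in simp)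
      show "((\<lambda>t. 4 * \<delta> / J0 * l t) \<longlongrightarrow> 0) at_top" using tendsto_mult_right_zero[OF llim] .
    qed
    from tendsto_diff[OF tendsto_diff[OF L tendsto_mult_right_zero[OF llim, of C]] this]
    have "((\<lambda>t. g t / 2) \<longlongrightarrow> L) at_top" by (simp add: F_def H1_def)
    then show ?thesis unfolding g_def by blast
  qed
qed

subsection \<open>The stable set and the limit energy\<close>

text \<open>\<open>flow\<close>, a definite description, and \<open>H_infinity\<close>, a
  \<open>Lim\<close>, are replaced once and for all by a concrete solution and a genuine
  limit.\<close>

lemma phase_limit:
  assumes \<delta>: "\<delta> > 0" and p: "(r0, v0, l0) \<in> phase_space"
  obtains w v where "w 0 = 1 / r0 - 1" "v 0 = v0"
    "\<And>t. t \<ge> 0 \<Longrightarrow> (w has_real_derivative - (1 + w t)\<^sup>2 * v t - 2/3 * sigma_of \<delta> (l_of \<delta> l0 t) * (1 + w t)) (at t within {0..})"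
    "\<And>t. t \<ge> 0 \<Longrightarrow> (v has_real_derivative (1 + w t)\<^sup>2 * w t - 2/3 * sigma_of \<delta> (l_of \<delta> l0 t) * v t) (at t within {0..})"
    "\<And>t. t \<ge> 0 \<Longrightarrow> 1 + w t > 0"
    "\<And>t. t \<ge> 0 \<Longrightarrow> flow \<delta> t (r0, v0, l0) = (1 / (1 + w t), v t, l_of \<delta> l0 t)"
    "((\<lambda>t. ((w t)\<^sup>2 + (v t)\<^sup>2) / 2) \<longlongrightarrow> H_infinity \<delta> (r0, v0, l0)) at_top"
proof -
  have rl: "r0 > 0" "l0 \<ge> 0" using p by (auto simp: phase_space_def)
  obtain w v where i: "w 0 = 1 / r0 - 1" "v 0 = v0"
    and dw: "\<And>t. t \<ge> 0 \<Longrightarrow> (w has_real_derivative - (1 + w t)\<^sup>2 * v t - 2/3 * sigma_of \<delta> (l_of \<delta> l0 t) * (1 + w t)) (at t within {0..})"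
    and dv: "\<And>t. t \<ge> 0 \<Longrightarrow> (v has_real_derivative (1 + w t)\<^sup>2 * w t - 2/3 * sigma_of \<delta> (l_of \<delta> l0 t) * v t) (at t within {0..})"
    and pos: "\<And>t. t \<ge> 0 \<Longrightarrow> 1 + w t > 0"
    and fl: "\<And>t. t \<ge> 0 \<Longrightarrow> flow \<delta> t (r0, v0, l0) = (1 / (1 + w t), v t, l_of \<delta> l0 t)"
    by (rule phase_solution[where ?v0.0 = v0, OF \<delta> rl]) (rule that; assumption)
  obtain L where L: "((\<lambda>t. ((w t)\<^sup>2 + (v t)\<^sup>2) / 2) \<longlongrightarrow> L) at_top"
    using energy_converges[OF \<delta> rl(2) dw dv pos] by blast
  have "\<forall>\<^sub>F t in at_top. ((w t)\<^sup>2 + (v t)\<^sup>2) / 2 = (case flow \<delta> t (r0, v0, l0) of (r, v, l) \<Rightarrow> H r v)"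
    using eventually_ge_at_top[of 0] by eventually_elim (simp add: fl H_of_w[OF pos])
  from Lim_transform_eventually[OF L this] have "H_infinity \<delta> (r0, v0, l0) = L"
    unfolding H_infinity_def by (intro tendsto_Lim) auto
  then show ?thesis using that[OF i dw dv pos fl] L by simp
qed

lemma Gamma1_of_w:
  assumes "1 + w > 0" "w\<^sup>2 + v\<^sup>2 = 2 * h"
  shows "(1 / (1 + w), v, 0) \<in> Gamma1 h"
  using assms H_of_w[of w v] by (simp add: Gamma1_def)

lemma abs_less_1_of_energy:
  assumes "w\<^sup>2 + v\<^sup>2 = 2 * h" "h < 1/2" shows "\<bar>w\<bar> < 1" "\<bar>v\<bar> < (1 :: real)"
proof -
  have "w\<^sup>2 \<le> w\<^sup>2 + v\<^sup>2" "v\<^sup>2 \<le> w\<^sup>2 + v\<^sup>2" by simp_all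
  then have "w\<^sup>2 < 1" "v\<^sup>2 < 1" using assms by linarith+
  then show "\<bar>w\<bar> < 1" "\<bar>v\<bar> < 1" by (simp_all add: abs_square_less_1)
qed

text \<open>H is not uniformly continuous as r tends to 0, but \<open>Gamma1 h\<close> lies in r >
  1/2, so points closer than 1/4 to it have r > 1/4, where 1 / r is Lipschitz. The constant 18 is
  (32 + 3) / 2 rounded up.\<close>

lemma energy_near_Gamma1:
  assumes w: "1 + w > 0" and q: "q \<in> Gamma1 h" and h: "h < 1/2"
    and \<eta>: "\<eta> \<le> 1/4" "dist (1 / (1 + w), v, l) q < \<eta>"
  shows "\<bar>(w\<^sup>2 + v\<^sup>2) / 2 - h\<bar> \<le> 18 * \<eta>"
proof -
  obtain r1 v1 where q1: "q = (r1, v1, 0)" "r1 > 0" "H r1 v1 = h" using q by (auto simp: Gamma1_def)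
  define w1 where "w1 = 1 / r1 - 1"
  have r1: "r1 = 1 / (1 + w1)" "1 + w1 > 0" using q1(2) by (simp_all add: w1_def)
  have e1: "w1\<^sup>2 + v1\<^sup>2 = 2 * h" using q1(3) H_of_w[OF r1(2), of v1] r1(1) by simp
  note a1 = abs_less_1_of_energy[OF e1 h]
  define y y1 where "y = 1 + w" and "y1 = 1 + w1"
  have y: "y > 0" "y1 > 0" "y1 < 2" using w r1 a1 by (auto simp: y_def y1_def)
  have d: "\<bar>1 / y - 1 / y1\<bar> < \<eta>" "\<bar>v - v1\<bar> < \<eta>"
    using \<eta>(2) triple_le_norm[of "(1 / (1 + w), v, l) - q"] unfolding q1(1) r1(1) dist_norm y_def y1_def
    by simp_all
  have "1 / y1 > 1/2" using y by (simp add: field_simps)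
  then have "1 / y > 1/4" using d(1) \<eta>(1) by linarith
  then have y4: "y < 4" using y by (simp add: field_simps)
  have "\<bar>y - y1\<bar> = y * y1 * \<bar>1 / y - 1 / y1\<bar>"
  proof -
    have "y1 - y = y * y1 * (1 / y - 1 / y1)" using y by (simp add: field_simps)
    then have "\<bar>y1 - y\<bar> = \<bar>y * y1\<bar> * \<bar>1 / y - 1 / y1\<bar>" by (simp add: abs_mult)
    then show ?thesis using y by (simp add: abs_minus_commute)
  qed
  also have "\<dots> \<le> 4 * 2 * \<eta>" by (intro mult_mono) (use y y4 d in auto)
  finally have dw: "\<bar>w - w1\<bar> \<le> 8 * \<eta>" by (simp add: y_def y1_def)
  have "\<bar>w\<^sup>2 - w1\<^sup>2\<bar> = \<bar>w - w1\<bar> * \<bar>w + w1\<bar>" by (simp add: power2_eq_square algebra_simps flip: abs_mult)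
  also have "\<dots> \<le> (8 * \<eta>) * 4" using dw a1 \<eta>(1) by (intro mult_mono) auto
  finally have 1: "\<bar>w\<^sup>2 - w1\<^sup>2\<bar> \<le> 32 * \<eta>" by simp
  have "\<bar>v\<^sup>2 - v1\<^sup>2\<bar> = \<bar>v - v1\<bar> * \<bar>v + v1\<bar>" by (simp add: power2_eq_square algebra_simps flip: abs_mult)
  also have "\<dots> \<le> \<eta> * 3" using d(2) a1 \<eta>(1) by (intro mult_mono) auto
  finally have "\<bar>v\<^sup>2 - v1\<^sup>2\<bar> \<le> 3 * \<eta>" by simp
  moreover have "\<eta> \<ge> 0" using d(2) by simp
  ultimately show ?thesis using 1 e1 unfolding abs_le_iff by (simp add: field_simps)
qed

text \<open>Scaling (w, v) by c moves a point radially to another energy level. The lower bound m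
  for 1 + w bounds r from above, which makes the displacement proportional to |c - 1|; the last
  summand is the distance to the plane l = 0.\<close>

lemma dist_scaled_Gamma1:
  assumes m: "0 < m" and w: "m \<le> 1 + w" "m \<le> 1 + c * w" and wv: "\<bar>w\<bar> \<le> 1" "\<bar>v\<bar> \<le> 1"
  shows "dist (1 / (1 + w), v, l) (1 / (1 + c * w), c * v, 0) \<le> (1 / m\<^sup>2 + 1) * \<bar>c - 1\<bar> + \<bar>l\<bar>"
proof -
  have p: "0 < 1 + w" "0 < 1 + c * w" using m w by auto
  have "1 / (1 + w) - 1 / (1 + c * w) = (c - 1) * w / ((1 + w) * (1 + c * w))"
    using p by (simp add: field_simps)
  then have "\<bar>1 / (1 + w) - 1 / (1 + c * w)\<bar> = \<bar>c - 1\<bar> * \<bar>w\<bar> / ((1 + w) * (1 + c * w))"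
    using p by (simp add: abs_mult)
  also have "\<dots> \<le> \<bar>c - 1\<bar> * 1 / (m * m)"
    by (intro frac_le mult_mono) (use m w wv in auto)
  finally have 1: "\<bar>1 / (1 + w) - 1 / (1 + c * w)\<bar> \<le> 1 / m\<^sup>2 * \<bar>c - 1\<bar>" by (simp add: power2_eq_square)
  have "\<bar>v - c * v\<bar> = \<bar>c - 1\<bar> * \<bar>v\<bar>" by (simp add: algebra_simps flip: abs_mult)
  also have "\<dots> \<le> \<bar>c - 1\<bar> * 1" using wv by (intro mult_left_mono) auto
  finally have 2: "\<bar>v - c * v\<bar> \<le> \<bar>c - 1\<bar>" by simp
  have "dist (1 / (1 + w), v, l) (1 / (1 + c * w), c * v, 0) \<le> \<bar>1 / (1 + w) - 1 / (1 + c * w)\<bar> + \<bar>v - c * v\<bar> + \<bar>l\<bar>"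
    using norm_triple_le[of "(1 / (1 + w), v, l) - (1 / (1 + c * w), c * v, 0)"] by (simp add: dist_norm)
  then show ?thesis using 1 2 by (simp add: algebra_simps)
qed

lemma stable_set_Gamma1:
  assumes \<delta>: "\<delta> > 0" and h: "0 < h" "h < 1/2"
  shows "stable_set \<delta> (Gamma1 h) = {p \<in> phase_space. H_infinity \<delta> p = h}"
proof -
  have "((\<lambda>t. infdist (flow \<delta> t p) (Gamma1 h)) \<longlongrightarrow> 0) at_top \<longleftrightarrow> H_infinity \<delta> p = h"
    if p: "p \<in> phase_space" for p
  proof -
    obtain r0 v0 l0 where p0: "p = (r0, v0, l0)" by (cases p) auto
    have l0: "l0 \<ge> 0" using p by (simp add: p0 phase_space_def)
    obtain w v where pos: "\<And>t. t \<ge> 0 \<Longrightarrow> 1 + w t > 0"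
      and fl: "\<And>t. t \<ge> 0 \<Longrightarrow> flow \<delta> t p = (1 / (1 + w t), v t, l_of \<delta> l0 t)"
      and lim: "((\<lambda>t. ((w t)\<^sup>2 + (v t)\<^sup>2) / 2) \<longlongrightarrow> H_infinity \<delta> p) at_top"
      using p unfolding p0 by (rule phase_limit[OF \<delta>]) blast
    show ?thesis
    proof
      assume inf: "((\<lambda>t. infdist (flow \<delta> t p) (Gamma1 h)) \<longlongrightarrow> 0) at_top"
      \<comment> \<open>\<open>infdist\<close> to the empty set is 0 by convention; only for a
        nonempty set does a small value yield a nearby point.\<close>
      have ne: "Gamma1 h \<noteq> {}" using Gamma1_of_w[of "sqrt (2 * h)" 0 h] h by (auto simp: add_pos_nonneg)
      have "((\<lambda>t. ((w t)\<^sup>2 + (v t)\<^sup>2) / 2) \<longlongrightarrow> h) at_top"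
      proof (rule tendstoI)
        fix \<epsilon> :: real assume \<epsilon>: "\<epsilon> > 0"
        define \<eta> where "\<eta> = min (1/4) (\<epsilon> / 36)"
        have \<eta>: "\<eta> > 0" "\<eta> \<le> 1/4" "18 * \<eta> < \<epsilon>" using \<epsilon> by (auto simp: \<eta>_def min_def)
        have "\<forall>\<^sub>F t in at_top. infdist (flow \<delta> t p) (Gamma1 h) < \<eta>"
          by (rule order_tendstoD(2)[OF inf \<eta>(1)])
        then show "\<forall>\<^sub>F t in at_top. dist (((w t)\<^sup>2 + (v t)\<^sup>2) / 2) h < \<epsilon>"
          using eventually_ge_at_top[of 0]
        proof eventually_elim
          case (elim t)
          have "\<exists>q\<in>Gamma1 h. dist (flow \<delta> t p) q < \<eta>"
          proof (rule ccontr)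
            assume "\<not> ?thesis"
            then have "\<eta> \<le> infdist (flow \<delta> t p) (Gamma1 h)"
              unfolding infdist_notempty[OF ne] by (intro cINF_greatest[OF ne]) (auto simp: not_less)
            then show False using elim by simp
          qed
          then obtain q where "q \<in> Gamma1 h" "dist (1 / (1 + w t), v t, l_of \<delta> l0 t) q < \<eta>"
            using fl[OF elim(2)] by auto
          from energy_near_Gamma1[OF pos[OF elim(2)] this(1) h(2) \<eta>(2) this(2)] show ?case
            using \<eta>(3) by (simp add: dist_real_def)
        qed
      qed
      with lim show "H_infinity \<delta> p = h" by (rule tendsto_unique[OF trivial_limit_at_top_linorder])
    next
      assume Hh: "H_infinity \<delta> p = h"
      define g where "g t = (w t)\<^sup>2 + (v t)\<^sup>2" for t
      \<comment> \<open>The radial factor that moves (w t, v t) onto the circle w^2 + v^2 = 2 h; it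
        tends to 1.\<close>
      define c where "c t = sqrt (2 * h / g t)" for t
      have g: "(g \<longlongrightarrow> 2 * h) at_top" 
      proof -
        have "g = (\<lambda>t. 2 * (((w t)\<^sup>2 + (v t)\<^sup>2) / 2))" by (simp add: g_def fun_eq_iff field_simps)
        then show ?thesis using tendsto_mult_left[OF lim[unfolded Hh], of 2] by simp
      qed
      have "(c \<longlongrightarrow> sqrt (2 * h / (2 * h))) at_top" unfolding c_def by (intro tendsto_intros g) (use h in auto)
      then have c1: "(c \<longlongrightarrow> 1) at_top" using h by simp
      \<comment> \<open>Half the distance between the circle w^2 + v^2 = 2 h and the line w = -1,
        where r is infinite. This is where h < 1/2 enters.\<close>
      define m where "m = (1 - sqrt (2 * h)) / 2"
      have s1: "sqrt (2 * h) < 1" using h by simp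
      have m: "m > 0" "sqrt (2 * h) \<le> 1 - m" using s1 by (auto simp: m_def field_simps)
      have "(1 - m)\<^sup>2 > (sqrt (2 * h))\<^sup>2" using m(1,2) s1 h by (intro power_strict_mono) (auto simp: m_def field_simps)
      then have ev: "\<forall>\<^sub>F t in at_top. 0 < g t \<and> g t < (1 - m)\<^sup>2"
        using order_tendstoD[OF g] h by (auto intro: eventually_conj)
      have bound: "infdist (flow \<delta> t p) (Gamma1 h) \<le> (1 / m\<^sup>2 + 1) * \<bar>c t - 1\<bar> + l_of \<delta> l0 t"
        if t: "t \<ge> 0" and gt: "0 < g t" "g t < (1 - m)\<^sup>2" for t
      proof -
        have "0 \<le> sqrt (2 * h)" using h by simp
        from order_trans[OF this m(2)] have m1: "1 - m \<ge> 0" "m \<le> 1" by simp_all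
        have "(w t)\<^sup>2 \<le> g t" "(v t)\<^sup>2 \<le> g t" by (simp_all add: g_def)
        then have "(w t)\<^sup>2 \<le> (1 - m)\<^sup>2" "(v t)\<^sup>2 \<le> (1 - m)\<^sup>2" using gt(2) by linarith+
        then have wv: "\<bar>w t\<bar> \<le> 1 - m" "\<bar>v t\<bar> \<le> 1 - m" using m1 by (auto simp: abs_le_square_iff[symmetric])
        have cg: "(c t)\<^sup>2 * g t = 2 * h" using gt h by (simp add: c_def)
        have e: "(c t * w t)\<^sup>2 + (c t * v t)\<^sup>2 = 2 * h" using cg by (simp add: g_def power_mult_distrib algebra_simps)
        have "(c t * w t)\<^sup>2 \<le> (c t * w t)\<^sup>2 + (c t * v t)\<^sup>2" by simp
        then have "\<bar>c t * w t\<bar> \<le> sqrt (2 * h)" unfolding e by (rule real_le_rsqrt[of "\<bar>c t * w t\<bar>", unfolded power2_abs])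
        then have cw: "m \<le> 1 + c t * w t" using m(2) by linarith
        have "(1 / (1 + c t * w t), c t * v t, 0) \<in> Gamma1 h"
          by (rule Gamma1_of_w[OF _ e]) (use cw m in linarith)
        then have "infdist (flow \<delta> t p) (Gamma1 h) \<le> dist (flow \<delta> t p) (1 / (1 + c t * w t), c t * v t, 0)"
          by (rule infdist_le)
        also have "\<dots> \<le> (1 / m\<^sup>2 + 1) * \<bar>c t - 1\<bar> + \<bar>l_of \<delta> l0 t\<bar>"
          unfolding fl[OF t] by (rule dist_scaled_Gamma1[OF m(1) _ cw]) (use wv m(1) in auto)
        finally show ?thesis using sigma_l_of(2)[OF \<delta> l0 t] by simp
      qed
      show "((\<lambda>t. infdist (flow \<delta> t p) (Gamma1 h)) \<longlongrightarrow> 0) at_top"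
      proof (rule Lim_null_comparison)
        show "\<forall>\<^sub>F t in at_top. norm (infdist (flow \<delta> t p) (Gamma1 h)) \<le> (1 / m\<^sup>2 + 1) * \<bar>c t - 1\<bar> + l_of \<delta> l0 t"
          using ev eventually_ge_at_top[of 0]
          by eventually_elim (simp add: bound infdist_nonneg)
        have "((\<lambda>t. (1 / m\<^sup>2 + 1) * \<bar>c t - 1\<bar> + l_of \<delta> l0 t) \<longlongrightarrow> (1 / m\<^sup>2 + 1) * \<bar>1 - 1\<bar> + 0) at_top"
          by (intro tendsto_intros c1 l_of_tendsto \<delta> l0)
        then show "((\<lambda>t. (1 / m\<^sup>2 + 1) * \<bar>c t - 1\<bar> + l_of \<delta> l0 t) \<longlongrightarrow> 0) at_top" by simp
      qed
    qed
  qed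
  then show ?thesis by (auto simp: stable_set_def)
qed

section \<open>Agreement of the limits in the two time variables\<close>

context annulus_flow
begin

text \<open>The curve (e cos \<phi>, e sin \<phi>) along the flow in angle time, and the solution
  (w, v) read off at the time \<rho>, solve the same nonautonomous equation with the same initial
  value and hence coincide. Since \<rho> tends to infinity, the two limits agree.\<close>

lemma H_infinity_eq_Kinf:
  assumes \<delta>: "\<delta> > 0" and l: "l \<ge> 0" and p: "(e, \<phi>, sigma_of \<delta> l) \<in> S"
  shows "H_infinity \<delta> (1 / (1 + e * cos \<phi>), e * sin \<phi>, l) = Kinf (e, \<phi>, sigma_of \<delta> l)"
proof -
  define p where "p = (e, \<phi>, sigma_of \<delta> l)"
  have pS: "p \<in> S" using p by (simp add: p_def)
  have pD: "p \<in> D" using X_D[OF pS, of 0] X_0[OF pS] by simp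
  have y0: "1 + e * cos \<phi> > 0" 
  proof -
    have "\<bar>e\<bar> < b" using pD ab by (simp add: p_def mem_slab)
    from one_plus_ecos[OF this, of \<phi>] show ?thesis using ab by linarith
  qed
  have ps: "(1 / (1 + e * cos \<phi>), e * sin \<phi>, l) \<in> phase_space" using y0 l by (simp add: phase_space_def)
  obtain w v where i: "w 0 = 1 / (1 / (1 + e * cos \<phi>)) - 1" "v 0 = e * sin \<phi>"
    and dw: "\<And>t. t \<ge> 0 \<Longrightarrow> (w has_real_derivative - (1 + w t)\<^sup>2 * v t - 2/3 * sigma_of \<delta> (l_of \<delta> l t) * (1 + w t)) (at t within {0..})"
    and dv: "\<And>t. t \<ge> 0 \<Longrightarrow> (v has_real_derivative (1 + w t)\<^sup>2 * w t - 2/3 * sigma_of \<delta> (l_of \<delta> l t) * v t) (at t within {0..})"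
    and lim: "((\<lambda>t. ((w t)\<^sup>2 + (v t)\<^sup>2) / 2) \<longlongrightarrow> H_infinity \<delta> (1 / (1 + e * cos \<phi>), e * sin \<phi>, l)) at_top"
    by (rule phase_limit[OF \<delta> ps]) (rule that; assumption)
  define s where "s t = sig (X t p)" for t
  define F where "F t z = f2 (X t p) *\<^sub>R (- (1 + fst z)\<^sup>2 * snd z - 2/3 * s t * (1 + fst z), (1 + fst z)\<^sup>2 * fst z - 2/3 * s t * snd z)"
    for t and z :: "real \<times> real"
  define x1 where "x1 t = (ecc (X t p) * cos (ang (X t p)), ecc (X t p) * sin (ang (X t p)))" for t
  define x2 where "x2 t = (w (\<rho> t p), v (\<rho> t p))" for t
  have \<rho>0: "\<rho> t p \<ge> 0" if "t \<ge> 0" for t using \<rho>_ge[OF pS that] that by simp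
  have sl: "sigma_of \<delta> (l_of \<delta> l (\<rho> t p)) = s t" if "t \<ge> 0" for t
    using sigma_l_of(1)[OF \<delta> l \<rho>0[OF that]] X_sig_bounds(3)[OF pS that] by (simp add: s_def p_def)
  have dx2: "(x2 has_vector_derivative F t (x2 t)) (at t within {0..})" if t: "t \<ge> 0" for t
  proof -
    have im: "(\<lambda>t. \<rho> t p) ` {0..} \<subseteq> {0..}" using \<rho>0 by auto
    have "((w \<circ> (\<lambda>t. \<rho> t p)) has_real_derivative (- (1 + w (\<rho> t p))\<^sup>2 * v (\<rho> t p) - 2/3 * s t * (1 + w (\<rho> t p))) * f2 (X t p)) (at t within {0..})"
      by (rule DERIV_image_chain[OF DERIV_subset[OF dw[OF \<rho>0[OF t], unfolded sl[OF t]] im] \<rho>_deriv[OF pS t]])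
    moreover have "((v \<circ> (\<lambda>t. \<rho> t p)) has_real_derivative ((1 + w (\<rho> t p))\<^sup>2 * w (\<rho> t p) - 2/3 * s t * v (\<rho> t p)) * f2 (X t p)) (at t within {0..})"
      by (rule DERIV_image_chain[OF DERIV_subset[OF dv[OF \<rho>0[OF t], unfolded sl[OF t]] im] \<rho>_deriv[OF pS t]])
    ultimately show ?thesis
      unfolding x2_def F_def has_real_derivative_iff_has_vector_derivative comp_def
      by (auto intro!: has_vector_derivative_Pair simp: mult.commute)
  qed
  \<comment> \<open>The polar equations imply the Cartesian ones. The product E * M clears the 1 / E
    in \<open>Om\<close>, in accordance with the Cartesian field being regular at e = 0.\<close>
  have alg: "\<sigma> * (- (2/3) * (E + c) / M) * c - E * s = (1 / M) * (- (1 + E * c)\<^sup>2 * (E * s) - 2/3 * \<sigma> * (1 + E * c))"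
    "\<sigma> * (- (2/3) * (E + c) / M) * s + E * c = (1 / M) * ((1 + E * c)\<^sup>2 * (E * c) - 2/3 * \<sigma> * (E * s))"
    if "M = (1 + E * c)\<^sup>2 + 2/3 * \<sigma> * s / E" "M > 0" "E > 0" "c\<^sup>2 + s\<^sup>2 = 1" for E c s \<sigma> M :: real
  proof -
    have EM: "E * M = E * (1 + E * c)\<^sup>2 + 2/3 * \<sigma> * s" using that(1,3) by (simp add: algebra_simps)
    have cc: "c * c = 1 - s * s" using that(4) by (simp add: power2_eq_square)
    have 1: "\<sigma> * (- (2/3) * (E + c)) * c - (E * M) * s = - (1 + E * c)\<^sup>2 * (E * s) - 2/3 * \<sigma> * (1 + E * c)"
    proof -
      have "\<sigma> * (- (2/3) * (E + c)) * c - (E * M) * s = - (1 + E * c)\<^sup>2 * (E * s) - 2/3 * \<sigma> * (E * c + (c * c + s * s))"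
        unfolding EM by (simp add: field_simps)
      then show ?thesis unfolding cc by (simp add: algebra_simps)
    qed
    have 2: "\<sigma> * (- (2/3) * (E + c)) * s + (E * M) * c = (1 + E * c)\<^sup>2 * (E * c) - 2/3 * \<sigma> * (E * s)"
      unfolding EM by (simp add: algebra_simps)
    show "\<sigma> * (- (2/3) * (E + c) / M) * c - E * s = (1 / M) * (- (1 + E * c)\<^sup>2 * (E * s) - 2/3 * \<sigma> * (1 + E * c))"
      unfolding 1[symmetric] using that(2) by (simp add: diff_divide_distrib)
    show "\<sigma> * (- (2/3) * (E + c) / M) * s + E * c = (1 / M) * ((1 + E * c)\<^sup>2 * (E * c) - 2/3 * \<sigma> * (E * s))"
      unfolding 2[symmetric] using that(2) by (simp add: add_divide_distrib)
  qed
  have dx1: "(x1 has_vector_derivative F t (x1 t)) (at t within {0..})" if t: "t \<ge> 0" for t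
  proof -
    let ?x = "X t p"
    have xD: "?x \<in> D" by (rule X_D[OF pS t])
    have E: "ecc ?x > 0" using xD ab by (simp add: mem_slab)
    note a = alg[OF Om_def[of ?x] Om_pos[OF xD] E sin_cos_squared_add2]
    have "((\<lambda>t. ecc (X t p) * cos (ang (X t p))) has_real_derivative (sig ?x * f1 ?x) * cos (ang ?x) - ecc ?x * sin (ang ?x)) (at t within {0..})"
      by (auto intro!: derivative_eq_intros X_components[OF pS t])
    moreover have "((\<lambda>t. ecc (X t p) * sin (ang (X t p))) has_real_derivative (sig ?x * f1 ?x) * sin (ang ?x) + ecc ?x * cos (ang ?x)) (at t within {0..})"
      by (auto intro!: derivative_eq_intros X_components[OF pS t])
    moreover have "F t (x1 t) = ((sig ?x * f1 ?x) * cos (ang ?x) - ecc ?x * sin (ang ?x), (sig ?x * f1 ?x) * sin (ang ?x) + ecc ?x * cos (ang ?x))"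
      unfolding F_def x1_def f1_def f2_def s_def fst_conv snd_conv scaleR_Pair real_scaleR_def a ..
    ultimately show ?thesis
      unfolding x1_def has_real_derivative_iff_has_vector_derivative by (simp add: has_vector_derivative_Pair)
  qed
  have cont: "continuous_on {0..} x1" "continuous_on {0..} x2"
    by (rule continuous_on_vector_derivative[OF dx1], simp, rule continuous_on_vector_derivative[OF dx2], simp)
  have eq: "x1 T = x2 T" if T: "T \<ge> 0" for T
  proof -
    have "bounded (x1 ` {0..T} \<union> x2 ` {0..T})"
      by (intro bounded_Un[THEN iffD2] conjI compact_imp_bounded compact_continuous_image continuous_on_subset[OF cont(1)]
          continuous_on_subset[OF cont(2)]) auto
    then obtain R where R: "\<forall>y\<in>x1 ` {0..T} \<union> x2 ` {0..T}. norm y \<le> R" by (auto simp: bounded_iff)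
    have cs: "continuous_on {0..} s" unfolding s_def by (intro continuous_intros X_cont pS)
    have sb: "\<bar>s t\<bar> \<le> s1" if "t \<ge> 0" for t using X_D[OF pS that] by (simp add: s_def mem_slab)
    obtain L where L: "L \<ge> 0" "\<And>t x y. t \<ge> 0 \<Longrightarrow> x \<in> cball 0 R \<Longrightarrow> y \<in> cball 0 R \<Longrightarrow>
       norm ((- (1 + fst x)\<^sup>2 * snd x - 2/3 * s t * (1 + fst x), (1 + fst x)\<^sup>2 * fst x - 2/3 * s t * snd x) -
         (- (1 + fst y)\<^sup>2 * snd y - 2/3 * s t * (1 + fst y), (1 + fst y)\<^sup>2 * fst y - 2/3 * s t * snd y)) \<le> L * (1 + t) powr 0 * norm (x - y)"
      using glipE[OF tame_glip[OF tame_polynomial_field[OF cs sb]]] by blast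
    obtain B where B: "B \<ge> 0" "\<And>x. x \<in> D \<Longrightarrow> \<bar>f2 x\<bar> \<le> B" using f_Lipschitz by metis
    show ?thesis
    proof (rule ode_unique[where f = F and L = "B * L", OF _ _ _ _ T])
      fix t assume t: "0 \<le> t" "t \<le> T"
      show "(x1 has_vector_derivative F t (x1 t)) (at t within {0..T})" "(x2 has_vector_derivative F t (x2 t)) (at t within {0..T})"
        using dx1[OF t(1)] dx2[OF t(1)] by (auto intro: has_vector_derivative_within_subset)
      have "x1 t \<in> cball 0 R" "x2 t \<in> cball 0 R" using R t by auto
      from L(2)[OF t(1) this] t(1) have "norm (F t (x1 t) - F t (x2 t)) \<le> \<bar>f2 (X t p)\<bar> * (L * norm (x1 t - x2 t))"
        unfolding F_def scaleR_diff_right[symmetric] norm_scaleR by (intro mult_left_mono) auto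
      also have "\<dots> \<le> B * (L * norm (x1 t - x2 t))"
        by (intro mult_right_mono B(2) X_D[OF pS t(1)]) (use L(1) in auto)
      finally show "norm (F t (x1 t) - F t (x2 t)) \<le> B * L * norm (x1 t - x2 t)" by (simp add: mult_ac)
    next
      show "x1 0 = x2 0" using X_0[OF pS] i by (simp add: x1_def x2_def \<rho>_def p_def)
    qed
  qed
  have "filterlim (\<lambda>t. \<rho> t p) at_top at_top"
  proof (rule filterlim_at_top_mono)
    show "filterlim (\<lambda>t::real. 1/5 * t) at_top at_top"
      by (rule filterlim_tendsto_pos_mult_at_top[OF tendsto_const _ filterlim_ident]) simp
    show "\<forall>\<^sub>F t in at_top. 1/5 * t \<le> \<rho> t p" using eventually_ge_at_top[of 0]
      by eventually_elim (use \<rho>_ge[OF pS] in simp)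
  qed
  from filterlim_compose[OF lim this]
  have "((\<lambda>t. ((w (\<rho> t p))\<^sup>2 + (v (\<rho> t p))\<^sup>2) / 2) \<longlongrightarrow> H_infinity \<delta> (1 / (1 + e * cos \<phi>), e * sin \<phi>, l)) at_top" .
  moreover have "\<forall>\<^sub>F t in at_top. ((w (\<rho> t p))\<^sup>2 + (v (\<rho> t p))\<^sup>2) / 2 = (ecc (X t p))\<^sup>2 / 2"
    using eventually_ge_at_top[of 0]
  proof eventually_elim
    case (elim t)
    have "w (\<rho> t p) = ecc (X t p) * cos (ang (X t p))" "v (\<rho> t p) = ecc (X t p) * sin (ang (X t p))"
      using eq[OF elim] by (auto simp: x1_def x2_def)
    then show ?case by (simp add: power_mult_distrib flip: distrib_left)
  qed
  ultimately have "((\<lambda>t. (ecc (X t p))\<^sup>2 / 2) \<longlongrightarrow> H_infinity \<delta> (1 / (1 + e * cos \<phi>), e * sin \<phi>, l)) at_top"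
    by (rule Lim_transform_eventually)
  from tendsto_unique[OF trivial_limit_at_top_linorder this Kinf_tendsto[OF pS]] show ?thesis by (simp add: p_def)
qed

end

subsection \<open>Level sets in polar coordinates\<close>

lemma glip_of_derivative:
  fixes f :: "real \<Rightarrow> real"
  assumes I: "convex I" and d: "\<And>x. x \<in> I \<Longrightarrow> (f has_real_derivative f' x) (at x within I)"
    and B: "\<And>x. x \<in> I \<Longrightarrow> \<bar>f' x\<bar> \<le> B"
  shows "glip 0 (\<lambda>_. f) I"
proof (rule glipI[where C = B])
  fix t :: real and x y assume t: "t \<ge> 0" and xy: "x \<in> I" "y \<in> I"
  have "norm (f x - f y) \<le> B * norm (x - y)"
    by (rule field_differentiable_bound[OF I d]) (use B xy in auto)
  then show "norm (f x - f y) \<le> B * (1 + t) powr 0 * norm (x - y)" using t by simp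
qed auto

lemma tame_of_derivative:
  fixes f :: "real \<Rightarrow> real"
  assumes "glip 0 (\<lambda>_. f) I" "\<And>x. x \<in> I \<Longrightarrow> \<bar>f x\<bar> \<le> C"
    and d: "\<And>x. x \<in> I \<Longrightarrow> (f has_real_derivative f' x) (at x within I)"
    and t: "tame 0 k (\<lambda>_. f') I"
  shows "tame 0 (Suc k) (\<lambda>_. f) I"
proof -
  have "semitame 0 (Suc k) (\<lambda>_. f) I"
    by (rule semitame_SucI[where y' = "\<lambda>_ x h. f' x * h", OF assms(1)])
      (use d t in \<open>auto simp: has_field_derivative_def\<close>)
  moreover have "gbound 0 (\<lambda>_. f) I" by (rule gboundI[where C = C]) (use assms(2) in auto)
  ultimately show ?thesis by (simp add: tame_def)
qed

lemma tame_ident_bounded: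
  fixes I :: "real set" shows "(\<And>x. x \<in> I \<Longrightarrow> \<bar>x\<bar> \<le> B) \<Longrightarrow> tame 0 k (\<lambda>_ x. x) I"
  by (rule tame_bounded_linear[where B = B]) (auto intro: bounded_linear_ident)

lemma tame_arctan: "tame 0 k (\<lambda>_. arctan) {-1..1 :: real}"
proof -
  have d: "(arctan has_real_derivative inverse (1 + x\<^sup>2)) (at x within {-1..1})" for x
    by (rule DERIV_subset[OF DERIV_arctan]) simp
  have g: "glip 0 (\<lambda>_. arctan) {-1..1 :: real}"
  proof (rule glip_of_derivative[OF _ d])
    show "\<bar>inverse (1 + x\<^sup>2)\<bar> \<le> 1" for x :: real
      using le_imp_inverse_le[of 1 "1 + x\<^sup>2"] by simp
  qed simp
  have b: "\<bar>arctan x\<bar> \<le> 2" for x using arctan_bounded[of x] pi_less_4 by (auto simp: abs_le_iff)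
  have "tame 0 k (\<lambda>_ x. inverse (1 + x\<^sup>2)) {-1..1 :: real}"
    by (rule tame_inverse[where c = 1])
      (auto intro!: tame_add tame_const tame_power0 tame_ident_bounded[where B = 1])
  from tame_of_derivative[OF g b d this] have "tame 0 (Suc k) (\<lambda>_. arctan) {-1..1 :: real}" .
  then show ?thesis by (rule tame_le) simp
qed

text \<open>Bootstrap: the derivative is the inverse of 2 sqrt x, so order k gives order k + 1. The
  interval excludes 0, which keeps the inverse bounded.\<close>

lemma tame_sqrt:
  assumes c: "0 < c" shows "tame 0 k (\<lambda>_. sqrt) {c..1 :: real}"
proof -
  have d: "(sqrt has_real_derivative inverse (2 * sqrt x)) (at x within {c..1})" if "x \<in> {c..1}" for x
    using that c by (auto intro!: derivative_eq_intros simp: field_simps)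
  have low: "2 * sqrt c \<le> 2 * sqrt x" if "x \<in> {c..1}" for x using that by simp
  have pc: "0 < 2 * sqrt c" using c by simp
  have g: "glip 0 (\<lambda>_. sqrt) {c..1}"
  proof (rule glip_of_derivative[OF _ d])
    fix x assume x: "x \<in> {c..1}"
    have "inverse (2 * sqrt x) \<le> inverse (2 * sqrt c)" by (rule le_imp_inverse_le[OF low[OF x] pc])
    then show "\<bar>inverse (2 * sqrt x)\<bar> \<le> inverse (2 * sqrt c)" using x c by simp
  qed simp_all
  have b: "\<bar>sqrt x\<bar> \<le> 1" if "x \<in> {c..1}" for x using that c by simp
  have "tame 0 (Suc k) (\<lambda>_. sqrt) {c..1}"
  proof (induction k)
    case 0
    have "tame 0 0 (\<lambda>_. sqrt) {c..1}"
      using g b by (auto simp: tame_def intro!: gboundI[where C = 1])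
    then have "tame 0 0 (\<lambda>_ x. inverse (2 * sqrt x)) {c..1}"
      by (intro tame_inverse[OF pc] tame_mult0 tame_const) (use low pc in force)
    from tame_of_derivative[OF g b d this] show ?case .
  next
    case (Suc k)
    then have "tame 0 (Suc k) (\<lambda>_ x. inverse (2 * sqrt x)) {c..1}"
      by (intro tame_inverse[OF pc] tame_mult0 tame_const) (use low pc in force)
    from tame_of_derivative[OF g b d this] show ?case .
  qed
  then show ?thesis by (rule tame_le) simp
qed

text \<open>The third coordinate is here the angular momentum l itself and not 3 \<delta> l^3;
  \<open>sig\<close> serves as a mere projection.\<close>

definition polar :: "real \<times> real \<times> real \<Rightarrow> real \<times> real \<times> real" where
  "polar x = (1 / (1 + ecc x * cos (ang x)), ecc x * sin (ang x), sig x)"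

text \<open>This is 2 H; in polar coordinates it is e^2.\<close>

definition energy2 :: "real \<times> real \<times> real \<Rightarrow> real" where
  "energy2 p = (1 / fst p - 1)\<^sup>2 + (fst (snd p))\<^sup>2"

lemma one_plus_ecos_pos: "0 < e \<Longrightarrow> e < 1 \<Longrightarrow> 0 < 1 + e * cos (\<phi>::real)"
proof -
  assume e: "0 < e" "e < 1"
  have "\<bar>e * cos \<phi>\<bar> \<le> e * 1" unfolding abs_mult using e by (intro mult_mono) auto
  then show ?thesis using e by linarith
qed

lemma polar_w: "0 < e \<Longrightarrow> e < 1 \<Longrightarrow> 1 / fst (polar (e, \<phi>, l)) - 1 = e * cos \<phi>"
  by (simp add: polar_def)

lemma energy2_polar: "0 < e \<Longrightarrow> e < 1 \<Longrightarrow> energy2 (polar (e, \<phi>, l)) = e\<^sup>2"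
  unfolding energy2_def by (simp only: polar_w) (simp add: polar_def power_mult_distrib flip: distrib_left)

lemma polar_surj:
  assumes "r > 0" "e\<^sup>2 = (1 / r - 1)\<^sup>2 + v\<^sup>2" "e > 0"
  obtains \<phi> where "0 \<le> \<phi>" "\<phi> < 2 * pi" "(r, v, l) = polar (e, \<phi>, l)"
proof -
  have "((1 / r - 1) / e)\<^sup>2 + (v / e)\<^sup>2 = 1" 
  proof -
    have "((1 / r - 1) / e)\<^sup>2 + (v / e)\<^sup>2 = ((1 / r - 1)\<^sup>2 + v\<^sup>2) / e\<^sup>2"
      by (simp only: power_divide add_divide_distrib)
    then show ?thesis unfolding assms(2)[symmetric] using assms(3) by simp
  qed
  then obtain \<phi> where \<phi>: "0 \<le> \<phi>" "\<phi> < 2 * pi" "(1 / r - 1) / e = cos \<phi>" "v / e = sin \<phi>"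
    using sincos_total_2pi by metis
  have "e * cos \<phi> = 1 / r - 1" "e * sin \<phi> = v" using \<phi>(3,4) assms(3) by (auto simp: field_simps)
  then show ?thesis using that[OF \<phi>(1,2)] assms(1) by (simp add: polar_def)
qed

lemma polar_eqD:
  assumes eq: "polar (e, \<phi>, l) = polar (e', \<phi>', l')" and e: "0 < e" "e < 1" "0 < e'" "e' < 1"
  shows "e = e'" "cos \<phi> = cos \<phi>'" "sin \<phi> = sin \<phi>'" "l = l'"
proof -
  have "e\<^sup>2 = e'\<^sup>2" using energy2_polar[OF e(1,2), of \<phi> l] energy2_polar[OF e(3,4), of \<phi>' l'] eq by simp
  then show ee: "e = e'" using e by (simp add: power2_eq_iff)
  have "e * cos \<phi> = e' * cos \<phi>'" using polar_w[OF e(1,2), of \<phi> l] polar_w[OF e(3,4), of \<phi>' l'] eq by simp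
  then show "cos \<phi> = cos \<phi>'" using ee e by simp
  show "sin \<phi> = sin \<phi>'" "l = l'" using eq ee e by (auto simp: polar_def)
qed

lemma semitame_polar:
  fixes e \<phi> l :: "'p::euclidean_space \<Rightarrow> real"
  assumes "tame 0 k (\<lambda>_. e) S" "semitame 0 k (\<lambda>_. \<phi>) S" "semitame 0 k (\<lambda>_. l) S"
    and b: "b < 1" "\<And>x. x \<in> S \<Longrightarrow> 0 < e x \<and> e x < b"
  shows "semitame 0 k (\<lambda>_ x. polar (e x, \<phi> x, l x)) S"
proof -
  have low: "\<bar>1 + e x * cos (\<phi> x)\<bar> \<ge> 1 - b" if "x \<in> S" for x
  proof -
    have "\<bar>e x * cos (\<phi> x)\<bar> \<le> e x * 1" unfolding abs_mult using b(2)[OF that] by (intro mult_mono) auto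
    then show ?thesis using b(2)[OF that] by linarith
  qed
  have "tame 0 k (\<lambda>_ x. 1 / (1 + e x * cos (\<phi> x))) S"
    by (intro tame_divide[where c = "1 - b"] tame_add tame_const tame_mult0 tame_cos assms(1,2)) (use b(1) low in auto)
  moreover have "tame 0 k (\<lambda>_ x. e x * sin (\<phi> x)) S" by (intro tame_mult0 tame_sin assms(1,2))
  ultimately have "semitame 0 k (\<lambda>_ x. (1 / (1 + e x * cos (\<phi> x)), e x * sin (\<phi> x), l x)) S"
    by (intro semitame_Pair assms(3) tame_semitame)
  then show ?thesis by (simp add: polar_def)
qed

lemma semitame_continuous: "semitame 0 k' (\<lambda>_. f) S \<Longrightarrow> continuous_on S f"
  using semitame_Ck_on[of 0 f S] semitame_le[of 0 k' "\<lambda>_. f" S 0] by simp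

text \<open>Separates the geometry from the dynamics: G is a function on the phase space, K its
  polar form, and E exhibits the level sets of K as graphs over angle and angular momentum. One
  order more than k is assumed so that E has an angular derivative whatever k is.\<close>

locale polar_levels =
  fixes a1 b1 l0 h1 h2 :: real and k :: nat and K E G :: "real \<times> real \<times> real \<Rightarrow> real"
  assumes ab: "0 < a1" "a1 < b1" "b1 < 1" and l0: "0 < l0"
    and tK: "tame 0 (Suc k) (\<lambda>_. K) ({a1<..<b1} \<times> UNIV \<times> {0..<l0})"
    and tE: "semitame 0 (Suc k) (\<lambda>_. E) ({h1<..<h2} \<times> UNIV \<times> {0..<l0})"
    and E_bounds: "\<And>h \<phi> l. h1 < h \<Longrightarrow> h < h2 \<Longrightarrow> 0 \<le> l \<Longrightarrow> l < l0 \<Longrightarrow> a1 < E (h, \<phi>, l) \<and> E (h, \<phi>, l) < b1"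
    and E_iff: "\<And>h \<phi> l e. h1 < h \<Longrightarrow> h < h2 \<Longrightarrow> 0 \<le> l \<Longrightarrow> l < l0 \<Longrightarrow> a1 < e \<Longrightarrow> e < b1 \<Longrightarrow>
      K (e, \<phi>, l) = h \<longleftrightarrow> E (h, \<phi>, l) = e"
    and G: "\<And>e \<phi> l. a1 < e \<Longrightarrow> e < b1 \<Longrightarrow> 0 \<le> l \<Longrightarrow> l < l0 \<Longrightarrow> G (polar (e, \<phi>, l)) = K (e, \<phi>, l)"
begin

definition N :: "(real \<times> real \<times> real) set" where
  "N = {p \<in> phase_space. a1\<^sup>2 < energy2 p \<and> energy2 p < b1\<^sup>2 \<and> sig p < l0}"

definition \<Phi> :: "real \<times> real \<times> real \<Rightarrow> real \<times> real \<times> real" where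
  "\<Phi> x = polar (E x, fst (snd x), snd (snd x))"

lemma polar_N: assumes "a1 < e" "e < b1" "0 \<le> l" "l < l0" shows "polar (e, \<phi>, l) \<in> N"
proof -
  have e: "0 < e" "e < 1" using assms ab by auto
  have "a1\<^sup>2 < e\<^sup>2" "e\<^sup>2 < b1\<^sup>2" using assms ab by (auto intro!: power_strict_mono)
  then show ?thesis using assms one_plus_ecos_pos[OF e] energy2_polar[OF e]
    by (auto simp: N_def phase_space_def polar_def)
qed

lemma N_polar:
  assumes "p \<in> N"
  obtains e \<phi> l where "a1 < e" "e < b1" "0 \<le> \<phi>" "\<phi> < 2 * pi" "0 \<le> l" "l < l0" "p = polar (e, \<phi>, l)"
proof -
  obtain r v l where p: "p = (r, v, l)" by (cases p) auto
  have r: "r > 0" "0 \<le> l" "l < l0" and en: "a1\<^sup>2 < (1 / r - 1)\<^sup>2 + v\<^sup>2" "(1 / r - 1)\<^sup>2 + v\<^sup>2 < b1\<^sup>2"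
    using assms by (auto simp: p N_def phase_space_def energy2_def)
  define e where "e = sqrt ((1 / r - 1)\<^sup>2 + v\<^sup>2)"
  have e2: "e\<^sup>2 = (1 / r - 1)\<^sup>2 + v\<^sup>2" by (simp add: e_def)
  have e0: "0 \<le> e" by (simp add: e_def)
  have e: "a1 < e" "e < b1"
    using en ab e0 by (auto simp flip: e2 intro: power_less_imp_less_base[of _ 2])
  then have "e > 0" using ab by simp
  from polar_surj[OF r(1) e2 this] obtain \<phi> where "0 \<le> \<phi>" "\<phi> < 2 * pi" "(r, v, l) = polar (e, \<phi>, l)" by metis
  then show ?thesis using that e r p by blast
qed

lemma level_eq:
  assumes "h1 < h" "h < h2"
  shows "{p \<in> N. G p = h} = {\<Phi> (h, \<phi>, l) | \<phi> l. 0 \<le> \<phi> \<and> \<phi> < 2 * pi \<and> 0 \<le> l \<and> l < l0}"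
proof (intro equalityI subsetI)
  fix p assume "p \<in> {p \<in> N. G p = h}"
  then have p: "p \<in> N" "G p = h" by auto
  from p(1) obtain e \<phi> l where q: "a1 < e" "e < b1" "0 \<le> \<phi>" "\<phi> < 2 * pi" "0 \<le> l" "l < l0" "p = polar (e, \<phi>, l)"
    by (rule N_polar)
  have "E (h, \<phi>, l) = e" using G[OF q(1,2,5,6)] p(2) q(7) E_iff[OF assms q(5,6,1,2)] by simp
  then have "p = \<Phi> (h, \<phi>, l)" using q(7) by (simp add: \<Phi>_def)
  then show "p \<in> {\<Phi> (h, \<phi>, l) | \<phi> l. 0 \<le> \<phi> \<and> \<phi> < 2 * pi \<and> 0 \<le> l \<and> l < l0}" using q by blast
next
  fix p assume "p \<in> {\<Phi> (h, \<phi>, l) | \<phi> l. 0 \<le> \<phi> \<and> \<phi> < 2 * pi \<and> 0 \<le> l \<and> l < l0}"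
  then obtain \<phi> l where p: "p = polar (E (h, \<phi>, l), \<phi>, l)" "0 \<le> l" "l < l0" by (auto simp: \<Phi>_def)
  have e: "a1 < E (h, \<phi>, l)" "E (h, \<phi>, l) < b1" using E_bounds[OF assms p(2,3)] by auto
  show "p \<in> {p \<in> N. G p = h}"
    using polar_N[OF e p(2,3)] G[OF e p(2,3)] E_iff[OF assms p(2,3) e] p(1) by simp
qed

lemma tame_E: "tame 0 k (\<lambda>_. E) ({h1<..<h2} \<times> UNIV \<times> {0..<l0})"
  unfolding tame_def
proof
  show "gbound 0 (\<lambda>_. E) ({h1<..<h2} \<times> UNIV \<times> {0..<l0})"
  proof (rule gboundI[where C = 1])
    fix t :: real and x :: "real \<times> real \<times> real" assume "t \<ge> 0" "x \<in> {h1<..<h2} \<times> UNIV \<times> {0..<l0}"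
    then show "norm (E x) \<le> 1 * (1 + t) powr 0"
      using E_bounds[of "fst x" "snd (snd x)" "fst (snd x)"] ab by auto
  qed
  show "semitame 0 k (\<lambda>_. E) ({h1<..<h2} \<times> UNIV \<times> {0..<l0})" by (rule semitame_less[OF tE])
qed

lemma bounded_linear_coords:
  "bounded_linear (\<lambda>x::real \<times> real \<times> real. fst (snd x))" "bounded_linear (\<lambda>x::real \<times> real \<times> real. snd (snd x))"
  by (auto intro: bounded_linear_compose[OF bounded_linear_fst bounded_linear_snd]
      bounded_linear_compose[OF bounded_linear_snd bounded_linear_snd])

lemma semitame_\<Phi>: "semitame 0 k (\<lambda>_. \<Phi>) ({h1<..<h2} \<times> UNIV \<times> {0..<l0})"
  unfolding \<Phi>_def
proof (rule semitame_polar[OF tame_E])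
  show "0 < E x \<and> E x < b1" if "x \<in> {h1<..<h2} \<times> UNIV \<times> {0..<l0}" for x
    using that E_bounds[of "fst x" "snd (snd x)" "fst (snd x)"] ab by auto
qed (use ab in \<open>auto intro!: semitame_linear bounded_linear_coords\<close>)

lemma openin_N: "openin (top_of_set phase_space) N"
proof -
  have "continuous_on phase_space (\<lambda>p. (energy2 p, sig p))"
    unfolding energy2_def by (intro continuous_intros) (auto simp: phase_space_def)
  from continuous_openin_preimage_gen[OF this, of "{a1\<^sup>2<..<b1\<^sup>2} \<times> {..<l0}"]
  have "openin (top_of_set phase_space) (phase_space \<inter> (\<lambda>p. (energy2 p, sig p)) -` ({a1\<^sup>2<..<b1\<^sup>2} \<times> {..<l0}))"
    by (simp add: open_Times)
  moreover have "phase_space \<inter> (\<lambda>p. (energy2 p, sig p)) -` ({a1\<^sup>2<..<b1\<^sup>2} \<times> {..<l0}) = N"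
    by (auto simp: N_def)
  ultimately show ?thesis by simp
qed

lemma open_nbhd_N:
  assumes "a1\<^sup>2 < 2 * h" "2 * h < b1\<^sup>2" shows "open_nbhd (Gamma1 h) N"
proof -
  have "p \<in> N" if p: "p \<in> Gamma1 h" for p
  proof -
    obtain r v where q: "p = (r, v, 0)" "r > 0" "H r v = h" using p by (auto simp: Gamma1_def)
    have "1 + (1 / r - 1) > 0" using q(2) by simp
    from H_of_w[OF this, of v] have "energy2 p = 2 * h" using q by (simp add: energy2_def)
    then show ?thesis using assms q l0 by (simp add: N_def phase_space_def)
  qed
  then show ?thesis using openin_N by (auto simp: open_nbhd_def)
qed

text \<open>Periodicity of E follows from that of \<open>polar\<close> and from the uniqueness in
  \<open>E_iff\<close>. The immersion condition says that the polar angle advances at speed 1: d2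
  cos \<phi> - d1 sin \<phi> = e > 0 for the velocity (d1, d2) in the plane of w and v.\<close>

lemma angular_param_level:
  assumes h: "h1 < h" "h < h2"
  shows "angular_param k l0 (\<lambda>\<phi> l. \<Phi> (h, \<phi>, l)) {p \<in> N. G p = h}"
proof -
  have per: "E (h, \<phi> + 2 * pi, l) = E (h, \<phi>, l)" if l: "0 \<le> l" "l < l0" for \<phi> l
  proof -
    let ?e = "E (h, \<phi>, l)"
    have e: "a1 < ?e" "?e < b1" using E_bounds[OF h l] by auto
    have "polar (?e, \<phi> + 2 * pi, l) = polar (?e, \<phi>, l)" by (simp add: polar_def)
    then have "K (?e, \<phi> + 2 * pi, l) = h"
      using G[OF e l, of "\<phi> + 2 * pi"] G[OF e l, of \<phi>] E_iff[OF h l e, of \<phi>] by simp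
    then show ?thesis using E_iff[OF h l e] by simp
  qed
  have bij: "bij_betw (\<lambda>(\<phi>, l). \<Phi> (h, \<phi>, l)) ({0..<2 * pi} \<times> {0..<l0}) {p \<in> N. G p = h}"
    unfolding bij_betw_def
  proof
    show "inj_on (\<lambda>(\<phi>, l). \<Phi> (h, \<phi>, l)) ({0..<2 * pi} \<times> {0..<l0})"
    proof (rule inj_onI, clarify)
      fix \<phi> l \<phi>' l' assume a: "\<phi> \<in> {0..<2 * pi}" "l \<in> {0..<l0}" "\<phi>' \<in> {0..<2 * pi}" "l' \<in> {0..<l0}"
        and eq: "\<Phi> (h, \<phi>, l) = \<Phi> (h, \<phi>', l')"
      have e: "0 < E (h, \<phi>, l)" "E (h, \<phi>, l) < 1" "0 < E (h, \<phi>', l')" "E (h, \<phi>', l') < 1"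
        using E_bounds[OF h, of l \<phi>] E_bounds[OF h, of l' \<phi>'] a ab by auto
      note D = polar_eqD[OF eq[unfolded \<Phi>_def fst_conv snd_conv] e]
      from D(2,3) obtain n :: int where n: "\<phi>' = \<phi> + 2 * pi * n"
        using sin_cos_eq_iff[of \<phi>' \<phi>] by metis
      have "\<bar>2 * pi * real_of_int n\<bar> < 2 * pi * 1" using a n by auto
      then have "\<bar>real_of_int n\<bar> < 1" using pi_gt_zero by (simp add: abs_mult)
      then have "n = 0" by simp
      then show "\<phi> = \<phi>' \<and> l = l'" using n D(4) by simp
    qed
    show "(\<lambda>(\<phi>, l). \<Phi> (h, \<phi>, l)) ` ({0..<2 * pi} \<times> {0..<l0}) = {p \<in> N. G p = h}"
      unfolding level_eq[OF h] by (auto simp: image_iff) (metis atLeastLessThan_iff)+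
  qed
  have der: "\<exists>D. D \<noteq> 0 \<and> ((\<lambda>s. \<Phi> (h, s, l)) has_vector_derivative D) (at \<phi>)" if l: "0 \<le> l" "l < l0" for \<phi> l
  proof -
    let ?S = "{h1<..<h2} \<times> (UNIV :: real set) \<times> {0..<l0}"
    obtain E' where E': "\<And>t p. t \<ge> 0 \<Longrightarrow> p \<in> ?S \<Longrightarrow> (E has_derivative E' t p) (at p within ?S)"
      "\<And>b. b \<in> Basis \<Longrightarrow> tame 0 k (\<lambda>t p. E' t p b) ?S"
      using semitame_SucE[OF tE] by blast
    define d where "d = E' 0 (h, \<phi>, l) (0, 1, 0)"
    have "((\<lambda>s. E (h, s, l)) has_derivative (\<lambda>u. E' 0 (h, \<phi>, l) (0, u, 0))) (at \<phi> within UNIV)"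
    proof (rule has_derivative_in_compose[where f = "\<lambda>s. (h, s, l)" and f' = "\<lambda>u. (0, u, 0)" and g = E and g' = "E' 0 (h, \<phi>, l)"])
      show "((\<lambda>s. (h, s, l)) has_derivative (\<lambda>u. (0, u, 0))) (at \<phi> within UNIV)"
        by (intro has_derivative_Pair has_derivative_const has_derivative_ident)
      show "(E has_derivative E' 0 (h, \<phi>, l)) (at (h, \<phi>, l) within range (\<lambda>s. (h, s, l)))"
        by (rule has_derivative_subset[OF E'(1)]) (use h l in auto)
    qed
    moreover have "E' 0 (h, \<phi>, l) (0, u, 0) = d * u" for u
      using linear_scale[OF has_derivative_linear[OF E'(1)[of 0 "(h, \<phi>, l)"]], of u "(0, 1, 0)"] h l by (simp add: d_def)
    ultimately have dE: "((\<lambda>s. E (h, s, l)) has_real_derivative d) (at \<phi>)"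
      by (simp add: has_field_derivative_def)
    let ?e = "E (h, \<phi>, l)"
    have e: "0 < ?e" "?e < 1" using E_bounds[OF h l] ab by (meson less_trans)+
    define y where "y = 1 + ?e * cos \<phi>"
    have y: "y > 0" unfolding y_def by (rule one_plus_ecos_pos[OF e])
    define d1 where "d1 = d * cos \<phi> - ?e * sin \<phi>"
    define d2 where "d2 = d * sin \<phi> + ?e * cos \<phi>"
    have D1: "((\<lambda>s. 1 / (1 + E (h, s, l) * cos s)) has_real_derivative - d1 / y\<^sup>2) (at \<phi>)"
      unfolding d1_def y_def using y[unfolded y_def] by (auto intro!: derivative_eq_intros dE simp: power2_eq_square)
    have D2: "((\<lambda>s. E (h, s, l) * sin s) has_real_derivative d2) (at \<phi>)"
      unfolding d2_def by (auto intro!: derivative_eq_intros dE)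
    have "((\<lambda>s. \<Phi> (h, s, l)) has_vector_derivative (- d1 / y\<^sup>2, d2, 0)) (at \<phi>)"
      unfolding \<Phi>_def polar_def fst_conv snd_conv
      using D1 D2 by (intro has_vector_derivative_Pair) (auto simp: has_real_derivative_iff_has_vector_derivative)
    moreover have "(- d1 / y\<^sup>2, d2, 0) \<noteq> (0 :: real \<times> real \<times> real)"
    proof
      assume "(- d1 / y\<^sup>2, d2, 0) = (0 :: real \<times> real \<times> real)"
      then have "d1 = 0" "d2 = 0" using y by (auto simp: zero_prod_def)
      moreover have "d2 * cos \<phi> - d1 * sin \<phi> = ?e * ((cos \<phi>)\<^sup>2 + (sin \<phi>)\<^sup>2)"
      proof -
        have "(D * s + r * c) * c - (D * c - r * s) * s = r * (c\<^sup>2 + s\<^sup>2)" for D r s c :: real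
          by (simp add: power2_eq_square algebra_simps)
        then show ?thesis unfolding d1_def d2_def .
      qed
      ultimately show False using e by simp
    qed
    ultimately show ?thesis by blast
  qed
  show ?thesis unfolding angular_param_def
    using per bij der by (auto simp: \<Phi>_def polar_def)
qed

text \<open>Polar coordinates centred at the angle \<open>\<alpha>\<close>: the sector \<open>\<bar>\<phi> - \<alpha>\<bar> < \<pi>/4\<close> is where \<open>\<bar>z2\<bar> < z1\<close> for the
  rotated Cartesian coordinates \<open>z1 = e cos (\<phi> - \<alpha>)\<close> and \<open>z2 = e sin (\<phi> - \<alpha>)\<close>.\<close>

definition z1 :: "real \<Rightarrow> real \<times> real \<times> real \<Rightarrow> real" where
  "z1 \<alpha> p = (1 / fst p - 1) * cos \<alpha> + fst (snd p) * sin \<alpha>"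

definition z2 :: "real \<Rightarrow> real \<times> real \<times> real \<Rightarrow> real" where
  "z2 \<alpha> p = fst (snd p) * cos \<alpha> - (1 / fst p - 1) * sin \<alpha>"

definition angle :: "real \<Rightarrow> real \<times> real \<times> real \<Rightarrow> real" where
  "angle \<alpha> p = \<alpha> + arctan (z2 \<alpha> p / z1 \<alpha> p)"

definition unpolar :: "real \<Rightarrow> real \<times> real \<times> real \<Rightarrow> real \<times> real \<times> real" where
  "unpolar \<alpha> p = (sqrt (energy2 p), angle \<alpha> p, sig p)"

definition sector :: "real \<Rightarrow> (real \<times> real \<times> real) set" where
  "sector \<alpha> = {p \<in> N. z2 \<alpha> p < z1 \<alpha> p \<and> - z2 \<alpha> p < z1 \<alpha> p}"

lemma z_squares: "(z1 \<alpha> p)\<^sup>2 + (z2 \<alpha> p)\<^sup>2 = energy2 p"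
proof -
  have "(W * c + V * s)\<^sup>2 + (V * c - W * s)\<^sup>2 = (W\<^sup>2 + V\<^sup>2) * (c\<^sup>2 + s\<^sup>2)" for W V c s :: real
    by (simp add: power2_eq_square algebra_simps)
  then show ?thesis unfolding z1_def z2_def energy2_def by simp
qed

lemma z_polar:
  assumes "0 < e" "e < 1"
  shows "z1 \<alpha> (polar (e, \<phi>, l)) = e * cos (\<phi> - \<alpha>)" "z2 \<alpha> (polar (e, \<phi>, l)) = e * sin (\<phi> - \<alpha>)"
  unfolding z1_def z2_def polar_w[OF assms] by (simp_all add: polar_def cos_diff sin_diff algebra_simps)

lemma abs_sin_less_cos:
  fixes \<theta> :: real
  assumes "\<bar>\<theta>\<bar> < pi / 4" shows "0 < cos \<theta>" "\<bar>sin \<theta>\<bar> < cos \<theta>"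
proof -
  show c: "0 < cos \<theta>" using assms by (intro cos_gt_zero_pi) auto
  have "tan \<theta> < tan (pi / 4)" by (rule tan_monotone) (use assms in auto)
  moreover have "tan (- (pi / 4)) < tan \<theta>" by (rule tan_monotone) (use assms in auto)
  ultimately have "tan \<theta> < 1" "- 1 < tan \<theta>" by (simp_all add: tan_45)
  then have "sin \<theta> / cos \<theta> < 1" "- 1 < sin \<theta> / cos \<theta>" unfolding tan_def .
  then show "\<bar>sin \<theta>\<bar> < cos \<theta>" using c by (simp add: field_simps abs_less_iff)
qed

lemma unpolar_polar:
  assumes e: "a1 < e" "e < b1" and \<phi>: "\<bar>\<phi> - \<alpha>\<bar> < pi / 4" and l: "0 \<le> l" "l < l0"
  shows "polar (e, \<phi>, l) \<in> sector \<alpha>" "unpolar \<alpha> (polar (e, \<phi>, l)) = (e, \<phi>, l)"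
proof -
  have e': "0 < e" "e < 1" using e ab by auto
  note c = abs_sin_less_cos[OF \<phi>]
  have sc: "sin (\<phi> - \<alpha>) < cos (\<phi> - \<alpha>)" "- sin (\<phi> - \<alpha>) < cos (\<phi> - \<alpha>)"
    using c(2) unfolding abs_less_iff by linarith+
  have "e * sin (\<phi> - \<alpha>) < e * cos (\<phi> - \<alpha>)" "e * (- sin (\<phi> - \<alpha>)) < e * cos (\<phi> - \<alpha>)"
    by (rule mult_strict_left_mono[OF sc(1) e'(1)], rule mult_strict_left_mono[OF sc(2) e'(1)])
  then show "polar (e, \<phi>, l) \<in> sector \<alpha>"
    using polar_N[OF e l] unfolding sector_def mem_Collect_eq z_polar[OF e'] mult_minus_right by blast
  have "z2 \<alpha> (polar (e, \<phi>, l)) / z1 \<alpha> (polar (e, \<phi>, l)) = tan (\<phi> - \<alpha>)"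
    using e' by (simp add: z_polar[OF e'] tan_def)
  moreover have "- (pi / 2) < \<phi> - \<alpha>" "\<phi> - \<alpha> < pi / 2"
    using \<phi> pi_gt_zero unfolding abs_less_iff by linarith+
  then have "arctan (tan (\<phi> - \<alpha>)) = \<phi> - \<alpha>" by (rule arctan_tan)
  ultimately show "unpolar \<alpha> (polar (e, \<phi>, l)) = (e, \<phi>, l)"
    using e' by (simp add: unpolar_def angle_def energy2_polar[OF e']) (simp add: polar_def)
qed

lemma sector_bounds:
  assumes "p \<in> sector \<alpha>"
  shows "a1 / 2 \<le> z1 \<alpha> p" "\<bar>z2 \<alpha> p / z1 \<alpha> p\<bar> < 1" "\<bar>angle \<alpha> p - \<alpha>\<bar> < pi / 4"
    "a1 < sqrt (energy2 p)" "sqrt (energy2 p) < b1" "0 \<le> sig p" "sig p < l0" "fst p > 0"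
proof -
  have z: "\<bar>z2 \<alpha> p\<bar> < z1 \<alpha> p" and N: "p \<in> N" using assms by (auto simp: sector_def)
  have en: "a1\<^sup>2 < energy2 p" "energy2 p < b1\<^sup>2" using N by (auto simp: N_def)
  have "(z2 \<alpha> p)\<^sup>2 \<le> (z1 \<alpha> p)\<^sup>2" using z by (intro abs_le_square_iff[THEN iffD1]) auto
  \<comment> \<open>In the sector z1 dominates z2 and carries at least half of z1^2 + z2^2 > a1^2;
    the bound a1 / sqrt 2 is weakened to a1 / 2.\<close>
  then have "a1\<^sup>2 \<le> 2 * (z1 \<alpha> p)\<^sup>2" using en(1) z_squares[of \<alpha> p] by linarith
  moreover have "2 * (z1 \<alpha> p)\<^sup>2 \<le> (2 * z1 \<alpha> p)\<^sup>2" by (simp add: power_mult_distrib)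
  ultimately have "a1\<^sup>2 \<le> (2 * z1 \<alpha> p)\<^sup>2" by linarith
  then have "a1 \<le> 2 * z1 \<alpha> p" by (rule power2_le_imp_le) (use z in auto)
  then show "a1 / 2 \<le> z1 \<alpha> p" by simp
  then have zp: "z1 \<alpha> p > 0" using ab by simp
  show q: "\<bar>z2 \<alpha> p / z1 \<alpha> p\<bar> < 1" using z zp by (simp add: abs_divide)
  have "arctan (z2 \<alpha> p / z1 \<alpha> p) < arctan 1" "arctan (- 1) < arctan (z2 \<alpha> p / z1 \<alpha> p)"
    using q by (auto simp only: arctan_less_iff abs_less_iff)
  then show "\<bar>angle \<alpha> p - \<alpha>\<bar> < pi / 4" by (simp add: angle_def arctan_one arctan_minus abs_less_iff)
  have s: "(sqrt (energy2 p))\<^sup>2 = energy2 p" "0 \<le> sqrt (energy2 p)" by (simp_all add: energy2_def)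
  show "a1 < sqrt (energy2 p)" "sqrt (energy2 p) < b1"
    using en s ab by (auto intro: real_less_rsqrt real_less_lsqrt)
  show "0 \<le> sig p" "sig p < l0" "fst p > 0" using N by (auto simp: N_def phase_space_def)
qed

text \<open>Since z1 > 0, the arctangent of z2 / z1 is the angle relative to \<alpha>; cos and sin
  of it are z1 / e and z2 / e, and rotating back by \<alpha> returns w and v.\<close>

lemma polar_unpolar:
  assumes p: "p \<in> sector \<alpha>" shows "polar (unpolar \<alpha> p) = p"
proof -
  note b = sector_bounds[OF p]
  define x where "x = z2 \<alpha> p / z1 \<alpha> p"
  define e where "e = sqrt (energy2 p)"
  have zp: "z1 \<alpha> p > 0" using b(1) ab by simp
  have "1 + x\<^sup>2 = energy2 p / (z1 \<alpha> p)\<^sup>2"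
    unfolding z_squares[of \<alpha> p, symmetric] x_def using zp by (simp add: power_divide add_divide_distrib)
  then have s: "sqrt (1 + x\<^sup>2) = e / z1 \<alpha> p" using zp by (simp add: e_def real_sqrt_divide)
  have e: "e > 0" "e < 1" using b(4,5) ab unfolding e_def by linarith+
  have c: "e * cos (arctan x) = z1 \<alpha> p" "e * sin (arctan x) = z2 \<alpha> p"
    unfolding cos_arctan sin_arctan s using zp e by (auto simp: x_def)
  define W V where "W = 1 / fst p - 1" and "V = fst (snd p)"
  have zz: "z1 \<alpha> p = W * cos \<alpha> + V * sin \<alpha>" "z2 \<alpha> p = V * cos \<alpha> - W * sin \<alpha>"
    by (simp_all add: z1_def z2_def W_def V_def)
  have rot: "(W * c + V * s) * c - (V * c - W * s) * s = W * (c\<^sup>2 + s\<^sup>2)"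
    "(W * c + V * s) * s + (V * c - W * s) * c = V * (c\<^sup>2 + s\<^sup>2)" for c s :: real
    by (simp_all add: power2_eq_square algebra_simps)
  have "e * cos (angle \<alpha> p) = z1 \<alpha> p * cos \<alpha> - z2 \<alpha> p * sin \<alpha>"
    unfolding c[symmetric] by (simp add: angle_def x_def cos_add algebra_simps)
  also have "\<dots> = W * ((cos \<alpha>)\<^sup>2 + (sin \<alpha>)\<^sup>2)" unfolding zz by (rule rot)
  finally have W: "e * cos (angle \<alpha> p) = W" by simp
  have "e * sin (angle \<alpha> p) = z1 \<alpha> p * sin \<alpha> + z2 \<alpha> p * cos \<alpha>"
    unfolding c[symmetric] by (simp add: angle_def x_def sin_add algebra_simps)
  also have "\<dots> = V * ((cos \<alpha>)\<^sup>2 + (sin \<alpha>)\<^sup>2)" unfolding zz by (rule rot)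
  finally have V: "e * sin (angle \<alpha> p) = V" by simp
  have "polar (unpolar \<alpha> p) = (1 / (1 + W), V, sig p)"
    using W V by (simp add: polar_def unpolar_def e_def)
  then show ?thesis by (simp add: W_def V_def prod_eq_iff)
qed

text \<open>On the sector the denominators are bounded below, r by 1/2 and z1 by a1 / 2, and arctan
  is evaluated on [-1, 1] only. The angle is bounded there, hence \<open>tame\<close>.\<close>

lemma tame_unpolar: "semitame 0 k' (\<lambda>_. unpolar \<alpha>) (sector \<alpha>)"
  "tame 0 k' (\<lambda>_. angle \<alpha>) (sector \<alpha>)"
proof -
  have rb: "1/2 \<le> fst p" "\<bar>fst p\<bar> \<le> 1 / (1 - b1)" "\<bar>fst (snd p)\<bar> \<le> 1" if p: "p \<in> sector \<alpha>" for p
  proof -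
    have en: "energy2 p < b1\<^sup>2" and r: "fst p > 0" using p by (auto simp: sector_def N_def phase_space_def)
    have "(1 / fst p - 1)\<^sup>2 \<le> energy2 p" "(fst (snd p))\<^sup>2 \<le> energy2 p" by (simp_all add: energy2_def)
    then have "(1 / fst p - 1)\<^sup>2 \<le> b1\<^sup>2" "(fst (snd p))\<^sup>2 \<le> b1\<^sup>2" using en by linarith+
    then have w: "\<bar>1 / fst p - 1\<bar> \<le> b1" "\<bar>fst (snd p)\<bar> \<le> b1" using ab by (auto simp: abs_le_square_iff[symmetric])
    then show "\<bar>fst (snd p)\<bar> \<le> 1" using ab by simp
    have "1 / fst p \<le> 2" "1 - b1 \<le> 1 / fst p" using w ab unfolding abs_le_iff by linarith+
    then show "1/2 \<le> fst p" "\<bar>fst p\<bar> \<le> 1 / (1 - b1)" using r ab by (auto simp: field_simps)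
  qed
  have tr: "tame 0 k' (\<lambda>_ p. fst p) (sector \<alpha>)" "tame 0 k' (\<lambda>_ p. fst (snd p)) (sector \<alpha>)"
    by (rule tame_bounded_linear[where B = "1 / (1 - b1)"], rule bounded_linear_fst, use rb in force)
      (rule tame_bounded_linear[where B = 1], rule bounded_linear_coords, use rb in force)
  have tw: "tame 0 k' (\<lambda>_ p. 1 / fst p - 1) (sector \<alpha>)"
    by (intro tame_diff tame_const tame_divide[where c = "1/2"] tr) (use rb in force)+
  have tz: "tame 0 k' (\<lambda>_. z1 \<alpha>) (sector \<alpha>)" "tame 0 k' (\<lambda>_. z2 \<alpha>) (sector \<alpha>)"
    unfolding z1_def z2_def by (intro tame_add tame_diff tame_mult0 tame_const tr tw)+
  have te: "tame 0 k' (\<lambda>_. energy2) (sector \<alpha>)"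
    unfolding energy2_def by (intro tame_add tame_power0 tr tw)
  have ts: "tame 0 k' (\<lambda>_ p. sqrt (energy2 p)) (sector \<alpha>)"
  proof (rule tame_comp0[OF tame_sqrt[of "a1\<^sup>2"] _ tame_semitame[OF te]])
    show "0 < a1\<^sup>2" using ab by simp
    have "b1\<^sup>2 \<le> 1" using ab by (simp add: power_le_one)
    then show "energy2 p \<in> {a1\<^sup>2..1}" if "p \<in> sector \<alpha>" for p
      using that by (auto simp: sector_def N_def)
  qed
  have tq: "tame 0 k' (\<lambda>_ p. z2 \<alpha> p / z1 \<alpha> p) (sector \<alpha>)"
    by (rule tame_divide[where c = "a1 / 2"]) (use ab sector_bounds(1) tz in force)+
  have "tame 0 k' (\<lambda>_ p. arctan (z2 \<alpha> p / z1 \<alpha> p)) (sector \<alpha>)"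
  proof (rule tame_comp0[OF tame_arctan _ tame_semitame[OF tq]])
    show "z2 \<alpha> p / z1 \<alpha> p \<in> {-1..1}" if "p \<in> sector \<alpha>" for p
      using sector_bounds(2)[OF that] unfolding abs_less_iff atLeastAtMost_iff by linarith
  qed
  then show ta: "tame 0 k' (\<lambda>_. angle \<alpha>) (sector \<alpha>)"
    unfolding angle_def by (intro tame_add tame_const)
  show "semitame 0 k' (\<lambda>_. unpolar \<alpha>) (sector \<alpha>)"
    unfolding unpolar_def
    by (intro semitame_Pair semitame_linear bounded_linear_coords tame_semitame[OF ts] tame_semitame[OF ta])
qed

text \<open>The straightening map takes K - h in place of e and keeps angle and l; its inverse is
  \<open>\<Phi>\<close> at the level h + x. Near a point of angle \<alpha> the sector around
  \<alpha> makes the angle single-valued.\<close>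

lemma Ck_surface_level:
  assumes h: "h1 < h" "h < h2"
  shows "Ck_surface k {p \<in> N. G p = h}"
  unfolding Ck_surface_def
proof (intro conjI ballI)
  show "{p \<in> N. G p = h} \<subseteq> phase_space" by (auto simp: N_def)
  fix p0 assume p0: "p0 \<in> {p \<in> N. G p = h}"
  then obtain \<alpha> l1 where p01: "p0 = \<Phi> (h, \<alpha>, l1)" "0 \<le> l1" "l1 < l0" unfolding level_eq[OF h] by blast
  let ?K = "\<lambda>p. K (unpolar \<alpha> p)"
  \<comment> \<open>The second condition keeps the level in (h1, h2), where E is defined.\<close>
  define U where "U = sector \<alpha> \<inter> ?K -` {h1<..<h2}"
  define V where "V = {h1 - h<..<h2 - h} \<times> {\<alpha> - pi / 4<..<\<alpha> + pi / 4} \<times> {0..<l0}"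
  define \<psi> where "\<psi> p = (?K p - h, angle \<alpha> p, sig p)" for p
  define \<psi>' where "\<psi>' x = \<Phi> (h + fst x, snd x)" for x
  have unp: "unpolar \<alpha> p \<in> {a1<..<b1} \<times> UNIV \<times> {0..<l0}" if "p \<in> sector \<alpha>" for p
    using sector_bounds[OF that] by (simp add: unpolar_def)
  have tKu: "tame 0 k (\<lambda>_. ?K) (sector \<alpha>)"
    by (rule tame_comp0[OF tame_le[OF tK] _ tame_unpolar(1)]) (use unp in auto)
  have GK: "G p = ?K p" if p: "p \<in> sector \<alpha>" for p
    using G[of "sqrt (energy2 p)" "sig p" "angle \<alpha> p"] sector_bounds[OF p] polar_unpolar[OF p]
    by (simp add: unpolar_def)
  have oS: "openin (top_of_set phase_space) (sector \<alpha>)"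
  proof -
    have "continuous_on N (\<lambda>p. (z1 \<alpha> p - z2 \<alpha> p, z1 \<alpha> p + z2 \<alpha> p))"
      unfolding z1_def z2_def by (intro continuous_intros) (auto simp: N_def phase_space_def)
    from continuous_openin_preimage_gen[OF this, of "{0<..} \<times> {0<..}"]
    have "openin (top_of_set N) (N \<inter> (\<lambda>p. (z1 \<alpha> p - z2 \<alpha> p, z1 \<alpha> p + z2 \<alpha> p)) -` ({0<..} \<times> {0<..}))"
      by (simp add: open_Times)
    moreover have "N \<inter> (\<lambda>p. (z1 \<alpha> p - z2 \<alpha> p, z1 \<alpha> p + z2 \<alpha> p)) -` ({0<..} \<times> {0<..}) = sector \<alpha>"
      by (auto simp: sector_def)
    ultimately show ?thesis using openin_trans[OF _ openin_N] by simp
  qed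
  have oU: "openin (top_of_set phase_space) U"
    unfolding U_def
    by (rule openin_trans[OF continuous_openin_preimage_gen[OF semitame_continuous[OF tame_semitame[OF tKu]]] oS]) simp
  have oV: "openin (top_of_set half_space) V"
  proof -
    have "V = half_space \<inter> ({h1 - h<..<h2 - h} \<times> {\<alpha> - pi / 4<..<\<alpha> + pi / 4} \<times> {..<l0})"
      by (auto simp: V_def half_space_def)
    moreover have "open ({h1 - h<..<h2 - h} \<times> {\<alpha> - pi / 4<..<\<alpha> + pi / 4} \<times> {..<l0})"
      by (intro open_Times) auto
    ultimately show ?thesis by (simp add: openin_open_Int)
  qed
  have \<psi>: "\<psi> p \<in> V" "\<psi>' (\<psi> p) = p" if p: "p \<in> U" for p
  proof -
    have pS: "p \<in> sector \<alpha>" and Kp: "h1 < ?K p" "?K p < h2" using p by (auto simp: U_def)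
    note b = sector_bounds[OF pS]
    have "\<alpha> - pi / 4 < angle \<alpha> p" "angle \<alpha> p < \<alpha> + pi / 4" using b(3) unfolding abs_less_iff by linarith+
    then show "\<psi> p \<in> V" using b(6,7) Kp by (simp add: \<psi>_def V_def)
    have "E (?K p, angle \<alpha> p, sig p) = sqrt (energy2 p)"
      using E_iff[OF Kp b(6,7,4,5), of "angle \<alpha> p"] by (simp add: unpolar_def)
    then have "\<psi>' (\<psi> p) = polar (unpolar \<alpha> p)"
      by (simp add: \<psi>'_def \<psi>_def \<Phi>_def unpolar_def)
    then show "\<psi>' (\<psi> p) = p" using polar_unpolar[OF pS] by simp
  qed
  have \<psi>': "\<psi>' x \<in> U" "\<psi> (\<psi>' x) = x" if x: "x \<in> V" for x
  proof -
    obtain y \<phi> l where x': "x = (y, \<phi>, l)" by (cases x) auto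
    have y: "h1 < h + y" "h + y < h2" and \<phi>V: "\<alpha> - pi / 4 < \<phi>" "\<phi> < \<alpha> + pi / 4" and l: "0 \<le> l" "l < l0"
      using x by (auto simp: x' V_def)
    have \<phi>: "\<bar>\<phi> - \<alpha>\<bar> < pi / 4" using \<phi>V unfolding abs_less_iff by linarith
    let ?e = "E (h + y, \<phi>, l)"
    have e: "a1 < ?e" "?e < b1" using E_bounds[OF y l] by auto
    have eq: "\<psi>' x = polar (?e, \<phi>, l)" by (simp add: \<psi>'_def \<Phi>_def x')
    note u = unpolar_polar[OF e \<phi> l]
    have Ke: "K (?e, \<phi>, l) = h + y" using E_iff[OF y l e, of \<phi>] by simp
    show "\<psi>' x \<in> U" using u Ke y by (simp add: eq U_def)
    have "angle \<alpha> (\<psi>' x) = \<phi>" "sig (\<psi>' x) = l" using u(2) by (simp_all add: eq unpolar_def)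
    moreover have "K (unpolar \<alpha> (\<psi>' x)) = h + y" using u(2) Ke eq by simp
    ultimately show "\<psi> (\<psi>' x) = x" by (simp add: \<psi>_def x')
  qed
  have s\<psi>: "semitame 0 k (\<lambda>_. \<psi>) U"
  proof -
    have "semitame 0 k (\<lambda>_. \<psi>) (sector \<alpha>)"
      unfolding \<psi>_def
      by (intro semitame_Pair tame_semitame[OF tame_diff[OF tKu tame_const]] tame_semitame[OF tame_unpolar(2)]
          semitame_linear bounded_linear_coords)
    then show ?thesis by (rule semitame_subset) (auto simp: U_def)
  qed
  have s\<psi>': "semitame 0 k (\<lambda>_. \<psi>') V"
  proof -
    let ?f = "\<lambda>x :: real \<times> real \<times> real. (h + fst x, snd x)"
    have sf: "semitame 0 k (\<lambda>_. ?f) V"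
      by (intro semitame_Pair semitame_add semitame_linear bounded_linear_fst bounded_linear_snd
          tame_semitame[OF tame_const])
    have fV: "?f x \<in> {h1<..<h2} \<times> UNIV \<times> {0..<l0}" if "x \<in> V" for x using that by (auto simp: V_def)
    have tE': "tame 0 k (\<lambda>_ x. E (?f x)) V" by (rule tame_comp0[OF tame_E _ sf]) (use fV in blast)
    have "semitame 0 k (\<lambda>_ x. polar (E (?f x), fst (snd x), snd (snd x))) V"
    proof (rule semitame_polar[OF tE'])
      show "0 < E (?f x) \<and> E (?f x) < b1" if "x \<in> V" for x
        using fV[OF that] E_bounds[of "h + fst x" "snd (snd x)" "fst (snd x)"] ab by auto
    qed (use ab in \<open>auto intro!: semitame_linear bounded_linear_coords\<close>)
    then show ?thesis by (rule semitame_cong) (simp add: \<psi>'_def \<Phi>_def)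
  qed
  have hom: "homeomorphism U V \<psi> \<psi>'"
  proof (rule homeomorphismI)
    show "continuous_on U \<psi>" "continuous_on V \<psi>'" by (rule semitame_continuous[OF s\<psi>] semitame_continuous[OF s\<psi>'])+
  qed (use \<psi> \<psi>' in auto)
  have im: "\<psi> ` ({p \<in> N. G p = h} \<inter> U) = V \<inter> {(x, y, z). x = 0}"
  proof (intro equalityI subsetI)
    fix x assume "x \<in> \<psi> ` ({p \<in> N. G p = h} \<inter> U)"
    then obtain p where p: "x = \<psi> p" "G p = h" "p \<in> U" by blast
    have "?K p = h" using GK p by (auto simp: U_def)
    then show "x \<in> V \<inter> {(x, y, z). x = 0}" using \<psi>(1)[OF p(3)] p(1) by (simp add: \<psi>_def)
  next
    fix x assume "x \<in> V \<inter> {(x, y, z). x = 0}"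
    then have x: "x \<in> V" "fst x = 0" by auto
    have U: "\<psi>' x \<in> U" "\<psi> (\<psi>' x) = x" by (rule \<psi>'[OF x(1)])+
    then have "?K (\<psi>' x) = h" using x(2) by (simp add: \<psi>_def prod_eq_iff)
    then have "\<psi>' x \<in> {p \<in> N. G p = h} \<inter> U" using U(1) GK by (auto simp: U_def sector_def)
    from imageI[OF this, of \<psi>] show "x \<in> \<psi> ` ({p \<in> N. G p = h} \<inter> U)" unfolding U(2) .
  qed
  have p0U: "p0 \<in> U"
  proof -
    let ?e = "E (h, \<alpha>, l1)"
    have e: "a1 < ?e" "?e < b1" using E_bounds[OF h p01(2,3)] by auto
    have "\<bar>\<alpha> - \<alpha>\<bar> < pi / 4" by simp
    note u = unpolar_polar[OF e this p01(2,3)]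
    have "K (?e, \<alpha>, l1) = h" using E_iff[OF h p01(2,3) e, of \<alpha>] by simp
    then show ?thesis using u h by (simp add: U_def p01(1) \<Phi>_def)
  qed
  show "\<exists>U V \<psi> \<psi>'. openin (top_of_set phase_space) U \<and> p0 \<in> U \<and> openin (top_of_set half_space) V \<and>
        homeomorphism U V \<psi> \<psi>' \<and> Ck_on k \<psi> U \<and> Ck_on k \<psi>' V \<and>
        \<psi> ` ({p \<in> N. G p = h} \<inter> U) = V \<inter> {(x, y, z). x = 0}"
    by (intro exI[of _ U] exI[of _ V] exI[of _ \<psi>] exI[of _ \<psi>'] conjI oU p0U oV hom im
        semitame_Ck_on[OF s\<psi>] semitame_Ck_on[OF s\<psi>'])
qed

end

subsection \<open>The main theorem\<close>

context annulus_flow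
begin

text \<open>\<sigma> is a polynomial in l, while l is not a smooth function of \<sigma> at 0:
  smoothness up to the boundary passes in this direction.\<close>

definition level :: "real \<Rightarrow> real \<times> real \<times> real \<Rightarrow> real" where
  "level \<delta> x = Kinf (fst x, fst (snd x), sigma_of \<delta> (snd (snd x)))"

text \<open>At l = 0 the level function is e^2 / 2, increasing in e with slope e > a1. For small l
  the slope stays above a1 / 2, and the values at \<alpha> and \<beta> still enclose (h1, h2): the
  intermediate value theorem gives E, and \<open>implicit_tame\<close> its smoothness.\<close>

lemma level_graph:
  assumes \<delta>: "\<delta> > 0" and \<alpha>\<beta>: "a1 < \<alpha>" "\<alpha> < \<beta>" "\<beta> < b1" and h12: "\<alpha>\<^sup>2 / 2 < h1" "h2 < \<beta>\<^sup>2 / 2"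
  obtains l0 E where "0 < l0"
    "\<And>l. 0 \<le> l \<Longrightarrow> l < l0 \<Longrightarrow> 0 \<le> sigma_of \<delta> l \<and> sigma_of \<delta> l < s0"
    "tame 0 (Suc k) (\<lambda>_. level \<delta>) ({a1<..<b1} \<times> UNIV \<times> {0..<l0})"
    "semitame 0 (Suc k) (\<lambda>_. E) ({h1<..<h2} \<times> UNIV \<times> {0..<l0})"
    "\<And>h \<phi> l. h1 < h \<Longrightarrow> h < h2 \<Longrightarrow> 0 \<le> l \<Longrightarrow> l < l0 \<Longrightarrow> a1 < E (h, \<phi>, l) \<and> E (h, \<phi>, l) < b1"
    "\<And>h \<phi> l e. h1 < h \<Longrightarrow> h < h2 \<Longrightarrow> 0 \<le> l \<Longrightarrow> l < l0 \<Longrightarrow> a1 < e \<Longrightarrow> e < b1 \<Longrightarrow>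
      level \<delta> (e, \<phi>, l) = h \<longleftrightarrow> E (h, \<phi>, l) = e"
proof -
  let ?K = "level \<delta>"
  \<comment> \<open>For l < 1 one has l^3 \<le> l, so \<sigma> \<le> 3 \<delta> l < s0.\<close>
  define L1 where "L1 = min 1 (s0 / (3 * \<delta>))"
  have L1: "0 < L1" using \<delta> order by (simp add: L1_def)
  have sg: "0 \<le> sigma_of \<delta> l \<and> sigma_of \<delta> l \<le> 3 * \<delta> * l \<and> sigma_of \<delta> l < s0" if l: "0 \<le> l" "l < L1" for l
  proof -
    have "l ^ 3 \<le> l * 1" unfolding power3_eq_cube mult.assoc
      using l by (intro mult_left_mono mult_le_one) (auto simp: L1_def)
    then have "sigma_of \<delta> l \<le> 3 * \<delta> * l" using \<delta> by (simp add: sigma_of_def)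
    moreover have "3 * \<delta> * l < s0" using l(2) \<delta> by (simp add: L1_def pos_less_divide_eq mult_ac)
    moreover have "0 \<le> sigma_of \<delta> l" using l \<delta> by (simp add: sigma_of_def)
    ultimately show ?thesis by linarith
  qed
  define S1 where "S1 = {a1<..<b1} \<times> (UNIV :: real set) \<times> {0..<L1}"
  have mem_S1: "x \<in> S1 \<longleftrightarrow> a1 < ecc x \<and> ecc x < b1 \<and> 0 \<le> sig x \<and> sig x < L1" for x
    by (cases x) (auto simp: S1_def)
  have bl: "bounded_linear (\<lambda>x::real \<times> real \<times> real. fst (snd x))" "bounded_linear (\<lambda>x::real \<times> real \<times> real. snd (snd x))"
    by (auto intro: bounded_linear_compose[OF bounded_linear_fst bounded_linear_snd]
        bounded_linear_compose[OF bounded_linear_snd bounded_linear_snd])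
  have tK: "tame 0 (Suc k) (\<lambda>_. ?K) S1"
  proof -
    have "tame 0 (Suc k) (\<lambda>_ x. sig x) S1"
      by (rule tame_bounded_linear[OF bl(2), where B = 1]) (auto simp: mem_S1 L1_def)
    then have "tame 0 (Suc k) (\<lambda>_ x. sigma_of \<delta> (sig x)) S1"
      unfolding sigma_of_def by (intro tame_mult0 tame_const tame_power0)
    then have "semitame 0 (Suc k) (\<lambda>_ x. (fst x, fst (snd x), sigma_of \<delta> (sig x))) S1"
      by (intro semitame_Pair semitame_linear bounded_linear_fst bl(1) tame_semitame)
    from tame_comp0[OF tame_Kinf _ this] show ?thesis
      unfolding level_def using sg by (simp add: mem_S mem_S1)
  qed
  obtain K1 where K1: "\<And>t x. t \<ge> 0 \<Longrightarrow> x \<in> S1 \<Longrightarrow> (?K has_derivative K1 t x) (at x within S1)"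
    "\<And>i. i \<in> Basis \<Longrightarrow> tame 0 k (\<lambda>t x. K1 t x i) S1"
    using semitame_SucE[OF tame_semitame[OF tK]] by blast
  define K' where "K' = K1 0"
  have dK: "(?K has_derivative K' x) (at x within S1)" if "x \<in> S1" for x using K1(1)[of 0 x] that by (simp add: K'_def)
  have tK': "tame 0 k (\<lambda>_ x. K' x i) S1" if "i \<in> Basis" for i
    unfolding K'_def by (rule tame_at[OF K1(2)[OF that]]) auto
  \<comment> \<open>\<open>Kinf_near\<close> at \<sigma> = 0 forces the level function to be e^2 / 2
    there.\<close>
  have at0: "K' (e, \<phi>, 0) (1, 0, 0) = e" if e: "a1 < e" "e < b1" for e \<phi>
  proof -
    have x: "(e, \<phi>, 0) \<in> S1" using e L1 by (simp add: mem_S1)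
    have "((\<lambda>u. ?K (u, \<phi>, 0)) has_derivative (\<lambda>u. K' (e, \<phi>, 0) (u, 0, 0))) (at e within {a1<..<b1})"
    proof (rule has_derivative_in_compose[where f = "\<lambda>u. (u, \<phi>, 0)" and f' = "\<lambda>u. (u, 0, 0)" and g = ?K and g' = "K' (e, \<phi>, 0)"])
      show "((\<lambda>u. (u, \<phi>, 0 :: real)) has_derivative (\<lambda>u. (u, 0, 0))) (at e within {a1<..<b1})"
        by (intro has_derivative_Pair has_derivative_const has_derivative_ident)
      show "(?K has_derivative K' (e, \<phi>, 0)) (at (e, \<phi>, 0) within (\<lambda>u. (u, \<phi>, 0)) ` {a1<..<b1})"
        by (rule has_derivative_subset[OF dK[OF x]]) (use L1 in \<open>auto simp: mem_S1\<close>)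
    qed
    moreover have "(\<lambda>u. K' (e, \<phi>, 0) (u, 0, 0)) = (*) (K' (e, \<phi>, 0) (1, 0, 0))"
    proof
      show "K' (e, \<phi>, 0) (u, 0, 0) = K' (e, \<phi>, 0) (1, 0, 0) * u" for u
        using linear_scale[OF has_derivative_linear[OF dK[OF x]], of u "(1, 0, 0)"] by simp
    qed
    ultimately have d: "((\<lambda>u. ?K (u, \<phi>, 0)) has_real_derivative K' (e, \<phi>, 0) (1, 0, 0)) (at e within {a1<..<b1})"
      unfolding has_field_derivative_def by metis
    have K0: "?K (u, \<phi>, 0) = u\<^sup>2 / 2" if "u \<in> {a1<..<b1}" for u
    proof -
      have "(u, \<phi>, 0) \<in> S" using that order by (simp add: mem_S)
      from Kinf_near[OF this] show ?thesis by (simp add: level_def sigma_of_def)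
    qed
    have eI: "e \<in> {a1<..<b1}" using e by simp
    from d have d': "((\<lambda>u. ?K (u, \<phi>, 0)) has_real_derivative K' (e, \<phi>, 0) (1, 0, 0)) (at e)"
      unfolding at_within_open[OF eI open_greaterThanLessThan] .
    have "((\<lambda>u. u\<^sup>2 / 2) has_real_derivative K' (e, \<phi>, 0) (1, 0, 0)) (at e)"
      by (rule has_field_derivative_transform_within_open[OF d' open_greaterThanLessThan eI K0])
    moreover have "((\<lambda>u. u\<^sup>2 / 2) has_real_derivative e) (at e)" by (auto intro!: derivative_eq_intros)
    ultimately show ?thesis by (rule DERIV_unique)
  qed
  have B: "(1, 0, 0) \<in> (Basis :: (real \<times> real \<times> real) set)" by (simp add: Basis_prod_def zero_prod_def)
  obtain L where L: "L \<ge> 0" "\<And>t x y. t \<ge> 0 \<Longrightarrow> x \<in> S1 \<Longrightarrow> y \<in> S1 \<Longrightarrow>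
      norm (K' x (1, 0, 0) - K' y (1, 0, 0)) \<le> L * (1 + t) powr 0 * norm (x - y)"
    using glipE[OF tame_glip[OF tK'[OF B]]] by blast
  define \<mu> where "\<mu> = min (h1 - \<alpha>\<^sup>2 / 2) (\<beta>\<^sup>2 / 2 - h2)"
  have \<mu>: "\<mu> > 0" using h12 by (simp add: \<mu>_def)
  \<comment> \<open>The bound with L makes the slope lose at most a1 / 2. The bound with \<mu> keeps
    \<open>Kinf\<close> within \<mu> of e^2 / 2, where \<mu> is the room between the levels and the
    values at \<alpha> and \<beta>.\<close>
  define l0 where "l0 = min L1 (min (a1 / (2 * (L + 1))) (\<mu> * (1 - b) / (6 * \<delta>)))"
  have a1: "a1 > 0" using ab order by linarith
  have l0: "0 < l0" using L1 a1 L(1) \<mu> ab \<delta> by (simp add: l0_def)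
  have lL: "l < L1" "L * l \<le> a1 / 2" "2 * sigma_of \<delta> l / (1 - b) \<le> \<mu>" if l: "0 \<le> l" "l < l0" for l
  proof -
    show 1: "l < L1" using l by (simp add: l0_def)
    have "l \<le> a1 / (2 * (L + 1))" using l by (simp add: l0_def)
    then have "l * (2 * (L + 1)) \<le> a1" using L(1) by (simp add: pos_le_divide_eq)
    then show "L * l \<le> a1 / 2" using l by (simp add: algebra_simps)
    have "l \<le> \<mu> * (1 - b) / (6 * \<delta>)" using l by (simp add: l0_def)
    then have "6 * \<delta> * l \<le> \<mu> * (1 - b)" using \<delta> by (simp add: pos_le_divide_eq mult_ac)
    then have "2 * sigma_of \<delta> l \<le> \<mu> * (1 - b)" using sg[OF l(1) 1] by linarith
    then show "2 * sigma_of \<delta> l / (1 - b) \<le> \<mu>" using ab by (simp add: pos_divide_le_eq)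
  qed
  define T where "T = (UNIV :: real set) \<times> {0..<l0}"
  have sub: "{a1<..<b1} \<times> T \<subseteq> S1" using lL(1) by (auto simp: T_def S1_def)
  have low: "a1 / 2 \<le> K' x (1, 0)" if x: "x \<in> {a1<..<b1} \<times> T" for x
  proof -
    obtain e \<phi> l where x': "x = (e, \<phi>, l)" by (cases x) auto
    have e: "a1 < e" "e < b1" and l: "0 \<le> l" "l < l0" using x by (auto simp: x' T_def)
    have "(e, \<phi>, 0) \<in> S1" "(e, \<phi>, l) \<in> S1" using e l L1 lL(1)[OF l] by (auto simp: mem_S1)
    from L(2)[of 0, OF _ this] have "\<bar>e - K' (e, \<phi>, l) (1, 0, 0)\<bar> \<le> L * norm ((e, \<phi>, 0) - (e, \<phi>, l))"
      by (simp add: at0[OF e])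
    also have "\<dots> \<le> L * l" using norm_triple_le[of "(e, \<phi>, 0) - (e, \<phi>, l)"] l L(1) by (intro mult_left_mono) auto
    finally show ?thesis using lL(2)[OF l] e by (simp add: x' zero_prod_def)
  qed
  define E where "E x = (SOME e. \<alpha> \<le> e \<and> e \<le> \<beta> \<and> ?K (e, snd x) = fst x)" for x :: "real \<times> real \<times> real"
  have E: "\<alpha> \<le> E (h, \<tau>) \<and> E (h, \<tau>) \<le> \<beta> \<and> ?K (E (h, \<tau>), \<tau>) = h" if h: "h1 < h" "h < h2" and \<tau>: "\<tau> \<in> T" for h \<tau>
  proof -
    obtain \<phi> l where \<tau>': "\<tau> = (\<phi>, l)" and l: "0 \<le> l" "l < l0" using \<tau> by (auto simp: T_def)
    have near: "\<bar>?K (e, \<tau>) - e\<^sup>2 / 2\<bar> \<le> \<mu>" if "a1 < e" "e < b1" for e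
    proof -
      have "(e, \<phi>, sigma_of \<delta> l) \<in> S" using that sg[OF l(1) lL(1)[OF l]] by (simp add: mem_S)
      from Kinf_near[OF this] show ?thesis using lL(3)[OF l] by (simp add: level_def \<tau>')
    qed
    have "continuous_on {\<alpha>..\<beta>} (\<lambda>e. ?K (e, \<tau>))"
    proof (rule continuous_on_compose2[OF semitame_continuous[OF tame_semitame[OF tK]]])
      show "(\<lambda>e. (e, \<tau>)) ` {\<alpha>..\<beta>} \<subseteq> S1" using \<alpha>\<beta> l lL(1)[OF l] by (auto simp: mem_S1 \<tau>')
    qed (intro continuous_intros)
    moreover have "?K (\<alpha>, \<tau>) \<le> h" using near[of \<alpha>] \<alpha>\<beta> h by (auto simp: \<mu>_def abs_le_iff)
    moreover have "h \<le> ?K (\<beta>, \<tau>)" using near[of \<beta>] \<alpha>\<beta> h by (auto simp: \<mu>_def abs_le_iff)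
    ultimately have "\<exists>e. \<alpha> \<le> e \<and> e \<le> \<beta> \<and> ?K (e, \<tau>) = h"
      using IVT'[of "\<lambda>e. ?K (e, \<tau>)" \<alpha> h \<beta>] \<alpha>\<beta>(2) by simp
    from someI_ex[OF this] show ?thesis by (simp add: E_def)
  qed
  have Eab: "a1 < E (h, \<tau>) \<and> E (h, \<tau>) < b1 \<and> ?K (E (h, \<tau>), \<tau>) = h" if "h \<in> {h1<..<h2}" "\<tau> \<in> T" for h \<tau>
    using E[of h \<tau>] that \<alpha>\<beta> by auto
  have T: "convex T" unfolding T_def by (intro convex_Times) auto
  have gK: "glip 0 (\<lambda>_. ?K) ({a1<..<b1} \<times> T)" by (rule tame_glip[OF tame_subset[OF tK sub]])
  have dK2: "(?K has_derivative K' x) (at x within {a1<..<b1} \<times> T)" if "x \<in> {a1<..<b1} \<times> T" for x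
    by (rule has_derivative_subset[OF dK sub]) (use that sub in blast)
  have a12: "a1 / 2 > 0" using a1 by simp
  note impl = implicit_tame[where J = "{h1<..<h2}" and k = k, OF T a12 gK dK2 tame_subset[OF tK' sub] low Eab]
  have tE: "semitame 0 (Suc k) (\<lambda>_. E) ({h1<..<h2} \<times> T)" by (rule impl(1); assumption)
  have expand: "a1 / 2 * (e' - e) \<le> ?K (e', \<tau>) - ?K (e, \<tau>)"
    if "a1 < e" "e \<le> e'" "e' < b1" "\<tau> \<in> T" for e e' \<tau>
    by (rule impl(2)[OF _ _ _ _ _ that]; assumption)
  have iff: "?K (e, \<tau>) = h \<longleftrightarrow> E (h, \<tau>) = e" if h: "h1 < h" "h < h2" and \<tau>: "\<tau> \<in> T" and e: "a1 < e" "e < b1" for h \<tau> e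
  proof
    assume K: "?K (e, \<tau>) = h"
    have "h \<in> {h1<..<h2}" using h by simp
    note e' = Eab[OF this \<tau>]
    have "a1 / 2 * (E (h, \<tau>) - e) \<le> 0" if "e \<le> E (h, \<tau>)"
      using expand[OF e(1) that e'[THEN conjunct2, THEN conjunct1] \<tau>] e' K by simp
    moreover have "a1 / 2 * (e - E (h, \<tau>)) \<le> 0" if "E (h, \<tau>) \<le> e"
      using expand[OF e'[THEN conjunct1] that e(2) \<tau>] e' K by simp
    ultimately show "E (h, \<tau>) = e" using a12 by (force simp: mult_le_0_iff)
  next
    assume "E (h, \<tau>) = e" then show "?K (e, \<tau>) = h" using Eab[of h \<tau>] h \<tau> by auto
  qed
  show ?thesis
  proof (rule that[of l0 E])
    show "tame 0 (Suc k) (\<lambda>_. ?K) ({a1<..<b1} \<times> UNIV \<times> {0..<l0})"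
      using tame_subset[OF tK sub] by (simp add: T_def)
    show "semitame 0 (Suc k) (\<lambda>_. E) ({h1<..<h2} \<times> UNIV \<times> {0..<l0})"
      using tE by (simp add: T_def)
    show "0 \<le> sigma_of \<delta> l \<and> sigma_of \<delta> l < s0" if "0 \<le> l" "l < l0" for l
      using sg[OF that(1) lL(1)[OF that]] by simp
    show "a1 < E (h, \<phi>, l) \<and> E (h, \<phi>, l) < b1" if "h1 < h" "h < h2" "0 \<le> l" "l < l0" for h \<phi> l
      using Eab[of h "(\<phi>, l)"] that by (simp add: T_def)
    show "?K (e, \<phi>, l) = h \<longleftrightarrow> E (h, \<phi>, l) = e" if "h1 < h" "h < h2" "0 \<le> l" "l < l0" "a1 < e" "e < b1" for h \<phi> l e
      using iff[of h "(\<phi>, l)" e] that by (simp add: T_def)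
  qed (rule l0)
qed

end

text \<open>With d = (1 - e) / 4 the radii are e/4 < e/3 < e/2 < 3e/4 < e < e + d/2 < e + d < e + 2d
  < e + 3d < 1. \<open>s1\<close> is the largest value, capped at 1, that the condition on the
  angular speed allows, and \<open>s0\<close> keeps the drift of e^2 below half of the smaller
  margin.\<close>

lemma annulus_flow_exists:
  assumes e: "0 < e" "e < 1"
  obtains a b s1 a2 a1 b1 b2 s2 s0 \<alpha> \<beta> where "annulus_flow a b s1 a2 a1 b1 b2 s2 s0"
    "a1 < \<alpha>" "0 < \<alpha>" "\<alpha> < e" "e < \<beta>" "\<beta> < b1" "b1 < 1"
proof -
  define d where "d = (1 - e) / 4"
  have d: "d > 0" "e + 4 * d = 1" using e by (auto simp: d_def field_simps)
  define b where "b = e + 3 * d"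
  define s1 where "s1 = min 1 (3/4 * (e / 4) * (1 - b)\<^sup>2)"
  define m where "m = min ((e/2)\<^sup>2 - (e/3)\<^sup>2) ((e + 2 * d)\<^sup>2 - (e + d)\<^sup>2)"
  define s0 where "s0 = min (s1 / 4) ((1 - b) / 6 * m)"
  have b: "b < 1" using d by (simp add: b_def)
  have "(e/3)\<^sup>2 < (e/2)\<^sup>2" "(e + d)\<^sup>2 < (e + 2 * d)\<^sup>2" using e d by (intro power_strict_mono; simp)+
  then have m: "m > 0" by (simp add: m_def)
  have s1: "0 < s1" "s1 \<le> 1" "2/3 * s1 / (e / 4) \<le> (1 - b)\<^sup>2 / 2"
  proof -
    show "0 < s1" "s1 \<le> 1" using e b by (auto simp: s1_def)
    have "s1 \<le> 3/4 * (e / 4) * (1 - b)\<^sup>2" by (simp add: s1_def)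
    then show "2/3 * s1 / (e / 4) \<le> (1 - b)\<^sup>2 / 2" using e by (simp add: pos_divide_le_eq mult_ac)
  qed
  have s0: "0 < s0" "s0 \<le> s1 / 4" "s0 \<le> (1 - b) / 6 * m" using s1 b m by (auto simp: s0_def)
  have "3 * s0 / (1 - b) \<le> m / 2" using s0(3) b by (simp add: pos_divide_le_eq field_simps)
  then have mg: "3 * s0 / (1 - b) < m" using m by linarith
  have "annulus_flow (e/4) b s1 (e/3) (e/2) (e + d) (e + 2 * d) (s1 / 2) s0"
  proof
    show "3 * s0 / (1 - b) < (e/2)\<^sup>2 - (e/3)\<^sup>2" "3 * s0 / (1 - b) < (e + 2 * d)\<^sup>2 - (e + d)\<^sup>2"
      using mg by (auto simp: m_def)
  qed (use e d b s1 s0 in \<open>auto simp: b_def\<close>)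
  then show ?thesis by (rule that[of _ _ _ _ _ _ _ _ _ "3/4 * e" "e + d / 2"]) (use e d in auto)
qed

theorem theorem2p7:
  fixes \<delta> h :: real
  assumes "\<delta> > 0" and "0 < h" and "h < 1 / 2"
  shows "stable_set \<delta> (Gamma1 h) = {p \<in> phase_space. H_infinity \<delta> p = h} \<and>
    (\<forall>k::nat. \<exists>(N :: real \<Rightarrow> (real \<times> real \<times> real) set) \<epsilon> l0
        (\<Phi> :: real \<times> real \<times> real \<Rightarrow> real \<times> real \<times> real).
       \<epsilon> > 0 \<and> l0 > 0 \<and> {h - \<epsilon><..<h + \<epsilon>} \<subseteq> {0<..<1/2} \<and>
       (\<forall>h'\<in>{h - \<epsilon><..<h + \<epsilon>}.
          open_nbhd (Gamma1 h') (N h') \<and>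
          Ck_surface k (stable_set \<delta> (Gamma1 h') \<inter> N h') \<and>
          angular_param k l0 (\<lambda>\<phi> l. \<Phi> (h', \<phi>, l)) (stable_set \<delta> (Gamma1 h') \<inter> N h')) \<and>
       Ck_on k \<Phi> ({h - \<epsilon><..<h + \<epsilon>} \<times> UNIV \<times> {0..<l0}))"
proof (intro conjI allI)
  show "stable_set \<delta> (Gamma1 h) = {p \<in> phase_space. H_infinity \<delta> p = h}"
    using assms by (rule stable_set_Gamma1)
next
  fix k :: nat
  define e where "e = sqrt (2 * h)"
  have e: "0 < e" "e < 1" "e\<^sup>2 = 2 * h" using assms by (auto simp: e_def)
  obtain a b s1 a2 a1 b1 b2 s2 s0 \<alpha> \<beta> where A: "annulus_flow a b s1 a2 a1 b1 b2 s2 s0"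
    and c: "a1 < \<alpha>" "0 < \<alpha>" "\<alpha> < e" "e < \<beta>" "\<beta> < b1" "b1 < 1"
    by (rule annulus_flow_exists[OF e(1,2)]) (rule that; assumption)
  interpret A: annulus_flow a b s1 a2 a1 b1 b2 s2 s0 by (rule A)
  have "\<alpha>\<^sup>2 < e\<^sup>2" "e\<^sup>2 < \<beta>\<^sup>2" "\<beta>\<^sup>2 < 1\<^sup>2" using c e by (intro power_strict_mono; simp)+
  then have sq: "\<alpha>\<^sup>2 / 2 < h" "h < \<beta>\<^sup>2 / 2" "\<beta>\<^sup>2 < 1" using e(3) by auto
  \<comment> \<open>Halving keeps the end points h - \<epsilon> and h + \<epsilon> strictly between
    \<alpha>^2 / 2 and \<beta>^2 / 2.\<close>
  define \<epsilon> where "\<epsilon> = min (h - \<alpha>\<^sup>2 / 2) (\<beta>\<^sup>2 / 2 - h) / 2"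
  have \<epsilon>: "\<epsilon> > 0" "\<alpha>\<^sup>2 / 2 < h - \<epsilon>" "h + \<epsilon> < \<beta>\<^sup>2 / 2" using sq by (auto simp: \<epsilon>_def min_def field_simps)
  have sub: "{h - \<epsilon><..<h + \<epsilon>} \<subseteq> {0<..<1/2}"
  proof
    fix x assume "x \<in> {h - \<epsilon><..<h + \<epsilon>}"
    moreover have "0 \<le> \<alpha>\<^sup>2 / 2" by simp
    ultimately have "0 < x" "x < 1/2" using \<epsilon> sq(3) unfolding greaterThanLessThan_iff by linarith+
    then show "x \<in> {0<..<1/2}" by simp
  qed
  have \<alpha>\<beta>: "\<alpha> < \<beta>" using c by simp
  obtain l0 E where l0: "0 < l0" and sg: "\<And>l. 0 \<le> l \<Longrightarrow> l < l0 \<Longrightarrow> 0 \<le> sigma_of \<delta> l \<and> sigma_of \<delta> l < s0"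
    and P: "tame 0 (Suc k) (\<lambda>_. A.level \<delta>) ({a1<..<b1} \<times> UNIV \<times> {0..<l0})"
    "semitame 0 (Suc k) (\<lambda>_. E) ({h - \<epsilon><..<h + \<epsilon>} \<times> UNIV \<times> {0..<l0})"
    "\<And>h' \<phi> l. h - \<epsilon> < h' \<Longrightarrow> h' < h + \<epsilon> \<Longrightarrow> 0 \<le> l \<Longrightarrow> l < l0 \<Longrightarrow> a1 < E (h', \<phi>, l) \<and> E (h', \<phi>, l) < b1"
    "\<And>h' \<phi> l e. h - \<epsilon> < h' \<Longrightarrow> h' < h + \<epsilon> \<Longrightarrow> 0 \<le> l \<Longrightarrow> l < l0 \<Longrightarrow> a1 < e \<Longrightarrow> e < b1 \<Longrightarrow>
      A.level \<delta> (e, \<phi>, l) = h' \<longleftrightarrow> E (h', \<phi>, l) = e"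
    by (rule A.level_graph[OF assms(1) c(1) \<alpha>\<beta> c(5) \<epsilon>(2,3)]) (rule that; assumption)
  interpret P: polar_levels a1 b1 l0 "h - \<epsilon>" "h + \<epsilon>" k "A.level \<delta>" E "H_infinity \<delta>"
  proof (unfold_locales, goal_cases)
    case (9 e \<phi> l)
    then have "(e, \<phi>, sigma_of \<delta> l) \<in> A.S" using sg[of l] by (simp add: A.mem_S)
    from A.H_infinity_eq_Kinf[OF assms(1) _ this] show ?case
      using 9 by (simp add: polar_def A.level_def)
  qed (use A.ab A.order c l0 P in auto)
  \<comment> \<open>The dynamical object becomes the level set of \<open>H_infinity\<close> treated
    in \<open>polar_levels\<close>.\<close>
  have M: "stable_set \<delta> (Gamma1 h') \<inter> P.N = {p \<in> P.N. H_infinity \<delta> p = h'}"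
    if "h' \<in> {h - \<epsilon><..<h + \<epsilon>}" for h'
  proof -
    have "0 < h'" "h' < 1/2" using that sub by auto
    from stable_set_Gamma1[OF assms(1) this] show ?thesis by (auto simp: P.N_def)
  qed
  have nb: "open_nbhd (Gamma1 h') P.N" if h': "h' \<in> {h - \<epsilon><..<h + \<epsilon>}" for h'
  proof (rule P.open_nbhd_N)
    have "a1\<^sup>2 < \<alpha>\<^sup>2" "\<beta>\<^sup>2 < b1\<^sup>2" using c P.ab by (intro power_strict_mono; simp)+
    then show "a1\<^sup>2 < 2 * h'" "2 * h' < b1\<^sup>2" using h' \<epsilon> unfolding greaterThanLessThan_iff by linarith+
  qed
  have cs: "Ck_surface k (stable_set \<delta> (Gamma1 h') \<inter> P.N)"
    "angular_param k l0 (\<lambda>\<phi> l. P.\<Phi> (h', \<phi>, l)) (stable_set \<delta> (Gamma1 h') \<inter> P.N)"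
    if h': "h' \<in> {h - \<epsilon><..<h + \<epsilon>}" for h'
    unfolding M[OF h'] using P.Ck_surface_level[of h'] P.angular_param_level[of h'] h' by simp_all
  show "\<exists>(N :: real \<Rightarrow> (real \<times> real \<times> real) set) \<epsilon> l0 (\<Phi> :: real \<times> real \<times> real \<Rightarrow> real \<times> real \<times> real).
       \<epsilon> > 0 \<and> l0 > 0 \<and> {h - \<epsilon><..<h + \<epsilon>} \<subseteq> {0<..<1/2} \<and>
       (\<forall>h'\<in>{h - \<epsilon><..<h + \<epsilon>}.
          open_nbhd (Gamma1 h') (N h') \<and>
          Ck_surface k (stable_set \<delta> (Gamma1 h') \<inter> N h') \<and>
          angular_param k l0 (\<lambda>\<phi> l. \<Phi> (h', \<phi>, l)) (stable_set \<delta> (Gamma1 h') \<inter> N h')) \<and>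
       Ck_on k \<Phi> ({h - \<epsilon><..<h + \<epsilon>} \<times> UNIV \<times> {0..<l0})"
    \<comment> \<open>One neighbourhood serves all h' near h, because N is a full annulus of
      energies.\<close>
    by (intro exI[of _ "\<lambda>_. P.N"] exI[of _ \<epsilon>] exI[of _ l0] exI[of _ P.\<Phi>] conjI ballI
        \<epsilon>(1) l0 sub semitame_Ck_on[OF P.semitame_\<Phi>] nb cs)
qed

end
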